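(* Let $\Gamma$ be a finite simple graph, $G=G_\Gamma$ its right-angled Artin group, $\chi\colon G\twoheadrightarrow\mathbb Z$ an epimorphism, $N=\ker(\chi)$, and $\iota\colon N\to G$ the inclusion. Suppose $H_i(N,\mathbb Q)$ has trivial $\mathbb Q\mathbb Z$-action, for $i=1,2$. Then we have a split exact sequence of graded Lie algebras $$0\to\mathfrak h(N)\xrightarrow{\mathfrak h(\iota)}\mathfrak h(G)\xrightarrow{\mathfrak h(\chi)}\mathfrak h(\mathbb Z)\to0.$$ In particular, the restriction of $\mathfrak h(\iota)$ to derived Lie subalgebras, $\mathfrak h'(\iota)\colon\mathfrak h'(N)\to\mathfrak h'(G)$, is an isomorphism of graded Lie algebras.
   Context: $G_\Gamma=\langle v\in\mathsf V\mid uv=vu\text{ if }\{u,v\}\in\mathsf E\rangle$ for $\Gamma=(\mathsf V,\mathsf E)$. The group $\mathbb Z=G/N$ acts on $H_i(N,\mathbb Q)$ via conjugation in $G$; the action is trivial if every element acts as the identity. (Triviality of the action on $H_1(N,\mathbb Q)$ implies that $N$ is finitely generated.) Rational holonomy Lie algebra of a finitely generated group $G$: let $A=H^*(G,\mathbb Q)$, $A_i=\operatorname{Hom}(A^i,\mathbb Q)$, let $\operatorname{Lie}(A_1)$ be the free Lie algebra on $A_1=H_1(G,\mathbb Q)$, graded by bracket length, and let $\nabla\colon A_2\to A_1\wedge A_1=\operatorname{Lie}_2(A_1)$ be the dual of the cup-product map $A^1\wedge A^1\to A^2$. Then $\mathfrak h(G)=\operatorname{Lie}(A_1)/(\operatorname{im}\nabla)$,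 the quotient by the Lie ideal generated by the image of $\nabla$. A homomorphism $\alpha\colon G\to H$ of finitely generated groups induces a graded Lie algebra morphism $\mathfrak h(\alpha)\colon\mathfrak h(G)\to\mathfrak h(H)$ extending $\alpha_*\colon H_1(G,\mathbb Q)\to H_1(H,\mathbb Q)$. $\mathfrak h'$ denotes the derived Lie subalgebra $[\mathfrak h,\mathfrak h]$. *)

theory Defs
  imports Complex_Main "HOL-Algebra.Elementary_Groups" "HOL-Algebra.QuotRing" "HOL-Algebra.Module"
    "HOL-Library.Function_Algebras" "HOL-Library.Poly_Mapping"
begin

section \<open>Rational vector spaces\<close>

text \<open>
  Vector spaces are \<^locale>\<open>module\<close>s over the field of rational numbers. As usual in HOL-Algebra,
  the record fields \<open>mult\<close> and \<open>one\<close> of a module carry no meaning; for the algebras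
  further below, \<open>mult\<close> is the (Lie) bracket and only \<open>one\<close> is meaningless.
\<close>

definition Rat :: "rat ring" where
  "Rat = \<lparr>carrier = UNIV, mult = (*), one = 1, zero = 0, add = (+)\<rparr>"

definition vspace ::
  "'a set \<Rightarrow> ('a \<Rightarrow> 'a \<Rightarrow> 'a) \<Rightarrow> 'a \<Rightarrow> (rat \<Rightarrow> 'a \<Rightarrow> 'a) \<Rightarrow> (rat, 'a) module" where
  "vspace C pl z sc =
    \<lparr>carrier = C, mult = undefined, one = undefined, zero = z, add = pl, smult = sc\<rparr>"

definition linear_maps ::
  "(rat, 'a, 'm) module_scheme \<Rightarrow> (rat, 'b, 'n) module_scheme \<Rightarrow> ('a \<Rightarrow> 'b) set" where
  "linear_maps M N = {f \<in> carrier M \<rightarrow> carrier N.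
     (\<forall>x\<in>carrier M. \<forall>y\<in>carrier M. f (x \<oplus>\<^bsub>M\<^esub> y) = f x \<oplus>\<^bsub>N\<^esub> f y) \<and>
     (\<forall>r. \<forall>x\<in>carrier M. f (r \<odot>\<^bsub>M\<^esub> x) = r \<odot>\<^bsub>N\<^esub> f x)}"

text \<open>Linear functionals are normalised to vanish outside the carrier, so that equality of
  functionals is equality of functions.\<close>

definition dual_space :: "(rat, 'a, 'm) module_scheme \<Rightarrow> (rat, 'a \<Rightarrow> rat) module" where
  "dual_space M = vspace
     {\<phi> \<in> linear_maps M (vspace UNIV (+) 0 (*)). \<forall>x. x \<notin> carrier M \<longrightarrow> \<phi> x = 0}
     (+) 0 (\<lambda>r \<phi> x. r * \<phi> x)"

definition lin_span :: "(rat, 'a, 'm) module_scheme \<Rightarrow> 'a set \<Rightarrow> 'a set" where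
  "lin_span M S = \<Inter> {W. submodule W Rat M \<and> S \<subseteq> W}"

definition quot_smult ::
  "(rat, 'a, 'm) module_scheme \<Rightarrow> 'a set \<Rightarrow> rat \<Rightarrow> 'a set \<Rightarrow> 'a set" where
  "quot_smult M W r X = (\<Union>x\<in>X. W +>\<^bsub>M\<^esub> (r \<odot>\<^bsub>M\<^esub> x))"

definition quot_space :: "(rat, 'a, 'm) module_scheme \<Rightarrow> 'a set \<Rightarrow> (rat, 'a set) module" where
  "quot_space M W = vspace (a_rcosets\<^bsub>M\<^esub> W) (set_add M) W (quot_smult M W)"

text \<open>The map \<open>M / W \<rightarrow> M' / W'\<close> induced by a map \<open>f : M \<rightarrow> M'\<close> that takes \<open>W\<close> into \<open>W'\<close>.\<close>

definition induced_map ::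
  "(rat, 'b, 'm) module_scheme \<Rightarrow> 'b set \<Rightarrow> ('a \<Rightarrow> 'b) \<Rightarrow> 'a set \<Rightarrow> 'b set" where
  "induced_map M' W' f X = (\<Union>x\<in>X. W' +>\<^bsub>M'\<^esub> f x)"

text \<open>The free vector space on a set \<open>S\<close> consists of the finitely supported functions
  with support in \<open>S\<close>.\<close>

definition fscale :: "rat \<Rightarrow> ('a \<Rightarrow>\<^sub>0 rat) \<Rightarrow> ('a \<Rightarrow>\<^sub>0 rat)" where
  "fscale r c = Poly_Mapping.map ((*) r) c"

definition free_space :: "'a set \<Rightarrow> (rat, 'a \<Rightarrow>\<^sub>0 rat) module" where
  "free_space S = vspace {c. Poly_Mapping.keys c \<subseteq> S} (+) 0 fscale"

definition lin_ext :: "('a \<Rightarrow> ('b \<Rightarrow>\<^sub>0 rat)) \<Rightarrow> ('a \<Rightarrow>\<^sub>0 rat) \<Rightarrow> ('b \<Rightarrow>\<^sub>0 rat)" where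
  "lin_ext f c = (\<Sum>x\<in>Poly_Mapping.keys c. fscale (Poly_Mapping.lookup c x) (f x))"


section \<open>Group presentations and right-angled Artin groups\<close>

text \<open>The letters \<open>(x, True)\<close> and \<open>(x, False)\<close> stand for \<open>x\<close> and its inverse.
  A defining relation \<open>l = r\<close> is given as the pair of words \<open>(l, r)\<close>.\<close>

type_synonym 'x word = "('x \<times> bool) list"

abbreviation group_words :: "'x set \<Rightarrow> 'x word set" where
  "group_words X \<equiv> lists (X \<times> UNIV)"

inductive_set word_equiv :: "'x set \<Rightarrow> ('x word \<times> 'x word) set \<Rightarrow> ('x word \<times> 'x word) set"
  for X :: "'x set" and R :: "('x word \<times> 'x word) set" where
  refl: "w \<in> group_words X \<Longrightarrow> (w, w) \<in> word_equiv X R"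
| sym: "(v, w) \<in> word_equiv X R \<Longrightarrow> (w, v) \<in> word_equiv X R"
| trans: "(u, v) \<in> word_equiv X R \<Longrightarrow> (v, w) \<in> word_equiv X R \<Longrightarrow> (u, w) \<in> word_equiv X R"
| cancel: "u \<in> group_words X \<Longrightarrow> w \<in> group_words X \<Longrightarrow> x \<in> X \<Longrightarrow>
    (u @ [(x, b), (x, \<not> b)] @ w, u @ w) \<in> word_equiv X R"
| relation: "u \<in> group_words X \<Longrightarrow> w \<in> group_words X \<Longrightarrow>
    l \<in> group_words X \<Longrightarrow> r \<in> group_words X \<Longrightarrow> (l, r) \<in> R \<Longrightarrow>
    (u @ l @ w, u @ r @ w) \<in> word_equiv X R"

definition presented_group :: "'x set \<Rightarrow> ('x word \<times> 'x word) set \<Rightarrow> 'x word set monoid" where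
  "presented_group X R =
    \<lparr>carrier = group_words X // word_equiv X R,
     mult = (\<lambda>A B. \<Union>a\<in>A. \<Union>b\<in>B. word_equiv X R `` {a @ b}),
     one = word_equiv X R `` {[]}\<rparr>"

definition finite_simple_graph :: "'v set \<Rightarrow> 'v set set \<Rightarrow> bool" where
  "finite_simple_graph V E \<longleftrightarrow> finite V \<and> (\<forall>e\<in>E. \<exists>u\<in>V. \<exists>v\<in>V. u \<noteq> v \<and> e = {u, v})"

definition raag :: "'v set \<Rightarrow> 'v set set \<Rightarrow> 'v word set monoid" where
  "raag V E = presented_group V
     {([(u, True), (v, True)], [(v, True), (u, True)]) | u v. {u, v} \<in> E}"


section \<open>Group homology and cohomology with rational coefficients\<close>

text \<open>Both are computed by the (inhomogeneous) bar complex with trivial coefficients: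
  the list \<open>[g\<^sub>1, \<dots>, g\<^sub>n]\<close> is the bar symbol, and \<open>bar_face G i\<close> is its \<open>i\<close>-th face,
  for \<open>0 \<le> i \<le> n\<close> and \<open>n > 0\<close>.\<close>

definition bar_tuples :: "('a, 'm) monoid_scheme \<Rightarrow> nat \<Rightarrow> 'a list set" where
  "bar_tuples G n = {xs. length xs = n \<and> set xs \<subseteq> carrier G}"

definition bar_face :: "('a, 'm) monoid_scheme \<Rightarrow> nat \<Rightarrow> 'a list \<Rightarrow> 'a list" where
  "bar_face G i xs =
    (if i = 0 then tl xs
     else if i = length xs then butlast xs
     else take (i - 1) xs @ [xs ! (i - 1) \<otimes>\<^bsub>G\<^esub> xs ! i] @ drop (i + 1) xs)"

subsection \<open>Homology\<close>

definition bar_boundary ::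
  "('a, 'm) monoid_scheme \<Rightarrow> ('a list \<Rightarrow>\<^sub>0 rat) \<Rightarrow> ('a list \<Rightarrow>\<^sub>0 rat)" where
  "bar_boundary G = lin_ext (\<lambda>xs. if xs = [] then 0
     else \<Sum>i\<le>length xs. Poly_Mapping.single (bar_face G i xs) ((-1) ^ i))"

definition bar_chains :: "('a, 'm) monoid_scheme \<Rightarrow> nat \<Rightarrow> (rat, 'a list \<Rightarrow>\<^sub>0 rat) module" where
  "bar_chains G n = free_space (bar_tuples G n)"

definition bar_cycles :: "('a, 'm) monoid_scheme \<Rightarrow> nat \<Rightarrow> (rat, 'a list \<Rightarrow>\<^sub>0 rat) module" where
  "bar_cycles G n =
     (bar_chains G n)\<lparr>carrier := {c \<in> carrier (bar_chains G n). bar_boundary G c = 0}\<rparr>"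

definition bar_boundaries :: "('a, 'm) monoid_scheme \<Rightarrow> nat \<Rightarrow> ('a list \<Rightarrow>\<^sub>0 rat) set" where
  "bar_boundaries G n = bar_boundary G ` carrier (bar_chains G (Suc n))"

definition group_homology ::
  "('a, 'm) monoid_scheme \<Rightarrow> nat \<Rightarrow> (rat, ('a list \<Rightarrow>\<^sub>0 rat) set) module" where
  "group_homology G n = quot_space (bar_cycles G n) (bar_boundaries G n)"

text \<open>For a normal subgroup \<open>N\<close> of \<open>G\<close>, conjugation \<open>x \<mapsto> g x g\<^sup>-\<^sup>1\<close> acts on the bar
  complex of \<open>N\<close> and on its homology. As inner automorphisms of \<open>N\<close> act trivially on homology,
  this is an action of \<open>G / N\<close>; it is trivial iff each \<open>g\<close> in \<open>G\<close> acts as the identity.\<close>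

definition homology_conj ::
  "('a, 'm) monoid_scheme \<Rightarrow> 'a set \<Rightarrow> nat \<Rightarrow> 'a \<Rightarrow>
   ('a list \<Rightarrow>\<^sub>0 rat) set \<Rightarrow> ('a list \<Rightarrow>\<^sub>0 rat) set" where
  "homology_conj G N n g =
     induced_map (bar_cycles (G\<lparr>carrier := N\<rparr>) n) (bar_boundaries (G\<lparr>carrier := N\<rparr>) n)
       (lin_ext (\<lambda>xs. Poly_Mapping.single (map (\<lambda>x. g \<otimes>\<^bsub>G\<^esub> x \<otimes>\<^bsub>G\<^esub> inv\<^bsub>G\<^esub> g) xs) 1))"

definition trivial_homology_action :: "('a, 'm) monoid_scheme \<Rightarrow> 'a set \<Rightarrow> nat \<Rightarrow> bool" where
  "trivial_homology_action G N n \<longleftrightarrow>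
     (\<forall>g\<in>carrier G. \<forall>c\<in>carrier (group_homology (G\<lparr>carrier := N\<rparr>) n). homology_conj G N n g c = c)"

subsection \<open>Cohomology\<close>

text \<open>Cochains are normalised to vanish outside \<^const>\<open>bar_tuples\<close>.\<close>

definition bar_cochains :: "('a, 'm) monoid_scheme \<Rightarrow> nat \<Rightarrow> (rat, 'a list \<Rightarrow> rat) module" where
  "bar_cochains G n =
     vspace {f. \<forall>xs. xs \<notin> bar_tuples G n \<longrightarrow> f xs = 0} (+) 0 (\<lambda>r f xs. r * f xs)"

definition bar_coboundary ::
  "('a, 'm) monoid_scheme \<Rightarrow> nat \<Rightarrow> ('a list \<Rightarrow> rat) \<Rightarrow> ('a list \<Rightarrow> rat)" where
  "bar_coboundary G n f = (\<lambda>xs. if xs \<in> bar_tuples G (Suc n)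
     then \<Sum>i\<le>Suc n. (-1) ^ i * f (bar_face G i xs) else 0)"

definition bar_cocycles :: "('a, 'm) monoid_scheme \<Rightarrow> nat \<Rightarrow> (rat, 'a list \<Rightarrow> rat) module" where
  "bar_cocycles G n =
     (bar_cochains G n)\<lparr>carrier := {f \<in> carrier (bar_cochains G n). bar_coboundary G n f = 0}\<rparr>"

definition bar_coboundaries :: "('a, 'm) monoid_scheme \<Rightarrow> nat \<Rightarrow> ('a list \<Rightarrow> rat) set" where
  "bar_coboundaries G n =
     (case n of 0 \<Rightarrow> {0} | Suc m \<Rightarrow> bar_coboundary G m ` carrier (bar_cochains G m))"

definition group_cohomology ::
  "('a, 'm) monoid_scheme \<Rightarrow> nat \<Rightarrow> (rat, ('a list \<Rightarrow> rat) set) module" where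
  "group_cohomology G n = quot_space (bar_cocycles G n) (bar_coboundaries G n)"

definition cup_cochain ::
  "('a, 'm) monoid_scheme \<Rightarrow> nat \<Rightarrow> nat \<Rightarrow> ('a list \<Rightarrow> rat) \<Rightarrow> ('a list \<Rightarrow> rat) \<Rightarrow> ('a list \<Rightarrow> rat)" where
  "cup_cochain G p q f g =
     (\<lambda>xs. if xs \<in> bar_tuples G (p + q) then f (take p xs) * g (drop p xs) else 0)"

definition cup ::
  "('a, 'm) monoid_scheme \<Rightarrow> nat \<Rightarrow> nat \<Rightarrow>
   ('a list \<Rightarrow> rat) set \<Rightarrow> ('a list \<Rightarrow> rat) set \<Rightarrow> ('a list \<Rightarrow> rat) set" where
  "cup G p q a b = (\<Union>f\<in>a. \<Union>g\<in>b.
     bar_coboundaries G (p + q) +>\<^bsub>bar_cocycles G (p + q)\<^esub> cup_cochain G p q f g)"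

text \<open>The map \<open>\<alpha>\<^sup>* : H\<^sup>n(H) \<rightarrow> H\<^sup>n(G)\<close> induced by a homomorphism \<open>\<alpha> : G \<rightarrow> H\<close>.\<close>

definition cohomology_map ::
  "('a, 'm) monoid_scheme \<Rightarrow> nat \<Rightarrow> ('a \<Rightarrow> 'b) \<Rightarrow> ('b list \<Rightarrow> rat) set \<Rightarrow> ('a list \<Rightarrow> rat) set" where
  "cohomology_map G n \<alpha> = induced_map (bar_cocycles G n) (bar_coboundaries G n)
     (\<lambda>f xs. if xs \<in> bar_tuples G n then f (map \<alpha> xs) else 0)"


section \<open>Graded Lie algebras\<close>

text \<open>Not necessarily associative rational algebras with a family of homogeneous
  components \<open>gr\<close>. The bracket of a Lie algebra is written as its multiplication.\<close>

record 'a graded_algebra = "(rat, 'a) module" +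
  gr :: "nat \<Rightarrow> 'a set"

definition graded_lie_algebra :: "('a, 'm) graded_algebra_scheme \<Rightarrow> bool" where
  "graded_lie_algebra L \<longleftrightarrow>
     module Rat L \<and>
     (\<forall>x\<in>carrier L. \<forall>y\<in>carrier L. x \<otimes>\<^bsub>L\<^esub> y \<in> carrier L) \<and>
     (\<forall>x\<in>carrier L. \<forall>y\<in>carrier L. \<forall>z\<in>carrier L.
        (x \<oplus>\<^bsub>L\<^esub> y) \<otimes>\<^bsub>L\<^esub> z = x \<otimes>\<^bsub>L\<^esub> z \<oplus>\<^bsub>L\<^esub> y \<otimes>\<^bsub>L\<^esub> z \<and>
        z \<otimes>\<^bsub>L\<^esub> (x \<oplus>\<^bsub>L\<^esub> y) = z \<otimes>\<^bsub>L\<^esub> x \<oplus>\<^bsub>L\<^esub> z \<otimes>\<^bsub>L\<^esub> y) \<and>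
     (\<forall>r. \<forall>x\<in>carrier L. \<forall>y\<in>carrier L.
        (r \<odot>\<^bsub>L\<^esub> x) \<otimes>\<^bsub>L\<^esub> y = r \<odot>\<^bsub>L\<^esub> (x \<otimes>\<^bsub>L\<^esub> y) \<and>
        x \<otimes>\<^bsub>L\<^esub> (r \<odot>\<^bsub>L\<^esub> y) = r \<odot>\<^bsub>L\<^esub> (x \<otimes>\<^bsub>L\<^esub> y)) \<and>
     (\<forall>x\<in>carrier L. x \<otimes>\<^bsub>L\<^esub> x = \<zero>\<^bsub>L\<^esub>) \<and>
     (\<forall>x\<in>carrier L. \<forall>y\<in>carrier L. \<forall>z\<in>carrier L.
        x \<otimes>\<^bsub>L\<^esub> (y \<otimes>\<^bsub>L\<^esub> z) \<oplus>\<^bsub>L\<^esub> y \<otimes>\<^bsub>L\<^esub> (z \<otimes>\<^bsub>L\<^esub> x) \<oplus>\<^bsub>L\<^esub> z \<otimes>\<^bsub>L\<^esub> (x \<otimes>\<^bsub>L\<^esub> y) = \<zero>\<^bsub>L\<^esub>) \<and>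
     (\<forall>n. submodule (gr L n) Rat L) \<and>
     (\<forall>x\<in>carrier L. \<exists>!c :: nat \<Rightarrow> 'a. (\<forall>n. c n \<in> gr L n) \<and>
        finite {n. c n \<noteq> \<zero>\<^bsub>L\<^esub>} \<and> x = finsum L c {n. c n \<noteq> \<zero>\<^bsub>L\<^esub>}) \<and>
     (\<forall>m n. \<forall>x\<in>gr L m. \<forall>y\<in>gr L n. x \<otimes>\<^bsub>L\<^esub> y \<in> gr L (m + n))"

definition graded_lie_hom ::
  "('a, 'm) graded_algebra_scheme \<Rightarrow> ('b, 'n) graded_algebra_scheme \<Rightarrow> ('a \<Rightarrow> 'b) set" where
  "graded_lie_hom L M = {f \<in> linear_maps L M.
     (\<forall>x\<in>carrier L. \<forall>y\<in>carrier L. f (x \<otimes>\<^bsub>L\<^esub> y) = f x \<otimes>\<^bsub>M\<^esub> f y) \<and>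
     (\<forall>n. f ` gr L n \<subseteq> gr M n)}"

definition graded_lie_iso ::
  "('a, 'm) graded_algebra_scheme \<Rightarrow> ('b, 'n) graded_algebra_scheme \<Rightarrow> ('a \<Rightarrow> 'b) \<Rightarrow> bool" where
  "graded_lie_iso L M f \<longleftrightarrow>
     graded_lie_algebra L \<and> graded_lie_algebra M \<and> f \<in> graded_lie_hom L M \<and>
     bij_betw f (carrier L) (carrier M) \<and> inv_into (carrier L) f \<in> graded_lie_hom M L"

text \<open>The sequence \<open>0 \<rightarrow> L \<rightarrow> M \<rightarrow> K \<rightarrow> 0\<close> with maps \<open>f\<close> and \<open>g\<close> is exact, and \<open>g\<close> has a
  section that is a morphism of graded Lie algebras.\<close>

definition split_exact_graded_lie ::
  "('a, 'm) graded_algebra_scheme \<Rightarrow> ('a \<Rightarrow> 'b) \<Rightarrow> ('b, 'n) graded_algebra_scheme \<Rightarrow>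
   ('b \<Rightarrow> 'c) \<Rightarrow> ('c, 'k) graded_algebra_scheme \<Rightarrow> bool" where
  "split_exact_graded_lie L f M g K \<longleftrightarrow>
     graded_lie_algebra L \<and> graded_lie_algebra M \<and> graded_lie_algebra K \<and>
     f \<in> graded_lie_hom L M \<and> g \<in> graded_lie_hom M K \<and>
     inj_on f (carrier L) \<and>
     f ` carrier L = {x \<in> carrier M. g x = \<zero>\<^bsub>K\<^esub>} \<and>
     g ` carrier M = carrier K \<and>
     (\<exists>s\<in>graded_lie_hom K M. \<forall>z\<in>carrier K. g (s z) = z)"

definition derived_subalgebra ::
  "('a, 'm) graded_algebra_scheme \<Rightarrow> ('a, 'm) graded_algebra_scheme" where
  "derived_subalgebra L =
     (let D = lin_span L {x \<otimes>\<^bsub>L\<^esub> y | x y. x \<in> carrier L \<and> y \<in> carrier L}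
      in L\<lparr>carrier := D, gr := \<lambda>n. gr L n \<inter> D\<rparr>)"

text \<open>Two-sided ideals of a not necessarily associative algebra; for Lie algebras these are
  the Lie ideals.\<close>

definition algebra_ideal :: "('a, 'm) graded_algebra_scheme \<Rightarrow> 'a set \<Rightarrow> bool" where
  "algebra_ideal L I \<longleftrightarrow> submodule I Rat L \<and>
     (\<forall>x\<in>I. \<forall>y\<in>carrier L. x \<otimes>\<^bsub>L\<^esub> y \<in> I \<and> y \<otimes>\<^bsub>L\<^esub> x \<in> I)"

definition gen_ideal :: "('a, 'm) graded_algebra_scheme \<Rightarrow> 'a set \<Rightarrow> 'a set" where
  "gen_ideal L S = \<Inter> {I. algebra_ideal L I \<and> S \<subseteq> I}"

definition quot_algebra ::
  "('a, 'm) graded_algebra_scheme \<Rightarrow> 'a set \<Rightarrow> 'a set graded_algebra" where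
  "quot_algebra L I =
    \<lparr>carrier = a_rcosets\<^bsub>L\<^esub> I, mult = rcoset_mult L I, one = undefined, zero = I,
     add = set_add L, smult = quot_smult L I,
     gr = (\<lambda>n. (\<lambda>x. I +>\<^bsub>L\<^esub> x) ` gr L n)\<rparr>"


section \<open>The free Lie algebra on a vector space\<close>

text \<open>It is the free non-associative algebra on the underlying set of the vector space \<open>V\<close>,
  modulo the smallest ideal that makes \<open>V \<rightarrow> Lie(V)\<close> linear and the product a Lie bracket.\<close>

datatype (set_mag: 'v) magma = Gen 'v | Br "'v magma" "'v magma"

fun bracket_length :: "'v magma \<Rightarrow> nat" where
  "bracket_length (Gen v) = 1"
| "bracket_length (Br s t) = bracket_length s + bracket_length t"

definition mag_mult ::
  "('v magma \<Rightarrow>\<^sub>0 rat) \<Rightarrow> ('v magma \<Rightarrow>\<^sub>0 rat) \<Rightarrow> ('v magma \<Rightarrow>\<^sub>0 rat)" where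
  "mag_mult p q = (\<Sum>s\<in>Poly_Mapping.keys p. \<Sum>t\<in>Poly_Mapping.keys q.
     Poly_Mapping.single (Br s t) (Poly_Mapping.lookup p s * Poly_Mapping.lookup q t))"

definition free_nonassoc :: "'v set \<Rightarrow> ('v magma \<Rightarrow>\<^sub>0 rat) graded_algebra" where
  "free_nonassoc X =
    \<lparr>carrier = {p. \<forall>t\<in>Poly_Mapping.keys p. set_mag t \<subseteq> X},
     mult = mag_mult, one = undefined, zero = 0, add = (+), smult = fscale,
     gr = (\<lambda>n. {p. \<forall>t\<in>Poly_Mapping.keys p. set_mag t \<subseteq> X \<and> bracket_length t = n})\<rparr>"

abbreviation mag_gen :: "'v \<Rightarrow> ('v magma \<Rightarrow>\<^sub>0 rat)" where
  "mag_gen v \<equiv> Poly_Mapping.single (Gen v) 1"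

definition lie_relators :: "(rat, 'v, 'm) module_scheme \<Rightarrow> ('v magma \<Rightarrow>\<^sub>0 rat) set" where
  "lie_relators V =
     {mag_gen (v \<oplus>\<^bsub>V\<^esub> w) - mag_gen v - mag_gen w | v w. v \<in> carrier V \<and> w \<in> carrier V} \<union>
     {mag_gen (r \<odot>\<^bsub>V\<^esub> v) - fscale r (mag_gen v) | r v. v \<in> carrier V} \<union>
     {mag_mult p p | p. p \<in> carrier (free_nonassoc (carrier V))} \<union>
     {mag_mult p (mag_mult q r) + mag_mult q (mag_mult r p) + mag_mult r (mag_mult p q) | p q r.
        p \<in> carrier (free_nonassoc (carrier V)) \<and> q \<in> carrier (free_nonassoc (carrier V)) \<and>
        r \<in> carrier (free_nonassoc (carrier V))}"

definition lie_ideal :: "(rat, 'v, 'm) module_scheme \<Rightarrow> ('v magma \<Rightarrow>\<^sub>0 rat) set" where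
  "lie_ideal V = gen_ideal (free_nonassoc (carrier V)) (lie_relators V)"

definition free_lie :: "(rat, 'v, 'm) module_scheme \<Rightarrow> ('v magma \<Rightarrow>\<^sub>0 rat) set graded_algebra" where
  "free_lie V = quot_algebra (free_nonassoc (carrier V)) (lie_ideal V)"

definition lie_gen :: "(rat, 'v, 'm) module_scheme \<Rightarrow> 'v \<Rightarrow> ('v magma \<Rightarrow>\<^sub>0 rat) set" where
  "lie_gen V v = lie_ideal V +>\<^bsub>free_nonassoc (carrier V)\<^esub> mag_gen v"

text \<open>The morphism \<open>Lie(V) \<rightarrow> Lie(W)\<close> extending a linear map \<open>f : V \<rightarrow> W\<close>.\<close>

definition free_lie_map ::
  "(rat, 'w, 'm) module_scheme \<Rightarrow> ('v \<Rightarrow> 'w) \<Rightarrow>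
   ('v magma \<Rightarrow>\<^sub>0 rat) set \<Rightarrow> ('w magma \<Rightarrow>\<^sub>0 rat) set" where
  "free_lie_map W f = induced_map (free_nonassoc (carrier W)) (lie_ideal W)
     (lin_ext (\<lambda>t. Poly_Mapping.single (map_magma f t) 1))"


section \<open>The holonomy Lie algebra\<close>

text \<open>\<open>A\<^sub>i = Hom(H\<^sup>i(G, \<rat>), \<rat>)\<close>; for \<open>i = 1\<close> and \<open>G\<close> finitely generated this
  is \<open>H\<^sub>1(G, \<rat>)\<close>.\<close>

type_synonym 'a hdual = "('a list \<Rightarrow> rat) set \<Rightarrow> rat"

definition cohom_dual :: "('a, 'm) monoid_scheme \<Rightarrow> nat \<Rightarrow> (rat, 'a hdual) module" where
  "cohom_dual G i = dual_space (group_cohomology G i)"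

text \<open>The graph of \<open>\<nabla> : A\<^sub>2 \<rightarrow> A\<^sub>1 \<and> A\<^sub>1 = Lie\<^sub>2(A\<^sub>1)\<close>. An element \<open>\<Sum>\<^sub>i x\<^sub>i \<and> y\<^sub>i\<close> of \<open>A\<^sub>1 \<and> A\<^sub>1\<close> is
  the functional \<open>a \<and> b \<mapsto> \<Sum>\<^sub>i x\<^sub>i(a) y\<^sub>i(b) - x\<^sub>i(b) y\<^sub>i(a)\<close> on \<open>A\<^sup>1 \<and> A\<^sup>1\<close>, and it corresponds
  to \<open>\<Sum>\<^sub>i [x\<^sub>i, y\<^sub>i]\<close> in \<open>Lie\<^sub>2(A\<^sub>1)\<close>. Being dual to the cup product, \<open>\<nabla> \<phi>\<close> is the element whose
  functional is \<open>a \<and> b \<mapsto> \<phi>(a \<union> b)\<close>. It is unique as the pairing is nondegenerate, and it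
  exists when \<open>A\<^sup>1\<close> is finite-dimensional.\<close>

definition nabla_graph ::
  "('a, 'm) monoid_scheme \<Rightarrow> ('a hdual \<times> ('a hdual magma \<Rightarrow>\<^sub>0 rat) set) set" where
  "nabla_graph G = {(\<phi>, w). \<phi> \<in> carrier (cohom_dual G 2) \<and>
     (\<exists>(n::nat) x y.
        x \<in> {..<n} \<rightarrow> carrier (cohom_dual G 1) \<and> y \<in> {..<n} \<rightarrow> carrier (cohom_dual G 1) \<and>
        w = finsum (free_lie (cohom_dual G 1))
              (\<lambda>i. lie_gen (cohom_dual G 1) (x i) \<otimes>\<^bsub>free_lie (cohom_dual G 1)\<^esub>
                    lie_gen (cohom_dual G 1) (y i)) {..<n} \<and>
        (\<forall>a\<in>carrier (group_cohomology G 1). \<forall>b\<in>carrier (group_cohomology G 1).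
           (\<Sum>i<n. x i a * y i b - x i b * y i a) = \<phi> (cup G 1 1 a b)))}"

definition nabla_image :: "('a, 'm) monoid_scheme \<Rightarrow> ('a hdual magma \<Rightarrow>\<^sub>0 rat) set set" where
  "nabla_image G = nabla_graph G `` carrier (cohom_dual G 2)"

definition holonomy_ideal :: "('a, 'm) monoid_scheme \<Rightarrow> ('a hdual magma \<Rightarrow>\<^sub>0 rat) set set" where
  "holonomy_ideal G = gen_ideal (free_lie (cohom_dual G 1)) (nabla_image G)"

definition holonomy ::
  "('a, 'm) monoid_scheme \<Rightarrow> ('a hdual magma \<Rightarrow>\<^sub>0 rat) set set graded_algebra" where
  "holonomy G = quot_algebra (free_lie (cohom_dual G 1)) (holonomy_ideal G)"

text \<open>The map \<open>\<alpha>\<^sub>* : A\<^sub>1(G) \<rightarrow> A\<^sub>1(H)\<close> is the transpose of \<open>\<alpha>\<^sup>* : H\<^sup>1(H) \<rightarrow> H\<^sup>1(G)\<close>.\<close>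

definition cohom_dual_map ::
  "('a, 'm) monoid_scheme \<Rightarrow> ('b, 'n) monoid_scheme \<Rightarrow> nat \<Rightarrow> ('a \<Rightarrow> 'b) \<Rightarrow> 'a hdual \<Rightarrow> 'b hdual" where
  "cohom_dual_map G H i \<alpha> x =
     (\<lambda>b. if b \<in> carrier (group_cohomology H i) then x (cohomology_map G i \<alpha> b) else 0)"

definition holonomy_map ::
  "('a, 'm) monoid_scheme \<Rightarrow> ('b, 'n) monoid_scheme \<Rightarrow> ('a \<Rightarrow> 'b) \<Rightarrow>
   ('a hdual magma \<Rightarrow>\<^sub>0 rat) set set \<Rightarrow> ('b hdual magma \<Rightarrow>\<^sub>0 rat) set set" where
  "holonomy_map G H \<alpha> = induced_map (free_lie (cohom_dual H 1)) (holonomy_ideal H)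
     (free_lie_map (cohom_dual H 1) (cohom_dual_map G H 1 \<alpha>))"

end

theory Submission
  imports Defs
begin

text \<open>
  Let \<open>m v = \<chi>(v)\<close>. A class in \<open>H\<^sup>1(G)\<close> or \<open>H\<^sup>2(G)\<close> is a function on the vertices or an alternating
  function on the edges. If \<open>m \<and> \<eta>\<close> vanishes on edges or triangles, then \<open>\<chi> \<union> \<eta>\<close> is the coboundary of an
  explicit cochain \<open>F\<close>. On \<open>N\<close> this \<open>F\<close> is a cocycle, and conjugation by an element \<open>t\<close> with \<open>\<chi>(t) = 1\<close>
  changes it by \<open>\<eta>\<close>. As the action on homology is trivial, \<open>\<eta>\<close> vanishes on \<open>N\<close>, which makes it a
  multiple of \<open>m\<close>. Dually, the vectors in \<open>\<rat>\<^sup>V\<close> and the combinations of edges that are killed by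
  contraction with \<open>m\<close> are contractions of edges and triangles.

  Hence the relations of \<open>\<hh>(N)\<close> are spanned by the brackets \<open>[p - (m p / m s) s, q - (m q / m s) s]\<close> for
  triangles \<open>p q s\<close> with \<open>m s \<noteq> 0\<close>. The relations \<open>[u, v] = 0\<close> of \<open>\<hh>(G)\<close> express the bracket with \<open>t\<close> as a
  map \<open>D\<close> on the generators of \<open>\<hh>(N)\<close>, and \<open>D\<close> preserves the triangle relations by the Jacobi identity.
  So \<open>D\<close> is a derivation of \<open>\<hh>(N)\<close>, and \<open>\<hh>(G)\<close> is the semidirect product of \<open>\<hh>(N)\<close> with the line
  spanned by \<open>t\<close>.

  All computations take place in the free non-associative algebra \<open>F(A\<^sub>1)\<close> modulo the preimage \<open>hol_ideal\<close>
  of the holonomy ideal.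
\<close>


subsection \<open>Linear algebra\<close>

text \<open>The homology hypotheses enter only through evaluation: a cocycle of \<open>N\<close>
  takes the same value on a cycle and on its conjugate. In degree 2 this shows merely that the form
  of \<eta> kills the 2-cycles of \<open>N\<close>; over the rationals it is then the coboundary of
  a function \<open>h\<close> on \<open>N\<close>. The way back from \<open>N\<close> to the edges
  is to evaluate \<open>h\<close> on the \<open>N\<close>-parts of the two equal products of
  adjacent generators. The edge combination that represents a given vector is far from unique, so
  \<open>D\<close> depends on a choice and is linear only modulo the relations of \<open>N\<close>.
  Exactness in degree 1 provides a choice for every vector, and exactness in degree 2 says that two
  choices differ by relations. Injectivity of the map induced by the inclusion comes from an
  explicit left inverse and not from a comparison of bases. The left inverse lives on the free
  non-associative algebra, where homomorphisms and derivations may be prescribed on generators; that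
  it respects the ideals is checked afterwards.\<close>

lemma functional_in_span:
  fixes d :: "'i \<Rightarrow> 's \<Rightarrow> rat" and w :: "'s \<Rightarrow> rat"
  assumes "finite I" and "finite S"
    and "\<And>x. (\<And>i. i \<in> I \<Longrightarrow> (\<Sum>s\<in>S. d i s * x s) = 0) \<Longrightarrow> (\<Sum>s\<in>S. w s * x s) = 0"
  shows "\<exists>k. \<forall>s\<in>S. w s = (\<Sum>i\<in>I. k i * d i s)"
  using assms(1,3)
proof (induction I arbitrary: w)
  case empty
  have "w s = 0" if "s \<in> S" for s
    using empty[of "\<lambda>x. if x = s then 1 else 0"] \<open>finite S\<close> that
    by (simp add: if_distrib[of "\<lambda>y. _ * y"] sum.delta cong: if_cong)
  then show ?case by simp
next
  case (insert j I)
  show ?case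
  proof (cases "\<forall>x. (\<forall>i\<in>I. (\<Sum>s\<in>S. d i s * x s) = 0) \<longrightarrow> (\<Sum>s\<in>S. d j s * x s) = 0")
    case True
    then have "\<exists>k. \<forall>s\<in>S. w s = (\<Sum>i\<in>I. k i * d i s)"
      by (intro insert.IH insert.prems) auto
    then obtain k where k: "\<And>s. s \<in> S \<Longrightarrow> w s = (\<Sum>i\<in>I. k i * d i s)" by blast
    show ?thesis
      using insert.hyps k by (intro exI[of _ "k(j := 0)"]) (auto intro!: sum.cong)
  next
    case False
    then obtain x where x: "\<And>i. i \<in> I \<Longrightarrow> (\<Sum>s\<in>S. d i s * x s) = 0"
      and xj: "(\<Sum>s\<in>S. d j s * x s) \<noteq> 0" by blast
    \<comment> \<open>With this \<open>c\<close> the functional \<open>w - c * d j\<close> vanishes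
      at \<open>x\<close>; every \<open>y\<close> killed by the functionals of \<open>I\<close> is a
      multiple of \<open>x\<close> plus a vector killed by those of
      \<open>insert j I\<close>.\<close>
    define c where "c = (\<Sum>s\<in>S. w s * x s) / (\<Sum>s\<in>S. d j s * x s)"
    have "\<exists>k. \<forall>s\<in>S. w s - c * d j s = (\<Sum>i\<in>I. k i * d i s)"
    proof (rule insert.IH)
      fix y assume y: "\<And>i. i \<in> I \<Longrightarrow> (\<Sum>s\<in>S. d i s * y s) = 0"
      define b where "b = (\<Sum>s\<in>S. d j s * y s) / (\<Sum>s\<in>S. d j s * x s)"
      have lin: "(\<Sum>s\<in>S. f s * (y s - b * x s)) = (\<Sum>s\<in>S. f s * y s) - b * (\<Sum>s\<in>S. f s * x s)" for f
        by (simp add: right_diff_distrib sum_subtractf sum_distrib_left mult_ac)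
      have "(\<Sum>s\<in>S. w s * (y s - b * x s)) = 0"
      proof (rule insert.prems)
        fix i assume "i \<in> insert j I"
        then show "(\<Sum>s\<in>S. d i s * (y s - b * x s)) = 0"
          unfolding lin using x y xj by (auto simp: b_def)
      qed
      then have 1: "(\<Sum>s\<in>S. w s * y s) = b * (\<Sum>s\<in>S. w s * x s)" by (simp add: lin)
      have "(\<Sum>s\<in>S. (w s - c * d j s) * y s) = (\<Sum>s\<in>S. w s * y s) - c * (\<Sum>s\<in>S. d j s * y s)"
        by (simp add: algebra_simps sum_subtractf sum_distrib_left)
      also have "\<dots> = 0" using xj by (simp add: 1 b_def c_def)
      finally show "(\<Sum>s\<in>S. (w s - c * d j s) * y s) = 0" .
    qed
    then obtain k where k: "\<And>s. s \<in> S \<Longrightarrow> w s - c * d j s = (\<Sum>i\<in>I. k i * d i s)" by blast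
    have "w s = (\<Sum>i\<in>insert j I. (k(j := c)) i * d i s)" if "s \<in> S" for s
    proof -
      have "(\<Sum>i\<in>I. (k(j := c)) i * d i s) = (\<Sum>i\<in>I. k i * d i s)"
        using insert.hyps by (intro sum.cong) auto
      then show ?thesis using k[OF that] insert.hyps by (simp add: algebra_simps)
    qed
    then show ?thesis by blast
  qed
qed

lemma lookup_fscale [simp]: "Poly_Mapping.lookup (fscale r c) x = r * Poly_Mapping.lookup c x"
  by (auto simp: fscale_def Poly_Mapping.map.rep_eq when_def)

lemma fscale_add_right: "fscale r (p + q) = fscale r p + fscale r q"
  and fscale_add_left: "fscale (r + s) p = fscale r p + fscale s p"
  and fscale_diff_right: "fscale r (p - q) = fscale r p - fscale r q"
  and fscale_diff_left: "fscale (r - s) p = fscale r p - fscale s p"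
  and fscale_fscale: "fscale r (fscale s p) = fscale (r * s) p"
  and fscale_one: "fscale 1 p = p"
  and fscale_zero_left: "fscale 0 p = 0"
  and fscale_zero_right: "fscale r 0 = 0"
  and fscale_minus_one: "fscale (- 1) p = - p"
  and fscale_minus_left: "fscale (- r) p = - fscale r p"
  and fscale_minus_right: "fscale r (- p) = - fscale r p"
  and fscale_single: "fscale r (Poly_Mapping.single x s) = Poly_Mapping.single x (r * s)"
  by (auto intro!: poly_mapping_eqI simp: lookup_add lookup_minus lookup_single when_def algebra_simps)

lemma fscale_sum: "fscale r (\<Sum>i\<in>I. f i) = (\<Sum>i\<in>I. fscale r (f i))"
  by (induction I rule: infinite_finite_induct) (auto simp: fscale_add_right fscale_zero_right)

lemma fscale_sum_left: "fscale (\<Sum>i\<in>I. f i) p = (\<Sum>i\<in>I. fscale (f i) p)"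
  by (induction I rule: infinite_finite_induct) (auto simp: fscale_add_left fscale_zero_left)

lemmas fscale_simps = fscale_add_right fscale_add_left fscale_diff_right fscale_diff_left
  fscale_fscale fscale_one fscale_zero_left fscale_zero_right fscale_minus_one
  fscale_minus_left fscale_minus_right fscale_sum

lemma keys_fscale: "Poly_Mapping.keys (fscale r p) \<subseteq> Poly_Mapping.keys p"
  by (auto simp: in_keys_iff)

lemma vector_space_fscale: "vector_space fscale"
  by standard (simp_all add: fscale_simps)

lemma vector_space_rat: "vector_space ((*) :: rat \<Rightarrow> rat \<Rightarrow> rat)"
  by standard (simp_all add: algebra_simps)

lemma lin_ext_superset:
  assumes "finite A" "Poly_Mapping.keys c \<subseteq> A"
  shows "lin_ext f c = (\<Sum>x\<in>A. fscale (Poly_Mapping.lookup c x) (f x))"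
  unfolding lin_ext_def
  by (rule sum.mono_neutral_left) (use assms in \<open>auto simp: in_keys_iff fscale_zero_left\<close>)

lemma lin_ext_add: "lin_ext f (c + d) = lin_ext f c + lin_ext f d"
proof -
  let ?A = "Poly_Mapping.keys c \<union> Poly_Mapping.keys d"
  have "Poly_Mapping.keys (c + d) \<subseteq> ?A" by (rule Poly_Mapping.keys_add)
  then show ?thesis
    by (simp add: lin_ext_superset[of ?A] lookup_add fscale_add_left sum.distrib)
qed

lemma lin_ext_fscale: "lin_ext f (fscale r c) = fscale r (lin_ext f c)"
  using keys_fscale[of r c]
  by (simp add: lin_ext_superset[of "Poly_Mapping.keys c"] fscale_sum fscale_fscale)

lemma lin_ext_zero [simp]: "lin_ext f 0 = 0"
  by (simp add: lin_ext_def)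

lemma lin_ext_single: "lin_ext f (Poly_Mapping.single x r) = fscale r (f x)"
  by (auto simp: lin_ext_superset[of "{x}"])

lemma lin_ext_uminus: "lin_ext f (- c) = - lin_ext f c"
  using lin_ext_fscale[of f "-1" c] by (simp add: fscale_minus_one)

lemma lin_ext_diff: "lin_ext f (c - d) = lin_ext f c - lin_ext f d"
  using lin_ext_add[of f c "- d"] by (simp add: lin_ext_uminus)

lemma lin_ext_sum: "lin_ext f (\<Sum>i\<in>I. g i) = (\<Sum>i\<in>I. lin_ext f (g i))"
  by (induction I rule: infinite_finite_induct) (auto simp: lin_ext_add)

lemma lin_ext_fun_add: "lin_ext (\<lambda>x. f x + g x) c = lin_ext f c + lin_ext g c"
  by (simp add: lin_ext_def fscale_add_right sum.distrib)

lemma lin_ext_fun_fscale: "lin_ext (\<lambda>x. fscale r (f x)) c = fscale r (lin_ext f c)"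
  by (simp add: lin_ext_def fscale_sum fscale_fscale mult_ac)

lemma lin_ext_single_id [simp]: "lin_ext (\<lambda>x. Poly_Mapping.single x 1) c = c"
  by (rule poly_mapping_eqI)
    (auto simp: lin_ext_def lookup_sum lookup_single when_def in_keys_iff sum.delta if_distrib cong: if_cong)

lemma lin_ext_closed:
  assumes "\<And>x. x \<in> Poly_Mapping.keys c \<Longrightarrow> f x \<in> W" and "0 \<in> W"
    and "\<And>p q. p \<in> W \<Longrightarrow> q \<in> W \<Longrightarrow> p + q \<in> W" and "\<And>r p. p \<in> W \<Longrightarrow> fscale r p \<in> W"
  shows "lin_ext f c \<in> W"
proof -
  have "(\<Sum>x\<in>A. fscale (Poly_Mapping.lookup c x) (f x)) \<in> W" if "A \<subseteq> Poly_Mapping.keys c" for A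
    using finite_subset[OF that finite_keys] that
    by (induction A rule: finite_induct) (use assms in auto)
  then show ?thesis by (simp add: lin_ext_def)
qed

lemma span_singles_induct:
  assumes "\<And>x. x \<in> Poly_Mapping.keys c \<Longrightarrow> Poly_Mapping.single x 1 \<in> W" and "0 \<in> W"
    and "\<And>p q. p \<in> W \<Longrightarrow> q \<in> W \<Longrightarrow> p + q \<in> W" and "\<And>r p. p \<in> W \<Longrightarrow> fscale r p \<in> W"
  shows "c \<in> W"
  using lin_ext_closed[of c "\<lambda>x. Poly_Mapping.single x 1" W] assms by simp

section \<open>Pairing formal combinations with rational-valued functions\<close>

definition lin_eval :: "('a \<Rightarrow> rat) \<Rightarrow> ('a \<Rightarrow>\<^sub>0 rat) \<Rightarrow> rat" where
  "lin_eval f c = (\<Sum>x\<in>Poly_Mapping.keys c. Poly_Mapping.lookup c x * f x)"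

lemma lin_eval_superset:
  assumes "finite A" "Poly_Mapping.keys c \<subseteq> A"
  shows "lin_eval f c = (\<Sum>x\<in>A. Poly_Mapping.lookup c x * f x)"
  unfolding lin_eval_def
  by (rule sum.mono_neutral_left) (use assms in \<open>auto simp: in_keys_iff\<close>)

lemma lin_eval_add: "lin_eval f (c + d) = lin_eval f c + lin_eval f d"
proof -
  let ?A = "Poly_Mapping.keys c \<union> Poly_Mapping.keys d"
  have "Poly_Mapping.keys (c + d) \<subseteq> ?A" by (rule Poly_Mapping.keys_add)
  then show ?thesis
    by (simp add: lin_eval_superset[of ?A] lookup_add algebra_simps sum.distrib)
qed

lemma lin_eval_fscale: "lin_eval f (fscale r c) = r * lin_eval f c"
  using keys_fscale[of r c]
  by (simp add: lin_eval_superset[of "Poly_Mapping.keys c"] sum_distrib_left mult_ac)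

lemma lin_eval_zero [simp]: "lin_eval f 0 = 0"
  by (simp add: lin_eval_def)

lemma lin_eval_single [simp]: "lin_eval f (Poly_Mapping.single x r) = r * f x"
  by (auto simp: lin_eval_superset[of "{x}"])

lemma lin_eval_diff: "lin_eval f (c - d) = lin_eval f c - lin_eval f d"
  using lin_eval_add[of f c "fscale (-1) d"] by (simp add: lin_eval_fscale) (simp add: fscale_minus_one)

lemma lin_eval_sum: "lin_eval f (\<Sum>i\<in>I. g i) = (\<Sum>i\<in>I. lin_eval f (g i))"
  by (induction I rule: infinite_finite_induct) (auto simp: lin_eval_add)

lemma lin_eval_lin_ext: "lin_eval f (lin_ext g c) = lin_eval (\<lambda>x. lin_eval f (g x)) c"
  by (simp add: lin_ext_def lin_eval_sum lin_eval_fscale) (simp add: lin_eval_def)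

lemma lin_eval_cong: "(\<And>x. x \<in> Poly_Mapping.keys c \<Longrightarrow> f x = g x) \<Longrightarrow> lin_eval f c = lin_eval g c"
  by (simp add: lin_eval_def)

lemma lin_eval_fun_add: "lin_eval (\<lambda>x. f x + g x) c = lin_eval f c + lin_eval g c"
  by (simp add: lin_eval_def algebra_simps sum.distrib)

lemma lin_eval_fun_mult: "lin_eval (\<lambda>x. r * f x) c = r * lin_eval f c"
  by (simp add: lin_eval_def sum_distrib_left mult_ac)

lemma lin_eval_fun_diff: "lin_eval (\<lambda>x. f x - g x) c = lin_eval f c - lin_eval g c"
  by (simp add: lin_eval_def algebra_simps sum_subtractf)

text \<open>A linear right inverse \<open>g\<close> of \<open>D\<close> on its range exists in any
  dimension, and \<open>c - g (D c)\<close> lies in the kernel of \<open>D\<close>. Bar chains form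
  infinite-dimensional spaces, which the finite elimination in \<open>functional_in_span\<close>
  does not reach.\<close>

lemma functional_factors:
  fixes D :: "('a \<Rightarrow>\<^sub>0 rat) \<Rightarrow> ('b \<Rightarrow>\<^sub>0 rat)" and f :: "('a \<Rightarrow>\<^sub>0 rat) \<Rightarrow> rat"
  assumes "Vector_Spaces.linear fscale fscale D" and "Vector_Spaces.linear fscale (*) f"
    and "\<And>c. D c = 0 \<Longrightarrow> f c = 0"
  shows "\<exists>h. Vector_Spaces.linear fscale (*) h \<and> (\<forall>c. f c = h (D c))"
proof -
  interpret a: vector_space_pair fscale fscale
    by (intro vector_space_pair.intro vector_space_fscale)
  interpret b: Vector_Spaces.linear fscale fscale D by fact
  interpret c: Vector_Spaces.linear fscale "(*)" f by fact
  obtain g where g: "Vector_Spaces.linear fscale fscale g" "\<And>c. D (g (D c)) = D c"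
    using a.linear_exists_right_inverse_on[OF assms(1) a.vs1.subspace_UNIV] by auto
  have "f c = f (g (D c))" for c
  proof -
    have "f (c - g (D c)) = 0" by (rule assms(3)) (simp add: b.diff g)
    then show ?thesis by (simp add: c.diff)
  qed
  moreover have "Vector_Spaces.linear fscale (*) (f \<circ> g)"
    using g(1) assms(2) by (rule Vector_Spaces.linear_compose)
  ultimately show ?thesis by (intro exI[of _ "f \<circ> g"]) simp
qed

lemma linear_lin_ext: "Vector_Spaces.linear fscale fscale (lin_ext f)"
  by (intro Vector_Spaces.linear_iff[THEN iffD2] conjI vector_space_fscale allI lin_ext_add lin_ext_fscale)

lemma linear_lin_eval: "Vector_Spaces.linear fscale (*) (lin_eval f)"
  by (intro Vector_Spaces.linear_iff[THEN iffD2] conjI vector_space_fscale vector_space_rat allI lin_eval_add lin_eval_fscale)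

subsection \<open>The free non-associative algebra\<close>

notation mag_mult (infixl "\<star>" 70)

text \<open>As two nested linear extensions, the product inherits its bilinearity from
  \<open>lin_ext\<close>.\<close>

lemma mag_mult_lin_ext:
  "p \<star> q = lin_ext (\<lambda>s. lin_ext (\<lambda>t. Poly_Mapping.single (Br s t) 1) q) p"
  by (simp add: mag_mult_def lin_ext_def fscale_sum fscale_fscale fscale_single)

lemma mag_mult_add_left: "(p + q) \<star> r = p \<star> r + q \<star> r"
  and mag_mult_add_right: "r \<star> (p + q) = r \<star> p + r \<star> q"
  and mag_mult_fscale_left: "fscale c p \<star> q = fscale c (p \<star> q)"
  and mag_mult_fscale_right: "p \<star> fscale c q = fscale c (p \<star> q)"
  and mag_mult_zero_left [simp]: "0 \<star> q = 0"
  and mag_mult_diff_left: "(p - q) \<star> r = p \<star> r - q \<star> r"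
  and mag_mult_uminus_left: "(- p) \<star> r = - (p \<star> r)"
  by (simp_all add: mag_mult_lin_ext lin_ext_add lin_ext_fun_add lin_ext_fscale lin_ext_fun_fscale
      lin_ext_diff lin_ext_uminus)

lemma mag_mult_uminus_right: "r \<star> (- p) = - (r \<star> p)"
  using mag_mult_fscale_right[of r "-1" p] by (simp add: fscale_minus_one)

lemma mag_mult_zero_right [simp]: "r \<star> 0 = 0"
  using mag_mult_fscale_right[of r 0 0] by (simp add: fscale_zero_left)

lemma mag_mult_diff_right: "r \<star> (p - q) = r \<star> p - r \<star> q"
  using mag_mult_add_right[of r p "- q"] by (simp add: mag_mult_uminus_right)

lemma mag_mult_sum_left: "(\<Sum>i\<in>I. f i) \<star> q = (\<Sum>i\<in>I. f i \<star> q)"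
  by (induction I rule: infinite_finite_induct) (auto simp: mag_mult_add_left)

lemma mag_mult_sum_right: "q \<star> (\<Sum>i\<in>I. f i) = (\<Sum>i\<in>I. q \<star> f i)"
  by (induction I rule: infinite_finite_induct) (auto simp: mag_mult_add_right)

lemma mag_mult_single:
  "Poly_Mapping.single s a \<star> Poly_Mapping.single t b = Poly_Mapping.single (Br s t) (a * b)"
  by (simp add: mag_mult_lin_ext lin_ext_single fscale_single)

lemmas mag_mult_simps = mag_mult_add_left mag_mult_add_right mag_mult_fscale_left
  mag_mult_fscale_right mag_mult_diff_left mag_mult_diff_right mag_mult_uminus_left
  mag_mult_uminus_right

lemma single_Br: "Poly_Mapping.single (Br s t) 1 = Poly_Mapping.single s (1::rat) \<star> Poly_Mapping.single t 1"
  by (simp add: mag_mult_single)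

lemma free_nonassoc_sel:
  "mult (free_nonassoc X) = (\<star>)" "add (free_nonassoc X) = (+)" "zero (free_nonassoc X) = 0"
  "smult (free_nonassoc X) = fscale"
  "p \<in> carrier (free_nonassoc X) \<longleftrightarrow> (\<forall>t\<in>Poly_Mapping.keys p. set_mag t \<subseteq> X)"
  "p \<in> gr (free_nonassoc X) n \<longleftrightarrow>
    p \<in> carrier (free_nonassoc X) \<and> (\<forall>t\<in>Poly_Mapping.keys p. bracket_length t = n)"
  by (auto simp: free_nonassoc_def)

abbreviation free_carrier :: "'v set \<Rightarrow> ('v magma \<Rightarrow>\<^sub>0 rat) set" where
  "free_carrier X \<equiv> carrier (free_nonassoc X)"

lemma free_carrier_zero [simp, intro]: "0 \<in> free_carrier X"
  by (simp add: free_nonassoc_sel)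

lemma free_carrier_add [simp, intro]:
  "p \<in> free_carrier X \<Longrightarrow> q \<in> free_carrier X \<Longrightarrow> p + q \<in> free_carrier X"
  using Poly_Mapping.keys_add[of p q] by (auto simp: free_nonassoc_sel)

lemma free_carrier_fscale [simp, intro]: "p \<in> free_carrier X \<Longrightarrow> fscale r p \<in> free_carrier X"
  using keys_fscale[of r p] by (auto simp: free_nonassoc_sel)

lemma free_carrier_uminus [simp, intro]: "p \<in> free_carrier X \<Longrightarrow> - p \<in> free_carrier X"
  using free_carrier_fscale[of p X "-1"] by (simp add: fscale_minus_one)

lemma free_carrier_diff [simp, intro]:
  "p \<in> free_carrier X \<Longrightarrow> q \<in> free_carrier X \<Longrightarrow> p - q \<in> free_carrier X"
  using free_carrier_add[of p X "- q"] by simp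

lemma free_carrier_sum [simp, intro]:
  "(\<And>i. i \<in> I \<Longrightarrow> f i \<in> free_carrier X) \<Longrightarrow> (\<Sum>i\<in>I. f i) \<in> free_carrier X"
  by (induction I rule: infinite_finite_induct) auto

lemma free_carrier_single [intro]: "set_mag t \<subseteq> X \<Longrightarrow> Poly_Mapping.single t r \<in> free_carrier X"
  by (auto simp: free_nonassoc_sel split: if_splits)

lemma free_carrier_gen [simp, intro]: "x \<in> X \<Longrightarrow> mag_gen x \<in> free_carrier X"
  by (rule free_carrier_single) simp

lemma keys_mag_mult:
  "Poly_Mapping.keys (p \<star> q) \<subseteq> {Br s t | s t. s \<in> Poly_Mapping.keys p \<and> t \<in> Poly_Mapping.keys q}"
proof
  fix z assume z: "z \<in> Poly_Mapping.keys (p \<star> q)"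
  then have "z \<in> (\<Union>s\<in>Poly_Mapping.keys p. \<Union>t\<in>Poly_Mapping.keys q.
      Poly_Mapping.keys (Poly_Mapping.single (Br s t) (Poly_Mapping.lookup p s * Poly_Mapping.lookup q t)))"
    unfolding mag_mult_def using keys_sum by (fast dest: subsetD[OF keys_sum])
  then show "z \<in> {Br s t | s t. s \<in> Poly_Mapping.keys p \<and> t \<in> Poly_Mapping.keys q}"
    by (auto split: if_splits)
qed

lemma free_carrier_mult [simp, intro]:
  "p \<in> free_carrier X \<Longrightarrow> q \<in> free_carrier X \<Longrightarrow> p \<star> q \<in> free_carrier X"
  using keys_mag_mult[of p q] by (fastforce simp: free_nonassoc_sel)

lemma free_carrier_induct [consumes 1, case_names gen mult zero add fscale]:
  assumes "p \<in> free_carrier X"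
    and gen: "\<And>x. x \<in> X \<Longrightarrow> P (mag_gen x)"
    and mult: "\<And>p q. p \<in> free_carrier X \<Longrightarrow> q \<in> free_carrier X \<Longrightarrow> P p \<Longrightarrow> P q \<Longrightarrow> P (p \<star> q)"
    and "P 0"
    and "\<And>p q. p \<in> free_carrier X \<Longrightarrow> q \<in> free_carrier X \<Longrightarrow> P p \<Longrightarrow> P q \<Longrightarrow> P (p + q)"
    and "\<And>r p. p \<in> free_carrier X \<Longrightarrow> P p \<Longrightarrow> P (fscale r p)"
  shows "P p"
proof -
  have mag: "P (Poly_Mapping.single t 1)" if "set_mag t \<subseteq> X" for t
    using that
  proof (induction t)
    case (Gen x)
    then show ?case using gen by simp
  next
    case (Br s t)
    then show ?case unfolding single_Br by (intro mult free_carrier_single) auto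
  qed
  have "p \<in> {p \<in> free_carrier X. P p}"
  proof (rule span_singles_induct)
    fix t assume "t \<in> Poly_Mapping.keys p"
    then have "set_mag t \<subseteq> X" using assms(1) by (simp add: free_nonassoc_sel)
    then show "Poly_Mapping.single t 1 \<in> {p \<in> free_carrier X. P p}"
      using mag by auto
  qed (use assms in auto)
  then show ?thesis by simp
qed

text \<open>Monomials span in each argument, and the values at 0 come from homogeneity with scalar
  0. This yields product rules for maps that are defined by recursion on monomials.\<close>

lemma bilinear_eqI:
  assumes "\<And>s t. b (Poly_Mapping.single s (1::rat)) (Poly_Mapping.single t (1::rat))
      = (b' (Poly_Mapping.single s 1) (Poly_Mapping.single t 1) :: 'c \<Rightarrow>\<^sub>0 rat)"
    and "\<And>p p' q. b (p + p') q = b p q + b p' q" "\<And>p q q'. b p (q + q') = b p q + b p q'"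
    and "\<And>r p q. b (fscale r p) q = fscale r (b p q)" "\<And>r p q. b p (fscale r q) = fscale r (b p q)"
    and "\<And>p p' q. b' (p + p') q = b' p q + b' p' q" "\<And>p q q'. b' p (q + q') = b' p q + b' p q'"
    and "\<And>r p q. b' (fscale r p) q = fscale r (b' p q)" "\<And>r p q. b' p (fscale r q) = fscale r (b' p q)"
  shows "b p q = b' p q"
proof -
  have z: "b 0 q = 0" "b' 0 q = 0" "b q' 0 = 0" "b' q' 0 = 0" for q q'
    using assms(4)[of 0 0 q] assms(8)[of 0 0 q] assms(5)[of q' 0 0] assms(9)[of q' 0 0]
    by (simp_all add: fscale_zero_left)
  have 1: "q \<in> {q. b (Poly_Mapping.single s 1) q = b' (Poly_Mapping.single s 1) q}" for s q
    by (rule span_singles_induct) (use assms z in auto)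
  have "p \<in> {p. \<forall>q. b p q = b' p q}"
    by (rule span_singles_induct) (use assms z 1 in auto)
  then show ?thesis by simp
qed

section \<open>Derivations of the free non-associative algebra\<close>

primrec deriv_magma :: "('v \<Rightarrow> ('v magma \<Rightarrow>\<^sub>0 rat)) \<Rightarrow> 'v magma \<Rightarrow> ('v magma \<Rightarrow>\<^sub>0 rat)" where
  "deriv_magma d (Gen x) = d x"
| "deriv_magma d (Br s t) = deriv_magma d s \<star> Poly_Mapping.single t 1
     + Poly_Mapping.single s 1 \<star> deriv_magma d t"

text \<open>The free algebra imposes no relations, so every prescription on generators extends to a
  derivation. Which ideals it preserves is the question answered by
  \<open>free_deriv_gen_ideal\<close>.\<close>

definition free_deriv :: "('v \<Rightarrow> ('v magma \<Rightarrow>\<^sub>0 rat)) \<Rightarrow> ('v magma \<Rightarrow>\<^sub>0 rat) \<Rightarrow> ('v magma \<Rightarrow>\<^sub>0 rat)" where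
  "free_deriv d = lin_ext (deriv_magma d)"

lemma free_deriv_linear:
  "free_deriv d (p + q) = free_deriv d p + free_deriv d q"
  "free_deriv d (fscale r p) = fscale r (free_deriv d p)"
  "free_deriv d (p - q) = free_deriv d p - free_deriv d q"
  "free_deriv d (- p) = - free_deriv d p"
  "free_deriv d 0 = 0"
  "free_deriv d (\<Sum>i\<in>I. f i) = (\<Sum>i\<in>I. free_deriv d (f i))"
  by (simp_all add: free_deriv_def lin_ext_add lin_ext_fscale lin_ext_diff lin_ext_uminus lin_ext_sum)

lemma free_deriv_gen [simp]: "free_deriv d (mag_gen x) = d x"
  by (simp add: free_deriv_def lin_ext_single fscale_one)

lemma free_deriv_mult: "free_deriv d (p \<star> q) = free_deriv d p \<star> q + p \<star> free_deriv d q"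
  by (rule bilinear_eqI[where b = "\<lambda>p q. free_deriv d (p \<star> q)"
        and b' = "\<lambda>p q. free_deriv d p \<star> q + p \<star> free_deriv d q"])
    (simp_all add: mag_mult_simps free_deriv_linear fscale_simps flip: single_Br,
      simp add: free_deriv_def lin_ext_single fscale_one)

lemma free_deriv_closed:
  assumes "\<And>x. x \<in> X \<Longrightarrow> d x \<in> free_carrier X" "p \<in> free_carrier X"
  shows "free_deriv d p \<in> free_carrier X"
  using assms(2) by (induction rule: free_carrier_induct) (auto simp: assms free_deriv_linear free_deriv_mult)

section \<open>Algebra maps induced by maps of generators\<close>

definition mag_map :: "('v \<Rightarrow> 'w) \<Rightarrow> ('v magma \<Rightarrow>\<^sub>0 rat) \<Rightarrow> ('w magma \<Rightarrow>\<^sub>0 rat)" where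
  "mag_map f = lin_ext (\<lambda>t. Poly_Mapping.single (map_magma f t) 1)"

lemma mag_map_linear:
  "mag_map f (p + q) = mag_map f p + mag_map f q"
  "mag_map f (fscale r p) = fscale r (mag_map f p)"
  "mag_map f (p - q) = mag_map f p - mag_map f q"
  "mag_map f (- p) = - mag_map f p"
  "mag_map f 0 = 0"
  "mag_map f (\<Sum>i\<in>I. g i) = (\<Sum>i\<in>I. mag_map f (g i))"
  by (simp_all add: mag_map_def lin_ext_add lin_ext_fscale lin_ext_diff lin_ext_uminus lin_ext_sum)

lemma mag_map_gen [simp]: "mag_map f (mag_gen x) = mag_gen (f x)"
  by (simp add: mag_map_def lin_ext_single fscale_one)

lemma mag_map_mult: "mag_map f (p \<star> q) = mag_map f p \<star> mag_map f q"
  by (rule bilinear_eqI[where b = "\<lambda>p q. mag_map f (p \<star> q)"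
        and b' = "\<lambda>p q. mag_map f p \<star> mag_map f q"])
    (simp_all add: mag_mult_simps mag_map_linear fscale_simps flip: single_Br,
      simp add: mag_map_def lin_ext_single fscale_one mag_mult_single)

lemma mag_map_closed:
  assumes "\<And>x. x \<in> X \<Longrightarrow> f x \<in> Y" "p \<in> free_carrier X"
  shows "mag_map f p \<in> free_carrier Y"
  using assms(2) by (induction rule: free_carrier_induct) (auto simp: assms mag_map_linear mag_map_mult)

lemma mag_map_comp:
  assumes "\<And>x. x \<in> X \<Longrightarrow> g (f x) = h x" "p \<in> free_carrier X"
  shows "mag_map g (mag_map f p) = mag_map h p"
  using assms(2) by (induction rule: free_carrier_induct) (auto simp: assms mag_map_linear mag_map_mult)

lemma mag_map_id: 
  assumes "\<And>x. x \<in> X \<Longrightarrow> f x = x" "p \<in> free_carrier X"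
  shows "mag_map f p = p"
  using assms(2) by (induction rule: free_carrier_induct) (auto simp: assms mag_map_linear mag_map_mult)

section \<open>The grading by bracket length\<close>

definition gcomp :: "nat \<Rightarrow> ('v magma \<Rightarrow>\<^sub>0 rat) \<Rightarrow> ('v magma \<Rightarrow>\<^sub>0 rat)" where
  "gcomp n = lin_ext (\<lambda>t. if bracket_length t = n then Poly_Mapping.single t 1 else 0)"

lemma lookup_gcomp:
  "Poly_Mapping.lookup (gcomp n p) t = (if bracket_length t = n then Poly_Mapping.lookup p t else 0)"
proof -
  have "Poly_Mapping.lookup (gcomp n p) t =
    (\<Sum>x\<in>Poly_Mapping.keys p. if x = t then (if bracket_length t = n then Poly_Mapping.lookup p t else 0) else 0)"
    unfolding gcomp_def lin_ext_def lookup_sum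
    by (rule sum.cong) (auto simp: lookup_single when_def)
  then show ?thesis by (auto simp: sum.delta in_keys_iff)
qed

lemma gcomp_linear:
  "gcomp n (p + q) = gcomp n p + gcomp n q"
  "gcomp n (fscale r p) = fscale r (gcomp n p)"
  "gcomp n (p - q) = gcomp n p - gcomp n q"
  "gcomp n (- p) = - gcomp n p"
  "gcomp n 0 = 0"
  "gcomp n (\<Sum>i\<in>I. f i) = (\<Sum>i\<in>I. gcomp n (f i))"
  by (simp_all add: gcomp_def lin_ext_add lin_ext_fscale lin_ext_diff lin_ext_uminus lin_ext_sum)

lemma keys_gcomp: "Poly_Mapping.keys (gcomp n p) = {t \<in> Poly_Mapping.keys p. bracket_length t = n}"
  by (auto simp: in_keys_iff lookup_gcomp split: if_splits)

lemma gcomp_closed: "p \<in> free_carrier X \<Longrightarrow> gcomp n p \<in> free_carrier X"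
  by (auto simp: free_nonassoc_sel keys_gcomp)

lemma gr_free_nonassoc_iff: "p \<in> gr (free_nonassoc X) n \<longleftrightarrow> p \<in> free_carrier X \<and> gcomp n p = p"
proof -
  have "(\<forall>t\<in>Poly_Mapping.keys p. bracket_length t = n) \<longleftrightarrow> gcomp n p = p"
  proof
    assume "\<forall>t\<in>Poly_Mapping.keys p. bracket_length t = n"
    then show "gcomp n p = p" by (intro poly_mapping_eqI) (auto simp: lookup_gcomp in_keys_iff)
  next
    assume "gcomp n p = p"
    then show "\<forall>t\<in>Poly_Mapping.keys p. bracket_length t = n" using keys_gcomp[of n p] by auto
  qed
  then show ?thesis by (simp add: free_nonassoc_sel(6))
qed

lemma gcomp_gcomp: "gcomp m (gcomp n p) = (if m = n then gcomp n p else 0)"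
  by (rule poly_mapping_eqI) (auto simp: lookup_gcomp)

lemma gcomp_finite: "finite {n. gcomp n p \<noteq> 0}"
proof (rule finite_subset)
  show "{n. gcomp n p \<noteq> 0} \<subseteq> bracket_length ` Poly_Mapping.keys p"
  proof
    fix n assume "n \<in> {n. gcomp n p \<noteq> 0}"
    then obtain t where "t \<in> Poly_Mapping.keys (gcomp n p)" by (auto simp flip: keys_eq_empty)
    then show "n \<in> bracket_length ` Poly_Mapping.keys p" by (auto simp: keys_gcomp)
  qed
qed simp

lemma gcomp_sum:
  assumes "finite S" "{n. gcomp n p \<noteq> 0} \<subseteq> S"
  shows "(\<Sum>n\<in>S. gcomp n p) = p"
proof (rule poly_mapping_eqI)
  fix t
  have "Poly_Mapping.lookup (\<Sum>n\<in>S. gcomp n p) t =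
     (\<Sum>n\<in>S. if n = bracket_length t then Poly_Mapping.lookup p t else 0)"
    by (simp add: lookup_sum lookup_gcomp eq_commute)
  also have "\<dots> = Poly_Mapping.lookup p t"
  proof (cases "bracket_length t \<in> S")
    case False
    then have "gcomp (bracket_length t) p = 0" using assms by auto
    then have "Poly_Mapping.lookup p t = 0"
      using lookup_gcomp[of "bracket_length t" p t] by simp
    then show ?thesis by (simp cong: if_cong)
  qed (use assms in \<open>simp add: sum.delta\<close>)
  finally show "Poly_Mapping.lookup (\<Sum>n\<in>S. gcomp n p) t = Poly_Mapping.lookup p t" .
qed

lemma gcomp_mult_homogeneous:
  assumes "gcomp m p = p" "gcomp n q = q"
  shows "gcomp (m + n) (p \<star> q) = p \<star> q"
proof -
  have "p \<in> gr (free_nonassoc UNIV) m" "q \<in> gr (free_nonassoc UNIV) n"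
    using assms by (auto simp: gr_free_nonassoc_iff free_nonassoc_sel)
  then have "p \<star> q \<in> gr (free_nonassoc UNIV) (m + n)"
    using keys_mag_mult[of p q] by (fastforce simp: free_nonassoc_sel)
  then show ?thesis by (simp add: gr_free_nonassoc_iff)
qed

lemma gcomp_gen: "gcomp n (mag_gen x) = (if n = 1 then mag_gen x else 0)"
  by (simp add: gcomp_def lin_ext_single fscale_simps)

lemma gcomp_mag_map: "gcomp n (mag_map f p) = mag_map f (gcomp n p)"
proof -
  have bl: "bracket_length (map_magma f t) = bracket_length t" for t
    by (induction t) auto
  have "p \<in> {p. gcomp n (mag_map f p) = mag_map f (gcomp n p)}"
    by (rule span_singles_induct)
      (auto simp: mag_map_linear gcomp_linear mag_map_def gcomp_def lin_ext_single fscale_simps bl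
        lin_ext_add lin_ext_fscale)
  then show ?thesis by simp
qed

lemma bracket_length_pos: "bracket_length t > 0"
  by (induction t) auto

lemma gcomp_1_mult: "gcomp (Suc 0) (p \<star> q) = 0"
proof (rule poly_mapping_eqI)
  fix t
  show "Poly_Mapping.lookup (gcomp (Suc 0) (p \<star> q)) t = Poly_Mapping.lookup 0 t"
  proof (cases "t \<in> Poly_Mapping.keys (p \<star> q)")
    case True
    then obtain a b where "t = Br a b" using keys_mag_mult[of p q] by auto
    then show ?thesis using bracket_length_pos[of a] bracket_length_pos[of b]
      by (auto simp: lookup_gcomp)
  qed (simp add: lookup_gcomp in_keys_iff)
qed

text \<open>The derivation that fixes the generators; it multiplies each monomial by its bracket
  length.\<close>

definition euler_deriv :: "('v magma \<Rightarrow>\<^sub>0 rat) \<Rightarrow> ('v magma \<Rightarrow>\<^sub>0 rat)" where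
  "euler_deriv = free_deriv mag_gen"

lemma gcomp_euler_deriv: "gcomp n (euler_deriv p) = fscale (of_nat n) (gcomp n p)"
proof -
  have dm: "deriv_magma mag_gen t = Poly_Mapping.single t (of_nat (bracket_length t))" for t :: "'a magma"
    by (induction t) (auto simp: mag_mult_single simp flip: single_add)
  have "p \<in> {p. gcomp n (euler_deriv p) = fscale (of_nat n) (gcomp n p)}"
    by (rule span_singles_induct)
      (auto simp: euler_deriv_def free_deriv_linear gcomp_linear fscale_simps mult_ac free_deriv_def
        lin_ext_single gcomp_def dm fscale_single lin_ext_add lin_ext_fscale)
  then show ?thesis by simp
qed

subsection \<open>Quotients of non-associative algebras\<close>

lemma cring_Rat: "cring Rat"
  by (rule cringI)
    (auto simp: Rat_def algebra_simps intro!: abelian_groupI comm_monoidI exI[of _ "- _"])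

lemma Rat_sel [simp]: "carrier Rat = UNIV" "add Rat = (+)" "mult Rat = (*)" "one Rat = 1" "zero Rat = 0"
  by (auto simp: Rat_def)

lemma a_inv_Rat [simp]: "\<ominus>\<^bsub>Rat\<^esub> x = - x"
proof -
  interpret cring Rat by (rule cring_Rat)
  show ?thesis by (rule minus_equality) auto
qed

lemma module_Rat_I:
  assumes "z \<in> C" "\<And>x y. x \<in> C \<Longrightarrow> y \<in> C \<Longrightarrow> pl x y \<in> C" "\<And>r x. x \<in> C \<Longrightarrow> sc r x \<in> C"
    and "carrier M = C" "add M = pl" "zero M = z" "smult M = sc"
    and "\<And>x y w. x \<in> C \<Longrightarrow> y \<in> C \<Longrightarrow> w \<in> C \<Longrightarrow> pl (pl x y) w = pl x (pl y w)"
    and "\<And>x y. x \<in> C \<Longrightarrow> y \<in> C \<Longrightarrow> pl x y = pl y x"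
    and "\<And>x. x \<in> C \<Longrightarrow> pl z x = x" and "\<And>x. x \<in> C \<Longrightarrow> pl (sc (-1) x) x = z"
    and "\<And>r s x. x \<in> C \<Longrightarrow> sc (r + s) x = pl (sc r x) (sc s x)"
    and "\<And>r x y. x \<in> C \<Longrightarrow> y \<in> C \<Longrightarrow> sc r (pl x y) = pl (sc r x) (sc r y)"
    and "\<And>r s x. x \<in> C \<Longrightarrow> sc (r * s) x = sc r (sc s x)"
    and "\<And>x. x \<in> C \<Longrightarrow> sc 1 x = x"
  shows "module Rat M"
proof (rule moduleI[OF cring_Rat])
  show "abelian_group M"
  proof (rule abelian_groupI)
    show "\<exists>y\<in>carrier M. y \<oplus>\<^bsub>M\<^esub> x = \<zero>\<^bsub>M\<^esub>" if "x \<in> carrier M" for x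
      using that assms by (intro bexI[of _ "sc (-1) x"]) simp_all
  qed (use assms in simp_all)
qed (use assms in simp_all)

lemma module_a_inv: "module Rat M \<Longrightarrow> x \<in> carrier M \<Longrightarrow> \<ominus>\<^bsub>M\<^esub> x = (-1) \<odot>\<^bsub>M\<^esub> x"
  using module.smult_l_minus[of Rat M 1 x] module.smult_one[of Rat M x] by simp

lemma submodule_Rat_iff:
  assumes "module Rat M"
  shows "submodule W Rat M \<longleftrightarrow> W \<subseteq> carrier M \<and> \<zero>\<^bsub>M\<^esub> \<in> W \<and>
    (\<forall>x\<in>W. \<forall>y\<in>W. x \<oplus>\<^bsub>M\<^esub> y \<in> W) \<and> (\<forall>r. \<forall>x\<in>W. r \<odot>\<^bsub>M\<^esub> x \<in> W)"
proof
  assume W: "submodule W Rat M"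
  interpret module Rat M by fact
  interpret submodule W Rat M by fact
  show "W \<subseteq> carrier M \<and> \<zero>\<^bsub>M\<^esub> \<in> W \<and>
    (\<forall>x\<in>W. \<forall>y\<in>W. x \<oplus>\<^bsub>M\<^esub> y \<in> W) \<and> (\<forall>r. \<forall>x\<in>W. r \<odot>\<^bsub>M\<^esub> x \<in> W)"
    using submoduleE[OF W] one_closed by (auto intro: submodule.smult_closed[OF W])
next
  assume "W \<subseteq> carrier M \<and> \<zero>\<^bsub>M\<^esub> \<in> W \<and>
    (\<forall>x\<in>W. \<forall>y\<in>W. x \<oplus>\<^bsub>M\<^esub> y \<in> W) \<and> (\<forall>r. \<forall>x\<in>W. r \<odot>\<^bsub>M\<^esub> x \<in> W)"
  then show "submodule W Rat M"
    by (intro module.submoduleI[OF assms]) (auto simp: module_a_inv[OF assms] subsetD)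
qed

lemma submodule_carrier: "module Rat M \<Longrightarrow> submodule (carrier M) Rat M"
proof -
  assume "module Rat M"
  then interpret module Rat M .
  show ?thesis
    unfolding submodule_Rat_iff[OF module_axioms]
    using M.zero_closed M.a_closed smult_closed by auto
qed

text \<open>The bilinear part of \<open>graded_lie_algebra\<close>, without alternation, Jacobi
  identity and grading. It suffices for forming quotients by ideals and holds for the free algebra
  before any Lie relation is imposed.\<close>

definition nonassoc_algebra :: "('a, 'm) graded_algebra_scheme \<Rightarrow> bool" where
  "nonassoc_algebra L \<longleftrightarrow> module Rat L \<and>
     (\<forall>x\<in>carrier L. \<forall>y\<in>carrier L. x \<otimes>\<^bsub>L\<^esub> y \<in> carrier L) \<and>
     (\<forall>x\<in>carrier L. \<forall>y\<in>carrier L. \<forall>z\<in>carrier L.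
        (x \<oplus>\<^bsub>L\<^esub> y) \<otimes>\<^bsub>L\<^esub> z = x \<otimes>\<^bsub>L\<^esub> z \<oplus>\<^bsub>L\<^esub> y \<otimes>\<^bsub>L\<^esub> z \<and>
        z \<otimes>\<^bsub>L\<^esub> (x \<oplus>\<^bsub>L\<^esub> y) = z \<otimes>\<^bsub>L\<^esub> x \<oplus>\<^bsub>L\<^esub> z \<otimes>\<^bsub>L\<^esub> y) \<and>
     (\<forall>r. \<forall>x\<in>carrier L. \<forall>y\<in>carrier L.
        (r \<odot>\<^bsub>L\<^esub> x) \<otimes>\<^bsub>L\<^esub> y = r \<odot>\<^bsub>L\<^esub> (x \<otimes>\<^bsub>L\<^esub> y) \<and>
        x \<otimes>\<^bsub>L\<^esub> (r \<odot>\<^bsub>L\<^esub> y) = r \<odot>\<^bsub>L\<^esub> (x \<otimes>\<^bsub>L\<^esub> y))"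

lemma nonassoc_algebra_free: "nonassoc_algebra (free_nonassoc X)"
  unfolding nonassoc_algebra_def
proof (intro conjI)
  show "module Rat (free_nonassoc X)"
    by (rule module_Rat_I[OF _ _ _ HOL.refl HOL.refl HOL.refl HOL.refl])
      (auto simp: free_nonassoc_sel(1-4) fscale_simps add_ac mult_ac)
qed (auto simp: free_nonassoc_sel(1-4) mag_mult_simps)

lemma nonassoc_algebra_image:
  assumes L: "nonassoc_algebra L"
    and Q: "carrier Q = f ` carrier L" "\<zero>\<^bsub>Q\<^esub> = f \<zero>\<^bsub>L\<^esub>"
    "\<And>x y. x \<in> carrier L \<Longrightarrow> y \<in> carrier L \<Longrightarrow> f x \<oplus>\<^bsub>Q\<^esub> f y = f (x \<oplus>\<^bsub>L\<^esub> y)"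
    "\<And>x y. x \<in> carrier L \<Longrightarrow> y \<in> carrier L \<Longrightarrow> f x \<otimes>\<^bsub>Q\<^esub> f y = f (x \<otimes>\<^bsub>L\<^esub> y)"
    "\<And>r x. x \<in> carrier L \<Longrightarrow> r \<odot>\<^bsub>Q\<^esub> f x = f (r \<odot>\<^bsub>L\<^esub> x)"
  shows "nonassoc_algebra Q"
proof -
  interpret module Rat L using L by (simp add: nonassoc_algebra_def)
  have inv: "(- 1) \<odot>\<^bsub>L\<^esub> x \<oplus>\<^bsub>L\<^esub> x = \<zero>\<^bsub>L\<^esub>" if "x \<in> carrier L" for x
    using that M.l_neg[of x] module_a_inv[OF module_axioms that] by simp
  have L2: "x \<in> carrier L \<Longrightarrow> y \<in> carrier L \<Longrightarrow> x \<otimes>\<^bsub>L\<^esub> y \<in> carrier L" for x y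
    using L by (auto simp: nonassoc_algebra_def)
  have sm: "x \<in> carrier L \<Longrightarrow> r \<odot>\<^bsub>L\<^esub> x \<in> carrier L" for r x
    using smult_closed by simp
  show ?thesis unfolding nonassoc_algebra_def
  proof (intro conjI)
    have l: "(r + s) \<odot>\<^bsub>L\<^esub> x = r \<odot>\<^bsub>L\<^esub> x \<oplus>\<^bsub>L\<^esub> s \<odot>\<^bsub>L\<^esub> x"
      "(r * s) \<odot>\<^bsub>L\<^esub> x = r \<odot>\<^bsub>L\<^esub> (s \<odot>\<^bsub>L\<^esub> x)" "1 \<odot>\<^bsub>L\<^esub> x = x" if "x \<in> carrier L" for r s x
      using that smult_l_distr[of r s x] smult_assoc1[of r s x] smult_one[of x] by simp_all
    have l': "r \<odot>\<^bsub>L\<^esub> (x \<oplus>\<^bsub>L\<^esub> y) = r \<odot>\<^bsub>L\<^esub> x \<oplus>\<^bsub>L\<^esub> r \<odot>\<^bsub>L\<^esub> y"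
      if "x \<in> carrier L" "y \<in> carrier L" for r x y
      using that smult_r_distr[of r x y] by simp
    show "module Rat Q"
    proof (rule module_Rat_I[where C = "f ` carrier L", OF _ _ _ Q(1) HOL.refl Q(2) HOL.refl])
      show "x \<oplus>\<^bsub>Q\<^esub> y = y \<oplus>\<^bsub>Q\<^esub> x" if "x \<in> f ` carrier L" "y \<in> f ` carrier L" for x y
        using that by (auto simp: Q(3) M.a_comm)
      show "x \<oplus>\<^bsub>Q\<^esub> y \<oplus>\<^bsub>Q\<^esub> w = x \<oplus>\<^bsub>Q\<^esub> (y \<oplus>\<^bsub>Q\<^esub> w)"
        if "x \<in> f ` carrier L" "y \<in> f ` carrier L" "w \<in> f ` carrier L" for x y w
        using that by (auto simp: Q(3) M.a_assoc)
    qed (auto simp: Q(3,5) inv sm l l')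
    show "\<forall>x\<in>carrier Q. \<forall>y\<in>carrier Q. x \<otimes>\<^bsub>Q\<^esub> y \<in> carrier Q"
      unfolding Q(1) by (simp add: Q(4) L2)
    show "\<forall>x\<in>carrier Q. \<forall>y\<in>carrier Q. \<forall>z\<in>carrier Q.
        (x \<oplus>\<^bsub>Q\<^esub> y) \<otimes>\<^bsub>Q\<^esub> z = x \<otimes>\<^bsub>Q\<^esub> z \<oplus>\<^bsub>Q\<^esub> y \<otimes>\<^bsub>Q\<^esub> z \<and>
        z \<otimes>\<^bsub>Q\<^esub> (x \<oplus>\<^bsub>Q\<^esub> y) = z \<otimes>\<^bsub>Q\<^esub> x \<oplus>\<^bsub>Q\<^esub> z \<otimes>\<^bsub>Q\<^esub> y"
      unfolding Q(1) using L by (simp add: Q(3,4) L2 nonassoc_algebra_def)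
    show "\<forall>r. \<forall>x\<in>carrier Q. \<forall>y\<in>carrier Q.
        (r \<odot>\<^bsub>Q\<^esub> x) \<otimes>\<^bsub>Q\<^esub> y = r \<odot>\<^bsub>Q\<^esub> (x \<otimes>\<^bsub>Q\<^esub> y) \<and>
        x \<otimes>\<^bsub>Q\<^esub> (r \<odot>\<^bsub>Q\<^esub> y) = r \<odot>\<^bsub>Q\<^esub> (x \<otimes>\<^bsub>Q\<^esub> y)"
      unfolding Q(1) using L by (simp add: Q(4,5) L2 sm nonassoc_algebra_def)
  qed
qed

context
  fixes L :: "(rat, 'a, 'm) module_scheme" and I :: "'a set"
  assumes L: "module Rat L" and I: "submodule I Rat L"
begin

interpretation module Rat L by (rule L)

lemma submodule_facts:
  "I \<subseteq> carrier L" "\<zero>\<^bsub>L\<^esub> \<in> I" "x \<in> I \<Longrightarrow> y \<in> I \<Longrightarrow> x \<oplus>\<^bsub>L\<^esub> y \<in> I" "x \<in> I \<Longrightarrow> r \<odot>\<^bsub>L\<^esub> x \<in> I"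
  using I submodule_Rat_iff[OF module_axioms] by auto

lemma submod_abelian_subgroup: "abelian_subgroup I L"
  using I
  by (intro abelian_subgroupI3 additive_subgroup.intro abelian_group_axioms) (simp add: submodule_def)

interpretation abelian_subgroup I L by (rule submod_abelian_subgroup)

lemma submod_coset_mem_iff: "x \<in> carrier L \<Longrightarrow> z \<in> I +>\<^bsub>L\<^esub> x \<longleftrightarrow> (\<exists>i\<in>I. z = i \<oplus>\<^bsub>L\<^esub> x)"
  by (auto simp: a_r_coset_def')

lemma submod_coset_eq_iff:
  assumes "x \<in> carrier L" "y \<in> carrier L"
  shows "I +>\<^bsub>L\<^esub> x = I +>\<^bsub>L\<^esub> y \<longleftrightarrow> x \<ominus>\<^bsub>L\<^esub> y \<in> I"
proof -
  have "I +>\<^bsub>L\<^esub> x = I +>\<^bsub>L\<^esub> y \<longleftrightarrow> x \<in> I +>\<^bsub>L\<^esub> y"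
    using a_rcos_self[OF assms(1)] a_repr_independence'[OF _ assms(2)] by auto
  then show ?thesis using a_rcos_module[OF assms(2,1)] by (simp add: a_minus_def)
qed

text \<open>Operations on quotients and induced maps are defined as unions over all representatives.
  Such a union collapses to one coset as soon as the results agree modulo \<open>I\<close>.\<close>

lemma submod_coset_const:
  assumes "x \<in> carrier L" "S \<noteq> {}" "\<And>z. z \<in> S \<Longrightarrow> g z \<in> carrier L \<and> g z \<ominus>\<^bsub>L\<^esub> x \<in> I"
  shows "(\<Union>z\<in>S. I +>\<^bsub>L\<^esub> g z) = I +>\<^bsub>L\<^esub> x"
proof -
  have "I +>\<^bsub>L\<^esub> g z = I +>\<^bsub>L\<^esub> x" if "z \<in> S" for z
    using assms(1) assms(3)[OF that] by (simp add: submod_coset_eq_iff)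
  then show ?thesis using \<open>S \<noteq> {}\<close> by auto
qed

lemma submod_diff_add_cancel: "i \<in> carrier L \<Longrightarrow> x \<in> carrier L \<Longrightarrow> (i \<oplus>\<^bsub>L\<^esub> x) \<ominus>\<^bsub>L\<^esub> x = i"
  by (simp add: a_minus_def M.a_assoc M.r_neg)

lemma submod_quot_smult_coset:
  assumes x: "x \<in> carrier L"
  shows "quot_smult L I r (I +>\<^bsub>L\<^esub> x) = I +>\<^bsub>L\<^esub> (r \<odot>\<^bsub>L\<^esub> x)"
  unfolding quot_smult_def
proof (rule submod_coset_const)
  show "r \<odot>\<^bsub>L\<^esub> x \<in> carrier L" using x smult_closed by simp
  show "I +>\<^bsub>L\<^esub> x \<noteq> {}" using a_rcos_self[OF x] by auto
  fix z assume "z \<in> I +>\<^bsub>L\<^esub> x"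
  then obtain i where i: "i \<in> I" "z = i \<oplus>\<^bsub>L\<^esub> x" using x by (auto simp: submod_coset_mem_iff)
  then have "r \<odot>\<^bsub>L\<^esub> z = r \<odot>\<^bsub>L\<^esub> i \<oplus>\<^bsub>L\<^esub> r \<odot>\<^bsub>L\<^esub> x"
    using x submodule_facts(1) smult_r_distr by auto
  then show "r \<odot>\<^bsub>L\<^esub> z \<in> carrier L \<and> r \<odot>\<^bsub>L\<^esub> z \<ominus>\<^bsub>L\<^esub> r \<odot>\<^bsub>L\<^esub> x \<in> I"
    using i x submodule_facts(1) submodule_facts(4)[OF i(1), of r] smult_closed[of r]
    by (auto simp: submod_diff_add_cancel subsetD)
qed

lemma submod_rcosets: "a_rcosets\<^bsub>L\<^esub> I = (\<lambda>x. I +>\<^bsub>L\<^esub> x) ` carrier L"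
  by (auto simp: A_RCOSETS_def')

lemma submod_rcos_sum: "x \<in> carrier L \<Longrightarrow> y \<in> carrier L \<Longrightarrow>
    (I +>\<^bsub>L\<^esub> x) <+>\<^bsub>L\<^esub> (I +>\<^bsub>L\<^esub> y) = I +>\<^bsub>L\<^esub> (x \<oplus>\<^bsub>L\<^esub> y)"
  by (rule a_rcos_sum)

end

text \<open>The representatives of the coset are the sums of \<open>x\<close> and some
  \<open>i\<close> in \<open>I\<close>; their images differ from \<open>f x\<close> by
  \<open>f i\<close>, which lies in \<open>J\<close>.\<close>

lemma submod_induced_map:
  assumes L: "module Rat L" "submodule I Rat L" and M: "module Rat M" "submodule J Rat M"
    and x: "x \<in> carrier L" and f: "\<And>y. y \<in> carrier L \<Longrightarrow> f y \<in> carrier M"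
    and add: "\<And>i. i \<in> I \<Longrightarrow> f (i \<oplus>\<^bsub>L\<^esub> x) = f i \<oplus>\<^bsub>M\<^esub> f x" and I: "\<And>i. i \<in> I \<Longrightarrow> f i \<in> J"
  shows "induced_map M J f (I +>\<^bsub>L\<^esub> x) = J +>\<^bsub>M\<^esub> f x"
  unfolding induced_map_def
proof (rule submod_coset_const[OF M])
  interpret abelian_subgroup I L by (rule submod_abelian_subgroup[OF L])
  interpret M: module Rat M by (rule M)
  show "f x \<in> carrier M" by (simp add: f x)
  show "I +>\<^bsub>L\<^esub> x \<noteq> {}" using a_rcos_self[OF x] by auto
  fix z assume "z \<in> I +>\<^bsub>L\<^esub> x"
  then obtain i where i: "i \<in> I" "z = i \<oplus>\<^bsub>L\<^esub> x" using x by (auto simp: submod_coset_mem_iff[OF L])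
  then have "i \<in> carrier L" using submodule_facts(1)[OF L] by auto
  then show "f z \<in> carrier M \<and> f z \<ominus>\<^bsub>M\<^esub> f x \<in> J"
    using i I[OF i(1)] x f[of i] f[of x] f[of z] add[OF i(1)]
    by (simp add: submod_diff_add_cancel[OF M])
qed

context
  fixes L :: "('a, 'm) graded_algebra_scheme" and I :: "'a set"
  assumes L: "nonassoc_algebra L" and I: "algebra_ideal L I"
begin

interpretation module Rat L using L by (simp add: nonassoc_algebra_def)

lemma ideal_facts:
  "I \<subseteq> carrier L" "\<zero>\<^bsub>L\<^esub> \<in> I" "x \<in> I \<Longrightarrow> y \<in> I \<Longrightarrow> x \<oplus>\<^bsub>L\<^esub> y \<in> I" "x \<in> I \<Longrightarrow> r \<odot>\<^bsub>L\<^esub> x \<in> I"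
  "x \<in> I \<Longrightarrow> y \<in> carrier L \<Longrightarrow> x \<otimes>\<^bsub>L\<^esub> y \<in> I" "x \<in> I \<Longrightarrow> y \<in> carrier L \<Longrightarrow> y \<otimes>\<^bsub>L\<^esub> x \<in> I"
  using I submodule_Rat_iff[OF module_axioms] by (auto simp: algebra_ideal_def)

lemmas mod_sub = module_axioms I[unfolded algebra_ideal_def, THEN conjunct1]

lemmas abelian_subgroup_ideal = submod_abelian_subgroup[OF mod_sub]
lemmas coset_mem_iff = submod_coset_mem_iff[OF mod_sub]
lemmas coset_eq_iff = submod_coset_eq_iff[OF mod_sub]
lemmas coset_const = submod_coset_const[OF mod_sub]
lemmas diff_add_cancel = submod_diff_add_cancel[OF mod_sub]
lemmas quot_smult_coset = submod_quot_smult_coset[OF mod_sub]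

interpretation abelian_subgroup I L by (rule abelian_subgroup_ideal)

lemma quot_algebra_carrier: "carrier (quot_algebra L I) = (\<lambda>x. I +>\<^bsub>L\<^esub> x) ` carrier L"
  by (auto simp: quot_algebra_def A_RCOSETS_def')

lemma quot_algebra_zero: "\<zero>\<^bsub>quot_algebra L I\<^esub> = I +>\<^bsub>L\<^esub> \<zero>\<^bsub>L\<^esub>"
  using ideal_facts(1) by (simp add: quot_algebra_def M.a_coset_add_zero)

lemma quot_algebra_add:
  "x \<in> carrier L \<Longrightarrow> y \<in> carrier L \<Longrightarrow>
    (I +>\<^bsub>L\<^esub> x) \<oplus>\<^bsub>quot_algebra L I\<^esub> (I +>\<^bsub>L\<^esub> y) = I +>\<^bsub>L\<^esub> (x \<oplus>\<^bsub>L\<^esub> y)"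
  by (simp add: quot_algebra_def a_rcos_sum)

lemma quot_algebra_smult:
  "x \<in> carrier L \<Longrightarrow> r \<odot>\<^bsub>quot_algebra L I\<^esub> (I +>\<^bsub>L\<^esub> x) = I +>\<^bsub>L\<^esub> (r \<odot>\<^bsub>L\<^esub> x)"
  by (simp add: quot_algebra_def quot_smult_coset)

lemma quot_algebra_mult:
  assumes x: "x \<in> carrier L" and y: "y \<in> carrier L"
  shows "(I +>\<^bsub>L\<^esub> x) \<otimes>\<^bsub>quot_algebra L I\<^esub> (I +>\<^bsub>L\<^esub> y) = I +>\<^bsub>L\<^esub> (x \<otimes>\<^bsub>L\<^esub> y)"
proof -
  have cl: "a \<in> carrier L \<Longrightarrow> b \<in> carrier L \<Longrightarrow> a \<otimes>\<^bsub>L\<^esub> b \<in> carrier L" for a b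
    using L by (simp add: nonassoc_algebra_def)
  have *: "a \<otimes>\<^bsub>L\<^esub> b \<in> carrier L \<and> a \<otimes>\<^bsub>L\<^esub> b \<ominus>\<^bsub>L\<^esub> x \<otimes>\<^bsub>L\<^esub> y \<in> I"
    if a: "a \<in> I +>\<^bsub>L\<^esub> x" and b: "b \<in> I +>\<^bsub>L\<^esub> y" for a b
  proof -
    obtain i j where i: "i \<in> I" "a = i \<oplus>\<^bsub>L\<^esub> x" and j: "j \<in> I" "b = j \<oplus>\<^bsub>L\<^esub> y"
      using a b x y by (auto simp: coset_mem_iff)
    have ij: "i \<in> carrier L" "j \<in> carrier L" "a \<in> carrier L" "b \<in> carrier L"
      using i j x y ideal_facts(1) by auto
    \<comment> \<open>\<open>(i + x) (j + y) - x y = i (j + y) + x j\<close>, and both terms on the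
      right lie in the ideal.\<close>
    have "a \<otimes>\<^bsub>L\<^esub> b = i \<otimes>\<^bsub>L\<^esub> b \<oplus>\<^bsub>L\<^esub> x \<otimes>\<^bsub>L\<^esub> b"
      unfolding i(2) using L ij(1,4) x by (simp add: nonassoc_algebra_def)
    also have "x \<otimes>\<^bsub>L\<^esub> b = x \<otimes>\<^bsub>L\<^esub> j \<oplus>\<^bsub>L\<^esub> x \<otimes>\<^bsub>L\<^esub> y"
      unfolding j(2) using L ij(2) x y by (simp add: nonassoc_algebra_def)
    also have "i \<otimes>\<^bsub>L\<^esub> b \<oplus>\<^bsub>L\<^esub> (x \<otimes>\<^bsub>L\<^esub> j \<oplus>\<^bsub>L\<^esub> x \<otimes>\<^bsub>L\<^esub> y) = (i \<otimes>\<^bsub>L\<^esub> b \<oplus>\<^bsub>L\<^esub> x \<otimes>\<^bsub>L\<^esub> j) \<oplus>\<^bsub>L\<^esub> x \<otimes>\<^bsub>L\<^esub> y"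
      using cl ij x y by (simp add: M.a_assoc)
    finally show ?thesis
      using cl ij x y ideal_facts(3)[OF ideal_facts(5)[OF i(1) ij(4)] ideal_facts(6)[OF j(1) x]]
      by (simp add: diff_add_cancel)
  qed
  have "(\<Union>a\<in>I +>\<^bsub>L\<^esub> x. \<Union>b\<in>I +>\<^bsub>L\<^esub> y. I +>\<^bsub>L\<^esub> (a \<otimes>\<^bsub>L\<^esub> b)) = (\<Union>a\<in>I +>\<^bsub>L\<^esub> x. I +>\<^bsub>L\<^esub> (x \<otimes>\<^bsub>L\<^esub> y))"
    by (intro SUP_cong HOL.refl coset_const) (use * cl x y a_rcos_self[OF x] a_rcos_self[OF y] in auto)
  also have "\<dots> = I +>\<^bsub>L\<^esub> (x \<otimes>\<^bsub>L\<^esub> y)" using a_rcos_self[OF x] by auto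
  finally show ?thesis by (simp add: quot_algebra_def rcoset_mult_def)
qed

lemma quot_algebra_gr: "gr (quot_algebra L I) n = (\<lambda>x. I +>\<^bsub>L\<^esub> x) ` gr L n"
  by (simp add: quot_algebra_def)

lemma nonassoc_algebra_quot: "nonassoc_algebra (quot_algebra L I)"
  by (rule nonassoc_algebra_image[OF L quot_algebra_carrier quot_algebra_zero quot_algebra_add
        quot_algebra_mult quot_algebra_smult])

end

lemma algebra_ideal_carrier: "nonassoc_algebra L \<Longrightarrow> algebra_ideal L (carrier L)"
  by (auto simp: algebra_ideal_def nonassoc_algebra_def submodule_carrier)

lemma gen_ideal_superset: "S \<subseteq> gen_ideal L S"
  by (auto simp: gen_ideal_def)

lemma gen_ideal_least: "algebra_ideal L I \<Longrightarrow> S \<subseteq> I \<Longrightarrow> gen_ideal L S \<subseteq> I"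
  by (auto simp: gen_ideal_def)

lemma gen_ideal_ideal:
  assumes "nonassoc_algebra L" "S \<subseteq> carrier L"
  shows "algebra_ideal L (gen_ideal L S)"
proof -
  have m: "module Rat L" using assms by (simp add: nonassoc_algebra_def)
  show ?thesis
    unfolding algebra_ideal_def submodule_Rat_iff[OF m]
  proof (intro conjI ballI allI)
    show "gen_ideal L S \<subseteq> carrier L"
      using algebra_ideal_carrier[OF assms(1)] assms(2) by (rule gen_ideal_least)
  qed (auto simp: gen_ideal_def algebra_ideal_def submodule_Rat_iff[OF m])
qed

lemma algebra_ideal_free_iff:
  "algebra_ideal (free_nonassoc X) I \<longleftrightarrow> I \<subseteq> free_carrier X \<and> 0 \<in> I \<and>
    (\<forall>p\<in>I. \<forall>q\<in>I. p + q \<in> I) \<and> (\<forall>r. \<forall>p\<in>I. fscale r p \<in> I) \<and>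
    (\<forall>p\<in>I. \<forall>q\<in>free_carrier X. p \<star> q \<in> I \<and> q \<star> p \<in> I)"
  using nonassoc_algebra_free[of X] unfolding nonassoc_algebra_def
  by (simp add: algebra_ideal_def submodule_Rat_iff free_nonassoc_sel(1-4))

lemma free_nonassoc_minus:
  assumes "p \<in> free_carrier X" "q \<in> free_carrier X"
  shows "p \<ominus>\<^bsub>free_nonassoc X\<^esub> q = p - q"
  using nonassoc_algebra_free[of X] assms
  by (simp add: a_minus_def module_a_inv nonassoc_algebra_def free_nonassoc_sel(1-4) fscale_minus_one)

lemma induced_map_coset:
  assumes L: "nonassoc_algebra L" "algebra_ideal L I" and M: "nonassoc_algebra M" "algebra_ideal M J"
    and x: "x \<in> carrier L" and f: "\<And>y. y \<in> carrier L \<Longrightarrow> f y \<in> carrier M"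
    and add: "\<And>i. i \<in> I \<Longrightarrow> f (i \<oplus>\<^bsub>L\<^esub> x) = f i \<oplus>\<^bsub>M\<^esub> f x" and I: "\<And>i. i \<in> I \<Longrightarrow> f i \<in> J"
  shows "induced_map M J f (I +>\<^bsub>L\<^esub> x) = J +>\<^bsub>M\<^esub> f x"
  using assms by (intro submod_induced_map) (auto simp: nonassoc_algebra_def algebra_ideal_def)

subsection \<open>Lie ideals of the free non-associative algebra\<close>

text \<open>The quotient by such a \<open>J\<close> is a Lie algebra that receives a linear map from
  \<open>V\<close>. Congruence modulo \<open>J\<close> replaces computation in that Lie
  algebra.\<close>

locale lie_kernel =
  fixes V :: "(rat, 'v, 'm) module_scheme" and J :: "('v magma \<Rightarrow>\<^sub>0 rat) set"
  assumes module_V: "module Rat V"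
    and ideal_J: "algebra_ideal (free_nonassoc (carrier V)) J"
    and relators_J: "lie_relators V \<subseteq> J"
begin

lemma J_closed:
  shows J_subset: "p \<in> J \<Longrightarrow> p \<in> free_carrier (carrier V)" and J_zero [simp, intro]: "0 \<in> J"
    and J_add: "p \<in> J \<Longrightarrow> q \<in> J \<Longrightarrow> p + q \<in> J"
    and J_fscale: "p \<in> J \<Longrightarrow> fscale r p \<in> J"
    and J_mult_left: "p \<in> J \<Longrightarrow> q \<in> free_carrier (carrier V) \<Longrightarrow> p \<star> q \<in> J"
    and J_mult_right: "p \<in> J \<Longrightarrow> q \<in> free_carrier (carrier V) \<Longrightarrow> q \<star> p \<in> J"
  using ideal_J unfolding algebra_ideal_free_iff by auto

lemma J_uminus: "p \<in> J \<Longrightarrow> - p \<in> J"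
  using J_fscale[of p "-1"] by (simp add: fscale_minus_one)

lemma J_diff: "p \<in> J \<Longrightarrow> q \<in> J \<Longrightarrow> p - q \<in> J"
  using J_add[of p "- q"] J_uminus[of q] by simp

lemma J_sum: "(\<And>i. i \<in> I \<Longrightarrow> f i \<in> J) \<Longrightarrow> (\<Sum>i\<in>I. f i) \<in> J"
  by (induction I rule: infinite_finite_induct) (auto intro: J_add)

lemma J_sum_cong: "(\<And>i. i \<in> I \<Longrightarrow> f i - g i \<in> J) \<Longrightarrow> (\<Sum>i\<in>I. f i) - (\<Sum>i\<in>I. g i) \<in> J"
  using J_sum[of I "\<lambda>i. f i - g i"] by (simp add: sum_subtractf)

lemma J_trans: "p - q \<in> J \<Longrightarrow> q - r \<in> J \<Longrightarrow> p - r \<in> J"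
  using J_add[of "p - q" "q - r"] by simp

lemma J_commute: "p - q \<in> J \<Longrightarrow> q - p \<in> J"
  using J_uminus[of "p - q"] by simp

lemma J_mem_cong: "p - q \<in> J \<Longrightarrow> q \<in> J \<Longrightarrow> p \<in> J"
  using J_add[of "p - q" q] by simp

lemma J_mult_cong:
  assumes "p - p' \<in> J" "q - q' \<in> J" "p' \<in> free_carrier (carrier V)" "q \<in> free_carrier (carrier V)"
  shows "p \<star> q - p' \<star> q' \<in> J"
  using J_add[OF J_mult_left[OF assms(1,4)] J_mult_right[OF assms(2,3)]] by (simp add: mag_mult_simps)

lemma J_gen_add:
  "v \<in> carrier V \<Longrightarrow> w \<in> carrier V \<Longrightarrow> mag_gen (v \<oplus>\<^bsub>V\<^esub> w) - (mag_gen v + mag_gen w) \<in> J"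
  using relators_J unfolding lie_relators_def by (auto simp: diff_diff_eq)

lemma J_gen_smult: "v \<in> carrier V \<Longrightarrow> mag_gen (r \<odot>\<^bsub>V\<^esub> v) - fscale r (mag_gen v) \<in> J"
  using relators_J unfolding lie_relators_def by auto

lemma J_square: "p \<in> free_carrier (carrier V) \<Longrightarrow> p \<star> p \<in> J"
  using relators_J unfolding lie_relators_def by auto

lemma J_jacobi:
  "p \<in> free_carrier (carrier V) \<Longrightarrow> q \<in> free_carrier (carrier V) \<Longrightarrow> r \<in> free_carrier (carrier V) \<Longrightarrow>
    p \<star> (q \<star> r) + q \<star> (r \<star> p) + r \<star> (p \<star> q) \<in> J"
  using relators_J unfolding lie_relators_def by blast

text \<open>Polarisation of \<open>J_square\<close>.\<close>

lemma J_anticomm: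
  assumes "p \<in> free_carrier (carrier V)" "q \<in> free_carrier (carrier V)"
  shows "p \<star> q + q \<star> p \<in> J"
proof -
  have "(p + q) \<star> (p + q) - p \<star> p - q \<star> q \<in> J"
    using assms by (intro J_diff J_square) auto
  then show ?thesis by (simp add: mag_mult_simps algebra_simps)
qed

text \<open>The Jacobi relation with two brackets reversed by \<open>J_anticomm\<close>: left
  multiplication by \<open>p\<close> is a derivation modulo \<open>J\<close>.\<close>

lemma J_leibniz:
  assumes "p \<in> free_carrier (carrier V)" "q \<in> free_carrier (carrier V)" "r \<in> free_carrier (carrier V)"
  shows "p \<star> (q \<star> r) - ((p \<star> q) \<star> r + q \<star> (p \<star> r)) \<in> J"
proof -
  have "p \<star> (q \<star> r) + q \<star> (r \<star> p) + r \<star> (p \<star> q)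
     - (r \<star> (p \<star> q) + (p \<star> q) \<star> r) - q \<star> (r \<star> p + p \<star> r) \<in> J"
    using assms by (intro J_diff J_jacobi J_anticomm J_mult_right) auto
  then show ?thesis by (simp add: mag_mult_simps algebra_simps)
qed

end

text \<open>With the Lie relators included, this ideal of the free algebra is the full preimage of
  the ideal generated by the image of \<open>R\<close> in the free Lie algebra; see
  \<open>free_lie_proj_mem_gen_ideal\<close>.\<close>

definition lie_gen_ideal ::
  "(rat, 'v, 'm) module_scheme \<Rightarrow> ('v magma \<Rightarrow>\<^sub>0 rat) set \<Rightarrow> ('v magma \<Rightarrow>\<^sub>0 rat) set" where
  "lie_gen_ideal V R = gen_ideal (free_nonassoc (carrier V)) (lie_relators V \<union> R)"

lemma lie_relators_subset:
  assumes "module Rat V"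
  shows "lie_relators V \<subseteq> free_carrier (carrier V)"
proof -
  interpret module Rat V by fact
  have "v \<in> carrier V \<Longrightarrow> r \<odot>\<^bsub>V\<^esub> v \<in> carrier V" for r v using smult_closed by simp
  then show ?thesis by (auto simp: lie_relators_def)
qed

lemma lie_kernel_gen_ideal:
  assumes "module Rat V" "R \<subseteq> free_carrier (carrier V)"
  shows "lie_kernel V (lie_gen_ideal V R)"
proof (rule lie_kernel.intro)
  show "module Rat V" by fact
  show "algebra_ideal (free_nonassoc (carrier V)) (lie_gen_ideal V R)"
    unfolding lie_gen_ideal_def
    using lie_relators_subset[OF assms(1)] assms(2) by (intro gen_ideal_ideal nonassoc_algebra_free) auto
  show "lie_relators V \<subseteq> lie_gen_ideal V R"
    using gen_ideal_superset[of "lie_relators V \<union> R" "free_nonassoc (carrier V)"]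
    by (auto simp: lie_gen_ideal_def)
qed

lemma lie_gen_ideal_superset: "R \<subseteq> lie_gen_ideal V R"
  using gen_ideal_superset[of "lie_relators V \<union> R" "free_nonassoc (carrier V)"]
  by (auto simp: lie_gen_ideal_def)

lemma lie_gen_ideal_least:
  assumes "algebra_ideal (free_nonassoc (carrier V)) I" "lie_relators V \<subseteq> I" "R \<subseteq> I"
  shows "lie_gen_ideal V R \<subseteq> I"
  unfolding lie_gen_ideal_def using assms by (intro gen_ideal_least) auto

lemma lie_kernel_least:
  assumes "lie_kernel V I" "R \<subseteq> I"
  shows "lie_gen_ideal V R \<subseteq> I"
  using assms by (intro lie_gen_ideal_least) (auto simp: lie_kernel_def)

lemma lie_gen_ideal_empty: "lie_gen_ideal V {} = lie_ideal V"
  by (simp add: lie_gen_ideal_def lie_ideal_def)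

lemma lie_ideal_subset_gen_ideal: "lie_kernel V J \<Longrightarrow> lie_ideal V \<subseteq> J"
  using lie_kernel_least[of V J "{}"] by (simp add: lie_gen_ideal_empty)

text \<open>The elements of \<open>J\<close> whose derivative is again in \<open>J\<close> form an
  ideal; asking for both is what makes the product rule work. The target \<open>J\<close> may exceed
  the generated ideal, and \<open>d\<close> is linear only modulo \<open>J\<close>. The case
  \<open>R = {}\<close> handles the Lie relators before further relations are understood.\<close>

lemma free_deriv_gen_ideal:
  assumes V: "lie_kernel V J" and R: "R \<subseteq> J"
    and d: "\<And>v. v \<in> carrier V \<Longrightarrow> d v \<in> free_carrier (carrier V)"
    and d_add: "\<And>v w. v \<in> carrier V \<Longrightarrow> w \<in> carrier V \<Longrightarrow> d (v \<oplus>\<^bsub>V\<^esub> w) - (d v + d w) \<in> J"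
    and d_smult: "\<And>r v. v \<in> carrier V \<Longrightarrow> d (r \<odot>\<^bsub>V\<^esub> v) - fscale r (d v) \<in> J"
    and d_R: "\<And>p. p \<in> R \<Longrightarrow> free_deriv d p \<in> J"
    and p: "p \<in> lie_gen_ideal V R"
  shows "free_deriv d p \<in> J"
proof -
  let ?F = "free_carrier (carrier V)"
  interpret lie_kernel V J by (rule V)
  have D: "q \<in> ?F \<Longrightarrow> free_deriv d q \<in> ?F" for q by (rule free_deriv_closed[OF d])
  have "lie_gen_ideal V R \<subseteq> {p \<in> J. free_deriv d p \<in> J}"
  proof (rule lie_gen_ideal_least)
    show "algebra_ideal (free_nonassoc (carrier V)) {p \<in> J. free_deriv d p \<in> J}"
      unfolding algebra_ideal_free_iff
      by (auto simp: free_deriv_linear free_deriv_mult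
          intro: J_subset J_add J_fscale J_mult_left J_mult_right D)
    show "R \<subseteq> {p \<in> J. free_deriv d p \<in> J}"
      using R d_R by auto
    show "lie_relators V \<subseteq> {p \<in> J. free_deriv d p \<in> J}"
    proof
      fix x assume x: "x \<in> lie_relators V"
      have "free_deriv d x \<in> J"
        using x unfolding lie_relators_def
      proof (elim UnE CollectE exE conjE)
        fix v w assume "x = mag_gen (v \<oplus>\<^bsub>V\<^esub> w) - mag_gen v - mag_gen w" "v \<in> carrier V" "w \<in> carrier V"
        then show ?thesis using d_add[of v w] by (simp add: free_deriv_linear diff_diff_eq)
      next
        fix r v assume "x = mag_gen (r \<odot>\<^bsub>V\<^esub> v) - fscale r (mag_gen v)" "v \<in> carrier V"
        then show ?thesis using d_smult[of v r] by (simp add: free_deriv_linear)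
      next
        \<comment> \<open>The derivative of a square is an anticommutator.\<close>
        fix p assume "x = p \<star> p" "p \<in> ?F"
        then show ?thesis by (auto simp: free_deriv_mult intro: J_anticomm D)
      next
        fix p q r assume *: "x = p \<star> (q \<star> r) + q \<star> (r \<star> p) + r \<star> (p \<star> q)" "p \<in> ?F" "q \<in> ?F" "r \<in> ?F"
        \<comment> \<open>The Jacobi expression is trilinear, so its derivative is a sum of three
          Jacobi expressions.\<close>
        let ?j = "\<lambda>p q r. p \<star> (q \<star> r) + q \<star> (r \<star> p) + r \<star> (p \<star> q)" and ?D = "free_deriv d"
        have "free_deriv d x = ?j (?D p) q r + ?j p (?D q) r + ?j p q (?D r)"
          unfolding *(1) by (simp add: free_deriv_mult free_deriv_linear mag_mult_simps)
        also have "\<dots> \<in> J" using * by (intro J_add J_jacobi D)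
        finally show ?thesis .
      qed
      then show "x \<in> {p \<in> J. free_deriv d p \<in> J}" using x relators_J by auto
    qed
  qed
  then show ?thesis using p by auto
qed

text \<open>An ideal that is stable under the Euler derivation is homogeneous, since the Euler
  derivation separates the degrees.\<close>

lemma gcomp_ideal:
  assumes V: "module Rat V" and R: "R \<subseteq> gr (free_nonassoc (carrier V)) k"
    and p: "p \<in> lie_gen_ideal V R"
  shows "gcomp n p \<in> lie_gen_ideal V R"
proof -
  let ?J = "lie_gen_ideal V R"
  have RF: "R \<subseteq> free_carrier (carrier V)" using R by (auto simp: gr_free_nonassoc_iff)
  interpret lie_kernel V ?J by (rule lie_kernel_gen_ideal[OF V RF])
  have eu: "euler_deriv q \<in> ?J" if "q \<in> ?J" for q
    unfolding euler_deriv_def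
  proof (rule free_deriv_gen_ideal[OF lie_kernel_axioms lie_gen_ideal_superset _ J_gen_add J_gen_smult _ that])
    fix q assume q: "q \<in> R"
    then have k: "gcomp k q = q" using R by (auto simp: gr_free_nonassoc_iff)
    have "euler_deriv q = fscale (of_nat k) q"
    proof (rule poly_mapping_eqI)
      fix t
      have "Poly_Mapping.lookup (gcomp (bracket_length t) (euler_deriv q)) t =
          Poly_Mapping.lookup (fscale (of_nat (bracket_length t)) (gcomp (bracket_length t) (gcomp k q))) t"
        by (simp only: gcomp_euler_deriv k)
      then have "Poly_Mapping.lookup (euler_deriv q) t = of_nat (bracket_length t) * Poly_Mapping.lookup (gcomp k q) t"
        by (simp add: lookup_gcomp)
      then have "Poly_Mapping.lookup (euler_deriv q) t = of_nat k * Poly_Mapping.lookup (gcomp k q) t"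
        by (simp add: lookup_gcomp split: if_splits)
      then show "Poly_Mapping.lookup (euler_deriv q) t = Poly_Mapping.lookup (fscale (of_nat k) q) t"
        by (simp add: k)
    qed
    then show "free_deriv mag_gen q \<in> ?J"
      using q lie_gen_ideal_superset[of R V] J_fscale by (auto simp flip: euler_deriv_def)
  qed auto
  have "\<forall>n. gcomp n q \<in> ?J" if "finite S" "q \<in> ?J" "{n. gcomp n q \<noteq> 0} \<subseteq> S" for S q
    using that
  proof (induction S arbitrary: q rule: finite_induct)
    case (insert m S)
    \<comment> \<open>This kills the component of degree \<open>m\<close> and multiplies the one of
      degree \<open>n\<close> by \<open>n - m\<close>, which is invertible for the other degrees.
      The set of occurring degrees shrinks.\<close>
    define e where "e = euler_deriv q - fscale (of_nat m) q"
    have ge: "gcomp n e = fscale (of_nat n - of_nat m) (gcomp n q)" for n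
      by (simp add: e_def gcomp_linear gcomp_euler_deriv fscale_diff_left)
    have "gcomp n e \<in> ?J" for n
    proof -
      have "e \<in> ?J" using insert.prems eu by (auto simp: e_def intro: J_diff J_fscale)
      moreover have "{n. gcomp n e \<noteq> 0} \<subseteq> S"
      proof
        fix n assume "n \<in> {n. gcomp n e \<noteq> 0}"
        then have "gcomp n q \<noteq> 0" "n \<noteq> m" by (auto simp: ge fscale_zero_right fscale_zero_left)
        then show "n \<in> S" using insert.prems by auto
      qed
      ultimately show ?thesis using insert.IH by blast
    qed
    then have 1: "gcomp n q \<in> ?J" if "n \<noteq> m" for n
      using that J_fscale[of "gcomp n e" "1 / (of_nat n - of_nat m)"]
      by (simp add: ge fscale_fscale fscale_one)
    have "q = gcomp m q + (\<Sum>n\<in>S. gcomp n q)"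
      using gcomp_sum[of "insert m S" q] insert by simp
    then have "gcomp m q = q - (\<Sum>n\<in>S. gcomp n q)" by (simp add: algebra_simps)
    also have "\<dots> \<in> ?J" using insert by (intro J_diff J_sum 1) auto
    finally show ?case using 1 by (metis (full_types))
  next
    case empty
    then show ?case by auto
  qed
  then show ?thesis using p gcomp_finite by blast
qed

subsection \<open>Graded Lie algebras presented by the free non-associative algebra\<close>

lemma finsum_image:
  assumes "module Rat Q" "f 0 = \<zero>\<^bsub>Q\<^esub>" "\<And>x. x \<in> C \<Longrightarrow> f x \<in> carrier Q"
    and "\<And>x y. x \<in> C \<Longrightarrow> y \<in> C \<Longrightarrow> f x \<oplus>\<^bsub>Q\<^esub> f y = f (x + y)"
    and "0 \<in> C" "\<And>x y. x \<in> C \<Longrightarrow> y \<in> C \<Longrightarrow> x + y \<in> C"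
    and "finite A" "\<And>i. i \<in> A \<Longrightarrow> g i \<in> C"
  shows "finsum Q (\<lambda>i. f (g i)) A = f (\<Sum>i\<in>A. g i)"
proof -
  interpret module Rat Q by fact
  from assms(7,8) have "finsum Q (\<lambda>i. f (g i)) A = f (\<Sum>i\<in>A. g i) \<and> (\<Sum>i\<in>A. g i) \<in> C"
    by (induction A rule: finite_induct) (use assms in \<open>auto simp: Pi_def M.finsum_insert\<close>)
  then show ?thesis ..
qed

text \<open>\<open>C\<close> is a subalgebra of the free algebra and need not be all of it, so that
  derived subalgebras can be presented in the same form. Homogeneity of \<open>J\<close> makes the
  decomposition into graded pieces unique.\<close>

locale lie_presentation =
  fixes L :: "('a, 'm) graded_algebra_scheme" and C J :: "('v magma \<Rightarrow>\<^sub>0 rat) set"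
    and \<pi> :: "('v magma \<Rightarrow>\<^sub>0 rat) \<Rightarrow> 'a"
  assumes C: "0 \<in> C" "\<And>p q. p \<in> C \<Longrightarrow> q \<in> C \<Longrightarrow> p + q \<in> C" "\<And>r p. p \<in> C \<Longrightarrow> fscale r p \<in> C"
      "\<And>p q. p \<in> C \<Longrightarrow> q \<in> C \<Longrightarrow> p \<star> q \<in> C" "\<And>n p. p \<in> C \<Longrightarrow> gcomp n p \<in> C"
    and J: "\<And>p. p \<in> C \<Longrightarrow> p \<star> p \<in> J"
      "\<And>p q r. p \<in> C \<Longrightarrow> q \<in> C \<Longrightarrow> r \<in> C \<Longrightarrow> p \<star> (q \<star> r) + q \<star> (r \<star> p) + r \<star> (p \<star> q) \<in> J"
      "\<And>n p. p \<in> J \<Longrightarrow> gcomp n p \<in> J"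
    and L: "carrier L = \<pi> ` C" "\<zero>\<^bsub>L\<^esub> = \<pi> 0"
      "\<And>p q. p \<in> C \<Longrightarrow> q \<in> C \<Longrightarrow> \<pi> p \<oplus>\<^bsub>L\<^esub> \<pi> q = \<pi> (p + q)"
      "\<And>p q. p \<in> C \<Longrightarrow> q \<in> C \<Longrightarrow> \<pi> p \<otimes>\<^bsub>L\<^esub> \<pi> q = \<pi> (p \<star> q)"
      "\<And>r p. p \<in> C \<Longrightarrow> r \<odot>\<^bsub>L\<^esub> \<pi> p = \<pi> (fscale r p)"
      "\<And>n. gr L n = \<pi> ` {p \<in> C. gcomp n p = p}"
      "\<And>p q. p \<in> C \<Longrightarrow> q \<in> C \<Longrightarrow> \<pi> p = \<pi> q \<longleftrightarrow> p - q \<in> J"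
begin

lemma C_uminus: "p \<in> C \<Longrightarrow> - p \<in> C"
  using C(3)[of p "-1"] by (simp add: fscale_minus_one)

lemma C_sum: "(\<And>i. i \<in> I \<Longrightarrow> f i \<in> C) \<Longrightarrow> (\<Sum>i\<in>I. f i) \<in> C"
  by (induction I rule: infinite_finite_induct) (auto intro: C)

lemma L_module: "module Rat L"
  by (rule module_Rat_I[OF _ _ _ HOL.refl HOL.refl HOL.refl HOL.refl]; unfold L(1,2); (elim imageE)?)
    (simp_all add: C C_uminus L(3,5) add_ac fscale_simps mult_ac)

lemma finsum_L: "finite A \<Longrightarrow> (\<And>i. i \<in> A \<Longrightarrow> g i \<in> C) \<Longrightarrow> finsum L (\<lambda>i. \<pi> (g i)) A = \<pi> (\<Sum>i\<in>A. g i)"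
  by (rule finsum_image[where C = C]) (auto simp: L_module L C)

lemma ex1_decomposition:
  assumes x: "x \<in> carrier L"
  shows "\<exists>!c :: nat \<Rightarrow> 'a. (\<forall>n. c n \<in> gr L n) \<and>
    finite {n. c n \<noteq> \<zero>\<^bsub>L\<^esub>} \<and> x = finsum L c {n. c n \<noteq> \<zero>\<^bsub>L\<^esub>}"
proof -
  obtain p where p: "p \<in> C" "x = \<pi> p" using x L(1) by auto
  show ?thesis
  proof (rule ex1I[of _ "\<lambda>n. \<pi> (gcomp n p)"], intro conjI allI)
    let ?S = "{n. \<pi> (gcomp n p) \<noteq> \<zero>\<^bsub>L\<^esub>}"
    show "\<pi> (gcomp n p) \<in> gr L n" for n
      using p C(5) by (auto simp: L(6) gcomp_gcomp)
    have sub: "?S \<subseteq> {n. gcomp n p \<noteq> 0}" by (auto simp: L(2))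
    show fin: "finite ?S" by (rule finite_subset[OF sub gcomp_finite])
    \<comment> \<open>A nonzero component may have zero class; adding such terms does not change the
      sum.\<close>
    have "finsum L (\<lambda>n. \<pi> (gcomp n p)) ?S = finsum L (\<lambda>n. \<pi> (gcomp n p)) {n. gcomp n p \<noteq> 0}"
    proof -
      interpret module Rat L by (rule L_module)
      show ?thesis
        by (rule M.add.finprod_mono_neutral_cong_left) (use sub gcomp_finite p C(5) L(1) in auto)
    qed
    also have "\<dots> = \<pi> (\<Sum>n\<in>{n. gcomp n p \<noteq> 0}. gcomp n p)"
      by (rule finsum_L) (use gcomp_finite p C(5) in auto)
    also have "\<dots> = x" by (simp add: gcomp_sum gcomp_finite p)
    finally show "x = finsum L (\<lambda>n. \<pi> (gcomp n p)) ?S" ..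
  next
    fix c assume "(\<forall>n. c n \<in> gr L n) \<and> finite {n. c n \<noteq> \<zero>\<^bsub>L\<^esub>} \<and> x = finsum L c {n. c n \<noteq> \<zero>\<^bsub>L\<^esub>}"
    then have c: "\<And>n. c n \<in> gr L n" and fin: "finite {n. c n \<noteq> \<zero>\<^bsub>L\<^esub>}"
      and xc: "x = finsum L c {n. c n \<noteq> \<zero>\<^bsub>L\<^esub>}" by auto
    have "\<forall>n. \<exists>q. q \<in> C \<and> gcomp n q = q \<and> c n = \<pi> q" using c by (auto simp: L(6))
    then obtain q where q: "\<And>n. q n \<in> C" "\<And>n. gcomp n (q n) = q n" "\<And>n. c n = \<pi> (q n)" by metis
    let ?S = "{n. c n \<noteq> \<zero>\<^bsub>L\<^esub>}"
    have "finsum L c ?S = finsum L (\<lambda>n. \<pi> (q n)) ?S" by (simp add: q(3)[abs_def])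
    also have "\<dots> = \<pi> (\<Sum>n\<in>?S. q n)" by (rule finsum_L) (use fin q in auto)
    finally have "\<pi> p = \<pi> (\<Sum>n\<in>?S. q n)" using p xc by simp
    \<comment> \<open>Two decompositions differ by an element of \<open>J\<close>. Its component of
      degree \<open>n\<close> is in \<open>J\<close> again, which compares the summands degree by
      degree.\<close>
    then have d: "p - (\<Sum>n\<in>?S. q n) \<in> J" using p q C_sum[of ?S q] by (simp add: L(7))
    show "c = (\<lambda>n. \<pi> (gcomp n p))"
    proof
      fix n
      have "gcomp n (\<Sum>m\<in>?S. q m) = (\<Sum>m\<in>?S. if m = n then q n else 0)"
        unfolding gcomp_linear
      proof (rule sum.cong)
        fix m show "gcomp n (q m) = (if m = n then q n else 0)"
          using q(2)[of m] gcomp_gcomp[of n m "q m"] by auto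
      qed simp
      also have "\<dots> = (if n \<in> ?S then q n else 0)" using fin by (simp add: sum.delta)
      finally have "gcomp n p - (if n \<in> ?S then q n else 0) \<in> J"
        using J(3)[OF d, of n] by (simp add: gcomp_linear(3))
      then have "\<pi> (gcomp n p) = \<pi> (if n \<in> ?S then q n else 0)"
        using L(7)[OF C(5)[OF p(1)], of "if n \<in> ?S then q n else 0" n] q(1)[of n] C(1) by (auto split: if_splits)
      also have "\<dots> = c n" using q(3)[of n] by (auto simp: L(2))
      finally show "c n = \<pi> (gcomp n p)" ..
    qed
  qed
qed

lemma graded_lie_algebra_L: "graded_lie_algebra L"
  unfolding graded_lie_algebra_def
proof (intro conjI)
  show "module Rat L" by (rule L_module)
  show "\<forall>x\<in>carrier L. \<forall>y\<in>carrier L. x \<otimes>\<^bsub>L\<^esub> y \<in> carrier L"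
    unfolding L(1) by (auto simp: L(4) C)
  show "\<forall>x\<in>carrier L. \<forall>y\<in>carrier L. \<forall>z\<in>carrier L.
        (x \<oplus>\<^bsub>L\<^esub> y) \<otimes>\<^bsub>L\<^esub> z = x \<otimes>\<^bsub>L\<^esub> z \<oplus>\<^bsub>L\<^esub> y \<otimes>\<^bsub>L\<^esub> z \<and>
        z \<otimes>\<^bsub>L\<^esub> (x \<oplus>\<^bsub>L\<^esub> y) = z \<otimes>\<^bsub>L\<^esub> x \<oplus>\<^bsub>L\<^esub> z \<otimes>\<^bsub>L\<^esub> y"
    unfolding L(1) by (simp add: L(3,4) C mag_mult_simps)
  show "\<forall>r. \<forall>x\<in>carrier L. \<forall>y\<in>carrier L.
        (r \<odot>\<^bsub>L\<^esub> x) \<otimes>\<^bsub>L\<^esub> y = r \<odot>\<^bsub>L\<^esub> (x \<otimes>\<^bsub>L\<^esub> y) \<and>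
        x \<otimes>\<^bsub>L\<^esub> (r \<odot>\<^bsub>L\<^esub> y) = r \<odot>\<^bsub>L\<^esub> (x \<otimes>\<^bsub>L\<^esub> y)"
    unfolding L(1) by (simp add: L(4,5) C mag_mult_simps)
  show "\<forall>x\<in>carrier L. x \<otimes>\<^bsub>L\<^esub> x = \<zero>\<^bsub>L\<^esub>"
    unfolding L(1) by (simp add: L(2,4,7) C J)
  show "\<forall>x\<in>carrier L. \<forall>y\<in>carrier L. \<forall>z\<in>carrier L.
        x \<otimes>\<^bsub>L\<^esub> (y \<otimes>\<^bsub>L\<^esub> z) \<oplus>\<^bsub>L\<^esub> y \<otimes>\<^bsub>L\<^esub> (z \<otimes>\<^bsub>L\<^esub> x) \<oplus>\<^bsub>L\<^esub> z \<otimes>\<^bsub>L\<^esub> (x \<otimes>\<^bsub>L\<^esub> y) = \<zero>\<^bsub>L\<^esub>"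
    unfolding L(1) by (simp add: L(2,3,4,7) C J)
  show "\<forall>n. submodule (gr L n) Rat L"
    unfolding submodule_Rat_iff[OF L_module]
  proof (intro allI conjI ballI)
    show "gr L n \<subseteq> carrier L" for n by (auto simp: L(1,6))
    show "\<zero>\<^bsub>L\<^esub> \<in> gr L n" for n by (auto simp: L(2,6) C gcomp_linear)
    show "x \<oplus>\<^bsub>L\<^esub> y \<in> gr L n" if "x \<in> gr L n" "y \<in> gr L n" for n x y
      using that by (auto simp: L(3,6) C gcomp_linear)
    show "r \<odot>\<^bsub>L\<^esub> x \<in> gr L n" if "x \<in> gr L n" for n r x
      using that by (auto simp: L(5,6) C gcomp_linear)
  qed
  show "\<forall>m n. \<forall>x\<in>gr L m. \<forall>y\<in>gr L n. x \<otimes>\<^bsub>L\<^esub> y \<in> gr L (m + n)"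
    by (auto simp: L(4,6) C gcomp_mult_homogeneous)
  show "\<forall>x\<in>carrier L. \<exists>!c :: nat \<Rightarrow> 'a. (\<forall>n. c n \<in> gr L n) \<and>
        finite {n. c n \<noteq> \<zero>\<^bsub>L\<^esub>} \<and> x = finsum L c {n. c n \<noteq> \<zero>\<^bsub>L\<^esub>}"
    using ex1_decomposition by blast
qed

lemma graded_lie_hom_L:
  assumes M: "lie_presentation M C' J' \<pi>'"
    and f: "\<And>p. p \<in> C \<Longrightarrow> f (\<pi> p) = \<pi>' (\<Phi> p)"
    and \<Phi>: "\<And>p. p \<in> C \<Longrightarrow> \<Phi> p \<in> C'" 
      "\<And>p q. p \<in> C \<Longrightarrow> q \<in> C \<Longrightarrow> \<Phi> (p + q) = \<Phi> p + \<Phi> q" "\<And>r p. p \<in> C \<Longrightarrow> \<Phi> (fscale r p) = fscale r (\<Phi> p)"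
      "\<And>p q. p \<in> C \<Longrightarrow> q \<in> C \<Longrightarrow> \<Phi> (p \<star> q) - \<Phi> p \<star> \<Phi> q \<in> J'"
      "\<And>n p. p \<in> C \<Longrightarrow> gcomp n p = p \<Longrightarrow> gcomp n (\<Phi> p) = \<Phi> p"
  shows "f \<in> graded_lie_hom L M"
proof -
  interpret M: lie_presentation M C' J' \<pi>' by fact
  have "\<pi>' (\<Phi> (p \<star> q)) = \<pi>' (\<Phi> p \<star> \<Phi> q)" if "p \<in> C" "q \<in> C" for p q
    using that by (subst M.L(7)) (auto simp: \<Phi> C M.C)
  then show ?thesis
    unfolding graded_lie_hom_def linear_maps_def L(1,6) M.L(1,6)
    using f \<Phi> by (auto simp: L(3,4,5) M.L(3,4,5) C intro!: imageI)
qed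

text \<open>The point is that the inverse respects the grading. If \<open>p\<close> represents the
  preimage of an element of degree \<open>n\<close>, then so does \<open>gcomp n p\<close>, because
  \<open>\<Phi>\<close> commutes with taking components and \<open>f\<close> is injective.\<close>

lemma graded_lie_iso_L:
  assumes M: "lie_presentation M C' J' \<pi>'"
    and f: "\<And>p. p \<in> C \<Longrightarrow> f (\<pi> p) = \<pi>' (\<Phi> p)"
    and \<Phi>: "\<And>p. p \<in> C \<Longrightarrow> \<Phi> p \<in> C'" "\<And>n p. p \<in> C \<Longrightarrow> gcomp n (\<Phi> p) = \<Phi> (gcomp n p)"
    and hom: "f \<in> graded_lie_hom L M" and bij: "bij_betw f (carrier L) (carrier M)"
  shows "graded_lie_iso L M f"
proof -
  interpret M: lie_presentation M C' J' \<pi>' by fact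
  let ?g = "inv_into (carrier L) f"
  have gc: "?g y \<in> carrier L" if "y \<in> carrier M" for y
    using that bij by (metis bij_betw_imp_surj_on inv_into_into)
  have fg: "f (?g y) = y" if "y \<in> carrier M" for y
    using that bij by (metis bij_betw_imp_surj_on f_inv_into_f)
  have gf: "?g (f x) = x" if "x \<in> carrier L" for x
    using that bij by (metis bij_betw_imp_inj_on inv_into_f_f)
  have h: "\<And>x y. x \<in> carrier L \<Longrightarrow> y \<in> carrier L \<Longrightarrow> f (x \<oplus>\<^bsub>L\<^esub> y) = f x \<oplus>\<^bsub>M\<^esub> f y"
    "\<And>x y. x \<in> carrier L \<Longrightarrow> y \<in> carrier L \<Longrightarrow> f (x \<otimes>\<^bsub>L\<^esub> y) = f x \<otimes>\<^bsub>M\<^esub> f y"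
    "\<And>r x. x \<in> carrier L \<Longrightarrow> f (r \<odot>\<^bsub>L\<^esub> x) = r \<odot>\<^bsub>M\<^esub> f x"
    using hom by (auto simp: graded_lie_hom_def linear_maps_def)
  have cl: "x \<oplus>\<^bsub>L\<^esub> y \<in> carrier L" "x \<otimes>\<^bsub>L\<^esub> y \<in> carrier L" "r \<odot>\<^bsub>L\<^esub> x \<in> carrier L"
    if "x \<in> carrier L" "y \<in> carrier L" for x y r
    using that unfolding L(1) by (auto simp: L(3-5) C)
  have "?g \<in> graded_lie_hom M L"
    unfolding graded_lie_hom_def linear_maps_def
  proof (intro CollectI conjI ballI allI funcsetI)
    show "?g y \<in> carrier L" if "y \<in> carrier M" for y by (rule gc[OF that])
    show "?g (x \<oplus>\<^bsub>M\<^esub> y) = ?g x \<oplus>\<^bsub>L\<^esub> ?g y" if "x \<in> carrier M" "y \<in> carrier M" for x y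
      using gf[OF cl(1)[OF gc gc]] that by (simp add: h gc fg)
    show "?g (x \<otimes>\<^bsub>M\<^esub> y) = ?g x \<otimes>\<^bsub>L\<^esub> ?g y" if "x \<in> carrier M" "y \<in> carrier M" for x y
      using gf[OF cl(2)[OF gc gc]] that by (simp add: h gc fg)
    show "?g (r \<odot>\<^bsub>M\<^esub> x) = r \<odot>\<^bsub>L\<^esub> ?g x" if "x \<in> carrier M" for r x
      using gf[OF cl(3)[OF gc gc]] that by (simp add: h gc fg)
    show "?g ` gr M n \<subseteq> gr L n" for n
    proof (rule image_subsetI)
      fix y assume "y \<in> gr M n"
      then obtain q where q: "q \<in> C'" "gcomp n q = q" "y = \<pi>' q" by (auto simp: M.L(6))
      then have y: "y \<in> carrier M" by (simp add: M.L(1))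
      then obtain p where p: "p \<in> C" "?g y = \<pi> p" using gc unfolding L(1) by blast
      then have "\<pi>' (\<Phi> p) = \<pi>' q" using fg[OF y] f[OF p(1)] q by simp
      then have "gcomp n (\<Phi> p - q) \<in> J'" using p q \<Phi> by (intro M.J(3)) (simp flip: M.L(7))
      then have "\<pi>' (\<Phi> (gcomp n p)) = y" using p q \<Phi> C(5) by (simp add: gcomp_linear M.L(7))
      then have "f (\<pi> (gcomp n p)) = y" using p C(5) by (simp add: f)
      then have "?g y = \<pi> (gcomp n p)" using gf[of "\<pi> (gcomp n p)"] p C(5) by (simp add: L(1))
      then show "?g y \<in> gr L n" using p C(5) by (auto simp: L(6) gcomp_gcomp)
    qed
  qed
  then show ?thesis
    using hom bij graded_lie_algebra_L M.graded_lie_algebra_L by (simp add: graded_lie_iso_def)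
qed

end

subsection \<open>The holonomy Lie algebra as a quotient of the free non-associative algebra\<close>

lemma lie_kernel_lie_ideal: "module Rat V \<Longrightarrow> lie_kernel V (lie_ideal V)"
  using lie_kernel_gen_ideal[of V "{}"] by (simp add: lie_gen_ideal_empty)

lemma nonassoc_algebra_free_lie: "module Rat V \<Longrightarrow> nonassoc_algebra (free_lie V)"
  unfolding free_lie_def
  by (intro nonassoc_algebra_quot nonassoc_algebra_free lie_kernel.ideal_J lie_kernel_lie_ideal)

definition free_lie_proj :: "(rat, 'v, 'm) module_scheme \<Rightarrow> ('v magma \<Rightarrow>\<^sub>0 rat) \<Rightarrow> ('v magma \<Rightarrow>\<^sub>0 rat) set" where
  "free_lie_proj V p = lie_ideal V +>\<^bsub>free_nonassoc (carrier V)\<^esub> p"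

context
  fixes V :: "(rat, 'v, 'm) module_scheme"
  assumes V: "module Rat V"
begin

interpretation I: lie_kernel V "lie_ideal V" by (rule lie_kernel_lie_ideal[OF V])

lemmas quot_facts = nonassoc_algebra_free[of "carrier V"] I.ideal_J

lemma free_lie_ops:
  "carrier (free_lie V) = free_lie_proj V ` free_carrier (carrier V)"
  "\<zero>\<^bsub>free_lie V\<^esub> = free_lie_proj V 0"
  "p \<in> free_carrier (carrier V) \<Longrightarrow> q \<in> free_carrier (carrier V) \<Longrightarrow>
    free_lie_proj V p \<oplus>\<^bsub>free_lie V\<^esub> free_lie_proj V q = free_lie_proj V (p + q)"
  "p \<in> free_carrier (carrier V) \<Longrightarrow> q \<in> free_carrier (carrier V) \<Longrightarrow>
    free_lie_proj V p \<otimes>\<^bsub>free_lie V\<^esub> free_lie_proj V q = free_lie_proj V (p \<star> q)"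
  "p \<in> free_carrier (carrier V) \<Longrightarrow> r \<odot>\<^bsub>free_lie V\<^esub> free_lie_proj V p = free_lie_proj V (fscale r p)"
  "gr (free_lie V) n = free_lie_proj V ` gr (free_nonassoc (carrier V)) n"
  "p \<in> free_carrier (carrier V) \<Longrightarrow> q \<in> free_carrier (carrier V) \<Longrightarrow>
    free_lie_proj V p = free_lie_proj V q \<longleftrightarrow> p - q \<in> lie_ideal V"
  unfolding free_lie_def free_lie_proj_def
  using quot_algebra_carrier[OF quot_facts] quot_algebra_zero[OF quot_facts]
    quot_algebra_add[OF quot_facts] quot_algebra_mult[OF quot_facts] quot_algebra_smult[OF quot_facts]
    quot_algebra_gr[OF quot_facts] coset_eq_iff[OF quot_facts]
  by (simp_all add: free_nonassoc_sel(1-4) free_nonassoc_minus)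

lemma free_lie_proj_carrier: "p \<in> free_carrier (carrier V) \<Longrightarrow> free_lie_proj V p \<in> carrier (free_lie V)"
  by (auto simp: free_lie_ops(1))

lemma free_lie_minus:
  assumes "p \<in> free_carrier (carrier V)" "q \<in> free_carrier (carrier V)"
  shows "free_lie_proj V p \<ominus>\<^bsub>free_lie V\<^esub> free_lie_proj V q = free_lie_proj V (p - q)"
proof -
  have "module Rat (free_lie V)"
    using nonassoc_algebra_free_lie[OF V] by (simp add: nonassoc_algebra_def)
  then show ?thesis
    using assms by (simp add: a_minus_def module_a_inv free_lie_proj_carrier free_lie_ops fscale_minus_one)
qed

context
  fixes R :: "('v magma \<Rightarrow>\<^sub>0 rat) set"
  assumes R: "R \<subseteq> free_carrier (carrier V)"
begin

lemma gen_ideal_free_lie: "algebra_ideal (free_lie V) (gen_ideal (free_lie V) (free_lie_proj V ` R))"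
  using R by (intro gen_ideal_ideal nonassoc_algebra_free_lie[OF V]) (auto simp: free_lie_ops(1))

interpretation J: lie_kernel V "lie_gen_ideal V R" by (rule lie_kernel_gen_ideal[OF V R])

lemma free_lie_module: "module Rat (free_lie V)"
  using nonassoc_algebra_free_lie[OF V] by (simp add: nonassoc_algebra_def)

text \<open>Minimality is used on both sides. The preimage of the ideal of the free Lie algebra
  contains the relators and \<open>R\<close>; conversely, the image of
  \<open>lie_gen_ideal V R\<close> is an ideal there, and it detects membership since
  \<open>lie_gen_ideal V R\<close> contains \<open>lie_ideal V\<close>.\<close>

lemma free_lie_proj_mem_gen_ideal:
  assumes p: "p \<in> free_carrier (carrier V)"
  shows "free_lie_proj V p \<in> gen_ideal (free_lie V) (free_lie_proj V ` R) \<longleftrightarrow> p \<in> lie_gen_ideal V R"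
proof
  let ?H = "gen_ideal (free_lie V) (free_lie_proj V ` R)"
  note H = ideal_facts[OF nonassoc_algebra_free_lie[OF V] gen_ideal_free_lie]
  have "lie_gen_ideal V R \<subseteq> {p \<in> free_carrier (carrier V). free_lie_proj V p \<in> ?H}"
  proof (rule lie_gen_ideal_least)
    show "algebra_ideal (free_nonassoc (carrier V)) {p \<in> free_carrier (carrier V). free_lie_proj V p \<in> ?H}"
      unfolding algebra_ideal_free_iff
      using H(2) H(3) H(4) H(5,6)[OF _ free_lie_proj_carrier]
      by (auto simp flip: free_lie_ops(2-5))
    have "free_lie_proj V p = \<zero>\<^bsub>free_lie V\<^esub>" if "p \<in> lie_relators V" for p
      unfolding free_lie_ops(2)
      by (subst free_lie_ops(7)) (use that I.relators_J I.J_subset in auto)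
    then show "lie_relators V \<subseteq> {p \<in> free_carrier (carrier V). free_lie_proj V p \<in> ?H}"
      using H(2) lie_relators_subset[OF V] by auto
    show "R \<subseteq> {p \<in> free_carrier (carrier V). free_lie_proj V p \<in> ?H}"
      using R gen_ideal_superset[of "free_lie_proj V ` R" "free_lie V"] by auto
  qed
  then show "p \<in> lie_gen_ideal V R \<Longrightarrow> free_lie_proj V p \<in> ?H" by auto
  have "?H \<subseteq> free_lie_proj V ` lie_gen_ideal V R"
  proof (rule gen_ideal_least)
    show "algebra_ideal (free_lie V) (free_lie_proj V ` lie_gen_ideal V R)"
      unfolding algebra_ideal_def submodule_Rat_iff[OF free_lie_module]
      unfolding free_lie_ops(1,2)
      by (auto simp: free_lie_ops J.J_subset
          intro!: imageI intro: J.J_add J.J_fscale J.J_mult_left J.J_mult_right)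
    show "free_lie_proj V ` R \<subseteq> free_lie_proj V ` lie_gen_ideal V R"
      using lie_gen_ideal_superset[of R V] by auto
  qed
  moreover assume "free_lie_proj V p \<in> ?H"
  ultimately obtain j where j: "j \<in> lie_gen_ideal V R" "free_lie_proj V p = free_lie_proj V j" by auto
  then have "p - j \<in> lie_ideal V" using p J.J_subset by (simp add: free_lie_ops(7))
  then have "p - j \<in> lie_gen_ideal V R"
    using lie_ideal_subset_gen_ideal[OF J.lie_kernel_axioms] by auto
  then show "p \<in> lie_gen_ideal V R" using j(1) by (rule J.J_mem_cong)
qed

text \<open>The two successive quotients become one. All of \<open>R\<close> has the same degree
  \<open>k\<close>, so \<open>gcomp_ideal\<close> makes the ideal homogeneous.\<close>

lemma lie_presentation_quot:
  fixes k
  assumes Rk: "R \<subseteq> gr (free_nonassoc (carrier V)) k"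
  defines "H \<equiv> gen_ideal (free_lie V) (free_lie_proj V ` R)"
  shows "lie_presentation (quot_algebra (free_lie V) H) (free_carrier (carrier V)) (lie_gen_ideal V R)
    (\<lambda>p. H +>\<^bsub>free_lie V\<^esub> free_lie_proj V p)"
proof -
  note HI = nonassoc_algebra_free_lie[OF V] gen_ideal_free_lie[folded H_def]
  note ops = quot_algebra_carrier[OF HI] quot_algebra_zero[OF HI] quot_algebra_add[OF HI]
    quot_algebra_mult[OF HI] quot_algebra_smult[OF HI] quot_algebra_gr[OF HI] coset_eq_iff[OF HI]
  have [simp]: "p \<in> free_carrier (carrier V) \<Longrightarrow> free_lie_proj V p \<in> carrier (free_lie V)" for p
    by (rule free_lie_proj_carrier)
  show ?thesis
  proof (rule lie_presentation.intro)
    show "gr (quot_algebra (free_lie V) H) n = (\<lambda>p. H +>\<^bsub>free_lie V\<^esub> free_lie_proj V p) `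
        {p \<in> free_carrier (carrier V). gcomp n p = p}" for n
    proof -
      have "gr (free_nonassoc (carrier V)) n = {p \<in> free_carrier (carrier V). gcomp n p = p}"
        by (auto simp: gr_free_nonassoc_iff)
      then show ?thesis by (simp add: ops(6) free_lie_ops(6) image_image)
    qed
    show "H +>\<^bsub>free_lie V\<^esub> free_lie_proj V p = H +>\<^bsub>free_lie V\<^esub> free_lie_proj V q \<longleftrightarrow> p - q \<in> lie_gen_ideal V R"
      if "p \<in> free_carrier (carrier V)" "q \<in> free_carrier (carrier V)" for p q
      using that by (simp add: ops(7) free_lie_minus) (simp add: H_def free_lie_proj_mem_gen_ideal)
    show "gcomp n p \<in> lie_gen_ideal V R" if "p \<in> lie_gen_ideal V R" for n p
      by (rule gcomp_ideal[OF V Rk that])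
    show "carrier (quot_algebra (free_lie V) H) =
        (\<lambda>p. H +>\<^bsub>free_lie V\<^esub> free_lie_proj V p) ` free_carrier (carrier V)"
      by (simp add: ops(1) free_lie_ops(1) image_image)
  qed (auto simp: ops(2-5) free_lie_ops(2-5) J.J_square J.J_jacobi gcomp_closed)
qed

end

end

text \<open>Being a Lie kernel, the preimage contains a generated ideal once it contains the
  generators. This is how induced maps are shown to respect ideals.\<close>

lemma mag_map_pullback:
  assumes V: "module Rat V" and W: "lie_kernel W J"
    and f: "f \<in> linear_maps V W"
  shows "lie_kernel V {p \<in> free_carrier (carrier V). mag_map f p \<in> J}" (is "lie_kernel V ?K")
proof (rule lie_kernel.intro)
  interpret lie_kernel W J by fact
  have f: "\<And>v. v \<in> carrier V \<Longrightarrow> f v \<in> carrier W"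
    "\<And>v w. v \<in> carrier V \<Longrightarrow> w \<in> carrier V \<Longrightarrow> f (v \<oplus>\<^bsub>V\<^esub> w) = f v \<oplus>\<^bsub>W\<^esub> f w"
    "\<And>r v. v \<in> carrier V \<Longrightarrow> f (r \<odot>\<^bsub>V\<^esub> v) = r \<odot>\<^bsub>W\<^esub> f v"
    using f by (auto simp: linear_maps_def)
  have [simp]: "p \<in> free_carrier (carrier V) \<Longrightarrow> mag_map f p \<in> free_carrier (carrier W)" for p
    by (rule mag_map_closed[OF f(1)])
  show "algebra_ideal (free_nonassoc (carrier V)) ?K"
    unfolding algebra_ideal_free_iff
    by (auto simp: mag_map_linear mag_map_mult intro: J_add J_fscale J_mult_left J_mult_right)
  show "lie_relators V \<subseteq> ?K"
  proof
    fix x assume x: "x \<in> lie_relators V"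
    have "mag_map f x \<in> J"
      using x unfolding lie_relators_def
    proof (elim UnE CollectE exE conjE)
      fix v w assume "x = mag_gen (v \<oplus>\<^bsub>V\<^esub> w) - mag_gen v - mag_gen w" "v \<in> carrier V" "w \<in> carrier V"
      then show ?thesis using J_gen_add[OF f(1) f(1), of v w] by (simp add: mag_map_linear diff_diff_eq f(2))
    next
      fix r v assume "x = mag_gen (r \<odot>\<^bsub>V\<^esub> v) - fscale r (mag_gen v)" "v \<in> carrier V"
      then show ?thesis using J_gen_smult[OF f(1), of v r] by (simp add: mag_map_linear f(3))
    qed (auto simp: mag_map_mult mag_map_linear intro: J_square J_jacobi)
    then show "x \<in> ?K" using x lie_relators_subset[OF V] by auto
  qed
qed fact

lemma free_lie_map_proj:
  assumes V: "module Rat V" and W: "module Rat W" and f: "f \<in> linear_maps V W"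
    and p: "p \<in> free_carrier (carrier V)"
  shows "free_lie_map W f (free_lie_proj V p) = free_lie_proj W (mag_map f p)"
proof -
  interpret V: lie_kernel V "lie_ideal V" by (rule lie_kernel_lie_ideal[OF V])
  interpret W: lie_kernel W "lie_ideal W" by (rule lie_kernel_lie_ideal[OF W])
  have fc: "v \<in> carrier V \<Longrightarrow> f v \<in> carrier W" for v using f by (auto simp: linear_maps_def)
  show ?thesis
    unfolding free_lie_map_def free_lie_proj_def mag_map_def[symmetric]
  proof (rule induced_map_coset[OF nonassoc_algebra_free V.ideal_J nonassoc_algebra_free W.ideal_J p])
    show "mag_map f y \<in> free_carrier (carrier W)" if "y \<in> free_carrier (carrier V)" for y
      by (rule mag_map_closed[OF fc that])
    show "mag_map f i \<in> lie_ideal W" if "i \<in> lie_ideal V" for i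
      using that lie_ideal_subset_gen_ideal[OF mag_map_pullback[OF V W.lie_kernel_axioms f]] by auto
  qed (simp add: free_nonassoc_sel mag_map_linear)
qed

subsection \<open>Derived subalgebras\<close>

context lie_presentation begin

text \<open>A monomial of bracket length other than 1 is a product of two monomials, and no product
  has a component of degree 1.\<close>

lemma derived_carrier:
  assumes CX: "C = free_carrier X"
  shows "lin_span L {x \<otimes>\<^bsub>L\<^esub> y | x y. x \<in> carrier L \<and> y \<in> carrier L} = \<pi> ` {p \<in> C. gcomp 1 p = 0}"
    (is "?D = \<pi> ` ?C2")
proof
  have "submodule (\<pi> ` ?C2) Rat L"
    unfolding submodule_Rat_iff[OF L_module] unfolding L(1,2)
    using C by (auto simp: L gcomp_linear fscale_zero_right intro!: imageI)
  moreover have "{x \<otimes>\<^bsub>L\<^esub> y | x y. x \<in> carrier L \<and> y \<in> carrier L} \<subseteq> \<pi> ` ?C2"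
    using C by (auto simp: L gcomp_1_mult intro!: imageI)
  ultimately show "?D \<subseteq> \<pi> ` ?C2" by (auto simp: lin_span_def)
  show "\<pi> ` ?C2 \<subseteq> ?D"
    unfolding lin_span_def
  proof (intro subsetI InterI)
    fix x W
    assume x: "x \<in> \<pi> ` ?C2"
      and "W \<in> {W. submodule W Rat L \<and> {x \<otimes>\<^bsub>L\<^esub> y | x y. x \<in> carrier L \<and> y \<in> carrier L} \<subseteq> W}"
    then have W: "submodule W Rat L" and WB: "{x \<otimes>\<^bsub>L\<^esub> y | x y. x \<in> carrier L \<and> y \<in> carrier L} \<subseteq> W" by auto
    note W = W[unfolded submodule_Rat_iff[OF L_module]]
    obtain p where p: "p \<in> C" "gcomp 1 p = 0" "x = \<pi> p" using x by auto
    have "p \<in> {p \<in> C. \<pi> p \<in> W}"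
    proof (rule span_singles_induct)
      fix t assume t: "t \<in> Poly_Mapping.keys p"
      have X: "set_mag t \<subseteq> X" using p(1) t by (auto simp: CX free_nonassoc_sel)
      have "bracket_length t \<noteq> 1"
      proof
        assume "bracket_length t = 1"
        then have "Poly_Mapping.lookup p t = Poly_Mapping.lookup (gcomp 1 p) t" by (simp add: lookup_gcomp)
        then show False using t p(2) by (simp add: in_keys_iff)
      qed
      then obtain a b where ab: "t = Br a b" by (cases t) auto
      have "\<pi> (Poly_Mapping.single a 1) \<otimes>\<^bsub>L\<^esub> \<pi> (Poly_Mapping.single b 1) \<in> W"
      proof (rule subsetD[OF WB])
        have "\<pi> (Poly_Mapping.single a 1) \<in> carrier L" "\<pi> (Poly_Mapping.single b 1) \<in> carrier L"
          using X ab unfolding L(1) CX by (auto intro!: imageI free_carrier_single)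
        then show "\<pi> (Poly_Mapping.single a 1) \<otimes>\<^bsub>L\<^esub> \<pi> (Poly_Mapping.single b 1)
            \<in> {x \<otimes>\<^bsub>L\<^esub> y | x y. x \<in> carrier L \<and> y \<in> carrier L}" by blast
      qed
      then have "\<pi> (Poly_Mapping.single t 1) \<in> W"
        using X ab L(4)[of "Poly_Mapping.single a 1" "Poly_Mapping.single b 1"]
        by (simp add: CX free_carrier_single mag_mult_single)
      then show "Poly_Mapping.single t 1 \<in> {p \<in> C. \<pi> p \<in> W}"
        using X by (auto simp: CX intro: free_carrier_single)
    qed (use W C in \<open>auto simp: L(2) simp flip: L(3,5)\<close>)
    then show "x \<in> W" using p by simp
  qed
qed

lemma lie_presentation_derived:
  assumes CX: "C = free_carrier X"
  shows "lie_presentation (derived_subalgebra L) {p \<in> C. gcomp 1 p = 0} J \<pi>"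
proof -
  let ?D = "derived_subalgebra L"
  have sel: "\<zero>\<^bsub>?D\<^esub> = \<zero>\<^bsub>L\<^esub>" "add ?D = add L" "mult ?D = mult L" "smult ?D = smult L"
    by (simp_all add: derived_subalgebra_def Let_def)
  have car: "carrier ?D = \<pi> ` {p \<in> C. gcomp 1 p = 0}"
    by (simp only: derived_carrier[OF CX, symmetric] derived_subalgebra_def Let_def) simp
  show ?thesis
  proof (rule lie_presentation.intro)
    show "gcomp n p \<in> {p \<in> C. gcomp 1 p = 0}" if "p \<in> {p \<in> C. gcomp 1 p = 0}" for n p
      using that C(5) by (auto simp: gcomp_gcomp)
    show "gr (derived_subalgebra L) n = \<pi> ` {p \<in> {p \<in> C. gcomp 1 p = 0}. gcomp n p = p}" for n
    proof -
      \<comment> \<open>A class may have one representative of degree \<open>n\<close> and another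
        one without component of degree 1. The component of degree \<open>n\<close> of the latter
        has both properties and, \<open>J\<close> being homogeneous, the same class.\<close>
      have "gr L n \<inter> \<pi> ` {p \<in> C. gcomp 1 p = 0} = \<pi> ` {p \<in> {p \<in> C. gcomp 1 p = 0}. gcomp n p = p}"
      proof (intro equalityI subsetI)
        fix x assume "x \<in> gr L n \<inter> \<pi> ` {p \<in> C. gcomp 1 p = 0}"
        then obtain p q where p: "p \<in> C" "gcomp n p = p" "x = \<pi> p"
          and q: "q \<in> C" "gcomp 1 q = 0" "x = \<pi> q" by (auto simp: L(6))
        then have "gcomp n (p - q) \<in> J" by (intro J) (simp flip: L(7))
        then have "\<pi> p = \<pi> (gcomp n q)" using p q C(5) by (simp add: L(7) gcomp_linear)
        then show "x \<in> \<pi> ` {p \<in> {p \<in> C. gcomp 1 p = 0}. gcomp n p = p}"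
          using p q C(5) by (auto intro!: image_eqI[of _ _ "gcomp n q"] simp: gcomp_gcomp)
      qed (auto simp: L(6))
      then show ?thesis by (simp add: derived_subalgebra_def derived_carrier[OF CX] Let_def)
    qed
    show "carrier ?D = \<pi> ` {p \<in> C. gcomp 1 p = 0}" by (rule car)
  qed (simp_all add: sel C J L gcomp_linear gcomp_1_mult fscale_zero_right)
qed

end

subsection \<open>Group cohomology in degrees 1 and 2\<close>

lemma bar_cochains_sel:
  "f \<in> carrier (bar_cochains G n) \<longleftrightarrow> (\<forall>xs. xs \<notin> bar_tuples G n \<longrightarrow> f xs = 0)"
  "add (bar_cochains G n) = (+)" "zero (bar_cochains G n) = 0" "smult (bar_cochains G n) = (\<lambda>r f xs. r * f xs)"
  by (auto simp: bar_cochains_def vspace_def)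

lemma bar_cocycles_sel:
  "f \<in> carrier (bar_cocycles G n) \<longleftrightarrow> (\<forall>xs. xs \<notin> bar_tuples G n \<longrightarrow> f xs = 0) \<and> bar_coboundary G n f = 0"
  "add (bar_cocycles G n) = (+)" "zero (bar_cocycles G n) = 0" "smult (bar_cocycles G n) = (\<lambda>r f xs. r * f xs)"
  by (auto simp: bar_cocycles_def bar_cochains_sel)

lemma bar_coboundary_add: "bar_coboundary G n (f + g) = bar_coboundary G n f + bar_coboundary G n g"
  by (auto simp: bar_coboundary_def algebra_simps sum.distrib fun_eq_iff)

lemma bar_coboundary_smult: "bar_coboundary G n (\<lambda>xs. r * f xs) = (\<lambda>xs. r * bar_coboundary G n f xs)"
  by (auto simp: bar_coboundary_def sum_distrib_left mult_ac fun_eq_iff simp del: sum.atMost_Suc)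

lemma bar_coboundary_zero: "bar_coboundary G n 0 = 0"
  by (auto simp: bar_coboundary_def fun_eq_iff)

lemma module_bar_cocycles: "module Rat (bar_cocycles G n)"
proof (rule module_Rat_I[OF _ _ _ HOL.refl HOL.refl HOL.refl HOL.refl])
  show "r \<odot>\<^bsub>bar_cocycles G n\<^esub> x \<in> carrier (bar_cocycles G n)" if "x \<in> carrier (bar_cocycles G n)" for r x
    using that by (simp add: bar_cocycles_sel bar_coboundary_smult fun_eq_iff)
qed (auto simp: bar_cocycles_sel bar_coboundary_add bar_coboundary_zero algebra_simps fun_eq_iff)

lemma bar_tuples_iff:
  "xs \<in> bar_tuples G 0 \<longleftrightarrow> xs = []"
  "xs \<in> bar_tuples G (Suc 0) \<longleftrightarrow> (\<exists>x\<in>carrier G. xs = [x])"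
  "xs \<in> bar_tuples G 2 \<longleftrightarrow> (\<exists>x\<in>carrier G. \<exists>y\<in>carrier G. xs = [x, y])"
  "xs \<in> bar_tuples G 3 \<longleftrightarrow> (\<exists>x\<in>carrier G. \<exists>y\<in>carrier G. \<exists>z\<in>carrier G. xs = [x, y, z])"
  by (auto simp: bar_tuples_def length_Suc_conv numeral_2_eq_2 numeral_3_eq_3)

text \<open>Both faces of \<open>[x]\<close> are the empty symbol and cancel. So degree 1 has no
  nonzero coboundaries, and a class there is a single homomorphism to the rationals.\<close>

lemma bar_coboundary_0: "bar_coboundary G 0 f = 0"
  by (auto simp: bar_coboundary_def fun_eq_iff bar_tuples_iff bar_face_def)

lemma bar_coboundary_1:
  assumes "x \<in> carrier G" "y \<in> carrier G"
  shows "bar_coboundary G (Suc 0) f [x, y] = f [y] - f [x \<otimes>\<^bsub>G\<^esub> y] + f [x]"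
  using assms by (simp add: bar_coboundary_def bar_tuples_def bar_face_def)

lemma bar_coboundary_2:
  assumes "x \<in> carrier G" "y \<in> carrier G" "z \<in> carrier G"
  shows "bar_coboundary G 2 f [x, y, z] = f [y, z] - f [x \<otimes>\<^bsub>G\<^esub> y, z] + f [x, y \<otimes>\<^bsub>G\<^esub> z] - f [x, y]"
  using assms by (simp add: bar_coboundary_def bar_tuples_def bar_face_def numeral_2_eq_2)

lemma bar_coboundary_1_eq_0_iff:
  "bar_coboundary G (Suc 0) f = 0 \<longleftrightarrow> (\<forall>x\<in>carrier G. \<forall>y\<in>carrier G. f [x \<otimes>\<^bsub>G\<^esub> y] = f [x] + f [y])"
proof -
  have "bar_coboundary G (Suc 0) f = 0 \<longleftrightarrow>
    (\<forall>x\<in>carrier G. \<forall>y\<in>carrier G. bar_coboundary G (Suc 0) f [x, y] = 0)"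
  proof (intro iffI ballI ext)
    fix xs assume *: "\<forall>x\<in>carrier G. \<forall>y\<in>carrier G. bar_coboundary G (Suc 0) f [x, y] = 0"
    show "bar_coboundary G (Suc 0) f xs = 0 xs"
    proof (cases "xs \<in> bar_tuples G 2")
      case True
      then show ?thesis using * by (auto simp: bar_tuples_iff)
    next
      case False
      then show ?thesis by (simp add: bar_coboundary_def numeral_2_eq_2)
    qed
  qed auto
  then show ?thesis by (auto simp: bar_coboundary_1 algebra_simps)
qed

lemma bar_coboundary_2_eq_0_iff:
  "bar_coboundary G 2 f = 0 \<longleftrightarrow> (\<forall>x\<in>carrier G. \<forall>y\<in>carrier G. \<forall>z\<in>carrier G.
     f [y, z] - f [x \<otimes>\<^bsub>G\<^esub> y, z] + f [x, y \<otimes>\<^bsub>G\<^esub> z] - f [x, y] = 0)"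
proof -
  have "bar_coboundary G 2 f = 0 \<longleftrightarrow>
    (\<forall>x\<in>carrier G. \<forall>y\<in>carrier G. \<forall>z\<in>carrier G. bar_coboundary G 2 f [x, y, z] = 0)"
  proof (intro iffI ballI ext)
    fix xs assume *: "\<forall>x\<in>carrier G. \<forall>y\<in>carrier G. \<forall>z\<in>carrier G. bar_coboundary G 2 f [x, y, z] = 0"
    show "bar_coboundary G 2 f xs = 0 xs"
    proof (cases "xs \<in> bar_tuples G 3")
      case True
      then show ?thesis using * by (auto simp: bar_tuples_iff)
    next
      case False
      then show ?thesis by (simp add: bar_coboundary_def numeral_3_eq_3 numeral_2_eq_2)
    qed
  qed auto
  then show ?thesis by (auto simp: bar_coboundary_2)
qed

text \<open>Only degrees 1 and 2 occur below. There, coboundaries are cocycles by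
  \<open>bar_coboundary_0\<close> and by associativity, respectively.\<close>

lemma submodule_bar_coboundaries:
  assumes "group G" "n = 1 \<or> n = 2"
  shows "submodule (bar_coboundaries G n) Rat (bar_cocycles G n)"
  using assms(2)
proof
  assume n: "n = 1"
  have "bar_coboundaries G 1 = {0}"
    by (auto simp: bar_coboundaries_def bar_coboundary_0 bar_cochains_sel intro!: image_eqI[of _ _ 0])
  then show ?thesis
    unfolding submodule_Rat_iff[OF module_bar_cocycles]
    by (auto simp: n bar_cocycles_sel bar_coboundary_zero fun_eq_iff)
next
  assume n: "n = 2"
  interpret group G by fact
  have B: "bar_coboundaries G 2 = bar_coboundary G 1 ` carrier (bar_cochains G 1)"
    by (simp add: bar_coboundaries_def numeral_2_eq_2)
  show ?thesis
    unfolding submodule_Rat_iff[OF module_bar_cocycles] unfolding n B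
  proof (intro conjI ballI allI)
    show "bar_coboundary G 1 ` carrier (bar_cochains G 1) \<subseteq> carrier (bar_cocycles G 2)"
    proof (intro image_subsetI)
      fix f assume "f \<in> carrier (bar_cochains G 1)"
      show "bar_coboundary G 1 f \<in> carrier (bar_cocycles G 2)"
        unfolding bar_cocycles_sel bar_coboundary_2_eq_0_iff
        by (auto simp: bar_coboundary_1 m_assoc) (simp add: bar_coboundary_def numeral_2_eq_2)
    qed
    show "\<zero>\<^bsub>bar_cocycles G 2\<^esub> \<in> bar_coboundary G 1 ` carrier (bar_cochains G 1)"
      by (auto simp: bar_cocycles_sel bar_cochains_sel bar_coboundary_zero intro!: image_eqI[of _ _ 0])
    fix x assume "x \<in> bar_coboundary G 1 ` carrier (bar_cochains G 1)"
    then obtain f where f: "f \<in> carrier (bar_cochains G 1)" "x = bar_coboundary G 1 f" by auto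
    show "r \<odot>\<^bsub>bar_cocycles G 2\<^esub> x \<in> bar_coboundary G 1 ` carrier (bar_cochains G 1)" for r
      using f by (auto simp: bar_cocycles_sel bar_cochains_sel bar_coboundary_smult
          intro!: image_eqI[of _ _ "\<lambda>xs. r * f xs"])
    fix y assume "y \<in> bar_coboundary G 1 ` carrier (bar_cochains G 1)"
    then obtain g where g: "g \<in> carrier (bar_cochains G 1)" "y = bar_coboundary G 1 g" by auto
    show "x \<oplus>\<^bsub>bar_cocycles G 2\<^esub> y \<in> bar_coboundary G 1 ` carrier (bar_cochains G 1)"
      using f g by (auto simp: bar_cocycles_sel bar_cochains_sel bar_coboundary_add
          intro!: image_eqI[of _ _ "f + g"])
  qed
qed

section \<open>Cohomology classes\<close>

definition cohom_class :: "('a, 'm) monoid_scheme \<Rightarrow> nat \<Rightarrow> ('a list \<Rightarrow> rat) \<Rightarrow> ('a list \<Rightarrow> rat) set" where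
  "cohom_class G n f = bar_coboundaries G n +>\<^bsub>bar_cocycles G n\<^esub> f"

context
  fixes G :: "('a, 'm) monoid_scheme" and n :: nat
  assumes G: "group G" and n: "n = 1 \<or> n = 2"
begin

lemmas cohom_quot = module_bar_cocycles[of G n] submodule_bar_coboundaries[OF G n]

lemma group_cohomology_ops:
  "carrier (group_cohomology G n) = cohom_class G n ` carrier (bar_cocycles G n)"
  "f \<in> carrier (bar_cocycles G n) \<Longrightarrow> g \<in> carrier (bar_cocycles G n) \<Longrightarrow>
    cohom_class G n f \<oplus>\<^bsub>group_cohomology G n\<^esub> cohom_class G n g = cohom_class G n (f + g)"
  "f \<in> carrier (bar_cocycles G n) \<Longrightarrow>
    r \<odot>\<^bsub>group_cohomology G n\<^esub> cohom_class G n f = cohom_class G n (\<lambda>xs. r * f xs)"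
  "f \<in> carrier (bar_cocycles G n) \<Longrightarrow> g \<in> carrier (bar_cocycles G n) \<Longrightarrow>
    cohom_class G n f = cohom_class G n g \<longleftrightarrow> f - g \<in> bar_coboundaries G n"
  unfolding group_cohomology_def quot_space_def vspace_def cohom_class_def
  using submod_rcosets[OF cohom_quot] submod_rcos_sum[OF cohom_quot]
    submod_quot_smult_coset[OF cohom_quot] submod_coset_eq_iff[OF cohom_quot]
  by (simp_all add: bar_cocycles_sel(2-4) a_minus_def module_a_inv[OF module_bar_cocycles] fun_diff_def plus_fun_def)

lemma cohom_class_carrier:
  "f \<in> carrier (bar_cocycles G n) \<Longrightarrow> cohom_class G n f \<in> carrier (group_cohomology G n)"
  by (simp add: group_cohomology_ops(1))

end

section \<open>Duals of cohomology spaces\<close>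

lemma dual_space_sel:
  "\<phi> \<in> carrier (dual_space M) \<longleftrightarrow> (\<forall>x\<in>carrier M. \<forall>y\<in>carrier M. \<phi> (x \<oplus>\<^bsub>M\<^esub> y) = \<phi> x + \<phi> y) \<and>
     (\<forall>r. \<forall>x\<in>carrier M. \<phi> (r \<odot>\<^bsub>M\<^esub> x) = r * \<phi> x) \<and> (\<forall>x. x \<notin> carrier M \<longrightarrow> \<phi> x = 0)"
  "add (dual_space M) = (+)" "zero (dual_space M) = 0" "smult (dual_space M) = (\<lambda>r \<phi> x. r * \<phi> x)"
  by (auto simp: dual_space_def vspace_def linear_maps_def)

lemma module_dual_space: "module Rat (dual_space M)"
  by (rule module_Rat_I[OF _ _ _ HOL.refl HOL.refl HOL.refl HOL.refl])
    (auto simp: dual_space_sel algebra_simps fun_eq_iff)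

lemma cohom_dual_sel:
  "add (cohom_dual G i) = (+)" "zero (cohom_dual G i) = 0"
  "smult (cohom_dual G i) = (\<lambda>r \<phi> x. r * \<phi> x)"
  by (simp_all add: cohom_dual_def dual_space_sel)

lemma module_cohom_dual: "module Rat (cohom_dual G i)"
  unfolding cohom_dual_def by (rule module_dual_space)

lemma cohom_dual_iff:
  assumes "group G" "n = 1 \<or> n = 2"
  shows "\<phi> \<in> carrier (cohom_dual G n) \<longleftrightarrow>
    (\<forall>f\<in>carrier (bar_cocycles G n). \<forall>g\<in>carrier (bar_cocycles G n).
       \<phi> (cohom_class G n (f + g)) = \<phi> (cohom_class G n f) + \<phi> (cohom_class G n g)) \<and>
    (\<forall>r. \<forall>f\<in>carrier (bar_cocycles G n). \<phi> (cohom_class G n (\<lambda>xs. r * f xs)) = r * \<phi> (cohom_class G n f)) \<and>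
    (\<forall>x. x \<notin> carrier (group_cohomology G n) \<longrightarrow> \<phi> x = 0)"
  unfolding cohom_dual_def dual_space_sel(1) group_cohomology_ops(1)[OF assms]
  using group_cohomology_ops(2,3)[OF assms] by simp

lemma cohom_dual_ext:
  assumes "group G" "n = 1 \<or> n = 2" "\<phi> \<in> carrier (cohom_dual G n)" "\<psi> \<in> carrier (cohom_dual G n)"
    and "\<And>f. f \<in> carrier (bar_cocycles G n) \<Longrightarrow> \<phi> (cohom_class G n f) = \<psi> (cohom_class G n f)"
  shows "\<phi> = \<psi>"
proof
  fix x
  show "\<phi> x = \<psi> x"
  proof (cases "x \<in> carrier (group_cohomology G n)")
    case True
    then show ?thesis using assms(5) by (auto simp: group_cohomology_ops(1)[OF assms(1,2)])
  next
    case False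
    then show ?thesis using assms(3,4) by (simp add: cohom_dual_iff[OF assms(1,2)])
  qed
qed

text \<open>Meaningful only if \<open>\<psi>\<close> is linear on cocycles and vanishes on coboundaries.\<close>

definition cohom_functional ::
  "('a, 'm) monoid_scheme \<Rightarrow> nat \<Rightarrow> (('a list \<Rightarrow> rat) \<Rightarrow> rat) \<Rightarrow> 'a hdual" where
  "cohom_functional G n \<psi> X =
     (if X \<in> carrier (group_cohomology G n) then \<psi> (SOME f. f \<in> carrier (bar_cocycles G n) \<and> X = cohom_class G n f) else 0)"

context
  fixes G :: "('a, 'm) monoid_scheme" and n :: nat and \<psi> :: "('a list \<Rightarrow> rat) \<Rightarrow> rat"
  assumes G: "group G" and n: "n = 1 \<or> n = 2"
    and \<psi>: "\<And>f g. f \<in> carrier (bar_cocycles G n) \<Longrightarrow> g \<in> carrier (bar_cocycles G n) \<Longrightarrow> \<psi> (f + g) = \<psi> f + \<psi> g"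
      "\<And>r f. f \<in> carrier (bar_cocycles G n) \<Longrightarrow> \<psi> (\<lambda>xs. r * f xs) = r * \<psi> f"
      "\<And>f. f \<in> bar_coboundaries G n \<Longrightarrow> \<psi> f = 0"
begin

lemma cohom_functional_class:
  assumes f: "f \<in> carrier (bar_cocycles G n)"
  shows "cohom_functional G n \<psi> (cohom_class G n f) = \<psi> f"
proof -
  define g where "g = (SOME g. g \<in> carrier (bar_cocycles G n) \<and> cohom_class G n f = cohom_class G n g)"
  have "g \<in> carrier (bar_cocycles G n) \<and> cohom_class G n f = cohom_class G n g"
    unfolding g_def by (rule someI[of _ f]) (simp add: f)
  then have g: "g \<in> carrier (bar_cocycles G n)" and "f - g \<in> bar_coboundaries G n"
    using f by (auto simp: group_cohomology_ops(4)[OF G n])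
  then have "\<psi> (f - g) = 0" "f - g \<in> carrier (bar_cocycles G n)"
    using \<psi>(3) submodule_facts(1)[OF cohom_quot[OF G n]] by auto
  then have "\<psi> f = \<psi> g" using \<psi>(1)[of "f - g" g] g by simp
  then show ?thesis by (simp add: cohom_functional_def cohom_class_carrier[OF G n f] g_def)
qed

lemma cohom_functional_carrier: "cohom_functional G n \<psi> \<in> carrier (cohom_dual G n)"
proof -
  interpret module Rat "bar_cocycles G n" by (rule module_bar_cocycles)
  have 1: "f + g \<in> carrier (bar_cocycles G n)" if "f \<in> carrier (bar_cocycles G n)" "g \<in> carrier (bar_cocycles G n)" for f g
    using M.a_closed[OF that] by (simp add: bar_cocycles_sel(2))
  have 2: "(\<lambda>xs. r * f xs) \<in> carrier (bar_cocycles G n)" if "f \<in> carrier (bar_cocycles G n)" for r f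
    using smult_closed[OF _ that, of r] by (simp add: bar_cocycles_sel(4))
  show ?thesis
    unfolding cohom_dual_iff[OF G n]
    by (simp add: cohom_functional_class 1 2 \<psi>) (simp add: cohom_functional_def)
qed

end

subsection \<open>Characters and the cup product\<close>

text \<open>Values outside the carrier are left free, so the same function serves as a character of
  \<open>G\<close> and, restricted, of \<open>N\<close>; \<open>char_cochain\<close> does the
  normalisation.\<close>

definition group_chars :: "('a, 'm) monoid_scheme \<Rightarrow> ('a \<Rightarrow> rat) set" where
  "group_chars G = {a. \<forall>x\<in>carrier G. \<forall>y\<in>carrier G. a (x \<otimes>\<^bsub>G\<^esub> y) = a x + a y}"

definition char_cochain :: "('a, 'm) monoid_scheme \<Rightarrow> ('a \<Rightarrow> rat) \<Rightarrow> ('a list \<Rightarrow> rat)" where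
  "char_cochain G a xs = (if xs \<in> bar_tuples G 1 then a (hd xs) else 0)"

definition char_class :: "('a, 'm) monoid_scheme \<Rightarrow> ('a \<Rightarrow> rat) \<Rightarrow> ('a list \<Rightarrow> rat) set" where
  "char_class G a = cohom_class G 1 (char_cochain G a)"

lemma char_cochain_cocycle_iff: "char_cochain G a \<in> carrier (bar_cocycles G 1) \<longleftrightarrow> a \<in> group_chars G"
  if "group G"
proof -
  interpret group G by fact
  show ?thesis
    by (auto simp: bar_cocycles_sel bar_coboundary_1_eq_0_iff group_chars_def char_cochain_def bar_tuples_iff)
qed

lemma bar_cocycles_1: "carrier (bar_cocycles G 1) = char_cochain G ` group_chars G" if "group G"
proof (intro equalityI subsetI)
  interpret group G by fact
  fix f assume f: "f \<in> carrier (bar_cocycles G 1)"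
  have "f = char_cochain G (\<lambda>x. f [x])"
    using f by (auto simp: fun_eq_iff char_cochain_def bar_tuples_iff bar_cocycles_sel)
  moreover have "(\<lambda>x. f [x]) \<in> group_chars G"
    using f by (simp add: bar_cocycles_sel bar_coboundary_1_eq_0_iff group_chars_def)
  ultimately show "f \<in> char_cochain G ` group_chars G" by blast
qed (auto simp: char_cochain_cocycle_iff[OF that] simp del: One_nat_def)

lemma group_cohomology_1: "carrier (group_cohomology G 1) = char_class G ` group_chars G" if "group G"
  using group_cohomology_ops(1)[OF that, of 1] bar_cocycles_1[OF that]
  by (simp add: char_class_def image_image)

lemma char_class_carrier: "group G \<Longrightarrow> a \<in> group_chars G \<Longrightarrow> char_class G a \<in> carrier (group_cohomology G 1)"
  by (simp add: group_cohomology_1 del: One_nat_def)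

lemma char_class_cong:
  assumes "\<And>x. x \<in> carrier G \<Longrightarrow> a x = b x"
  shows "char_class G a = char_class G b"
proof -
  have "char_cochain G a = char_cochain G b"
    using assms by (auto simp: fun_eq_iff char_cochain_def bar_tuples_iff)
  then show ?thesis by (simp add: char_class_def)
qed

lemma char_cochain_ops:
  "char_cochain G a + char_cochain G b = char_cochain G (\<lambda>x. a x + b x)"
  "(\<lambda>xs. r * char_cochain G a xs) = char_cochain G (\<lambda>x. r * a x)"
  by (auto simp: char_cochain_def fun_eq_iff)

lemma cohom_dual_1_iff:
  assumes "group G"
  shows "\<phi> \<in> carrier (cohom_dual G 1) \<longleftrightarrow>
    (\<forall>a\<in>group_chars G. \<forall>b\<in>group_chars G.
       \<phi> (char_class G (\<lambda>x. a x + b x)) = \<phi> (char_class G a) + \<phi> (char_class G b)) \<and>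
    (\<forall>r. \<forall>a\<in>group_chars G. \<phi> (char_class G (\<lambda>x. r * a x)) = r * \<phi> (char_class G a)) \<and>
    (\<forall>x. x \<notin> carrier (group_cohomology G 1) \<longrightarrow> \<phi> x = 0)"
  using cohom_dual_iff[OF assms, of 1 \<phi>]
  unfolding bar_cocycles_1[OF assms] by (simp add: char_cochain_ops char_class_def)

lemma cohom_dual_1_ext:
  assumes "group G" "\<phi> \<in> carrier (cohom_dual G 1)" "\<psi> \<in> carrier (cohom_dual G 1)"
    and "\<And>a. a \<in> group_chars G \<Longrightarrow> \<phi> (char_class G a) = \<psi> (char_class G a)"
  shows "\<phi> = \<psi>"
  by (rule cohom_dual_ext[OF assms(1) _ assms(2,3)])
    (use assms(4) in \<open>auto simp: bar_cocycles_1[OF assms(1)] char_class_def simp del: One_nat_def\<close>)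

definition char_functional :: "('a, 'm) monoid_scheme \<Rightarrow> (('a \<Rightarrow> rat) \<Rightarrow> rat) \<Rightarrow> 'a hdual" where
  "char_functional G \<psi> = cohom_functional G 1 (\<lambda>f. \<psi> (\<lambda>x. f [x]))"

context
  fixes G :: "('a, 'm) monoid_scheme" and \<psi> :: "('a \<Rightarrow> rat) \<Rightarrow> rat"
  assumes G: "group G"
    and \<psi>: "\<And>a b. a \<in> group_chars G \<Longrightarrow> b \<in> group_chars G \<Longrightarrow> \<psi> (\<lambda>x. a x + b x) = \<psi> a + \<psi> b"
      "\<And>r a. a \<in> group_chars G \<Longrightarrow> \<psi> (\<lambda>x. r * a x) = r * \<psi> a"
      "\<And>a b. (\<And>x. x \<in> carrier G \<Longrightarrow> a x = b x) \<Longrightarrow> \<psi> a = \<psi> b"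
begin

lemma char_functional_aux:
  "f \<in> carrier (bar_cocycles G 1) \<Longrightarrow> g \<in> carrier (bar_cocycles G 1) \<Longrightarrow>
    \<psi> (\<lambda>x. (f + g) [x]) = \<psi> (\<lambda>x. f [x]) + \<psi> (\<lambda>x. g [x])"
  "f \<in> carrier (bar_cocycles G 1) \<Longrightarrow> \<psi> (\<lambda>x. r * f [x]) = r * \<psi> (\<lambda>x. f [x])"
  "f \<in> bar_coboundaries G 1 \<Longrightarrow> \<psi> (\<lambda>x. f [x]) = 0"
proof -
  have 1: "(\<lambda>x. f [x]) \<in> group_chars G" if "f \<in> carrier (bar_cocycles G 1)" for f
    using that by (simp add: bar_cocycles_sel bar_coboundary_1_eq_0_iff group_chars_def)
  show "f \<in> carrier (bar_cocycles G 1) \<Longrightarrow> g \<in> carrier (bar_cocycles G 1) \<Longrightarrow>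
    \<psi> (\<lambda>x. (f + g) [x]) = \<psi> (\<lambda>x. f [x]) + \<psi> (\<lambda>x. g [x])"
    using \<psi>(1)[OF 1 1] by simp
  show "f \<in> carrier (bar_cocycles G 1) \<Longrightarrow> \<psi> (\<lambda>x. r * f [x]) = r * \<psi> (\<lambda>x. f [x])"
    using \<psi>(2)[OF 1] by simp
  have "\<psi> (\<lambda>x. 0) = 0" using \<psi>(2)[of "\<lambda>x. 0" 0] by (simp add: group_chars_def)
  then show "f \<in> bar_coboundaries G 1 \<Longrightarrow> \<psi> (\<lambda>x. f [x]) = 0"
    by (auto simp: bar_coboundaries_def bar_coboundary_0)
qed

lemma char_functional_carrier: "char_functional G \<psi> \<in> carrier (cohom_dual G 1)"
  unfolding char_functional_def
  by (rule cohom_functional_carrier[OF G]) (use char_functional_aux in \<open>simp_all del: One_nat_def\<close>)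

lemma char_functional_class:
  assumes "a \<in> group_chars G"
  shows "char_functional G \<psi> (char_class G a) = \<psi> a"
proof -
  have "char_cochain G a \<in> carrier (bar_cocycles G 1)"
    using assms by (simp add: char_cochain_cocycle_iff[OF G] del: One_nat_def)
  then have "char_functional G \<psi> (char_class G a) = \<psi> (\<lambda>x. char_cochain G a [x])"
    unfolding char_functional_def char_class_def
    by (intro cohom_functional_class[OF G]) (use char_functional_aux in \<open>simp_all del: One_nat_def\<close>)
  also have "\<dots> = \<psi> a" by (rule \<psi>(3)) (simp add: char_cochain_def bar_tuples_iff)
  finally show ?thesis .
qed

end

text \<open>The class of \<open>g\<close> in the first rational homology, as an element of the dual
  of \<open>H^1\<close>.\<close>

definition eval_char :: "('a, 'm) monoid_scheme \<Rightarrow> 'a \<Rightarrow> 'a hdual" where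
  "eval_char G g = char_functional G (\<lambda>a. a g)"

lemma eval_char:
  assumes "group G" "g \<in> carrier G"
  shows eval_char_carrier: "eval_char G g \<in> carrier (cohom_dual G 1)"
    and eval_char_class: "a \<in> group_chars G \<Longrightarrow> eval_char G g (char_class G a) = a g"
  unfolding eval_char_def
  using char_functional_carrier[OF assms(1), of "\<lambda>a. a g"] char_functional_class[OF assms(1), of "\<lambda>a. a g" a]
    assms(2) by simp_all

definition cup_chars :: "('a, 'm) monoid_scheme \<Rightarrow> ('a \<Rightarrow> rat) \<Rightarrow> ('a \<Rightarrow> rat) \<Rightarrow> ('a list \<Rightarrow> rat)" where
  "cup_chars G a b = cup_cochain G 1 1 (char_cochain G a) (char_cochain G b)"

lemma cup_chars_eq:
  "cup_chars G a b xs = (if xs \<in> bar_tuples G 2 then a (xs ! 0) * b (xs ! 1) else 0)"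
  by (auto simp: cup_chars_def cup_cochain_def char_cochain_def bar_tuples_iff numeral_2_eq_2[symmetric] One_nat_def[symmetric]
      simp del: One_nat_def) (auto simp: bar_tuples_iff)

lemma cup_chars_cocycle:
  assumes "group G" "a \<in> group_chars G" "b \<in> group_chars G"
  shows "cup_chars G a b \<in> carrier (bar_cocycles G 2)"
proof -
  interpret group G by fact
  show ?thesis
    unfolding bar_cocycles_sel bar_coboundary_2_eq_0_iff
    using assms(2,3) by (auto simp: cup_chars_eq bar_tuples_iff group_chars_def algebra_simps)
qed

text \<open>A class of degree 1 is a singleton, so the union over representatives in
  \<open>cup\<close> has only one term.\<close>

lemma cup_char_class:
  assumes G: "group G" and a: "a \<in> group_chars G" and b: "b \<in> group_chars G"
  shows "cup G 1 1 (char_class G a) (char_class G b) = cohom_class G 2 (cup_chars G a b)"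
proof -
  have sing: "cohom_class G 1 f = {f}" for f
  proof -
    have "bar_coboundaries G 1 = {0}"
      by (auto simp: bar_coboundaries_def bar_coboundary_0 bar_cochains_sel intro!: image_eqI[of _ _ 0])
    then show ?thesis
      unfolding cohom_class_def a_r_coset_def' by (auto simp: bar_cocycles_sel)
  qed
  show ?thesis
    unfolding cup_def char_class_def sing by (simp add: cohom_class_def cup_chars_def numeral_2_eq_2)
qed

subsection \<open>Functoriality\<close>

definition pull_cochain :: "('a, 'm) monoid_scheme \<Rightarrow> nat \<Rightarrow> ('a \<Rightarrow> 'b) \<Rightarrow> ('b list \<Rightarrow> rat) \<Rightarrow> ('a list \<Rightarrow> rat)" where
  "pull_cochain G n \<alpha> f xs = (if xs \<in> bar_tuples G n then f (map \<alpha> xs) else 0)"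

context
  fixes G :: "('a, 'm) monoid_scheme" and H :: "('b, 'k) monoid_scheme" and \<alpha> :: "'a \<Rightarrow> 'b"
  assumes G: "group G" and H: "group H" and \<alpha>: "\<alpha> \<in> hom G H"
begin

lemma bar_tuples_map: "xs \<in> bar_tuples G n \<Longrightarrow> map \<alpha> xs \<in> bar_tuples H n"
  using \<alpha> by (auto simp: bar_tuples_def hom_def)

lemma bar_face_map:
  assumes "xs \<in> bar_tuples G n" "i \<le> n" "n > 0"
  shows "bar_face H i (map \<alpha> xs) = map \<alpha> (bar_face G i xs)" "bar_face G i xs \<in> bar_tuples G (n - 1)"
proof -
  interpret G: group G by (rule G)
  have m: "x \<in> carrier G \<Longrightarrow> y \<in> carrier G \<Longrightarrow> \<alpha> (x \<otimes>\<^bsub>G\<^esub> y) = \<alpha> x \<otimes>\<^bsub>H\<^esub> \<alpha> y" for x y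
    using \<alpha> by (auto simp: hom_def)
  have nth: "xs ! j \<in> carrier G" if "j < n" for j
    using assms that by (auto simp: bar_tuples_def)
  show "bar_face H i (map \<alpha> xs) = map \<alpha> (bar_face G i xs)"
    using assms nth by (auto simp: bar_face_def bar_tuples_def map_tl map_butlast take_map drop_map m)
  show "bar_face G i xs \<in> bar_tuples G (n - 1)"
    using assms nth G.m_closed
    by (auto simp: bar_face_def bar_tuples_def dest: in_set_takeD in_set_dropD in_set_butlastD list.set_sel(2))
qed

lemma pull_cochain_coboundary:
  "pull_cochain G (Suc n) \<alpha> (bar_coboundary H n f) = bar_coboundary G n (pull_cochain G n \<alpha> f)"
proof
  fix xs
  show "pull_cochain G (Suc n) \<alpha> (bar_coboundary H n f) xs = bar_coboundary G n (pull_cochain G n \<alpha> f) xs"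
  proof (cases "xs \<in> bar_tuples G (Suc n)")
    case True
    then show ?thesis
      using bar_tuples_map[OF True] bar_face_map[OF True]
      by (auto simp: pull_cochain_def bar_coboundary_def intro!: sum.cong)
  qed (simp add: pull_cochain_def bar_coboundary_def)
qed

lemma pull_cochain_cocycle: "f \<in> carrier (bar_cocycles H n) \<Longrightarrow> pull_cochain G n \<alpha> f \<in> carrier (bar_cocycles G n)"
  by (auto simp: bar_cocycles_sel simp flip: pull_cochain_coboundary) (auto simp: pull_cochain_def fun_eq_iff)

lemma pull_cochain_coboundaries:
  assumes "f \<in> bar_coboundaries H n" shows "pull_cochain G n \<alpha> f \<in> bar_coboundaries G n"
proof (cases n)
  case 0
  then show ?thesis using assms by (auto simp: bar_coboundaries_def pull_cochain_def fun_eq_iff)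
next
  case (Suc m)
  then obtain g where "g \<in> carrier (bar_cochains H m)" "f = bar_coboundary H m g"
    using assms by (auto simp: bar_coboundaries_def)
  then show ?thesis
    unfolding bar_coboundaries_def Suc
    by (auto simp: pull_cochain_coboundary bar_cochains_sel pull_cochain_def
        intro!: image_eqI[of _ _ "pull_cochain G m \<alpha> g"])
qed

lemma pull_cochain_linear:
  "pull_cochain G n \<alpha> (f + g) = pull_cochain G n \<alpha> f + pull_cochain G n \<alpha> g"
  "pull_cochain G n \<alpha> (\<lambda>xs. r * f xs) = (\<lambda>xs. r * pull_cochain G n \<alpha> f xs)"
  by (auto simp: pull_cochain_def fun_eq_iff)

lemma cohomology_map_class:
  assumes n: "n = 1 \<or> n = 2" and f: "f \<in> carrier (bar_cocycles H n)"
  shows "cohomology_map G n \<alpha> (cohom_class H n f) = cohom_class G n (pull_cochain G n \<alpha> f)"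
  unfolding cohomology_map_def cohom_class_def
  unfolding pull_cochain_def[symmetric, abs_def]
  by (rule submod_induced_map[OF cohom_quot[OF H n] cohom_quot[OF G n] f])
    (simp_all add: pull_cochain_cocycle pull_cochain_coboundaries bar_cocycles_sel(2) pull_cochain_linear[unfolded plus_fun_def] plus_fun_def)

lemma group_chars_comp: "b \<in> group_chars H \<Longrightarrow> (\<lambda>x. b (\<alpha> x)) \<in> group_chars G"
  using \<alpha> by (auto simp: group_chars_def hom_def Pi_def)

lemma cohomology_map_char_class:
  assumes b: "b \<in> group_chars H"
  shows "cohomology_map G 1 \<alpha> (char_class H b) = char_class G (\<lambda>x. b (\<alpha> x))"
proof -
  have "pull_cochain G 1 \<alpha> (char_cochain H b) = char_cochain G (\<lambda>x. b (\<alpha> x))"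
    using hom_in_carrier[OF \<alpha>] by (auto simp: fun_eq_iff pull_cochain_def char_cochain_def bar_tuples_iff)
  then show ?thesis
    using cohomology_map_class[of 1 "char_cochain H b"] b
    by (simp add: char_class_def char_cochain_cocycle_iff[OF H] del: One_nat_def)
qed

lemma cohom_dual_map_carrier:
  assumes n: "n = 1 \<or> n = 2" and x: "x \<in> carrier (cohom_dual G n)"
  shows "cohom_dual_map G H n \<alpha> x \<in> carrier (cohom_dual H n)"
proof -
  interpret module Rat "bar_cocycles H n" by (rule module_bar_cocycles)
  have 1: "f + g \<in> carrier (bar_cocycles H n)" if "f \<in> carrier (bar_cocycles H n)" "g \<in> carrier (bar_cocycles H n)" for f g
    using M.a_closed[OF that] by (simp add: bar_cocycles_sel(2))
  have 2: "(\<lambda>xs. r * f xs) \<in> carrier (bar_cocycles H n)" if "f \<in> carrier (bar_cocycles H n)" for r f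
    using smult_closed[OF _ that, of r] by (simp add: bar_cocycles_sel(4))
  show ?thesis
    unfolding cohom_dual_iff[OF H n]
    using x[unfolded cohom_dual_iff[OF G n]]
    by (simp add: cohom_dual_map_def cohom_class_carrier[OF H n] cohomology_map_class[OF n] 1 2
        pull_cochain_linear pull_cochain_cocycle)
qed

lemma cohom_dual_map_linear:
  assumes n: "n = 1 \<or> n = 2"
  shows "cohom_dual_map G H n \<alpha> \<in> linear_maps (cohom_dual G n) (cohom_dual H n)"
  using cohom_dual_map_carrier[OF n]
  by (auto simp: linear_maps_def cohom_dual_sel cohom_dual_map_def fun_eq_iff)

lemma cohom_dual_map_char_class:
  "b \<in> group_chars H \<Longrightarrow> cohom_dual_map G H 1 \<alpha> x (char_class H b) = x (char_class G (\<lambda>g. b (\<alpha> g)))"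
  using char_class_carrier[OF H] by (simp add: cohom_dual_map_def cohomology_map_char_class del: One_nat_def)

lemma cohom_dual_map_cup:
  assumes "a \<in> group_chars H" "b \<in> group_chars H"
  shows "cohom_dual_map G H 2 \<alpha> \<phi> (cup H 1 1 (char_class H a) (char_class H b)) =
    \<phi> (cup G 1 1 (char_class G (\<lambda>g. a (\<alpha> g))) (char_class G (\<lambda>g. b (\<alpha> g))))"
proof -
  have "pull_cochain G 2 \<alpha> (cup_chars H a b) = cup_chars G (\<lambda>g. a (\<alpha> g)) (\<lambda>g. b (\<alpha> g))"
    using hom_in_carrier[OF \<alpha>]
    by (auto simp: fun_eq_iff pull_cochain_def cup_chars_eq bar_tuples_iff; metis)
  then show ?thesis
    using assms cup_chars_cocycle[OF H assms]
    by (simp add: cohom_dual_map_def cup_char_class[OF H] cup_char_class[OF G] group_chars_comp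
        cohom_class_carrier[OF H] cohomology_map_class del: One_nat_def)
qed

end


subsection \<open>Presenting the holonomy Lie algebra\<close>

declare One_nat_def [simp del]

text \<open>All quadratic expressions in the free non-associative algebra that represent a value of
  \<nabla>, with classes of degree 1 replaced by characters. They project exactly onto
  \<open>nabla_image\<close>, by \<open>nabla_image_eq\<close>.\<close>

definition nabla_rels :: "('a, 'm) monoid_scheme \<Rightarrow> ('a hdual magma \<Rightarrow>\<^sub>0 rat) set" where
  "nabla_rels G = {p. \<exists>\<phi>\<in>carrier (cohom_dual G 2). \<exists>(n::nat) x y.
     x \<in> {..<n} \<rightarrow> carrier (cohom_dual G 1) \<and> y \<in> {..<n} \<rightarrow> carrier (cohom_dual G 1) \<and>
     p = (\<Sum>i<n. mag_gen (x i) \<star> mag_gen (y i)) \<and>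
     (\<forall>a\<in>group_chars G. \<forall>b\<in>group_chars G.
       (\<Sum>i<n. x i (char_class G a) * y i (char_class G b) - x i (char_class G b) * y i (char_class G a))
       = \<phi> (cohom_class G 2 (cup_chars G a b)))}"

definition hol_ideal :: "('a, 'm) monoid_scheme \<Rightarrow> ('a hdual magma \<Rightarrow>\<^sub>0 rat) set" where
  "hol_ideal G = lie_gen_ideal (cohom_dual G 1) (nabla_rels G)"

definition hol_proj ::
  "('a, 'm) monoid_scheme \<Rightarrow> ('a hdual magma \<Rightarrow>\<^sub>0 rat) \<Rightarrow> ('a hdual magma \<Rightarrow>\<^sub>0 rat) set set" where
  "hol_proj G p = holonomy_ideal G +>\<^bsub>free_lie (cohom_dual G 1)\<^esub> free_lie_proj (cohom_dual G 1) p"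

abbreviation hol_gens :: "('a, 'm) monoid_scheme \<Rightarrow> ('a hdual magma \<Rightarrow>\<^sub>0 rat) set" where
  "hol_gens G \<equiv> free_carrier (carrier (cohom_dual G 1))"

lemma nabla_rels_gr: "nabla_rels G \<subseteq> gr (free_nonassoc (carrier (cohom_dual G 1))) 2"
proof
  fix p assume "p \<in> nabla_rels G"
  then obtain n :: nat and x y where
    "x \<in> {..<n} \<rightarrow> carrier (cohom_dual G 1)" "y \<in> {..<n} \<rightarrow> carrier (cohom_dual G 1)"
    "p = (\<Sum>i<n. mag_gen (x i) \<star> mag_gen (y i))"
    by (auto simp: nabla_rels_def)
  moreover have "gcomp 2 (mag_gen u \<star> mag_gen v) = mag_gen u \<star> mag_gen v" for u v :: "'a hdual"
    using gcomp_mult_homogeneous[of 1 "mag_gen u" 1 "mag_gen v"] by (simp add: gcomp_gen numeral_2_eq_2)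
  ultimately show "p \<in> gr (free_nonassoc (carrier (cohom_dual G 1))) 2"
    by (auto simp: gr_free_nonassoc_iff gcomp_linear Pi_iff intro!: free_carrier_sum free_carrier_mult)
qed

lemma nabla_rels_subset: "nabla_rels G \<subseteq> hol_gens G"
  using nabla_rels_gr[of G] by (auto simp: gr_free_nonassoc_iff)

lemma nabla_image_eq:
  assumes G: "group G"
  shows "nabla_image G = free_lie_proj (cohom_dual G 1) ` nabla_rels G"
proof -
  let ?V = "cohom_dual G 1" and ?L = "free_lie (cohom_dual G 1)"
  note ops = free_lie_ops[OF module_cohom_dual[of G 1]]
  have sum: "finsum ?L (\<lambda>i. lie_gen ?V (x i) \<otimes>\<^bsub>?L\<^esub> lie_gen ?V (y i)) {..<n} =
      free_lie_proj ?V (\<Sum>i<n. mag_gen (x i) \<star> mag_gen (y i))"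
    if xy: "x \<in> {..<n} \<rightarrow> carrier ?V" "y \<in> {..<n} \<rightarrow> carrier ?V" for n :: nat and x y
  proof -
    interpret module Rat ?L
      using nonassoc_algebra_free_lie[OF module_cohom_dual[of G 1]] by (simp add: nonassoc_algebra_def)
    have g: "mag_gen (x i) \<in> hol_gens G" "mag_gen (y i) \<in> hol_gens G" if "i < n" for i
      using xy that by auto
    have "finsum ?L (\<lambda>i. lie_gen ?V (x i) \<otimes>\<^bsub>?L\<^esub> lie_gen ?V (y i)) {..<n} =
        finsum ?L (\<lambda>i. free_lie_proj ?V (mag_gen (x i) \<star> mag_gen (y i))) {..<n}"
      using g by (intro M.finsum_cong')
        (auto simp: lie_gen_def free_lie_proj_def[symmetric] ops(4) free_lie_proj_carrier[OF module_cohom_dual])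
    also have "\<dots> = free_lie_proj ?V (\<Sum>i<n. mag_gen (x i) \<star> mag_gen (y i))"
      using g by (intro finsum_image[where C = "hol_gens G"])
        (auto simp: ops(2,3) module_axioms free_lie_proj_carrier[OF module_cohom_dual])
    finally show ?thesis .
  qed
  have ball: "(\<forall>a\<in>carrier (group_cohomology G 1). \<forall>b\<in>carrier (group_cohomology G 1). P a b) \<longleftrightarrow>
      (\<forall>a\<in>group_chars G. \<forall>b\<in>group_chars G. P (char_class G a) (char_class G b))" for P
    by (simp add: group_cohomology_1[OF G])
  have cup: "cup G 1 1 (char_class G a) (char_class G b) = cohom_class G 2 (cup_chars G a b)"
    if "a \<in> group_chars G" "b \<in> group_chars G" for a b
    by (rule cup_char_class[OF G that])
  have "w \<in> nabla_image G \<longleftrightarrow> w \<in> free_lie_proj ?V ` nabla_rels G" for w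
  proof -
    have "w \<in> nabla_image G \<longleftrightarrow> (\<exists>\<phi>\<in>carrier (cohom_dual G 2). \<exists>(n::nat) x y.
     x \<in> {..<n} \<rightarrow> carrier ?V \<and> y \<in> {..<n} \<rightarrow> carrier ?V \<and>
     w = finsum ?L (\<lambda>i. lie_gen ?V (x i) \<otimes>\<^bsub>?L\<^esub> lie_gen ?V (y i)) {..<n} \<and>
     (\<forall>a\<in>carrier (group_cohomology G 1). \<forall>b\<in>carrier (group_cohomology G 1).
       (\<Sum>i<n. x i a * y i b - x i b * y i a) = \<phi> (cup G 1 1 a b)))"
      unfolding nabla_image_def nabla_graph_def by blast
    also have "\<dots> \<longleftrightarrow> (\<exists>\<phi>\<in>carrier (cohom_dual G 2). \<exists>(n::nat) x y.
     x \<in> {..<n} \<rightarrow> carrier ?V \<and> y \<in> {..<n} \<rightarrow> carrier ?V \<and>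
     w = free_lie_proj ?V (\<Sum>i<n. mag_gen (x i) \<star> mag_gen (y i)) \<and>
     (\<forall>a\<in>group_chars G. \<forall>b\<in>group_chars G.
       (\<Sum>i<n. x i (char_class G a) * y i (char_class G b) - x i (char_class G b) * y i (char_class G a))
       = \<phi> (cohom_class G 2 (cup_chars G a b))))"
      unfolding ball
    proof (intro bex_cong ex_cong1 conj_cong HOL.refl ball_cong)
      fix n :: nat and x y
      assume "x \<in> {..<n} \<rightarrow> carrier ?V" "y \<in> {..<n} \<rightarrow> carrier ?V"
      then show "(w = finsum ?L (\<lambda>i. lie_gen ?V (x i) \<otimes>\<^bsub>?L\<^esub> lie_gen ?V (y i)) {..<n}) =
          (w = free_lie_proj ?V (\<Sum>i<n. mag_gen (x i) \<star> mag_gen (y i)))"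
        by (simp only: sum)
    qed (simp only: cup)
    also have "\<dots> \<longleftrightarrow> w \<in> free_lie_proj ?V ` nabla_rels G"
      unfolding nabla_rels_def by blast
    finally show ?thesis .
  qed
  then show ?thesis by blast
qed

lemma lie_presentation_holonomy:
  assumes "group G"
  shows "lie_presentation (holonomy G) (hol_gens G) (hol_ideal G) (hol_proj G)"
  using lie_presentation_quot[OF module_cohom_dual nabla_rels_subset nabla_rels_gr, of G]
  unfolding holonomy_def holonomy_ideal_def nabla_image_eq[OF assms] hol_ideal_def hol_proj_def[abs_def] .

lemma lie_kernel_hol_ideal: "lie_kernel (cohom_dual G 1) (hol_ideal G)"
  unfolding hol_ideal_def by (rule lie_kernel_gen_ideal[OF module_cohom_dual nabla_rels_subset])

context
  fixes G :: "('a, 'm) monoid_scheme" and H :: "('b, 'k) monoid_scheme" and \<alpha> :: "'a \<Rightarrow> 'b"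
  assumes G: "group G" and H: "group H" and \<alpha>: "\<alpha> \<in> hom G H"
begin

lemma cohom_dual_map_gens: "p \<in> hol_gens G \<Longrightarrow> mag_map (cohom_dual_map G H 1 \<alpha>) p \<in> hol_gens H"
  by (rule mag_map_closed[where X = "carrier (cohom_dual G 1)"]) (simp_all add: cohom_dual_map_carrier[OF G H \<alpha>])

text \<open>Naturality of the cup product: an expression for the value of \<nabla> at \<phi> goes to
  one for the value at the transported functional.\<close>

lemma mag_map_nabla_rels:
  assumes "p \<in> nabla_rels G"
  shows "mag_map (cohom_dual_map G H 1 \<alpha>) p \<in> nabla_rels H"
proof -
  let ?f = "cohom_dual_map G H 1 \<alpha>"
  obtain \<phi> and n :: nat and x y where \<phi>: "\<phi> \<in> carrier (cohom_dual G 2)"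
    and x: "x \<in> {..<n} \<rightarrow> carrier (cohom_dual G 1)" and y: "y \<in> {..<n} \<rightarrow> carrier (cohom_dual G 1)"
    and p: "p = (\<Sum>i<n. mag_gen (x i) \<star> mag_gen (y i))"
    and pair: "\<And>a b. a \<in> group_chars G \<Longrightarrow> b \<in> group_chars G \<Longrightarrow>
       (\<Sum>i<n. x i (char_class G a) * y i (char_class G b) - x i (char_class G b) * y i (char_class G a))
       = \<phi> (cohom_class G 2 (cup_chars G a b))"
    using assms by (auto simp: nabla_rels_def)
  have cl: "?f v \<in> carrier (cohom_dual H 1)" if "v \<in> carrier (cohom_dual G 1)" for v
    using that by (simp add: cohom_dual_map_carrier[OF G H \<alpha>])
  show ?thesis
    unfolding nabla_rels_def
  proof (rule CollectI, rule bexI[of _ "cohom_dual_map G H 2 \<alpha> \<phi>"], rule exI[of _ n],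
      rule exI[of _ "\<lambda>i. ?f (x i)"], rule exI[of _ "\<lambda>i. ?f (y i)"], intro conjI ballI)
    show "(\<lambda>i. ?f (x i)) \<in> {..<n} \<rightarrow> carrier (cohom_dual H 1)" "(\<lambda>i. ?f (y i)) \<in> {..<n} \<rightarrow> carrier (cohom_dual H 1)"
      using x y cl by auto
    show "mag_map ?f p = (\<Sum>i<n. mag_gen (?f (x i)) \<star> mag_gen (?f (y i)))"
      by (simp add: p mag_map_linear mag_map_mult)
    show "cohom_dual_map G H 2 \<alpha> \<phi> \<in> carrier (cohom_dual H 2)"
      using \<phi> by (simp add: cohom_dual_map_carrier[OF G H \<alpha>])
    fix a b assume ab: "a \<in> group_chars H" "b \<in> group_chars H"
    note ab' = group_chars_comp[OF G H \<alpha> ab(1)] group_chars_comp[OF G H \<alpha> ab(2)]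
    show "(\<Sum>i<n. ?f (x i) (char_class H a) * ?f (y i) (char_class H b)
        - ?f (x i) (char_class H b) * ?f (y i) (char_class H a))
        = cohom_dual_map G H 2 \<alpha> \<phi> (cohom_class H 2 (cup_chars H a b))"
      using cohom_dual_map_cup[OF G H \<alpha> ab, of \<phi>] pair[OF ab'] ab
      by (simp only: cohom_dual_map_char_class[OF G H \<alpha>] cup_char_class[OF G ab'] cup_char_class[OF H ab])
  qed
qed

lemma mag_map_hol_ideal:
  assumes "p \<in> hol_ideal G"
  shows "mag_map (cohom_dual_map G H 1 \<alpha>) p \<in> hol_ideal H"
proof -
  let ?f = "cohom_dual_map G H 1 \<alpha>"
  have f: "?f \<in> linear_maps (cohom_dual G 1) (cohom_dual H 1)"
    by (rule cohom_dual_map_linear[OF G H \<alpha>]) simp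
  have "hol_ideal G \<subseteq> {p \<in> hol_gens G. mag_map ?f p \<in> hol_ideal H}"
    unfolding hol_ideal_def[of G]
    using mag_map_nabla_rels nabla_rels_subset lie_gen_ideal_superset[of "nabla_rels H" "cohom_dual H 1"]
    by (intro lie_kernel_least mag_map_pullback[OF module_cohom_dual lie_kernel_hol_ideal f])
      (auto simp: hol_ideal_def)
  then show ?thesis using assms by auto
qed

lemma holonomy_map_proj:
  assumes p: "p \<in> hol_gens G"
  shows "holonomy_map G H \<alpha> (hol_proj G p) = hol_proj H (mag_map (cohom_dual_map G H 1 \<alpha>) p)"
proof -
  let ?f = "cohom_dual_map G H 1 \<alpha>" and ?V = "cohom_dual G 1" and ?W = "cohom_dual H 1"
  have f: "?f \<in> linear_maps ?V ?W"
    by (rule cohom_dual_map_linear[OF G H \<alpha>]) simp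
  note LV = nonassoc_algebra_free_lie[OF module_cohom_dual[of G 1]]
  note LW = nonassoc_algebra_free_lie[OF module_cohom_dual[of H 1]]
  note IV = gen_ideal_free_lie[OF module_cohom_dual nabla_rels_subset, of G,
      folded nabla_image_eq[OF G] holonomy_ideal_def]
  note IW = gen_ideal_free_lie[OF module_cohom_dual nabla_rels_subset, of H,
      folded nabla_image_eq[OF H] holonomy_ideal_def]
  note opsV = free_lie_ops[OF module_cohom_dual[of G 1]]
  note opsW = free_lie_ops[OF module_cohom_dual[of H 1]]
  note fp = free_lie_map_proj[OF module_cohom_dual module_cohom_dual f]
  have mem: "free_lie_proj ?V q \<in> holonomy_ideal G \<longleftrightarrow> q \<in> hol_ideal G" if "q \<in> hol_gens G" for q
    using free_lie_proj_mem_gen_ideal[OF module_cohom_dual nabla_rels_subset that]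
    unfolding holonomy_ideal_def nabla_image_eq[OF G] hol_ideal_def .
  have memH: "free_lie_proj ?W q \<in> holonomy_ideal H \<longleftrightarrow> q \<in> hol_ideal H" if "q \<in> hol_gens H" for q
    using free_lie_proj_mem_gen_ideal[OF module_cohom_dual nabla_rels_subset that]
    unfolding holonomy_ideal_def nabla_image_eq[OF H] hol_ideal_def .
  have i: "\<exists>q\<in>hol_gens G. i = free_lie_proj ?V q \<and> q \<in> hol_ideal G" if "i \<in> holonomy_ideal G" for i
    using that ideal_facts(1)[OF LV IV] mem unfolding opsV(1) by blast
  show ?thesis
    unfolding holonomy_map_def hol_proj_def fp[OF p, symmetric]
  proof (rule induced_map_coset[OF LV IV LW IW])
    show "free_lie_proj ?V p \<in> carrier (free_lie ?V)" using p by (simp add: opsV(1))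
    show "free_lie_map ?W ?f y \<in> carrier (free_lie ?W)" if "y \<in> carrier (free_lie ?V)" for y
      using that cohom_dual_map_gens by (auto simp: opsV(1) opsW(1) fp)
    fix i assume "i \<in> holonomy_ideal G"
    then obtain q where q: "q \<in> hol_gens G" "i = free_lie_proj ?V q" "q \<in> hol_ideal G" using i by blast
    show "free_lie_map ?W ?f (i \<oplus>\<^bsub>free_lie ?V\<^esub> free_lie_proj ?V p) =
        free_lie_map ?W ?f i \<oplus>\<^bsub>free_lie ?W\<^esub> free_lie_map ?W ?f (free_lie_proj ?V p)"
      unfolding q(2) opsV(3)[OF q(1) p] fp[OF q(1)] fp[OF p] fp[OF free_carrier_add[OF q(1) p]]
      unfolding mag_map_linear opsW(3)[OF cohom_dual_map_gens[OF q(1)] cohom_dual_map_gens[OF p]] ..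
    show "free_lie_map ?W ?f i \<in> holonomy_ideal H"
      unfolding q(2) fp[OF q(1)] memH[OF cohom_dual_map_gens[OF q(1)]] by (rule mag_map_hol_ideal[OF q(3)])
  qed
qed

lemma holonomy_map_hom: "holonomy_map G H \<alpha> \<in> graded_lie_hom (holonomy G) (holonomy H)"
proof (rule lie_presentation.graded_lie_hom_L[where \<Phi> = "mag_map (cohom_dual_map G H 1 \<alpha>)",
      OF lie_presentation_holonomy[OF G] lie_presentation_holonomy[OF H] holonomy_map_proj])
  show "mag_map (cohom_dual_map G H 1 \<alpha>) (p \<star> q) - mag_map (cohom_dual_map G H 1 \<alpha>) p \<star> mag_map (cohom_dual_map G H 1 \<alpha>) q
      \<in> hol_ideal H" for p q
    using lie_kernel.J_zero[OF lie_kernel_hol_ideal] by (simp add: mag_map_mult)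
qed (simp_all add: cohom_dual_map_gens mag_map_linear gcomp_mag_map)

end

subsection \<open>Right-angled Artin groups\<close>

lemma word_equiv_words:
  assumes "(v, w) \<in> word_equiv X R"
  shows "v \<in> group_words X" "w \<in> group_words X"
proof -
  have "v \<in> group_words X \<and> w \<in> group_words X"
    using assms by (induction rule: word_equiv.induct) auto
  then show "v \<in> group_words X" "w \<in> group_words X" by auto
qed

lemma equiv_word_equiv: "equiv (group_words X) (word_equiv X R)"
proof (rule equivI)
  show "word_equiv X R \<subseteq> group_words X \<times> group_words X"
    by (intro subrelI SigmaI; rule word_equiv_words)
  show "refl_on (group_words X) (word_equiv X R)" by (auto simp: refl_on_def word_equiv.refl)
  show "Relation.sym (word_equiv X R)" by (auto simp: sym_def word_equiv.sym)
  show "Relation.trans (word_equiv X R)" by (rule transI) (rule word_equiv.trans)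
qed

lemma word_equiv_append_context:
  assumes "(v, w) \<in> word_equiv X R" "a \<in> group_words X" "b \<in> group_words X"
  shows "(a @ v @ b, a @ w @ b) \<in> word_equiv X R"
  using assms(1)
proof (induction rule: word_equiv.induct)
  case (refl w)
  then show ?case using assms by (intro word_equiv.refl) auto
next
  case (cancel u w x c)
  then show ?case using word_equiv.cancel[of "a @ u" X "w @ b" x c R] assms by simp
next
  case (relation u w l r)
  then show ?case using word_equiv.relation[of "a @ u" X "w @ b" l r R] assms by simp
qed (blast intro: word_equiv.sym word_equiv.trans)+

lemma word_equiv_append:
  assumes "(u, u') \<in> word_equiv X R" "(v, v') \<in> word_equiv X R"
  shows "(u @ v, u' @ v') \<in> word_equiv X R"
  using word_equiv_append_context[OF assms(1), of "[]" v] word_equiv_append_context[OF assms(2), of u' "[]"]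
    word_equiv_words[OF assms(1)] word_equiv_words[OF assms(2)]
  by (auto intro: word_equiv.trans)

definition inv_word :: "'x word \<Rightarrow> 'x word" where
  "inv_word w = rev (map (\<lambda>(x, b). (x, \<not> b)) w)"

lemma inv_word_words: "w \<in> group_words X \<Longrightarrow> inv_word w \<in> group_words X"
  by (auto simp: inv_word_def)

lemma inv_word_left: "w \<in> group_words X \<Longrightarrow> (inv_word w @ w, []) \<in> word_equiv X R"
proof (induction w)
  case Nil
  then show ?case by (auto simp: inv_word_def intro: word_equiv.refl)
next
  case (Cons l w)
  obtain x b where l: "l = (x, b)" by (cases l)
  have "(inv_word w @ [(x, \<not> b), (x, \<not> \<not> b)] @ w, inv_word w @ w) \<in> word_equiv X R"
    using Cons.prems by (intro word_equiv.cancel inv_word_words) (auto simp: l)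
  moreover have "inv_word (l # w) @ l # w = inv_word w @ [(x, \<not> b), (x, \<not> \<not> b)] @ w"
    by (simp add: inv_word_def l)
  ultimately show ?case using Cons by (auto intro: word_equiv.trans)
qed

definition word_class :: "'x set \<Rightarrow> ('x word \<times> 'x word) set \<Rightarrow> 'x word \<Rightarrow> 'x word set" where
  "word_class X R w = word_equiv X R `` {w}"

lemma word_class_eq_iff:
  "u \<in> group_words X \<Longrightarrow> v \<in> group_words X \<Longrightarrow> word_class X R u = word_class X R v \<longleftrightarrow> (u, v) \<in> word_equiv X R"
  unfolding word_class_def by (rule eq_equiv_class_iff[OF equiv_word_equiv])

lemma presented_group_carrier: "carrier (presented_group X R) = word_class X R ` group_words X"
  by (auto simp: presented_group_def quotient_def word_class_def)

lemma presented_group_mult: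
  assumes "u \<in> group_words X" "v \<in> group_words X"
  shows "word_class X R u \<otimes>\<^bsub>presented_group X R\<^esub> word_class X R v = word_class X R (u @ v)"
proof -
  have "word_class X R (a @ b) = word_class X R (u @ v)"
    if "a \<in> word_class X R u" "b \<in> word_class X R v" for a b
  proof -
    have "(u @ v, a @ b) \<in> word_equiv X R"
      using that by (auto simp: word_class_def intro: word_equiv_append)
    then show ?thesis using word_equiv_words[of "u @ v" "a @ b" X R]
      by (subst word_class_eq_iff) (auto intro: word_equiv.sym)
  qed
  then have "(\<Union>a\<in>word_class X R u. \<Union>b\<in>word_class X R v. word_class X R (a @ b)) =
      (\<Union>a\<in>word_class X R u. \<Union>b\<in>word_class X R v. word_class X R (u @ v))"
    by (intro SUP_cong HOL.refl) blast
  moreover have "u \<in> word_class X R u" "v \<in> word_class X R v"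
    using assms by (auto simp: word_class_def intro: word_equiv.refl)
  ultimately have "(\<Union>a\<in>word_class X R u. \<Union>b\<in>word_class X R v. word_class X R (a @ b)) = word_class X R (u @ v)"
    by blast
  then show ?thesis by (simp add: presented_group_def word_class_def)
qed

lemma presented_group_one: "\<one>\<^bsub>presented_group X R\<^esub> = word_class X R []"
  by (simp add: presented_group_def word_class_def)

lemma group_presented_group: "group (presented_group X R)"
proof (rule groupI)
  show "\<exists>y\<in>carrier (presented_group X R). y \<otimes>\<^bsub>presented_group X R\<^esub> x = \<one>\<^bsub>presented_group X R\<^esub>"
    if "x \<in> carrier (presented_group X R)" for x
  proof -
    have "x \<in> word_class X R ` group_words X" using that by (simp only: presented_group_carrier)
    then obtain w where w: "x = word_class X R w" "w \<in> group_words X" by (rule imageE)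
    have "word_class X R (inv_word w) \<otimes>\<^bsub>presented_group X R\<^esub> x = \<one>\<^bsub>presented_group X R\<^esub>"
      unfolding w(1) presented_group_mult[OF inv_word_words[OF w(2)] w(2)] presented_group_one
      using inv_word_left[OF w(2)] by (subst word_class_eq_iff) (use w(2) inv_word_words[OF w(2)] in auto)
    then show ?thesis using inv_word_words[OF w(2)] unfolding presented_group_carrier by blast
  qed
next
  fix x y assume "x \<in> carrier (presented_group X R)" "y \<in> carrier (presented_group X R)"
  then show "x \<otimes>\<^bsub>presented_group X R\<^esub> y \<in> carrier (presented_group X R)"
    unfolding presented_group_carrier
    by (elim imageE) (simp only: presented_group_mult append_in_lists_conv conj_absorb imageI)
  fix z assume "z \<in> carrier (presented_group X R)"
  then show "x \<otimes>\<^bsub>presented_group X R\<^esub> y \<otimes>\<^bsub>presented_group X R\<^esub> z =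
      x \<otimes>\<^bsub>presented_group X R\<^esub> (y \<otimes>\<^bsub>presented_group X R\<^esub> z)"
    using \<open>x \<in> carrier (presented_group X R)\<close> \<open>y \<in> carrier (presented_group X R)\<close>
    unfolding presented_group_carrier
    by (elim imageE) (simp only: presented_group_mult append_in_lists_conv append_assoc simp_thms)
next
  show "\<one>\<^bsub>presented_group X R\<^esub> \<in> carrier (presented_group X R)"
    unfolding presented_group_carrier presented_group_one by (intro imageI) simp
  fix x assume "x \<in> carrier (presented_group X R)"
  then show "\<one>\<^bsub>presented_group X R\<^esub> \<otimes>\<^bsub>presented_group X R\<^esub> x = x"
    unfolding presented_group_carrier presented_group_one
    by (elim imageE) (simp only: presented_group_mult lists.Nil append_Nil)
qed

definition class_lift :: "('x word \<Rightarrow> 'c) \<Rightarrow> 'x word set \<Rightarrow> 'c" where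
  "class_lift f C = f (SOME w. w \<in> C)"

lemma class_lift:
  assumes "\<And>v w. (v, w) \<in> word_equiv X R \<Longrightarrow> f v = f w" "w \<in> group_words X"
  shows "class_lift f (word_class X R w) = f w"
proof -
  have "w \<in> word_class X R w" using assms(2) by (auto simp: word_class_def intro: word_equiv.refl)
  then have "(SOME v. v \<in> word_class X R w) \<in> word_class X R w" by (rule someI)
  then show ?thesis using assms(1) by (auto simp: class_lift_def word_class_def)
qed

section \<open>Exponent sums and bilinear cocycles\<close>

fun letter_exp :: "'x \<times> bool \<Rightarrow> 'x \<Rightarrow> rat" where
  "letter_exp (y, b) x = (if y = x then if b then 1 else - 1 else 0)"

definition word_exp :: "'x word \<Rightarrow> 'x \<Rightarrow> rat" where
  "word_exp w x = (\<Sum>l\<leftarrow>w. letter_exp l x)"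

lemma word_exp_simps [simp]:
  "word_exp [] x = 0" "word_exp (l # w) x = letter_exp l x + word_exp w x"
  "word_exp (u @ w) x = word_exp u x + word_exp w x"
  by (simp_all add: word_exp_def)

lemma word_exp_letter: "word_exp [l] = letter_exp l" "word_exp [] = (\<lambda>x. 0)"
  by auto

text \<open>On the exponent vectors of two group elements this is a bilinear, hence closed,
  2-cochain.\<close>

definition bilin :: "'x set \<Rightarrow> ('x \<Rightarrow> 'x \<Rightarrow> rat) \<Rightarrow> ('x \<Rightarrow> rat) \<Rightarrow> ('x \<Rightarrow> rat) \<Rightarrow> rat" where
  "bilin X M u w = (\<Sum>x\<in>X. \<Sum>y\<in>X. M x y * u x * w y)"

lemma bilin_add:
  "bilin X M (\<lambda>x. u x + u' x) w = bilin X M u w + bilin X M u' w"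
  "bilin X M u (\<lambda>x. w x + w' x) = bilin X M u w + bilin X M u w'"
  by (simp_all add: bilin_def algebra_simps sum.distrib)

lemma bilin_zero [simp]: "bilin X M (\<lambda>x. 0) w = 0" "bilin X M u (\<lambda>x. 0) = 0"
  by (simp_all add: bilin_def)

lemma bilin_letters:
  assumes "finite X" "x \<in> X" "y \<in> X"
  shows "bilin X M (letter_exp (x, b)) (letter_exp (y, c)) =
    (if b then 1 else - 1) * (if c then 1 else - 1) * M x y"
proof -
  have "bilin X M (letter_exp (x, b)) (letter_exp (y, c)) =
     (\<Sum>x'\<in>X. \<Sum>y'\<in>X. if y' = y then if x' = x then (if b then 1 else - 1) * (if c then 1 else - 1) * M x y else 0 else 0)"
    unfolding bilin_def by (intro sum.cong HOL.refl) auto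
  also have "\<dots> = (if b then 1 else - 1) * (if c then 1 else - 1) * M x y"
    using assms by (simp add: sum.delta)
  finally show ?thesis .
qed

text \<open>The last coordinate of the homomorphism to the Heisenberg-type group with cocycle \<open>- M\<close>
  that takes each generator \<open>x\<close> to \<open>(x, 0)\<close>.\<close>

fun heis_letter :: "('x \<Rightarrow> 'x \<Rightarrow> rat) \<Rightarrow> 'x \<times> bool \<Rightarrow> rat" where
  "heis_letter M (x, b) = (if b then 0 else - M x x)"

fun heis_word :: "'x set \<Rightarrow> ('x \<Rightarrow> 'x \<Rightarrow> rat) \<Rightarrow> 'x word \<Rightarrow> rat" where
  "heis_word X M [] = 0"
| "heis_word X M (l # w) = heis_letter M l - bilin X M (letter_exp l) (word_exp w) + heis_word X M w"

text \<open>In terms of cochains, the coboundary of \<open>heis_word X M\<close> is the bilinear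
  form \<open>M\<close> in the exponent sums.\<close>

lemma heis_word_append:
  "heis_word X M (u @ w) = heis_word X M u + heis_word X M w - bilin X M (word_exp u) (word_exp w)"
proof (induction u)
  case (Cons l u)
  have e: "word_exp (u @ w) = (\<lambda>x. word_exp u x + word_exp w x)"
    "word_exp (l # u) = (\<lambda>x. letter_exp l x + word_exp u x)"
    by auto
  show ?case by (simp add: Cons e bilin_add del: word_exp_simps(2,3))
qed (simp add: bilin_def)

definition raag_rels :: "'v set set \<Rightarrow> ('v word \<times> 'v word) set" where
  "raag_rels E = {([(u, True), (v, True)], [(v, True), (u, True)]) | u v. {u, v} \<in> E}"

lemma raag_eq: "raag V E = presented_group V (raag_rels E)"
  by (simp add: raag_def raag_rels_def)

lemma word_exp_equiv:
  assumes "(v, w) \<in> word_equiv V (raag_rels E)" shows "word_exp v = word_exp w"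
  using assms by (induction rule: word_equiv.induct) (auto simp: raag_rels_def fun_eq_iff)

text \<open>Symmetry of \<open>M\<close> on an edge says that the images of its two generators in
  the Heisenberg-type group commute, so the defining relations are respected.\<close>

lemma heis_word_equiv:
  assumes V: "finite V" and M: "\<And>u v. u \<in> V \<Longrightarrow> v \<in> V \<Longrightarrow> {u, v} \<in> E \<Longrightarrow> M u v = M v u"
    and "(v, w) \<in> word_equiv V (raag_rels E)"
  shows "heis_word V M v = heis_word V M w"
proof -
  have subst: "heis_word V M (u @ l @ w) = heis_word V M (u @ r @ w)"
    if "heis_word V M l = heis_word V M r" "word_exp l = word_exp r" for u l r w
  proof -
    have "word_exp (l @ w) = word_exp (r @ w)" using that(2) by (auto simp: fun_eq_iff)
    then show ?thesis using that by (simp add: heis_word_append)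
  qed
  show ?thesis
    using assms(3)
  proof (induction rule: word_equiv.induct)
    case (cancel u w x b)
    \<comment> \<open>The value \<open>- M x x\<close> given to an inverse letter offsets the term
      \<open>M x x\<close> that the bilinear form contributes.\<close>
    have "heis_word V M [(x, b), (x, \<not> b)] = heis_word V M []"
      using bilin_letters[OF V cancel(3) cancel(3), of M b "\<not> b"] cancel(3)
      by (simp add: word_exp_letter del: letter_exp.simps)
    moreover have "word_exp [(x, b), (x, \<not> b)] = word_exp []" by (auto simp: fun_eq_iff)
    ultimately show ?case using subst[of "[(x, b), (x, \<not> b)]" "[]" u w] by simp
  next
    case (relation u w l r)
    then obtain a c where ac: "l = [(a, True), (c, True)]" "r = [(c, True), (a, True)]" "{a, c} \<in> E"
      by (auto simp: raag_rels_def)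
    then have "a \<in> V" "c \<in> V" using relation by auto
    then have "heis_word V M l = heis_word V M r"
      using bilin_letters[OF V, of a c M True True] bilin_letters[OF V, of c a M True True] M[of a c] ac
      by (simp add: word_exp_letter del: letter_exp.simps)
    moreover have "word_exp l = word_exp r" by (auto simp: fun_eq_iff ac)
    ultimately show ?case by (rule subst)
  qed auto
qed

text \<open>Here \<open>co v\<close> is the exponent sum of the generator \<open>v\<close>. The assumption \<open>heis\<close> says that
  a bilinear cocycle is a coboundary if it is symmetric on the edges.\<close>

locale raag_group =
  fixes G :: "('g, 'm) monoid_scheme" and V :: "'v set" and adj :: "'v \<Rightarrow> 'v \<Rightarrow> bool"
    and gen :: "'v \<Rightarrow> 'g" and co :: "'v \<Rightarrow> 'g \<Rightarrow> rat"
  assumes G: "group G" and V: "finite V"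
    and adj_sym: "adj u v \<Longrightarrow> adj v u" and adj_irrefl: "\<not> adj v v"
    and adj_V: "adj u v \<Longrightarrow> u \<in> V \<and> v \<in> V"
    and gen: "v \<in> V \<Longrightarrow> gen v \<in> carrier G"
    and gen_commute: "adj u v \<Longrightarrow> gen u \<otimes>\<^bsub>G\<^esub> gen v = gen v \<otimes>\<^bsub>G\<^esub> gen u"
    and co: "co v \<in> group_chars G"
    and co_gen: "u \<in> V \<Longrightarrow> v \<in> V \<Longrightarrow> co v (gen u) = (if u = v then 1 else 0)"
    and chars: "a \<in> group_chars G \<Longrightarrow> g \<in> carrier G \<Longrightarrow> a g = (\<Sum>v\<in>V. a (gen v) * co v g)"
    and heis: "(\<And>u v. adj u v \<Longrightarrow> M u v = M v u) \<Longrightarrow>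
      \<exists>A. \<forall>x\<in>carrier G. \<forall>y\<in>carrier G. A (x \<otimes>\<^bsub>G\<^esub> y) = A x + A y - bilin V M (\<lambda>v. co v x) (\<lambda>v. co v y)"

lemma group_chars_one: "group G \<Longrightarrow> a \<in> group_chars G \<Longrightarrow> a \<one>\<^bsub>G\<^esub> = 0"
proof -
  assume G: "group G" and a: "a \<in> group_chars G"
  interpret group G by fact
  have "a (\<one>\<^bsub>G\<^esub> \<otimes>\<^bsub>G\<^esub> \<one>\<^bsub>G\<^esub>) = a \<one>\<^bsub>G\<^esub> + a \<one>\<^bsub>G\<^esub>"
    using a unfolding group_chars_def by blast
  then show ?thesis by simp
qed

text \<open>Words are left behind at this point: exponent sums give the characters, and
  \<open>heis_word\<close> gives the primitives of bilinear cocycles.\<close>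

lemma raag_group_raag:
  fixes V :: "'v set" and E :: "'v set set"
  assumes graph: "finite_simple_graph V E"
  shows "raag_group (raag V E) V (\<lambda>u v. {u, v} \<in> E) (\<lambda>v. word_class V (raag_rels E) [(v, True)])
    (\<lambda>v. class_lift (\<lambda>w. word_exp w v))"
proof (rule raag_group.intro)
  let ?G = "raag V E" and ?c = "word_class V (raag_rels E)" and ?co = "\<lambda>v. class_lift (\<lambda>w. word_exp w v)"
  interpret group ?G unfolding raag_eq by (rule group_presented_group)
  note car = presented_group_carrier[of V "raag_rels E", folded raag_eq]
  note mult = presented_group_mult[of _ V _ "raag_rels E", folded raag_eq]
  note one = presented_group_one[of V "raag_rels E", folded raag_eq]
  show "group ?G" by (rule group_axioms)
  show fin: "finite V" using graph by (simp add: finite_simple_graph_def)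
  have co: "?co v (?c w) = word_exp w v" if "w \<in> group_words V" for v w
    by (rule class_lift[OF _ that]) (simp add: word_exp_equiv[of _ _ V E])
  show "{v, u} \<in> E" if "{u, v} \<in> E" for u v using that by (simp add: insert_commute)
  show "\<not> {v, v} \<in> E" for v
    using graph unfolding finite_simple_graph_def by (metis doubleton_eq_iff)
  show EV: "u \<in> V \<and> v \<in> V" if "{u, v} \<in> E" for u v
    using graph that unfolding finite_simple_graph_def by (metis doubleton_eq_iff)
  show "?c [(v, True)] \<in> carrier ?G" if "v \<in> V" for v using that by (auto simp: car)
  show "?c [(u, True)] \<otimes>\<^bsub>?G\<^esub> ?c [(v, True)] = ?c [(v, True)] \<otimes>\<^bsub>?G\<^esub> ?c [(u, True)]" if "{u, v} \<in> E" for u v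
  proof -
    have "([(u, True), (v, True)], [(v, True), (u, True)]) \<in> word_equiv V (raag_rels E)"
      using word_equiv.relation[of "[]" V "[]" "[(u, True), (v, True)]" "[(v, True), (u, True)]" "raag_rels E"]
        that EV[OF that] by (auto simp: raag_rels_def)
    then show ?thesis using EV[OF that] by (simp add: mult word_class_eq_iff)
  qed
  show "?co v \<in> group_chars ?G" for v
    by (auto simp: group_chars_def car mult co)
  show "?co v (?c [(u, True)]) = (if u = v then 1 else 0)" if "u \<in> V" "v \<in> V" for u v
    using that by (subst co) auto
  show "a g = (\<Sum>v\<in>V. a (?c [(v, True)]) * ?co v g)" if a: "a \<in> group_chars ?G" and g: "g \<in> carrier ?G" for a g
  proof -
    have hom: "a (?c (u @ w)) = a (?c u) + a (?c w)" if "u \<in> group_words V" "w \<in> group_words V" for u w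
      using a that by (auto simp: group_chars_def car simp flip: mult)
    have a0: "a (?c []) = 0" using group_chars_one[OF group_axioms a] by (simp add: one)
    have inv: "a (?c [(x, False)]) = - a (?c [(x, True)])" if "x \<in> V" for x
    proof -
      have "([] @ [(x, True), (x, \<not> True)] @ [], [] @ []) \<in> word_equiv V (raag_rels E)"
        using that by (intro word_equiv.cancel) auto
      then have "?c ([(x, True)] @ [(x, False)]) = ?c []"
        using that by (subst word_class_eq_iff) auto
      then have "a (?c [(x, True)]) + a (?c [(x, False)]) = a (?c [])"
        using hom[of "[(x, True)]" "[(x, False)]"] that by simp
      then show ?thesis using a0 by simp
    qed
    have key: "a (?c w) = (\<Sum>v\<in>V. a (?c [(v, True)]) * word_exp w v)" if "w \<in> group_words V" for w
      using that
    proof (induction w rule: list.induct)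
      case Nil
      then show ?case by (simp add: a0)
    next
      case (Cons l w)
      obtain x b where l: "l = (x, b)" by (cases l)
      have x: "x \<in> V" using Cons.prems by (simp add: l)
      have "(\<Sum>v\<in>V. a (?c [(v, True)]) * letter_exp l v) = (\<Sum>v\<in>V. if v = x then a (?c [l]) else 0)"
        by (intro sum.cong HOL.refl) (auto simp: l inv x)
      also have "\<dots> = a (?c [l])" using fin x by simp
      finally have "(\<Sum>v\<in>V. a (?c [(v, True)]) * letter_exp l v) = a (?c [l])" .
      then show ?case
        using Cons hom[of "[l]" w] by (simp add: algebra_simps sum.distrib)
    qed
    obtain w where w: "g = ?c w" "w \<in> group_words V" using g unfolding car by (rule imageE)
    show ?thesis unfolding w(1) co[OF w(2)] by (rule key[OF w(2)])
  qed
  show "\<exists>A. \<forall>x\<in>carrier ?G. \<forall>y\<in>carrier ?G.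
      A (x \<otimes>\<^bsub>?G\<^esub> y) = A x + A y - bilin V M (\<lambda>v. ?co v x) (\<lambda>v. ?co v y)"
    if M: "\<And>u v. {u, v} \<in> E \<Longrightarrow> M u v = M v u" for M
  proof (intro exI[of _ "class_lift (heis_word V M)"] ballI)
    fix x y assume "x \<in> carrier ?G" "y \<in> carrier ?G"
    then obtain u w where uw: "u \<in> group_words V" "w \<in> group_words V" "x = ?c u" "y = ?c w"
      by (auto simp: car)
    have lift: "class_lift (heis_word V M) (?c w) = heis_word V M w" if "w \<in> group_words V" for w
      by (rule class_lift[OF _ that]) (rule heis_word_equiv[OF fin M])
    show "class_lift (heis_word V M) (x \<otimes>\<^bsub>?G\<^esub> y) =
      class_lift (heis_word V M) x + class_lift (heis_word V M) y - bilin V M (\<lambda>v. ?co v x) (\<lambda>v. ?co v y)"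
      using uw by (simp add: mult lift co heis_word_append)
  qed
qed

subsection \<open>Trivial actions on homology\<close>

lemma lin_ext_lin_ext: "lin_ext g (lin_ext f c) = lin_ext (\<lambda>x. lin_ext g (f x)) c"
  by (simp add: lin_ext_def[of f] lin_ext_def[of "\<lambda>x. lin_ext g (f x)"] lin_ext_sum lin_ext_fscale)

lemma bar_chains_carrier: "c \<in> carrier (bar_chains G n) \<longleftrightarrow> Poly_Mapping.keys c \<subseteq> bar_tuples G n"
  by (simp add: bar_chains_def free_space_def vspace_def)

text \<open>\<open>homology_conj\<close> is a union of cosets, one of which contains the conjugate
  of \<open>z\<close>. If the union is the class of \<open>z\<close>, the conjugate lies in this
  class.\<close>

lemma trivial_homology_actionD:
  assumes "trivial_homology_action G K n" and g: "g \<in> carrier G"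
    and z: "Poly_Mapping.keys z \<subseteq> bar_tuples (G\<lparr>carrier := K\<rparr>) n" "bar_boundary (G\<lparr>carrier := K\<rparr>) z = 0"
  shows "lin_ext (\<lambda>xs. Poly_Mapping.single (map (\<lambda>x. g \<otimes>\<^bsub>G\<^esub> x \<otimes>\<^bsub>G\<^esub> inv\<^bsub>G\<^esub> g) xs) 1) z - z
    \<in> bar_boundaries (G\<lparr>carrier := K\<rparr>) n"
proof -
  let ?N = "G\<lparr>carrier := K\<rparr>"
  let ?B = "bar_boundaries ?N n" and ?M = "bar_cycles ?N n"
  let ?c = "lin_ext (\<lambda>xs. Poly_Mapping.single (map (\<lambda>x. g \<otimes>\<^bsub>G\<^esub> x \<otimes>\<^bsub>G\<^esub> inv\<^bsub>G\<^esub> g) xs) 1)"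
  have add: "add ?M = (+)" by (simp add: bar_cycles_def bar_chains_def free_space_def vspace_def)
  have coset: "?B +>\<^bsub>?M\<^esub> x = {b + x | b. b \<in> ?B}" for x
    by (auto simp: a_r_coset_def' add)
  have "0 \<in> ?B"
    by (auto simp: bar_boundaries_def bar_boundary_def bar_chains_carrier intro!: image_eqI[of _ _ 0])
  then have self: "x \<in> ?B +>\<^bsub>?M\<^esub> x" for x unfolding coset by force
  have "z \<in> carrier ?M" using z by (simp add: bar_cycles_def bar_chains_carrier)
  then have "?B +>\<^bsub>?M\<^esub> z \<in> carrier (group_homology ?N n)"
    by (auto simp: group_homology_def quot_space_def vspace_def A_RCOSETS_def')
  then have "homology_conj G K n g (?B +>\<^bsub>?M\<^esub> z) = ?B +>\<^bsub>?M\<^esub> z"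
    using assms(1) g unfolding trivial_homology_action_def by blast
  moreover have "?B +>\<^bsub>?M\<^esub> ?c z \<subseteq> homology_conj G K n g (?B +>\<^bsub>?M\<^esub> z)"
    unfolding homology_conj_def induced_map_def using self[of z] by blast
  ultimately have "?c z \<in> ?B +>\<^bsub>?M\<^esub> z" using self[of "?c z"] by blast
  then show ?thesis by (auto simp: coset)
qed

text \<open>The coboundary is the transpose of the boundary under the pairing
  \<open>lin_eval\<close>.\<close>

lemma lin_eval_boundaries:
  assumes "bar_coboundary G n F = 0" "z \<in> bar_boundaries G n"
  shows "lin_eval F z = 0"
proof -
  obtain y where y: "Poly_Mapping.keys y \<subseteq> bar_tuples G (Suc n)" "z = bar_boundary G y"
    using assms(2) by (auto simp: bar_boundaries_def bar_chains_carrier)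
  have "lin_eval F z = lin_eval (\<lambda>xs. lin_eval F (if xs = [] then 0
     else \<Sum>i\<le>length xs. Poly_Mapping.single (bar_face G i xs) ((-1) ^ i))) y"
    by (simp add: y(2) bar_boundary_def lin_eval_lin_ext)
  also have "\<dots> = lin_eval (\<lambda>xs. 0) y"
  proof (rule lin_eval_cong)
    fix xs assume "xs \<in> Poly_Mapping.keys y"
    then have xs: "xs \<in> bar_tuples G (Suc n)" using y(1) by auto
    then have len: "length xs = Suc n" "xs \<noteq> []" by (auto simp: bar_tuples_def)
    have "bar_coboundary G n F xs = 0" using assms(1) by simp
    then show "lin_eval F (if xs = [] then 0
        else \<Sum>i\<le>length xs. Poly_Mapping.single (bar_face G i xs) ((-1) ^ i)) = 0"
      using xs len by (simp add: bar_coboundary_def lin_eval_sum del: sum.atMost_Suc)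
  qed
  also have "\<dots> = 0" by (simp add: lin_eval_def)
  finally show ?thesis .
qed

lemma bar_boundary_single:
  "bar_boundary G (Poly_Mapping.single [x] 1) = 0"
  "bar_boundary G (Poly_Mapping.single [x, y] 1) =
     Poly_Mapping.single [y] 1 - Poly_Mapping.single [x \<otimes>\<^bsub>G\<^esub> y] 1 + Poly_Mapping.single [x] 1"
  by (simp_all add: bar_boundary_def lin_ext_single fscale_one bar_face_def single_uminus)

lemma group_chars_int_pow:
  assumes "group G" "a \<in> group_chars G" "x \<in> carrier G"
  shows "a (x [^]\<^bsub>G\<^esub> (k::int)) = of_int k * a x"
proof -
  interpret group G by fact
  have a: "a (x \<otimes>\<^bsub>G\<^esub> y) = a x + a y" if "x \<in> carrier G" "y \<in> carrier G" for x y
    using assms(2) that by (simp add: group_chars_def)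
  have nat: "a (x [^]\<^bsub>G\<^esub> (n::nat)) = of_nat n * a x" for n
    using assms by (induction n) (auto simp: group_chars_one a algebra_simps)
  have inv: "a (inv\<^bsub>G\<^esub> y) = - a y" if "y \<in> carrier G" for y
    using a[of "inv\<^bsub>G\<^esub> y" y] that assms by (simp add: group_chars_one)
  show ?thesis
    using nat assms(3) by (cases k rule: int_cases2) (simp_all add: int_pow_int int_pow_neg inv)
qed

section \<open>The kernel of a character and conjugation on it\<close>

locale raag_kernel = raag_group G V adj gen co
  for G :: "('g, 'm) monoid_scheme" and V :: "'v set" and adj gen co +
  fixes \<chi> :: "'g \<Rightarrow> int" and K :: "'g set" and t :: 'g
  assumes \<chi>: "\<chi> \<in> hom G integer_group" and K: "K = kernel G integer_group \<chi>"
    and t: "t \<in> carrier G" "\<chi> t = 1"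
    and H1: "trivial_homology_action G K 1" and H2: "trivial_homology_action G K 2"
begin

abbreviation N where "N \<equiv> G\<lparr>carrier := K\<rparr>"

definition \<chi>' :: "'g \<Rightarrow> rat" where "\<chi>' g = of_int (\<chi> g)"

definition m :: "'v \<Rightarrow> rat" where "m v = \<chi>' (gen v)"

interpretation G: group G by (rule G)
interpretation \<chi>: group_hom G integer_group \<chi>
  by (intro group_hom.intro group_hom_axioms.intro G group_integer_group \<chi>)

lemma K_iff: "x \<in> K \<longleftrightarrow> x \<in> carrier G \<and> \<chi> x = 0"
  by (auto simp: K kernel_def)

lemma subgroup_K: "subgroup K G"
  unfolding K by (rule \<chi>.subgroup_kernel)

lemma group_N: "group N"
  using subgroup.subgroup_is_group[OF subgroup_K G] .

lemma \<chi>_mult [simp]: "x \<in> carrier G \<Longrightarrow> y \<in> carrier G \<Longrightarrow> \<chi> (x \<otimes>\<^bsub>G\<^esub> y) = \<chi> x + \<chi> y"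
  using \<chi>.hom_mult by simp

lemma \<chi>_inv [simp]: "x \<in> carrier G \<Longrightarrow> \<chi> (inv\<^bsub>G\<^esub> x) = - \<chi> x"
  using \<chi>.hom_inv by simp

lemma \<chi>'_char: "\<chi>' \<in> group_chars G"
  by (simp add: group_chars_def \<chi>'_def)

definition conj :: "'g \<Rightarrow> 'g \<Rightarrow> 'g" where "conj g x = g \<otimes>\<^bsub>G\<^esub> x \<otimes>\<^bsub>G\<^esub> inv\<^bsub>G\<^esub> g"

lemma conj_carrier [simp]: "g \<in> carrier G \<Longrightarrow> x \<in> carrier G \<Longrightarrow> conj g x \<in> carrier G"
  by (simp add: conj_def)

lemma conj_K: "g \<in> carrier G \<Longrightarrow> x \<in> K \<Longrightarrow> conj g x \<in> K"
  by (simp add: K_iff conj_def)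

lemma conj_mult: "g \<in> carrier G \<Longrightarrow> x \<in> carrier G \<Longrightarrow> y \<in> carrier G \<Longrightarrow> conj g (x \<otimes>\<^bsub>G\<^esub> y) = conj g x \<otimes>\<^bsub>G\<^esub> conj g y"
  by (simp add: conj_def G.m_assoc G.inv_solve_left)

lemma conj_shift: "g \<in> carrier G \<Longrightarrow> x \<in> carrier G \<Longrightarrow> conj g x \<otimes>\<^bsub>G\<^esub> g = g \<otimes>\<^bsub>G\<^esub> x"
  by (simp add: conj_def G.m_assoc)

lemma conj_conj: "g \<in> carrier G \<Longrightarrow> h \<in> carrier G \<Longrightarrow> x \<in> carrier G \<Longrightarrow> conj g (conj h x) = conj (g \<otimes>\<^bsub>G\<^esub> h) x"
  by (simp add: conj_def G.m_assoc G.inv_mult_group)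

lemma conj_one: "x \<in> carrier G \<Longrightarrow> conj \<one>\<^bsub>G\<^esub> x = x"
  by (simp add: conj_def)

lemma K_carrier: "x \<in> K \<Longrightarrow> x \<in> carrier G"
  by (simp add: K_iff)

lemma char_conj: "a \<in> group_chars G \<Longrightarrow> g \<in> carrier G \<Longrightarrow> x \<in> carrier G \<Longrightarrow> a (conj g x) = a x"
proof -
  assume *: "a \<in> group_chars G" "g \<in> carrier G" "x \<in> carrier G"
  have "a (conj g x \<otimes>\<^bsub>G\<^esub> g) = a (g \<otimes>\<^bsub>G\<^esub> x)" using * by (simp add: conj_shift)
  then show ?thesis using * by (simp add: group_chars_def)
qed

lemma group_chars_N: "\<phi> \<in> group_chars N \<longleftrightarrow> (\<forall>x\<in>K. \<forall>y\<in>K. \<phi> (x \<otimes>\<^bsub>G\<^esub> y) = \<phi> x + \<phi> y)"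
  by (simp add: group_chars_def)

lemma restrict_char: "a \<in> group_chars G \<Longrightarrow> a \<in> group_chars N"
  by (simp add: group_chars_def K_carrier)

text \<open>Conjugation changes a cycle by a boundary, on which a cocycle vanishes. This is the only
  form in which triviality of the action on homology is used.\<close>

lemma cycle_eval_invariant:
  assumes n: "trivial_homology_action G K n" and F: "bar_coboundary N n F = 0"
    and g: "g \<in> carrier G" and z: "Poly_Mapping.keys z \<subseteq> bar_tuples N n" "bar_boundary N z = 0"
  shows "lin_eval (\<lambda>xs. F (map (conj g) xs)) z = lin_eval F z"
proof -
  have "lin_eval F (lin_ext (\<lambda>xs. Poly_Mapping.single (map (\<lambda>x. g \<otimes>\<^bsub>G\<^esub> x \<otimes>\<^bsub>G\<^esub> inv\<^bsub>G\<^esub> g) xs) 1) z - z) = 0"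
    by (rule lin_eval_boundaries[OF F trivial_homology_actionD[OF n g z]])
  then show ?thesis by (simp add: lin_eval_diff lin_eval_lin_ext conj_def[abs_def])
qed

text \<open>Every symbol \<open>[x]\<close> is a 1-cycle.\<close>

lemma char_N_invariant:
  assumes "\<phi> \<in> group_chars N" "g \<in> carrier G" "x \<in> K"
  shows "\<phi> (conj g x) = \<phi> x"
proof -
  have 1: "bar_coboundary N 1 (char_cochain N \<phi>) = 0"
    using assms(1) char_cochain_cocycle_iff[OF group_N, of \<phi>] by (simp add: bar_cocycles_sel)
  have "lin_eval (\<lambda>xs. char_cochain N \<phi> (map (conj g) xs)) (Poly_Mapping.single [x] 1) =
      lin_eval (char_cochain N \<phi>) (Poly_Mapping.single [x] 1)"
    using assms by (intro cycle_eval_invariant[OF H1 1]) (auto simp: bar_tuples_def bar_boundary_single)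
  then show ?thesis using assms(3) conj_K[OF assms(2,3)] by (simp add: char_cochain_def bar_tuples_def)
qed

lemma bilin_co_split:
  "bilin V (\<lambda>u v. a u * b v) (\<lambda>v. co v x) (\<lambda>v. co v y) = (\<Sum>v\<in>V. a v * co v x) * (\<Sum>v\<in>V. b v * co v y)"
  by (simp add: bilin_def sum_product mult_ac)

lemma \<chi>'_sum: "x \<in> carrier G \<Longrightarrow> (\<Sum>v\<in>V. m v * co v x) = \<chi>' x"
  using chars[OF \<chi>'_char] by (simp add: m_def)

lemma lin_char: "(\<lambda>x. \<Sum>v\<in>V. a v * co v x) \<in> group_chars G"
  using co by (simp add: group_chars_def algebra_simps sum.distrib)

lemma lin_char_gen: "u \<in> V \<Longrightarrow> (\<Sum>v\<in>V. a v * co v (gen u)) = a u"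
proof -
  assume u: "u \<in> V"
  have "(\<Sum>v\<in>V. a v * co v (gen u)) = (\<Sum>v\<in>V. if v = u then a u else 0)"
    using u by (intro sum.cong) (auto simp: co_gen)
  then show ?thesis using V u by simp
qed

text \<open>The factor in \<open>N\<close> when \<open>g\<close> is written as an element of
  \<open>N\<close> times a power of \<open>t\<close>.\<close>

definition npart :: "'g \<Rightarrow> 'g" where "npart g = g \<otimes>\<^bsub>G\<^esub> t [^]\<^bsub>G\<^esub> (- \<chi> g)"

lemma \<chi>_pow: "\<chi> (t [^]\<^bsub>G\<^esub> (k::int)) = k"
  using \<chi>.hom_int_pow[OF t(1), of k] t(2) by simp

lemma pow_carrier [simp]: "t [^]\<^bsub>G\<^esub> (k::int) \<in> carrier G"
  using t by simp

lemma npart_K: "g \<in> carrier G \<Longrightarrow> npart g \<in> K"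
  by (simp add: K_iff npart_def \<chi>_pow)

lemma npart_mult:
  assumes "g \<in> carrier G" "h \<in> carrier G"
  shows "npart (g \<otimes>\<^bsub>G\<^esub> h) = npart g \<otimes>\<^bsub>G\<^esub> conj (t [^]\<^bsub>G\<^esub> \<chi> g) (npart h)"
proof -
  have 1: "t [^]\<^bsub>G\<^esub> (- \<chi> g) \<otimes>\<^bsub>G\<^esub> (t [^]\<^bsub>G\<^esub> \<chi> g \<otimes>\<^bsub>G\<^esub> y) = y" if "y \<in> carrier G" for y
    using that t by (simp add: G.m_assoc[symmetric] G.int_pow_mult[symmetric])
  have 2: "inv\<^bsub>G\<^esub> (t [^]\<^bsub>G\<^esub> \<chi> g) = t [^]\<^bsub>G\<^esub> (- \<chi> g)" using t by (simp add: G.int_pow_neg)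
  have 3: "t [^]\<^bsub>G\<^esub> (- \<chi> h) \<otimes>\<^bsub>G\<^esub> t [^]\<^bsub>G\<^esub> (- \<chi> g) = t [^]\<^bsub>G\<^esub> (- \<chi> g - \<chi> h)"
  proof -
    have e: "- \<chi> h + - \<chi> g = - \<chi> g - \<chi> h" by simp
    show ?thesis unfolding G.int_pow_mult[OF t(1), symmetric] e ..
  qed
  show ?thesis
    using assms t by (simp add: npart_def conj_def 2 G.m_assoc 1 3)
qed

lemma npart_N: "x \<in> K \<Longrightarrow> npart x = x"
  by (simp add: npart_def K_iff)

lemma char_npart: "a \<in> group_chars G \<Longrightarrow> g \<in> carrier G \<Longrightarrow> a g = a (npart g) + \<chi>' g * a t"
proof -
  assume a: "a \<in> group_chars G" and g: "g \<in> carrier G"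
  have "a (npart g) = a g + a (t [^]\<^bsub>G\<^esub> (- \<chi> g))" using a g by (simp add: npart_def group_chars_def)
  then show ?thesis by (simp add: group_chars_int_pow[OF G a t(1)] \<chi>'_def)
qed

text \<open>\<open>npart\<close> is multiplicative up to conjugation by a power of \<open>t\<close>,
  which characters of \<open>N\<close> do not notice. Hence every character of \<open>N\<close> is
  the restriction of one of \<open>G\<close>.\<close>

lemma extend_char:
  assumes "\<phi> \<in> group_chars N" shows "(\<lambda>g. \<phi> (npart g)) \<in> group_chars G"
  unfolding group_chars_def
proof (intro CollectI ballI)
  fix g h assume gh: "g \<in> carrier G" "h \<in> carrier G"
  have "\<phi> (npart (g \<otimes>\<^bsub>G\<^esub> h)) = \<phi> (npart g) + \<phi> (conj (t [^]\<^bsub>G\<^esub> \<chi> g) (npart h))"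
    using assms gh unfolding npart_mult[OF gh] group_chars_N by (auto simp: npart_K conj_K)
  then show "\<phi> (npart (g \<otimes>\<^bsub>G\<^esub> h)) = \<phi> (npart g) + \<phi> (npart h)"
    using assms gh by (simp add: char_N_invariant npart_K)
qed

subsection \<open>Exactness of multiplication by the character\<close>

lemma exact_1:
  assumes a: "\<And>u v. adj u v \<Longrightarrow> m u * a v = m v * a u"
  shows "\<exists>c. \<forall>v\<in>V. a v = c * m v"
proof -
  define a' where "a' x = (\<Sum>v\<in>V. a v * co v x)" for x
  have a': "a' \<in> group_chars G" unfolding a'_def[abs_def] by (rule lin_char)
  obtain A where "\<And>x y. x \<in> carrier G \<Longrightarrow> y \<in> carrier G \<Longrightarrow>
      A (x \<otimes>\<^bsub>G\<^esub> y) = A x + A y - bilin V (\<lambda>u v. m u * a v) (\<lambda>v. co v x) (\<lambda>v. co v y)"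
    using heis[of "\<lambda>u v. m u * a v"] a by blast
  then have A: "A (x \<otimes>\<^bsub>G\<^esub> y) = A x + A y - \<chi>' x * a' y" if "x \<in> carrier G" "y \<in> carrier G" for x y
    using that unfolding bilin_co_split by (simp add: \<chi>'_sum a'_def)
  have AN: "A \<in> group_chars N"
    by (simp add: group_chars_N A K_carrier) (simp add: K_iff \<chi>'_def)
  have a'K: "a' x = 0" if x: "x \<in> K" for x
  proof -
    \<comment> \<open>Both sides are expanded with \<open>A\<close>. The cup term is
      \<open>a' x\<close> on the left, since \<chi> is 1 at \<open>t\<close>, and 0 on the right,
      since \<chi> vanishes on \<open>N\<close>; the values of \<open>A\<close> cancel by
      invariance.\<close>
    have "A (t \<otimes>\<^bsub>G\<^esub> x) = A (conj t x \<otimes>\<^bsub>G\<^esub> t)" using x t by (simp add: conj_shift K_carrier)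
    moreover have "\<chi>' (conj t x) = 0" using conj_K[OF t(1) x] by (simp add: K_iff \<chi>'_def)
    ultimately show ?thesis
      using x t char_N_invariant[OF AN t(1) x] by (simp add: A K_carrier) (simp add: \<chi>'_def)
  qed
  \<comment> \<open>A character that vanishes on \<open>N\<close> is determined by its value at
    \<open>t\<close>, which is the constant sought.\<close>
  have "a v = a' t * m v" if "v \<in> V" for v
    using char_npart[OF a' gen[OF that]] a'K[OF npart_K[OF gen[OF that]]] lin_char_gen[OF that, of a]
    by (simp add: a'_def m_def)
  then show ?thesis by blast
qed

text \<open>A functional on 2-chains that vanishes on cycles factors through the boundary map. The
  factor, evaluated on the symbols \<open>[x]\<close>, is the primitive \<open>h\<close>.\<close>

lemma universal_coefficients:
  assumes "\<And>z. Poly_Mapping.keys z \<subseteq> bar_tuples N 2 \<Longrightarrow> bar_boundary N z = 0 \<Longrightarrow>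
    lin_eval (\<lambda>xs. \<beta> (xs ! 0) (xs ! 1)) z = 0"
  shows "\<exists>h. \<forall>x\<in>K. \<forall>y\<in>K. h (x \<otimes>\<^bsub>G\<^esub> y) = h x + h y - \<beta> x y"
proof -
  \<comment> \<open>\<open>r\<close> discards all symbols other than pairs in \<open>N\<close>, so
    that the factorisation can take place on a full free vector space.\<close>
  define r where "r xs = (if xs \<in> bar_tuples N 2 then Poly_Mapping.single xs 1 else (0 :: 'g list \<Rightarrow>\<^sub>0 rat))" for xs
  define D where "D = lin_ext (\<lambda>xs. bar_boundary N (r xs))"
  define f where "f = lin_eval (\<lambda>xs. lin_eval (\<lambda>xs. \<beta> (xs ! 0) (xs ! 1)) (r xs))"
  have "f c = 0" if "D c = 0" for c
  proof -
    have "Poly_Mapping.keys (lin_ext r c) \<subseteq> bar_tuples N 2"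
      unfolding lin_ext_def
      by (rule order_trans[OF keys_sum]) (auto simp: r_def fscale_single fscale_zero_right split: if_splits)
    moreover have "bar_boundary N (lin_ext r c) = 0"
      using that by (simp add: D_def bar_boundary_def lin_ext_lin_ext)
    ultimately have "lin_eval (\<lambda>xs. \<beta> (xs ! 0) (xs ! 1)) (lin_ext r c) = 0" by (rule assms)
    then show ?thesis by (simp add: f_def lin_eval_lin_ext)
  qed
  then obtain h0 where h0: "Vector_Spaces.linear fscale (*) h0" "\<And>c. f c = h0 (D c)"
    using functional_factors[of D f] linear_lin_ext linear_lin_eval unfolding D_def f_def by blast
  interpret h0: Vector_Spaces.linear fscale "(*)" h0 by (rule h0)
  have "\<beta> x y = h0 (Poly_Mapping.single [y] 1) - h0 (Poly_Mapping.single [x \<otimes>\<^bsub>G\<^esub> y] 1) + h0 (Poly_Mapping.single [x] 1)"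
    if "x \<in> K" "y \<in> K" for x y
  proof -
    have "[x, y] \<in> bar_tuples N 2" using that by (simp add: bar_tuples_def)
    then have "\<beta> x y = f (Poly_Mapping.single [x, y] 1)" by (simp add: f_def r_def)
    also have "\<dots> = h0 (bar_boundary N (Poly_Mapping.single [x, y] 1))"
      using \<open>[x, y] \<in> bar_tuples N 2\<close> by (simp add: h0(2) D_def lin_ext_single fscale_one r_def)
    finally show ?thesis by (simp add: bar_boundary_single h0.add h0.diff)
  qed
  then show ?thesis by (intro exI[of _ "\<lambda>x. h0 (Poly_Mapping.single [x] 1)"]) simp
qed

lemma bilin_char_right:
  "x \<in> carrier G \<Longrightarrow> y \<in> carrier G \<Longrightarrow>
    bilin V M w (\<lambda>v. co v (x \<otimes>\<^bsub>G\<^esub> y)) = bilin V M w (\<lambda>v. co v x) + bilin V M w (\<lambda>v. co v y)"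
  using co by (simp add: group_chars_def bilin_add)

lemma bilin_gen:
  assumes "u \<in> V" "v \<in> V"
  shows "bilin V M (\<lambda>x. co x (gen u)) (\<lambda>x. co x (gen v)) = M u v"
proof -
  have "bilin V M (\<lambda>x. co x (gen u)) (\<lambda>x. co x (gen v)) =
    (\<Sum>x\<in>V. if x = u then (\<Sum>y\<in>V. if y = v then M u v else 0) else 0)"
    unfolding bilin_def using assms by (intro sum.cong HOL.refl) (auto simp: co_gen intro!: sum.cong sum.neutral)
  then show ?thesis using assms V by simp
qed

text \<open>If \<open>\<eta>\<close> is a 2-cochain on the flag complex with \<open>m \<and> \<eta> = 0\<close>, then \<open>\<chi> \<union> \<eta>\<close> is the
  coboundary of an explicit \<open>F\<close>, since the trilinear form \<open>m \<otimes> \<eta>\<close> is a sum of forms that are symmetric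
  on edges in the first two or in the last two arguments.\<close>

lemma cup_primitive:
  assumes anti: "\<And>u v. \<eta> u v = - \<eta> v u" and supp: "\<And>u v. \<not> adj u v \<Longrightarrow> \<eta> u v = 0"
    and tri: "\<And>u v w. adj u v \<Longrightarrow> adj v w \<Longrightarrow> adj u w \<Longrightarrow> m w * \<eta> u v + m u * \<eta> v w + m v * \<eta> w u = 0"
  shows "\<exists>F. \<forall>x\<in>carrier G. \<forall>y\<in>carrier G. \<forall>z\<in>carrier G.
    F y z - F (x \<otimes>\<^bsub>G\<^esub> y) z + F x (y \<otimes>\<^bsub>G\<^esub> z) - F x y = \<chi>' x * bilin V \<eta> (\<lambda>v. co v y) (\<lambda>v. co v z)"
proof -
  \<comment> \<open>The factor 1/3 is the one for which the triangle relation makes \<open>a\<close>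
    symmetric in its first two arguments. Off triangles, the vanishing of \<eta> on non-edges does
    this.\<close>
  define b where "b w u v = (if adj w u \<and> adj u v \<and> adj w v then (m u * \<eta> w v + m v * \<eta> w u) / 3
      else if adj u v then 0 else m u * \<eta> w v)" for w u v
  define a where "a w u v = m w * \<eta> u v + b w u v" for w u v
  have b_sym: "b w u v = b w v u" if "adj u v" for w u v
    using that adj_sym[OF that] by (auto simp: b_def)
  have a_sym: "a w u v = a u w v" if wu: "adj w u" for w u v
  proof -
    have uw: "adj u w" by (rule adj_sym[OF wu])
    show ?thesis
    proof (cases "adj u v \<and> adj w v")
      case True
      then have "m v * \<eta> w u + m w * \<eta> u v + m u * \<eta> v w = 0" using wu by (intro tri) auto
      moreover have "\<eta> v w = - \<eta> w v" "\<eta> w u = - \<eta> u w" by (rule anti)+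
      ultimately show ?thesis using True wu uw by (simp add: a_def b_def field_simps)
    next
      case False
      then show ?thesis using wu uw supp[of u v] supp[of w v] by (auto simp: a_def b_def)
    qed
  qed
  have "\<exists>A. \<forall>x\<in>carrier G. \<forall>y\<in>carrier G.
      A (x \<otimes>\<^bsub>G\<^esub> y) = A x + A y - bilin V (\<lambda>w u. a w u v) (\<lambda>v. co v x) (\<lambda>v. co v y)" for v
    by (rule heis) (rule a_sym)
  then obtain A where A: "\<And>v x y. x \<in> carrier G \<Longrightarrow> y \<in> carrier G \<Longrightarrow>
      A v (x \<otimes>\<^bsub>G\<^esub> y) = A v x + A v y - bilin V (\<lambda>w u. a w u v) (\<lambda>v. co v x) (\<lambda>v. co v y)" by metis
  have "\<exists>B. \<forall>x\<in>carrier G. \<forall>y\<in>carrier G.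
      B (x \<otimes>\<^bsub>G\<^esub> y) = B x + B y - bilin V (\<lambda>u v. b w u v) (\<lambda>v. co v x) (\<lambda>v. co v y)" for w
    by (rule heis) (rule b_sym)
  then obtain B where B: "\<And>w x y. x \<in> carrier G \<Longrightarrow> y \<in> carrier G \<Longrightarrow>
      B w (x \<otimes>\<^bsub>G\<^esub> y) = B w x + B w y - bilin V (\<lambda>u v. b w u v) (\<lambda>v. co v x) (\<lambda>v. co v y)" by metis
  \<comment> \<open>Primitives in one variable are paired with exponent sums in the other. The
    coboundary of the first sum is the trilinear form \<open>a\<close>, that of the second is minus
    \<open>b\<close>.\<close>
  define F where "F x y = (\<Sum>v\<in>V. A v x * co v y) + (\<Sum>w\<in>V. co w x * B w y)" for x y
  have coh: "co v (x \<otimes>\<^bsub>G\<^esub> y) = co v x + co v y" if "x \<in> carrier G" "y \<in> carrier G" for v x y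
    using co[of v] that by (simp add: group_chars_def)
  show ?thesis
  proof (intro exI[of _ F] ballI)
    fix x y z assume xyz: "x \<in> carrier G" "y \<in> carrier G" "z \<in> carrier G"
    have "F y z - F (x \<otimes>\<^bsub>G\<^esub> y) z + F x (y \<otimes>\<^bsub>G\<^esub> z) - F x y =
       (\<Sum>v\<in>V. bilin V (\<lambda>w u. a w u v) (\<lambda>v. co v x) (\<lambda>v. co v y) * co v z)
       - (\<Sum>w\<in>V. co w x * bilin V (\<lambda>u v. b w u v) (\<lambda>v. co v y) (\<lambda>v. co v z))"
      using xyz by (simp add: F_def A B coh algebra_simps sum.distrib sum_subtractf)
    also have "(\<Sum>v\<in>V. bilin V (\<lambda>w u. a w u v) (\<lambda>v. co v x) (\<lambda>v. co v y) * co v z) =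
        (\<Sum>w\<in>V. \<Sum>u\<in>V. \<Sum>v\<in>V. a w u v * co w x * co u y * co v z)"
    proof -
      have "(\<Sum>v\<in>V. bilin V (\<lambda>w u. a w u v) (\<lambda>v. co v x) (\<lambda>v. co v y) * co v z) =
          (\<Sum>v\<in>V. \<Sum>w\<in>V. \<Sum>u\<in>V. a w u v * co w x * co u y * co v z)"
        unfolding bilin_def sum_distrib_right ..
      also have "\<dots> = (\<Sum>w\<in>V. \<Sum>v\<in>V. \<Sum>u\<in>V. a w u v * co w x * co u y * co v z)"
        by (rule sum.swap)
      also have "\<dots> = (\<Sum>w\<in>V. \<Sum>u\<in>V. \<Sum>v\<in>V. a w u v * co w x * co u y * co v z)"
        by (intro sum.cong HOL.refl sum.swap)
      finally show ?thesis .
    qed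
    also have "(\<Sum>w\<in>V. co w x * bilin V (\<lambda>u v. b w u v) (\<lambda>v. co v y) (\<lambda>v. co v z)) =
        (\<Sum>w\<in>V. \<Sum>u\<in>V. \<Sum>v\<in>V. b w u v * co w x * co u y * co v z)"
      unfolding bilin_def sum_distrib_left by (simp add: mult_ac)
    also have "(\<Sum>w\<in>V. \<Sum>u\<in>V. \<Sum>v\<in>V. a w u v * co w x * co u y * co v z)
        - (\<Sum>w\<in>V. \<Sum>u\<in>V. \<Sum>v\<in>V. b w u v * co w x * co u y * co v z) =
        (\<Sum>w\<in>V. \<Sum>u\<in>V. \<Sum>v\<in>V. (m w * co w x) * (\<eta> u v * co u y * co v z))"
      by (simp add: a_def sum_subtractf[symmetric] algebra_simps)
    also have "\<dots> = \<chi>' x * bilin V \<eta> (\<lambda>v. co v y) (\<lambda>v. co v z)"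
      unfolding \<chi>'_sum[OF xyz(1), symmetric] bilin_def
      by (simp only: sum_distrib_right) (simp only: sum_distrib_left)
    finally show "F y z - F (x \<otimes>\<^bsub>G\<^esub> y) z + F x (y \<otimes>\<^bsub>G\<^esub> z) - F x y = \<chi>' x * bilin V \<eta> (\<lambda>v. co v y) (\<lambda>v. co v z)" .
  qed
qed

text \<open>On \<open>N\<close> the form \<beta> of \<eta> is a coboundary. The effect on its
  primitive \<open>h\<close> of conjugation by \<open>t\<close> is \<open>2 * \<beta> t x\<close>
  plus a character \<open>c\<close>. Comparing \<open>h\<close> of the \<open>N\<close>-parts of the
  two products of adjacent generators expresses \<eta> through \<open>c\<close>.\<close>

lemma exact_2:
  assumes anti: "\<And>u v. \<eta> u v = - \<eta> v u" and supp: "\<And>u v. \<not> adj u v \<Longrightarrow> \<eta> u v = 0"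
    and tri: "\<And>u v w. adj u v \<Longrightarrow> adj v w \<Longrightarrow> adj u w \<Longrightarrow> m w * \<eta> u v + m u * \<eta> v w + m v * \<eta> w u = 0"
  shows "\<exists>b. \<forall>u v. adj u v \<longrightarrow> \<eta> u v = m v * b u - m u * b v"
proof -
  define \<beta> where "\<beta> x y = bilin V \<eta> (\<lambda>v. co v x) (\<lambda>v. co v y)" for x y
  obtain F where F: "\<And>x y z. x \<in> carrier G \<Longrightarrow> y \<in> carrier G \<Longrightarrow> z \<in> carrier G \<Longrightarrow>
      F y z - F (x \<otimes>\<^bsub>G\<^esub> y) z + F x (y \<otimes>\<^bsub>G\<^esub> z) - F x y = \<chi>' x * \<beta> y z"
    using cup_primitive[OF anti supp tri] unfolding \<beta>_def by blast
  \<comment> \<open>The prism operator of conjugation by \<open>t\<close>: it accounts for the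
    discrepancy between \<beta> and the difference of \<open>F\<close> and its conjugate.\<close>
  define \<kappa> where "\<kappa> x = F t x - F (conj t x) t" for x
  have prism: "\<beta> x y = F x y - F (conj t x) (conj t y) + (\<kappa> (x \<otimes>\<^bsub>G\<^esub> y) - \<kappa> x - \<kappa> y)"
    if xy: "x \<in> K" "y \<in> K" for x y
  proof -
    have c: "x \<in> carrier G" "y \<in> carrier G" "conj t x \<in> carrier G" "conj t y \<in> carrier G"
      using xy t by (auto simp: K_carrier)
    have z: "\<chi>' (conj t x) = 0" "\<chi>' t = 1"
      using conj_K[OF t(1) xy(1)] t by (auto simp: K_iff \<chi>'_def)
    show ?thesis
      using F[OF t(1) c(1,2)] F[OF c(3) t(1) c(2)] F[OF c(3,4) t(1)] c t
      by (simp add: z conj_mult[symmetric] conj_shift \<kappa>_def)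
  qed
  define F' where "F' xs = F (xs ! 0) (xs ! 1)" for xs
  have dF: "bar_coboundary N 2 F' = 0"
    unfolding bar_coboundary_2_eq_0_iff using F by (auto simp: F'_def K_carrier) (auto simp: K_iff \<chi>'_def)
  \<comment> \<open>Both parts of \<open>prism\<close> pair to zero with a cycle \<open>z\<close>:
    the difference of \<open>F\<close> and its conjugate by triviality of the action on
    \<open>H_2\<close>, the terms in \<kappa> because \<open>z\<close> is closed.\<close>
  have "lin_eval (\<lambda>xs. \<beta> (xs ! 0) (xs ! 1)) z = 0"
    if z: "Poly_Mapping.keys z \<subseteq> bar_tuples N 2" "bar_boundary N z = 0" for z
  proof -
    let ?k = "\<lambda>xs. \<kappa> (xs ! 0)"
    have "lin_eval (\<lambda>xs. \<beta> (xs ! 0) (xs ! 1)) z =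
        lin_eval (\<lambda>xs. (F' xs - F' (map (conj t) xs)) + (- 1) * lin_eval ?k (bar_boundary N (Poly_Mapping.single xs 1))) z"
    proof (rule lin_eval_cong)
      fix xs assume "xs \<in> Poly_Mapping.keys z"
      then have "xs \<in> bar_tuples N 2" using z(1) by auto
      then obtain x y where "x \<in> K" "y \<in> K" "xs = [x, y]" unfolding bar_tuples_iff by auto
      then show "\<beta> (xs ! 0) (xs ! 1) =
          (F' xs - F' (map (conj t) xs)) + (- 1) * lin_eval ?k (bar_boundary N (Poly_Mapping.single xs 1))"
        by (simp add: prism F'_def bar_boundary_single lin_eval_add lin_eval_diff)
    qed
    also have "\<dots> = lin_eval F' z - lin_eval (\<lambda>xs. F' (map (conj t) xs)) z
        + (- 1) * lin_eval (\<lambda>xs. lin_eval ?k (bar_boundary N (Poly_Mapping.single xs 1))) z"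
      by (simp only: lin_eval_fun_add lin_eval_fun_diff lin_eval_fun_mult)
    also have "lin_eval (\<lambda>xs. F' (map (conj t) xs)) z = lin_eval F' z"
      by (rule cycle_eval_invariant[OF H2 dF t(1) z])
    also have "lin_eval (\<lambda>xs. lin_eval ?k (bar_boundary N (Poly_Mapping.single xs 1))) z = lin_eval ?k (bar_boundary N z)"
      by (simp add: bar_boundary_def lin_eval_lin_ext lin_ext_single fscale_one)
    finally show ?thesis using z by simp
  qed
  from universal_coefficients[OF this] obtain h0 where
    h0: "\<And>x y. x \<in> K \<Longrightarrow> y \<in> K \<Longrightarrow> h0 (x \<otimes>\<^bsub>G\<^esub> y) = h0 x + h0 y - \<beta> x y" by blast
  define h where "h x = - h0 x" for x
  have h: "h (x \<otimes>\<^bsub>G\<^esub> y) = h x + h y + \<beta> x y" if "x \<in> K" "y \<in> K" for x y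
    using h0[OF that] by (simp add: h_def)
  have \<beta>_anti: "\<beta> x y = - \<beta> y x" for x y
  proof -
    have "\<beta> x y = (\<Sum>u\<in>V. \<Sum>v\<in>V. - (\<eta> v u * co v y * co u x))"
      unfolding \<beta>_def bilin_def using anti by (intro sum.cong HOL.refl) (metis mult.assoc mult.commute mult_minus_left)
    also have "\<dots> = (\<Sum>v\<in>V. \<Sum>u\<in>V. - (\<eta> v u * co v y * co u x))" by (rule sum.swap)
    also have "\<dots> = - \<beta> y x" unfolding \<beta>_def bilin_def by (simp add: sum_negf)
    finally show ?thesis .
  qed
  have \<beta>_conj: "\<beta> g (conj k x) = \<beta> g x" "\<beta> (conj k x) g = \<beta> x g" if "k \<in> carrier G" "x \<in> carrier G" for g k x
    using that char_conj[OF co] by (simp_all add: \<beta>_def)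
  \<comment> \<open>In a Heisenberg-type extension, conjugation by a lift of \<open>t\<close> shifts
    the central coordinate of \<open>x\<close> by \<open>\<beta> t x - \<beta> x t\<close>, which is
    \<open>2 * \<beta> t x\<close>; \<open>c\<close> is what remains.\<close>
  define c where "c x = h (conj t x) - h x - 2 * \<beta> t x" for x
  have c_char: "c \<in> group_chars N"
    unfolding group_chars_N
  proof (intro ballI)
    fix x y assume xy: "x \<in> K" "y \<in> K"
    then show "c (x \<otimes>\<^bsub>G\<^esub> y) = c x + c y"
      using t by (simp add: c_def conj_mult K_carrier h conj_K \<beta>_conj)
        (simp add: \<beta>_def bilin_char_right K_carrier)
  qed
  \<comment> \<open>Conjugation changes neither \<open>\<beta> t x\<close> nor \<open>c x\<close>,
    so the increments simply add up.\<close>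
  have pow_nat: "h (conj (t [^]\<^bsub>G\<^esub> int k) x) = h x + 2 * of_nat k * \<beta> t x + of_nat k * c x" if x: "x \<in> K" for k x
  proof (induction k)
    case 0
    then show ?case using x by (simp add: conj_one K_carrier)
  next
    case (Suc k)
    have e: "t [^]\<^bsub>G\<^esub> int (Suc k) = t \<otimes>\<^bsub>G\<^esub> t [^]\<^bsub>G\<^esub> int k"
      using t G.int_pow_mult[of t 1 "int k"] by (simp add: G.int_pow_1)
    have kx: "conj (t [^]\<^bsub>G\<^esub> int k) x \<in> K" using x by (simp add: conj_K)
    have "h (conj (t [^]\<^bsub>G\<^esub> int (Suc k)) x) = h (conj t (conj (t [^]\<^bsub>G\<^esub> int k) x))"
      unfolding e using t x by (simp add: conj_conj K_carrier)
    also have "\<dots> = h (conj (t [^]\<^bsub>G\<^esub> int k) x) + 2 * \<beta> t (conj (t [^]\<^bsub>G\<^esub> int k) x) + c (conj (t [^]\<^bsub>G\<^esub> int k) x)"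
      by (simp add: c_def)
    also have "\<dots> = h x + 2 * of_nat (Suc k) * \<beta> t x + of_nat (Suc k) * c x"
      using x by (simp add: Suc \<beta>_conj K_carrier char_N_invariant[OF c_char] algebra_simps)
    finally show ?case .
  qed
  have pow: "h (conj (t [^]\<^bsub>G\<^esub> k) x) = h x + 2 * of_int k * \<beta> t x + of_int k * c x" if x: "x \<in> K" for k x
  proof (cases k rule: int_cases2)
    case (nonneg n)
    then show ?thesis using pow_nat[OF x, of n] by simp
  next
    case (nonpos n)
    let ?y = "conj (t [^]\<^bsub>G\<^esub> k) x"
    have y: "?y \<in> K" using x by (simp add: conj_K)
    have "conj (t [^]\<^bsub>G\<^esub> int n) ?y = x"
      using x t by (simp add: conj_conj K_carrier nonpos G.int_pow_mult[symmetric] conj_one)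
    then show ?thesis
      using pow_nat[OF y, of n] x by (simp add: \<beta>_conj K_carrier char_N_invariant[OF c_char] nonpos)
  qed
  have hn: "h (npart (x \<otimes>\<^bsub>G\<^esub> y)) = h (npart x) + h (npart y) + 2 * \<chi>' x * \<beta> t (npart y)
      + \<chi>' x * c (npart y) + \<beta> (npart x) (npart y)" if "x \<in> carrier G" "y \<in> carrier G" for x y
    using that by (simp add: npart_mult h npart_K conj_K \<beta>_conj K_carrier[OF npart_K] pow) (simp add: \<chi>'_def)
  have \<beta>n: "\<beta> x y = \<beta> (npart x) (npart y) + \<chi>' x * \<beta> t (npart y) - \<chi>' y * \<beta> t (npart x)"
    if "x \<in> carrier G" "y \<in> carrier G" for x y
  proof -
    have e: "co v g = co v (npart g) + \<chi>' g * co v t" if "g \<in> carrier G" for v g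
      by (rule char_npart[OF co that])
    have s: "bilin V M (\<lambda>v. r * p v) q = r * bilin V M p q" "bilin V M q (\<lambda>v. r * p v) = r * bilin V M q p" for M r p q
      by (simp_all add: bilin_def sum_distrib_left mult_ac)
    have "\<beta> x y = \<beta> (npart x) (npart y) + \<chi>' y * \<beta> (npart x) t + \<chi>' x * \<beta> t (npart y) + \<chi>' x * \<chi>' y * \<beta> t t"
      unfolding \<beta>_def e[OF that(1)] e[OF that(2)] bilin_add s by (simp add: algebra_simps)
    moreover have "\<beta> t t = 0" using \<beta>_anti[of t t] by simp
    ultimately show ?thesis using \<beta>_anti[of "npart x" t] by simp
  qed
  \<comment> \<open>In the comparison of the two products, the terms that come from \<beta> combine
    to twice \<open>\<beta> (gen u) (gen v)\<close>; this is why \<open>c\<close> is halved.\<close>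
  have "\<eta> u v = m v * (c (npart (gen u)) / 2) - m u * (c (npart (gen v)) / 2)" if uv: "adj u v" for u v
  proof -
    have V: "u \<in> V" "v \<in> V" using adj_V[OF uv] by auto
    note g = gen[OF V(1)] gen[OF V(2)]
    have "h (npart (gen u \<otimes>\<^bsub>G\<^esub> gen v)) = h (npart (gen v \<otimes>\<^bsub>G\<^esub> gen u))"
      by (simp only: gen_commute[OF uv])
    then have "2 * \<beta> (gen u) (gen v) = m v * c (npart (gen u)) - m u * c (npart (gen v))"
      unfolding hn[OF g] hn[OF g(2,1)] \<beta>n[OF g] m_def using \<beta>_anti[of "npart (gen v)" "npart (gen u)"]
      by (simp add: algebra_simps)
    moreover have "\<beta> (gen u) (gen v) = \<eta> u v" unfolding \<beta>_def by (rule bilin_gen[OF V])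
    ultimately show ?thesis by simp
  qed
  then show ?thesis by (intro exI[of _ "\<lambda>u. c (npart (gen u)) / 2"]) blast
qed

end

subsection \<open>Quadratic elements of a Lie ideal quotient\<close>

text \<open>The spaces used below are dual spaces with pointwise operations, so a linear combination
  of generators is written directly as a function.\<close>

locale fun_lie_kernel = lie_kernel V J
  for V :: "(rat, 'x \<Rightarrow> rat, 'm) module_scheme" and J +
  assumes ops: "add V = (+)" "zero V = 0" "smult V = (\<lambda>r \<phi> x. r * \<phi> x)"
begin

lemma V_closed:
  "v \<in> carrier V \<Longrightarrow> w \<in> carrier V \<Longrightarrow> (\<lambda>X. v X + w X) \<in> carrier V"
  "v \<in> carrier V \<Longrightarrow> (\<lambda>X. r * v X) \<in> carrier V" "(\<lambda>X. 0) \<in> carrier V"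
proof -
  interpret module Rat V by (rule module_V)
  show "v \<in> carrier V \<Longrightarrow> w \<in> carrier V \<Longrightarrow> (\<lambda>X. v X + w X) \<in> carrier V"
    using M.a_closed[of v w] by (simp add: ops plus_fun_def)
  show "v \<in> carrier V \<Longrightarrow> (\<lambda>X. r * v X) \<in> carrier V"
    using smult_closed[of r v] by (simp add: ops)
  show "(\<lambda>X. 0) \<in> carrier V" using M.zero_closed by (simp add: ops zero_fun_def)
qed

lemma V_sum_closed: "(\<And>i. i \<in> I \<Longrightarrow> w i \<in> carrier V) \<Longrightarrow> (\<lambda>X. \<Sum>i\<in>I. c i * w i X) \<in> carrier V"
proof (induction I rule: infinite_finite_induct)
  case (insert i I)
  have "(\<lambda>X. c i * w i X + (\<Sum>i\<in>I. c i * w i X)) \<in> carrier V"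
    using insert by (intro V_closed) auto
  then show ?case using insert.hyps by simp
qed (simp_all add: V_closed)

lemma J_gen_plus: "v \<in> carrier V \<Longrightarrow> w \<in> carrier V \<Longrightarrow> mag_gen (\<lambda>X. v X + w X) - (mag_gen v + mag_gen w) \<in> J"
  using J_gen_add[of v w] by (simp add: ops plus_fun_def)

lemma J_gen_scale: "v \<in> carrier V \<Longrightarrow> mag_gen (\<lambda>X. r * v X) - fscale r (mag_gen v) \<in> J"
  using J_gen_smult[of v r] by (simp add: ops)

lemma J_gen_zero: "mag_gen (\<lambda>X. 0) \<in> J"
  using J_gen_scale[of "\<lambda>X. 0" 0] V_closed(3) by (simp add: fscale_zero_left)

lemma J_gen_lincomb:
  "finite I \<Longrightarrow> (\<And>i. i \<in> I \<Longrightarrow> w i \<in> carrier V) \<Longrightarrow>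
    mag_gen (\<lambda>X. \<Sum>i\<in>I. c i * w i X) - (\<Sum>i\<in>I. fscale (c i) (mag_gen (w i))) \<in> J"
proof (induction I rule: finite_induct)
  case empty
  then show ?case using J_gen_zero by simp
next
  case (insert i I)
  have "mag_gen (\<lambda>X. c i * w i X + (\<Sum>i\<in>I. c i * w i X))
      - (mag_gen (\<lambda>X. c i * w i X) + mag_gen (\<lambda>X. \<Sum>i\<in>I. c i * w i X))
      + (mag_gen (\<lambda>X. c i * w i X) - fscale (c i) (mag_gen (w i)))
      + (mag_gen (\<lambda>X. \<Sum>i\<in>I. c i * w i X) - (\<Sum>i\<in>I. fscale (c i) (mag_gen (w i)))) \<in> J"
    using insert by (intro J_add J_gen_plus J_gen_scale V_closed V_sum_closed) auto
  then show ?case using insert.hyps by (simp add: algebra_simps)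
qed

text \<open>The quadratic element with coefficient matrix \<Omega> in vectors \<open>w\<close>,
  which may be linearly dependent. Modulo \<open>J\<close> it depends only on the antisymmetric part
  of \<Omega>.\<close>

definition wedge :: "'i set \<Rightarrow> ('i \<Rightarrow> 'x \<Rightarrow> rat) \<Rightarrow> ('i \<Rightarrow> 'i \<Rightarrow> rat) \<Rightarrow> (('x \<Rightarrow> rat) magma \<Rightarrow>\<^sub>0 rat)" where
  "wedge I w \<Omega> = (\<Sum>i\<in>I. \<Sum>j\<in>I. fscale (\<Omega> i j) (mag_gen (w i) \<star> mag_gen (w j)))"

lemma wedge_linear:
  "wedge I w (\<lambda>i j. \<Omega> i j + \<Omega>' i j) = wedge I w \<Omega> + wedge I w \<Omega>'"
  "wedge I w (\<lambda>i j. r * \<Omega> i j) = fscale r (wedge I w \<Omega>)"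
  "wedge I w (\<lambda>i j. \<Omega> i j - \<Omega>' i j) = wedge I w \<Omega> - wedge I w \<Omega>'"
  "wedge I w (\<lambda>i j. \<Sum>k\<in>S. F k i j) = (\<Sum>k\<in>S. wedge I w (F k))"
proof -
  show "wedge I w (\<lambda>i j. \<Sum>k\<in>S. F k i j) = (\<Sum>k\<in>S. wedge I w (F k))"
  proof -
    let ?t = "\<lambda>k i j. fscale (F k i j) (mag_gen (w i) \<star> mag_gen (w j))"
    have "wedge I w (\<lambda>i j. \<Sum>k\<in>S. F k i j) = (\<Sum>i\<in>I. \<Sum>j\<in>I. \<Sum>k\<in>S. ?t k i j)"
      by (simp add: wedge_def fscale_sum_left)
    also have "\<dots> = (\<Sum>i\<in>I. \<Sum>k\<in>S. \<Sum>j\<in>I. ?t k i j)" by (intro sum.cong HOL.refl sum.swap)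
    also have "\<dots> = (\<Sum>k\<in>S. \<Sum>i\<in>I. \<Sum>j\<in>I. ?t k i j)" by (rule sum.swap)
    finally show ?thesis by (simp add: wedge_def)
  qed
qed (simp_all add: wedge_def fscale_simps sum.distrib sum_subtractf)

lemma wedge_cong: "(\<And>i j. i \<in> I \<Longrightarrow> j \<in> I \<Longrightarrow> \<Omega> i j = \<Omega>' i j) \<Longrightarrow> wedge I w \<Omega> = wedge I w \<Omega>'"
  by (simp add: wedge_def)

lemma wedge_closed: "(\<And>i. i \<in> I \<Longrightarrow> w i \<in> carrier V) \<Longrightarrow> wedge I w \<Omega> \<in> free_carrier (carrier V)"
  unfolding wedge_def by (intro free_carrier_sum free_carrier_fscale free_carrier_mult free_carrier_gen)

text \<open>The sum of the elements for \<Omega> and for its transpose is a combination of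
  anticommutators.\<close>

lemma wedge_antisymmetrize:
  assumes "\<And>i. i \<in> I \<Longrightarrow> w i \<in> carrier V"
  shows "fscale 2 (wedge I w \<Omega>) - wedge I w (\<lambda>i j. \<Omega> i j - \<Omega> j i) \<in> J"
proof -
  have "wedge I w (\<lambda>i j. \<Omega> j i) = (\<Sum>i\<in>I. \<Sum>j\<in>I. fscale (\<Omega> i j) (mag_gen (w j) \<star> mag_gen (w i)))"
    unfolding wedge_def by (rule sum.swap)
  then have "wedge I w \<Omega> + wedge I w (\<lambda>i j. \<Omega> j i) =
      (\<Sum>i\<in>I. \<Sum>j\<in>I. fscale (\<Omega> i j) (mag_gen (w i) \<star> mag_gen (w j) + mag_gen (w j) \<star> mag_gen (w i)))"
    by (simp add: wedge_def sum.distrib fscale_add_right)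
  also have "\<dots> \<in> J" using assms by (intro J_sum J_fscale J_anticomm free_carrier_gen)
  finally have "wedge I w \<Omega> + wedge I w (\<lambda>i j. \<Omega> j i) \<in> J" .
  moreover have "fscale 2 (wedge I w \<Omega>) = wedge I w \<Omega> + wedge I w \<Omega>"
    using fscale_add_left[of 1 1 "wedge I w \<Omega>"] by (simp add: fscale_one)
  ultimately show ?thesis by (simp add: wedge_linear(3) algebra_simps)
qed

lemma wedge_antisym_cong:
  assumes "\<And>i. i \<in> I \<Longrightarrow> w i \<in> carrier V"
    and "\<And>i j. i \<in> I \<Longrightarrow> j \<in> I \<Longrightarrow> \<Omega> i j - \<Omega> j i = \<Omega>' i j - \<Omega>' j i"
  shows "wedge I w \<Omega> - wedge I w \<Omega>' \<in> J"
proof -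
  have "wedge I w (\<lambda>i j. \<Omega> i j - \<Omega> j i) = wedge I w (\<lambda>i j. \<Omega>' i j - \<Omega>' j i)"
    using assms(2) by (rule wedge_cong)
  moreover have "fscale 2 (wedge I w \<Omega>) - wedge I w (\<lambda>i j. \<Omega> i j - \<Omega> j i)
      - (fscale 2 (wedge I w \<Omega>') - wedge I w (\<lambda>i j. \<Omega>' i j - \<Omega>' j i)) \<in> J"
    using assms(1) by (intro J_diff wedge_antisymmetrize)
  ultimately have "fscale 2 (wedge I w \<Omega>) - fscale 2 (wedge I w \<Omega>') \<in> J"
    by (simp add: algebra_simps)
  from J_fscale[OF this, of "1/2"] show ?thesis by (simp add: fscale_simps)
qed

lemma gen_mult_wedge:
  assumes "finite I" "\<And>i. i \<in> I \<Longrightarrow> w i \<in> carrier V"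
    and "x = (\<lambda>X. \<Sum>i\<in>I. a i * w i X)" "y = (\<lambda>X. \<Sum>i\<in>I. b i * w i X)"
  shows "mag_gen x \<star> mag_gen y - wedge I w (\<lambda>i j. a i * b j) \<in> J"
proof -
  have "mag_gen x \<star> mag_gen y
      - (\<Sum>i\<in>I. fscale (a i) (mag_gen (w i))) \<star> (\<Sum>i\<in>I. fscale (b i) (mag_gen (w i))) \<in> J"
    unfolding assms(3,4) using assms(1,2)
    by (intro J_mult_cong J_gen_lincomb V_sum_closed free_carrier_sum free_carrier_fscale free_carrier_gen)
  then have "mag_gen x \<star> mag_gen y
      - (\<Sum>i\<in>I. fscale (a i) (mag_gen (w i)) \<star> (\<Sum>i\<in>I. fscale (b i) (mag_gen (w i)))) \<in> J"
    by (simp only: mag_mult_sum_left)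
  then show ?thesis
    by (simp add: wedge_def mag_mult_sum_right mag_mult_simps fscale_sum fscale_fscale mult_ac)
qed

end

lemma fun_lie_kernel_cohom_dual: "lie_kernel (cohom_dual G 1) J \<Longrightarrow> fun_lie_kernel (cohom_dual G 1) J"
  by (intro fun_lie_kernel.intro fun_lie_kernel_axioms.intro) (simp_all add: cohom_dual_sel)

lemma cohom_dual_1_lincomb:
  assumes G: "group G" and x: "x \<in> carrier (cohom_dual G 1)" and I: "finite I" "\<And>i. i \<in> I \<Longrightarrow> a i \<in> group_chars G"
  shows "x (char_class G (\<lambda>g. \<Sum>i\<in>I. c i * a i g)) = (\<Sum>i\<in>I. c i * x (char_class G (a i)))"
proof -
  note x' = x[unfolded cohom_dual_1_iff[OF G]]
  have z: "(\<lambda>g. 0) \<in> group_chars G" by (simp add: group_chars_def)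
  have sc: "(\<lambda>g. r * b g) \<in> group_chars G" if "b \<in> group_chars G" for r b
    using that by (simp add: group_chars_def algebra_simps)
  from I show ?thesis
  proof (induction I rule: finite_induct)
    case empty
    show ?case using x'[THEN conjunct2, THEN conjunct1, rule_format, of "\<lambda>g. 0" 0] z by simp
  next
    case (insert i I)
    have s: "(\<lambda>g. \<Sum>i\<in>I. c i * a i g) \<in> group_chars G"
    proof -
      have "(\<Sum>i\<in>I. c i * a i (x \<otimes>\<^bsub>G\<^esub> y)) = (\<Sum>i\<in>I. c i * a i x + c i * a i y)"
        if "x \<in> carrier G" "y \<in> carrier G" for x y
        using insert.prems that by (intro sum.cong HOL.refl) (auto simp: group_chars_def algebra_simps)
      then show ?thesis by (simp add: group_chars_def sum.distrib)
    qed
    have "x (char_class G (\<lambda>g. c i * a i g + (\<Sum>i\<in>I. c i * a i g))) =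
        x (char_class G (\<lambda>g. c i * a i g)) + x (char_class G (\<lambda>g. \<Sum>i\<in>I. c i * a i g))"
      using x' sc[of "a i" "c i"] s insert.prems by auto
    then show ?case using insert x' by auto
  qed
qed

text \<open>The functional comes from the torus cycle \<open>[p, q] - [q, p]\<close>: it kills
  coboundaries because \<open>p\<close> and \<open>q\<close> commute, and its value on a cup product
  is the 2 by 2 determinant of the two characters at \<open>p\<close> and \<open>q\<close>. It
  supplies both the edge relations of \<open>G\<close> and the triangle relations of
  \<open>N\<close>.\<close>

lemma commuting_pair_nabla_rel:
  assumes G: "group G" and pq: "p \<in> carrier G" "q \<in> carrier G" "p \<otimes>\<^bsub>G\<^esub> q = q \<otimes>\<^bsub>G\<^esub> p"
  shows "mag_gen (eval_char G p) \<star> mag_gen (eval_char G q) \<in> nabla_rels G"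
proof -
  define \<psi> where "\<psi> f = f [p, q] - f [q, p]" for f :: "'a list \<Rightarrow> rat"
  have cob: "\<psi> f = 0" if "f \<in> bar_coboundaries G 2" for f
    using that pq by (auto simp: \<psi>_def bar_coboundaries_def numeral_2_eq_2 bar_coboundary_1)
  have lin: "\<psi> (f + g) = \<psi> f + \<psi> g" "\<psi> (\<lambda>xs. r * f xs) = r * \<psi> f" for f g r
    by (simp_all add: \<psi>_def algebra_simps)
  let ?\<phi> = "cohom_functional G 2 \<psi>"
  show ?thesis
    unfolding nabla_rels_def
  proof (rule CollectI, rule bexI[of _ ?\<phi>], rule exI[of _ "1::nat"],
      rule exI[of _ "\<lambda>i. eval_char G p"], rule exI[of _ "\<lambda>i. eval_char G q"], intro conjI ballI)
    show "?\<phi> \<in> carrier (cohom_dual G 2)"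
      by (rule cohom_functional_carrier[OF G]) (auto simp: lin cob)
    fix a b assume ab: "a \<in> group_chars G" "b \<in> group_chars G"
    have "?\<phi> (cohom_class G 2 (cup_chars G a b)) = \<psi> (cup_chars G a b)"
      by (rule cohom_functional_class[OF G]) (auto simp: lin cob cup_chars_cocycle[OF G ab])
    then show "(\<Sum>i<1::nat. eval_char G p (char_class G a) * eval_char G q (char_class G b)
        - eval_char G p (char_class G b) * eval_char G q (char_class G a)) = ?\<phi> (cohom_class G 2 (cup_chars G a b))"
      using pq ab by (simp add: \<psi>_def cup_chars_eq bar_tuples_iff eval_char_class[OF G])
  qed (use eval_char_carrier[OF G] pq in \<open>auto simp: One_nat_def lessThan_Suc\<close>)
qed

lemma commute_int_pow:
  assumes "group G" "x \<in> carrier G" "y \<in> carrier G" "x \<otimes>\<^bsub>G\<^esub> y = y \<otimes>\<^bsub>G\<^esub> x"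
  shows "x [^]\<^bsub>G\<^esub> (k::int) \<otimes>\<^bsub>G\<^esub> y = y \<otimes>\<^bsub>G\<^esub> x [^]\<^bsub>G\<^esub> k"
proof -
  interpret group G by fact
  have nat: "x [^]\<^bsub>G\<^esub> (n::nat) \<otimes>\<^bsub>G\<^esub> y = y \<otimes>\<^bsub>G\<^esub> x [^]\<^bsub>G\<^esub> n" for n
  proof (induction n)
    case (Suc n)
    have "x [^]\<^bsub>G\<^esub> Suc n \<otimes>\<^bsub>G\<^esub> y = x [^]\<^bsub>G\<^esub> n \<otimes>\<^bsub>G\<^esub> (y \<otimes>\<^bsub>G\<^esub> x)"
      using assms by (simp add: m_assoc)
    also have "\<dots> = (y \<otimes>\<^bsub>G\<^esub> x [^]\<^bsub>G\<^esub> n) \<otimes>\<^bsub>G\<^esub> x" using assms Suc by (simp add: m_assoc[symmetric])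
    finally show ?case using assms by (simp add: m_assoc)
  qed (use assms in simp)
  have "inv\<^bsub>G\<^esub> (x [^]\<^bsub>G\<^esub> (n::nat)) \<otimes>\<^bsub>G\<^esub> y = y \<otimes>\<^bsub>G\<^esub> inv\<^bsub>G\<^esub> (x [^]\<^bsub>G\<^esub> n)" for n
    using nat[of n] assms by (metis inv_solve_left inv_solve_right inv_closed m_assoc m_closed nat_pow_closed)
  then show ?thesis using nat by (cases k rule: int_cases2) (simp_all add: int_pow_int int_pow_neg assms)
qed

section \<open>Dual forms of the two exactness statements\<close>

context raag_kernel begin

text \<open>The vectors \<open>d e\<close> are the contractions of single edges with
  \<open>m\<close>. By \<open>exact_1\<close> a functional that kills them all is a multiple of
  \<open>m\<close>, so it kills \<open>x\<close>, and \<open>functional_in_span\<close>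
  applies.\<close>

lemma exact_1_primal:
  assumes x: "(\<Sum>v\<in>V. m v * x v) = 0"
  shows "\<exists>c. (\<forall>u w. \<not> adj u w \<longrightarrow> c u w = 0) \<and> (\<forall>v\<in>V. x v = (\<Sum>u\<in>V. m u * (c u v - c v u)))"
proof -
  define I where "I = {e \<in> V \<times> V. adj (fst e) (snd e)}"
  define d where "d e v = m (fst e) * (if v = snd e then 1 else 0) - m (snd e) * (if v = fst e then 1 else 0)" for e v
  have fin: "finite I" using V by (simp add: I_def)
  have delta: "(\<Sum>v\<in>V. (if v = p then 1 else 0) * f v) = f p" if "p \<in> V" for p and f :: "'v \<Rightarrow> rat"
    using V that by (simp add: if_distrib[of "\<lambda>c. c * _"] cong: if_cong)
  have d_sum: "(\<Sum>v\<in>V. d (u, w) v * a v) = m u * a w - m w * a u" if "u \<in> V" "w \<in> V" for u w a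
  proof -
    have "(\<Sum>v\<in>V. d (u, w) v * a v) =
        m u * (\<Sum>v\<in>V. (if v = w then 1 else 0) * a v) - m w * (\<Sum>v\<in>V. (if v = u then 1 else 0) * a v)"
      by (simp add: d_def algebra_simps sum_subtractf sum_distrib_left)
    then show ?thesis using that by (simp only: delta)
  qed
  have "\<exists>k. \<forall>v\<in>V. x v = (\<Sum>e\<in>I. k e * d e v)"
  proof (rule functional_in_span[OF fin V])
    fix a assume a: "\<And>e. e \<in> I \<Longrightarrow> (\<Sum>v\<in>V. d e v * a v) = 0"
    have "m u * a w = m w * a u" if "adj u w" for u w
      using a[of "(u, w)"] d_sum[of u w a] adj_V[OF that] that by (simp add: I_def)
    then obtain c where "\<forall>v\<in>V. a v = c * m v" using exact_1 by blast
    then have "(\<Sum>v\<in>V. x v * a v) = c * (\<Sum>v\<in>V. m v * x v)"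
      by (simp add: sum_distrib_left mult_ac)
    then show "(\<Sum>v\<in>V. x v * a v) = 0" using x by simp
  qed
  then obtain k where k: "\<And>v. v \<in> V \<Longrightarrow> x v = (\<Sum>e\<in>I. k e * d e v)" by blast
  define c where "c u w = (if adj u w then k (u, w) else 0)" for u w
  have "x v = (\<Sum>u\<in>V. m u * (c u v - c v u))" if v: "v \<in> V" for v
  proof -
    have "x v = (\<Sum>e\<in>V \<times> V. c (fst e) (snd e) * d e v)"
      unfolding k[OF v] by (rule sum.mono_neutral_cong_left) (use V in \<open>auto simp: I_def c_def\<close>)
    also have "\<dots> = (\<Sum>u\<in>V. \<Sum>w\<in>V. c u w * d (u, w) v)" by (simp add: sum.cartesian_product case_prod_beta)
    also have "\<dots> = (\<Sum>u\<in>V. \<Sum>w\<in>V. (if w = v then 1 else 0) * (m u * c u w))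
        - (\<Sum>u\<in>V. \<Sum>w\<in>V. (if u = v then 1 else 0) * (m w * c u w))"
      by (simp add: d_def algebra_simps sum_subtractf eq_commute[of v] cong: if_cong)
    also have "(\<Sum>u\<in>V. \<Sum>w\<in>V. (if u = v then 1 else 0) * (m w * c u w)) =
        (\<Sum>w\<in>V. \<Sum>u\<in>V. (if u = v then 1 else 0) * (m w * c u w))" by (rule sum.swap)
    finally show ?thesis using v by (simp only: delta) (simp add: algebra_simps sum_subtractf)
  qed
  then show ?thesis by (intro exI[of _ c]) (simp add: c_def)
qed

text \<open>The vector \<open>p - (m p / m r) r\<close>, which \<open>m\<close> kills. Its exterior
  product with \<open>tri_snd\<close> is the contraction of the triangle \<open>p q r\<close> with
  \<open>m\<close>, divided by \<open>m r\<close>.\<close>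

definition tri_fst :: "'v \<times> 'v \<times> 'v \<Rightarrow> 'v \<Rightarrow> rat" where
  "tri_fst = (\<lambda>(p, q, r) v. (if v = p then 1 else 0) - m p / m r * (if v = r then 1 else 0))"

definition tri_snd :: "'v \<times> 'v \<times> 'v \<Rightarrow> 'v \<Rightarrow> rat" where
  "tri_snd = (\<lambda>(p, q, r) v. (if v = q then 1 else 0) - m q / m r * (if v = r then 1 else 0))"

definition triangles :: "('v \<times> 'v \<times> 'v) set" where
  "triangles = {(p, q, r). adj p q \<and> adj q r \<and> adj p r \<and> m r \<noteq> 0}"

lemma finite_triangles: "finite triangles"
proof (rule finite_subset)
  show "triangles \<subseteq> V \<times> V \<times> V" using adj_V by (auto simp: triangles_def)
qed (use V in simp)

lemma tri_sum_aux:
  assumes "x \<in> V" "y \<in> V"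
  shows "(\<Sum>v\<in>V. ((if v = x then 1 else 0) - c * (if v = y then 1 else 0)) * f v) = f x - c * (f y :: rat)"
proof -
  have "(\<Sum>v\<in>V. ((if v = x then 1 else 0) - c * (if v = y then 1 else 0)) * f v) =
      (\<Sum>v\<in>V. if v = x then f v else 0) - c * (\<Sum>v\<in>V. if v = y then f v else 0)"
    unfolding sum_distrib_left sum_subtractf[symmetric]
    by (intro sum.cong HOL.refl) (auto simp: algebra_simps)
  then show ?thesis using V assms by simp
qed

lemma tri_sum:
  "p \<in> V \<Longrightarrow> s \<in> V \<Longrightarrow> (\<Sum>v\<in>V. tri_fst (p, q, s) v * f v) = f p - m p / m s * f s"
  "q \<in> V \<Longrightarrow> s \<in> V \<Longrightarrow> (\<Sum>v\<in>V. tri_snd (p, q, s) v * f v) = f q - m q / m s * f s"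
  unfolding tri_fst_def tri_snd_def prod.case by (rule tri_sum_aux; assumption)+

text \<open>A functional that kills the triangle vectors satisfies the hypothesis of
  \<open>exact_2\<close>, so on edges it is \<open>m v * b u - m u * b v\<close>. Such a functional
  kills \<Omega> because the contraction of \<Omega> with \<open>m\<close> is zero.\<close>

lemma exact_2_primal:
  assumes anti: "\<And>u v. \<Omega> u v = - \<Omega> v u" and supp: "\<And>u v. \<not> adj u v \<Longrightarrow> \<Omega> u v = 0"
    and \<Omega>: "\<And>v. v \<in> V \<Longrightarrow> (\<Sum>u\<in>V. m u * \<Omega> u v) = 0"
  shows "\<exists>k. \<forall>u\<in>V. \<forall>v\<in>V. \<Omega> u v =
    (\<Sum>T\<in>triangles. k T * (tri_fst T u * tri_snd T v - tri_fst T v * tri_snd T u))"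
proof -
  define d where "d T e = tri_fst T (fst e) * tri_snd T (snd e) - tri_fst T (snd e) * tri_snd T (fst e)" for T e
  have sw: "(\<Sum>e\<in>V \<times> V. f (fst e) (snd e)) = (\<Sum>e\<in>V \<times> V. f (snd e) (fst e))" for f :: "'v \<Rightarrow> 'v \<Rightarrow> rat"
    using sum.swap[of f V V] by (simp add: sum.cartesian_product case_prod_beta)
  \<comment> \<open>Against an antisymmetric matrix supported on edges, only the antisymmetric part
    of a test functional on edges counts.\<close>
  have reduce: "(\<Sum>e\<in>V \<times> V. D (fst e) (snd e) * (if adj (fst e) (snd e) then (\<eta> (fst e, snd e) - \<eta> (snd e, fst e)) / 2 else 0))
      = (\<Sum>e\<in>V \<times> V. D (fst e) (snd e) * \<eta> e)"
    if D: "\<And>u v. D u v = - D v u" "\<And>u v. \<not> adj u v \<Longrightarrow> D u v = 0"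
    for D :: "'v \<Rightarrow> 'v \<Rightarrow> rat" and \<eta> :: "'v \<times> 'v \<Rightarrow> rat"
  proof -
    have "(\<Sum>e\<in>V \<times> V. D (fst e) (snd e) * (if adj (fst e) (snd e) then (\<eta> (fst e, snd e) - \<eta> (snd e, fst e)) / 2 else 0))
        = (\<Sum>e\<in>V \<times> V. D (fst e) (snd e) * \<eta> (fst e, snd e) / 2 - D (fst e) (snd e) * \<eta> (snd e, fst e) / 2)"
      by (intro sum.cong HOL.refl) (auto simp: D(2) diff_divide_distrib right_diff_distrib)
    also have "\<dots> = (\<Sum>e\<in>V \<times> V. D (fst e) (snd e) * \<eta> (fst e, snd e) / 2)
        - (\<Sum>e\<in>V \<times> V. D (snd e) (fst e) * \<eta> (fst e, snd e) / 2)"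
      unfolding sum_subtractf sw[of "\<lambda>u v. D u v * \<eta> (v, u) / 2"] ..
    also have "\<dots> = (\<Sum>e\<in>V \<times> V. D (fst e) (snd e) * \<eta> e)"
      unfolding sum_subtractf[symmetric] by (intro sum.cong HOL.refl) (metis D(1) prod.collapse
          diff_minus_eq_add field_sum_of_halves minus_divide_left mult_minus_left)
    finally show ?thesis .
  qed
  have "\<exists>k. \<forall>e\<in>V \<times> V. \<Omega> (fst e) (snd e) = (\<Sum>T\<in>triangles. k T * d T e)"
  proof (rule functional_in_span[OF finite_triangles])
    fix \<eta> :: "'v \<times> 'v \<Rightarrow> rat"
    assume \<eta>: "\<And>T. T \<in> triangles \<Longrightarrow> (\<Sum>e\<in>V \<times> V. d T e * \<eta> e) = 0"
    define \<eta>' where "\<eta>' u v = (if adj u v then (\<eta> (u, v) - \<eta> (v, u)) / 2 else 0)" for u v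
    have a': "\<eta>' u v = - \<eta>' v u" for u v using adj_sym by (auto simp: \<eta>'_def field_simps)
    have red: "(\<Sum>e\<in>V \<times> V. D (fst e) (snd e) * \<eta>' (fst e) (snd e)) = (\<Sum>e\<in>V \<times> V. D (fst e) (snd e) * \<eta> e)"
      if "\<And>u v. D u v = - D v u" "\<And>u v. \<not> adj u v \<Longrightarrow> D u v = 0" for D
      using reduce[where \<eta> = \<eta> and D = D, OF that] by (simp add: \<eta>'_def)
    have tri0: "m r * \<eta>' p q + m p * \<eta>' q r + m q * \<eta>' r p = 0"
      if T: "adj p q" "adj q r" "adj p r" "m r \<noteq> 0" for p q r
    proof -
      let ?T = "(p, q, r)"
      have PV: "p \<in> V" "q \<in> V" "r \<in> V" using adj_V T by auto
      have "?T \<in> triangles" using T by (simp add: triangles_def)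
      then have d0: "(\<Sum>e\<in>V \<times> V. d ?T e * \<eta> e) = 0" by (rule \<eta>)
      have d1: "d ?T (u, v) = - d ?T (v, u)" for u v by (simp add: d_def)
      have d2: "d ?T (u, v) = 0" if "\<not> adj u v" for u v
        using that T adj_sym by (auto simp: d_def tri_fst_def tri_snd_def)
      have "(\<Sum>e\<in>V \<times> V. d ?T (fst e, snd e) * \<eta>' (fst e) (snd e)) = (\<Sum>e\<in>V \<times> V. d ?T (fst e, snd e) * \<eta> e)"
        by (rule red[of "\<lambda>u v. d ?T (u, v)"]) (rule d1, rule d2)
      then have "(\<Sum>e\<in>V \<times> V. d ?T e * \<eta>' (fst e) (snd e)) = 0"
        using d0 by (simp only: prod.collapse)
      then have 0: "(\<Sum>u\<in>V. \<Sum>v\<in>V. (tri_fst ?T u * tri_snd ?T v - tri_fst ?T v * tri_snd ?T u) * \<eta>' u v) = 0"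
        by (simp add: sum.cartesian_product case_prod_beta d_def)
      have z: "(\<Sum>u\<in>V. tri_fst ?T u * (\<Sum>v\<in>V. tri_snd ?T v * \<eta>' u v))
          - (\<Sum>u\<in>V. tri_snd ?T u * (\<Sum>v\<in>V. tri_fst ?T v * \<eta>' u v)) = 0"
        using 0 by (simp add: sum_distrib_left sum_subtractf algebra_simps)
      have n: "\<eta>' q p = - \<eta>' p q" "\<eta>' r q = - \<eta>' q r" "\<eta>' p r = - \<eta>' r p" by (rule a')+
      have rr: "\<eta>' r r = 0" using a'[of r r] by simp
      \<comment> \<open>The pairing runs over both orders of each edge, hence the 2; the denominator
        \<open>m r\<close> stems from the triangle vectors.\<close>
      have "2 * (m r * \<eta>' p q + m p * \<eta>' q r + m q * \<eta>' r p) / m r = 0"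
        using z unfolding tri_sum(1)[OF PV(1,3)] tri_sum(2)[OF PV(2,3)] n rr using T(4) by (simp add: add_divide_distrib algebra_simps)
      then show ?thesis using T(4) by simp
    qed
    have tri: "m w * \<eta>' u v + m u * \<eta>' v w + m v * \<eta>' w u = 0"
      if "adj u v" "adj v w" "adj u w" for u v w
    proof -
      note s = adj_sym[OF that(1)] adj_sym[OF that(2)] adj_sym[OF that(3)]
      \<comment> \<open>The identity is invariant under rotation of the triangle, so a vertex where
        \<open>m\<close> is nonzero can be put last; without such a vertex the identity is
        trivial.\<close>
      consider "m w \<noteq> 0" | "m u \<noteq> 0" | "m v \<noteq> 0" | "m u = 0" "m v = 0" "m w = 0" by blast
      then show ?thesis
      proof cases
        case 1
        then show ?thesis using tri0[OF that] by simp
      next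
        case 2
        then show ?thesis using tri0[OF that(2) s(3) s(1)] by simp
      next
        case 3
        then show ?thesis using tri0[OF s(3) that(1) s(2)] by simp
      qed simp
    qed
    have "\<exists>b. \<forall>u v. adj u v \<longrightarrow> \<eta>' u v = m v * b u - m u * b v"
      by (rule exact_2[OF a' _ tri]) (simp add: \<eta>'_def)
    then obtain b where b: "\<And>u v. adj u v \<Longrightarrow> \<eta>' u v = m v * b u - m u * b v" by blast
    have "(\<Sum>e\<in>V \<times> V. \<Omega> (fst e) (snd e) * \<eta> e) = (\<Sum>e\<in>V \<times> V. \<Omega> (fst e) (snd e) * \<eta>' (fst e) (snd e))"
      by (rule red[symmetric]) (rule anti, rule supp)
    also have "\<dots> = (\<Sum>u\<in>V. \<Sum>v\<in>V. \<Omega> u v * (m v * b u - m u * b v))"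
      unfolding sum.cartesian_product case_prod_beta
    proof (rule sum.cong)
      fix e show "\<Omega> (fst e) (snd e) * \<eta>' (fst e) (snd e) =
          \<Omega> (fst e) (snd e) * (m (snd e) * b (fst e) - m (fst e) * b (snd e))"
        using b supp by (cases "adj (fst e) (snd e)") simp_all
    qed simp
    also have "\<dots> = (\<Sum>u\<in>V. \<Sum>v\<in>V. - (b u * (m v * \<Omega> v u))) - (\<Sum>u\<in>V. \<Sum>v\<in>V. b v * (m u * \<Omega> u v))"
      unfolding sum_subtractf[symmetric]
    proof (intro sum.cong HOL.refl)
      fix u v show "\<Omega> u v * (m v * b u - m u * b v) = - (b u * (m v * \<Omega> v u)) - b v * (m u * \<Omega> u v)"
        unfolding anti[of u v] by (simp add: algebra_simps)
    qed
    also have "(\<Sum>u\<in>V. \<Sum>v\<in>V. b v * (m u * \<Omega> u v)) = (\<Sum>v\<in>V. b v * (\<Sum>u\<in>V. m u * \<Omega> u v))"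
      unfolding sum_distrib_left by (rule sum.swap)
    also have "(\<Sum>u\<in>V. \<Sum>v\<in>V. - (b u * (m v * \<Omega> v u))) = - (\<Sum>u\<in>V. b u * (\<Sum>v\<in>V. m v * \<Omega> v u))"
      by (simp add: sum_negf sum_distrib_left)
    also have "- (\<Sum>u\<in>V. b u * (\<Sum>v\<in>V. m v * \<Omega> v u)) - (\<Sum>v\<in>V. b v * (\<Sum>u\<in>V. m u * \<Omega> u v)) = 0"
      using \<Omega> by simp
    finally show "(\<Sum>e\<in>V \<times> V. \<Omega> (fst e) (snd e) * \<eta> e) = 0" .
  qed (use V in simp)
  then obtain k where k: "\<And>e. e \<in> V \<times> V \<Longrightarrow> \<Omega> (fst e) (snd e) = (\<Sum>T\<in>triangles. k T * d T e)" by blast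
  show ?thesis using k[of "(u, v)" for u v] by (intro exI[of _ k]) (simp add: d_def)
qed

end

lemma cup_chars_coboundary:
  assumes "group G" "\<And>x y. x \<in> carrier G \<Longrightarrow> y \<in> carrier G \<Longrightarrow> a x * b y = A x + A y - A (x \<otimes>\<^bsub>G\<^esub> y)"
  shows "cup_chars G a b \<in> bar_coboundaries G 2"
proof -
  interpret group G by fact
  have "cup_chars G a b = bar_coboundary G 1 (char_cochain G A)"
  proof
    fix xs show "cup_chars G a b xs = bar_coboundary G 1 (char_cochain G A) xs"
    proof (cases "xs \<in> bar_tuples G 2")
      case True
      then obtain x y where "x \<in> carrier G" "y \<in> carrier G" "xs = [x, y]" unfolding bar_tuples_iff by auto
      then show ?thesis
        using True assms(2)[of x y] by (simp add: cup_chars_eq One_nat_def bar_coboundary_1 char_cochain_def bar_tuples_iff)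
    next
      case False
      then show ?thesis by (simp add: cup_chars_eq bar_coboundary_def numeral_2_eq_2 One_nat_def)
    qed
  qed
  then show ?thesis
    by (auto simp: bar_coboundaries_def numeral_2_eq_2 One_nat_def bar_cochains_sel char_cochain_def)
qed

lemma fun_lie_kernel_lie_ideal: "fun_lie_kernel (cohom_dual G 1) (lie_ideal (cohom_dual G 1))"
  by (intro fun_lie_kernel_cohom_dual lie_kernel_lie_ideal module_cohom_dual)

lemma fun_lie_kernel_hol_ideal: "fun_lie_kernel (cohom_dual G 1) (hol_ideal G)"
  by (intro fun_lie_kernel_cohom_dual lie_kernel_hol_ideal)

lemma lie_ideal_hol_ideal: "p \<in> lie_ideal (cohom_dual G 1) \<Longrightarrow> p \<in> hol_ideal G"
  using lie_ideal_subset_gen_ideal[OF lie_kernel_hol_ideal] by auto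

lemma nabla_rels_hol_ideal: "p \<in> nabla_rels G \<Longrightarrow> p \<in> hol_ideal G"
  using lie_gen_ideal_superset by (auto simp: hol_ideal_def)

abbreviation wedge where "wedge \<equiv> fun_lie_kernel.wedge"

text \<open>The entry of \<Omega> at \<open>u, v\<close> is the value of the functional behind
  \<open>p\<close> on the cup product of \<open>cv u\<close> and \<open>cv v\<close>. A linear
  relation among the coordinates becomes a vanishing contraction of \<Omega>, a trivial cup product
  a zero entry. The factor 1/2 is there because each pair occurs in both orders.\<close>

lemma nabla_rel_wedge:
  fixes cv :: "'v \<Rightarrow> 'a \<Rightarrow> rat"
  assumes G: "group G" and V: "finite V" and cv: "\<And>v. cv v \<in> group_chars G"
    and w: "\<And>v. v \<in> V \<Longrightarrow> w v \<in> carrier (cohom_dual G 1)"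
    and frame: "\<And>x. x \<in> carrier (cohom_dual G 1) \<Longrightarrow> x = (\<lambda>X. \<Sum>v\<in>V. x (char_class G (cv v)) * w v X)"
    and p: "p \<in> nabla_rels G"
  shows "\<exists>\<Omega>. (\<forall>u v. \<Omega> u v = - \<Omega> v u) \<and>
    (\<forall>c. (\<forall>x\<in>carrier (cohom_dual G 1). (\<Sum>v\<in>V. c v * x (char_class G (cv v))) = 0) \<longrightarrow>
       (\<forall>v. (\<Sum>u\<in>V. c u * \<Omega> u v) = 0)) \<and>
    (\<forall>u v. cup_chars G (cv u) (cv v) \<in> bar_coboundaries G 2 \<longrightarrow> \<Omega> u v = 0) \<and>
    p - wedge V w (\<lambda>u v. \<Omega> u v / 2) \<in> lie_ideal (cohom_dual G 1)"
proof -
  interpret fun_lie_kernel "cohom_dual G 1" "lie_ideal (cohom_dual G 1)" by (rule fun_lie_kernel_lie_ideal)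
  obtain \<phi> and n :: nat and x y where \<phi>: "\<phi> \<in> carrier (cohom_dual G 2)"
    and x: "x \<in> {..<n} \<rightarrow> carrier (cohom_dual G 1)" and y: "y \<in> {..<n} \<rightarrow> carrier (cohom_dual G 1)"
    and p: "p = (\<Sum>i<n. mag_gen (x i) \<star> mag_gen (y i))"
    and pair: "\<And>a b. a \<in> group_chars G \<Longrightarrow> b \<in> group_chars G \<Longrightarrow>
       (\<Sum>i<n. x i (char_class G a) * y i (char_class G b) - x i (char_class G b) * y i (char_class G a))
       = \<phi> (cohom_class G 2 (cup_chars G a b))"
    using p by (auto simp: nabla_rels_def)
  let ?x = "\<lambda>i v. x i (char_class G (cv v))" and ?y = "\<lambda>i v. y i (char_class G (cv v))"
  define \<Omega> where "\<Omega> u v = (\<Sum>i<n. ?x i u * ?y i v - ?x i v * ?y i u)" for u v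
  have anti: "\<Omega> u v = - \<Omega> v u" for u v by (simp add: \<Omega>_def sum_negf[symmetric])
  have contr: "(\<Sum>u\<in>V. c u * \<Omega> u v) = 0"
    if c: "\<And>x. x \<in> carrier (cohom_dual G 1) \<Longrightarrow> (\<Sum>v\<in>V. c v * x (char_class G (cv v))) = 0" for c v
  proof -
    have "(\<Sum>u\<in>V. c u * \<Omega> u v) = (\<Sum>i<n. \<Sum>u\<in>V. c u * (?x i u * ?y i v - ?x i v * ?y i u))"
      unfolding \<Omega>_def sum_distrib_left by (rule sum.swap)
    also have "\<dots> = (\<Sum>i<n. (\<Sum>u\<in>V. c u * ?x i u) * ?y i v - (\<Sum>u\<in>V. c u * ?y i u) * ?x i v)"
    proof (intro sum.cong HOL.refl)
      fix i
      show "(\<Sum>u\<in>V. c u * (?x i u * ?y i v - ?x i v * ?y i u)) =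
          (\<Sum>u\<in>V. c u * ?x i u) * ?y i v - (\<Sum>u\<in>V. c u * ?y i u) * ?x i v"
        unfolding sum_distrib_right sum_subtractf[symmetric]
        by (intro sum.cong HOL.refl) (simp add: algebra_simps)
    qed
    also have "\<dots> = 0" using x y by (intro sum.neutral) (auto simp: c Pi_iff)
    finally show ?thesis .
  qed
  have vanish: "\<Omega> u v = 0" if "cup_chars G (cv u) (cv v) \<in> bar_coboundaries G 2" for u v
  proof -
    have z: "(\<lambda>xs. 0 * cup_chars G (cv u) (cv v) xs) = 0" by (simp add: fun_eq_iff)
    note c = cup_chars_cocycle[OF G cv cv, of u v]
    have "cohom_class G 2 (cup_chars G (cv u) (cv v)) = cohom_class G 2 0"
      using that c by (subst group_cohomology_ops(4)[OF G]) (auto simp: bar_cocycles_sel bar_coboundary_zero)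
    also have "\<phi> (cohom_class G 2 0) = 0 * \<phi> (cohom_class G 2 (cup_chars G (cv u) (cv v)))"
      using \<phi> c unfolding z[symmetric] by (subst (asm) cohom_dual_iff[OF G]) blast+
    finally have "\<phi> (cohom_class G 2 (cup_chars G (cv u) (cv v))) = 0" by simp
    then show ?thesis using pair[OF cv cv] by (simp add: \<Omega>_def)
  qed
  have "p - (\<Sum>i<n. wedge V w (\<lambda>u v. ?x i u * ?y i v)) \<in> lie_ideal (cohom_dual G 1)"
    unfolding p
  proof (rule J_sum_cong)
    fix i assume "i \<in> {..<n}"
    then show "mag_gen (x i) \<star> mag_gen (y i) - wedge V w (\<lambda>u v. ?x i u * ?y i v) \<in> lie_ideal (cohom_dual G 1)"
      using x y by (intro gen_mult_wedge V w frame) auto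
  qed
  then have "p - wedge V w (\<lambda>u v. \<Sum>i<n. ?x i u * ?y i v) \<in> lie_ideal (cohom_dual G 1)"
    by (simp only: wedge_linear(4))
  moreover have "wedge V w (\<lambda>u v. \<Sum>i<n. ?x i u * ?y i v) - wedge V w (\<lambda>u v. \<Omega> u v / 2) \<in> lie_ideal (cohom_dual G 1)"
  proof (rule wedge_antisym_cong[OF w])
    show "(\<Sum>i<n. ?x i u * ?y i v) - (\<Sum>i<n. ?x i v * ?y i u) = \<Omega> u v / 2 - \<Omega> v u / 2" for u v
    proof -
      have "(\<Sum>i<n. ?x i u * ?y i v) - (\<Sum>i<n. ?x i v * ?y i u) = \<Omega> u v"
        by (simp add: \<Omega>_def sum_subtractf)
      then show ?thesis using anti[of v u] by simp
    qed
  qed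
  ultimately have "p - wedge V w (\<lambda>u v. \<Omega> u v / 2) \<in> lie_ideal (cohom_dual G 1)" by (rule J_trans)
  then show ?thesis using anti contr vanish by (intro exI[of _ \<Omega>]) blast
qed

subsection \<open>The splitting of the first homology\<close>

context raag_kernel begin

interpretation G: group G by (rule G)
interpretation N: group N by (rule group_N)
interpretation JN: fun_lie_kernel "cohom_dual N 1" "hol_ideal N" by (rule fun_lie_kernel_hol_ideal)
interpretation JG: fun_lie_kernel "cohom_dual G 1" "hol_ideal G" by (rule fun_lie_kernel_hol_ideal)

definition e :: "'v \<Rightarrow> 'g hdual" where "e v = eval_char G (gen v)"
definition \<tau> :: "'g hdual" where "\<tau> = eval_char G t"
definition \<mu> :: "'g hdual \<Rightarrow> rat" where "\<mu> y = y (char_class G \<chi>')"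
text \<open>The transpose of the extension of characters from \<open>N\<close> to \<open>G\<close>;
  it is the projection along \<tau>, by \<open>r_\<iota>\<close> and
  \<open>\<iota>_r\<close>.\<close>

definition r :: "'g hdual \<Rightarrow> 'g hdual" where
  "r y = char_functional N (\<lambda>\<phi>. y (char_class G (\<lambda>g. \<phi> (npart g))))"
definition \<iota> :: "'g hdual \<Rightarrow> 'g hdual" where "\<iota> = cohom_dual_map N G 1 (\<lambda>x. x)"
definition ebar :: "'v \<Rightarrow> 'g hdual" where "ebar v = r (e v)"
text \<open>These are the coordinates of \<open>\<iota> x\<close> with respect to \<open>e\<close>.
  By \<open>frame_N\<close> they also write \<open>x\<close> in terms of the vectors
  \<open>ebar\<close>, which span but are linearly dependent.\<close>

definition coord :: "'g hdual \<Rightarrow> 'v \<Rightarrow> rat" where "coord x v = x (char_class N (co v))"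

lemma incl_hom: "(\<lambda>x. x) \<in> hom N G"
  by (auto simp: hom_def K_carrier)

lemma e_carrier: "v \<in> V \<Longrightarrow> e v \<in> carrier (cohom_dual G 1)"
  unfolding e_def by (intro eval_char_carrier[OF G] gen)

lemma e_class: "v \<in> V \<Longrightarrow> a \<in> group_chars G \<Longrightarrow> e v (char_class G a) = a (gen v)"
  unfolding e_def by (intro eval_char_class[OF G] gen)

lemma \<tau>_carrier: "\<tau> \<in> carrier (cohom_dual G 1)"
  unfolding \<tau>_def by (intro eval_char_carrier[OF G] t)

lemma \<tau>_class: "a \<in> group_chars G \<Longrightarrow> \<tau> (char_class G a) = a t"
  unfolding \<tau>_def by (intro eval_char_class[OF G] t)

context
  fixes y assumes y: "y \<in> carrier (cohom_dual G 1)"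
begin

lemma r_aux:
  "a \<in> group_chars N \<Longrightarrow> b \<in> group_chars N \<Longrightarrow>
    y (char_class G (\<lambda>g. a (npart g) + b (npart g))) =
    y (char_class G (\<lambda>g. a (npart g))) + y (char_class G (\<lambda>g. b (npart g)))"
  "a \<in> group_chars N \<Longrightarrow> y (char_class G (\<lambda>g. c * a (npart g))) = c * y (char_class G (\<lambda>g. a (npart g)))"
  "(\<And>x. x \<in> carrier N \<Longrightarrow> a x = b x) \<Longrightarrow>
    y (char_class G (\<lambda>g. a (npart g))) = y (char_class G (\<lambda>g. b (npart g)))"
proof -
  note y' = y[unfolded cohom_dual_1_iff[OF G]]
  show "y (char_class G (\<lambda>g. a (npart g) + b (npart g))) =
    y (char_class G (\<lambda>g. a (npart g))) + y (char_class G (\<lambda>g. b (npart g)))"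
    if "a \<in> group_chars N" "b \<in> group_chars N"
    by (rule y'[THEN conjunct1, rule_format, OF extend_char[OF that(1)] extend_char[OF that(2)]])
  show "y (char_class G (\<lambda>g. c * a (npart g))) = c * y (char_class G (\<lambda>g. a (npart g)))"
    if "a \<in> group_chars N"
    by (rule y'[THEN conjunct2, THEN conjunct1, rule_format, OF extend_char[OF that]])
  assume "\<And>x. x \<in> carrier N \<Longrightarrow> a x = b x"
  then have "char_class G (\<lambda>g. a (npart g)) = char_class G (\<lambda>g. b (npart g))"
    by (intro char_class_cong) (simp add: npart_K)
  then show "y (char_class G (\<lambda>g. a (npart g))) = y (char_class G (\<lambda>g. b (npart g)))" by simp
qed

lemma r_carrier: "r y \<in> carrier (cohom_dual N 1)"
  unfolding r_def by (rule char_functional_carrier[OF group_N]) (auto intro: r_aux)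

lemma r_class: "\<phi> \<in> group_chars N \<Longrightarrow> r y (char_class N \<phi>) = y (char_class G (\<lambda>g. \<phi> (npart g)))"
  unfolding r_def by (rule char_functional_class[OF group_N]) (auto intro: r_aux)

end

lemma r_lincomb: "r (\<lambda>X. \<Sum>i\<in>I. c i * w i X) = (\<lambda>X. \<Sum>i\<in>I. c i * r (w i) X)"
  by (simp add: r_def char_functional_def cohom_functional_def fun_eq_iff)

lemma r_linear: "r (\<lambda>X. v X + w X) = (\<lambda>X. r v X + r w X)" "r (\<lambda>X. c * w X) = (\<lambda>X. c * r w X)"
  by (simp_all add: r_def char_functional_def cohom_functional_def fun_eq_iff)

lemma \<iota>_carrier: "x \<in> carrier (cohom_dual N 1) \<Longrightarrow> \<iota> x \<in> carrier (cohom_dual G 1)"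
  unfolding \<iota>_def by (rule cohom_dual_map_carrier[OF group_N G incl_hom]) simp_all

lemma \<iota>_class: "a \<in> group_chars G \<Longrightarrow> \<iota> x (char_class G a) = x (char_class N a)"
  unfolding \<iota>_def using cohom_dual_map_char_class[OF group_N G incl_hom] by simp

lemma r_\<iota>:
  assumes x: "x \<in> carrier (cohom_dual N 1)" shows "r (\<iota> x) = x"
proof (rule cohom_dual_1_ext[OF group_N r_carrier[OF \<iota>_carrier[OF x]] x])
  fix \<phi> assume \<phi>: "\<phi> \<in> group_chars N"
  have "char_class N (\<lambda>g. \<phi> (npart g)) = char_class N \<phi>"
    by (rule char_class_cong) (simp add: npart_N)
  then show "r (\<iota> x) (char_class N \<phi>) = x (char_class N \<phi>)"
    using r_class[OF \<iota>_carrier[OF x] \<phi>] \<iota>_class[OF extend_char[OF \<phi>]] by simp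
qed

lemma \<iota>_r:
  assumes y: "y \<in> carrier (cohom_dual G 1)" shows "\<iota> (r y) = (\<lambda>X. y X + (- \<mu> y) * \<tau> X)"
proof (rule cohom_dual_1_ext[OF G \<iota>_carrier[OF r_carrier[OF y]]])
  show "(\<lambda>X. y X + (- \<mu> y) * \<tau> X) \<in> carrier (cohom_dual G 1)"
    by (intro JG.V_closed y \<tau>_carrier)
  fix a assume a: "a \<in> group_chars G"
  have "char_class G (\<lambda>g. a (npart g)) = char_class G (\<lambda>g. a g + (- a t) * \<chi>' g)"
    using char_npart[OF a] by (intro char_class_cong) (simp add: mult.commute)
  moreover have "y (char_class G (\<lambda>g. a g + (- a t) * \<chi>' g)) = y (char_class G a) + (- a t) * y (char_class G \<chi>')"
  proof -
    have "(\<lambda>g. (- a t) * \<chi>' g) \<in> group_chars G"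
      using \<chi>'_char unfolding group_chars_def by (simp add: algebra_simps)
    then show ?thesis using y[unfolded cohom_dual_1_iff[OF G]] a \<chi>'_char by metis
  qed
  ultimately show "\<iota> (r y) (char_class G a) = y (char_class G a) + (- \<mu> y) * \<tau> (char_class G a)"
    using \<iota>_class[OF a] r_class[OF y restrict_char[OF a]] \<tau>_class[OF a] by (simp add: \<mu>_def)
qed

lemma N_char_vanish:
  assumes "x \<in> carrier (cohom_dual N 1)" shows "x (char_class N \<chi>') = 0"
proof -
  have "char_class N \<chi>' = char_class N (\<lambda>g. 0 * \<chi>' g)"
    by (rule char_class_cong) (simp add: K_iff \<chi>'_def)
  then show ?thesis
    using assms[unfolded cohom_dual_1_iff[OF group_N]] restrict_char[OF \<chi>'_char] by (metis mult_zero_left)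
qed

lemma \<mu>_\<iota>: "x \<in> carrier (cohom_dual N 1) \<Longrightarrow> \<mu> (\<iota> x) = 0"
  by (simp add: \<mu>_def \<iota>_class[OF \<chi>'_char] N_char_vanish)

lemma \<mu>_e: "v \<in> V \<Longrightarrow> \<mu> (e v) = m v"
  by (simp add: \<mu>_def e_class[OF _ \<chi>'_char] m_def)

lemma frame_G:
  assumes y: "y \<in> carrier (cohom_dual G 1)"
  shows "y = (\<lambda>X. \<Sum>v\<in>V. y (char_class G (co v)) * e v X)"
proof (rule cohom_dual_1_ext[OF G y])
  show "(\<lambda>X. \<Sum>v\<in>V. y (char_class G (co v)) * e v X) \<in> carrier (cohom_dual G 1)"
    by (intro JG.V_sum_closed e_carrier)
  fix a assume a: "a \<in> group_chars G"
  have "char_class G a = char_class G (\<lambda>g. \<Sum>v\<in>V. a (gen v) * co v g)"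
    by (rule char_class_cong) (rule chars[OF a])
  then have "y (char_class G a) = (\<Sum>v\<in>V. a (gen v) * y (char_class G (co v)))"
    using cohom_dual_1_lincomb[OF G y V, where a = co] co by simp
  also have "\<dots> = (\<Sum>v\<in>V. y (char_class G (co v)) * e v (char_class G a))"
    by (intro sum.cong HOL.refl) (simp add: e_class[OF _ a])
  finally show "y (char_class G a) = (\<Sum>v\<in>V. y (char_class G (co v)) * e v (char_class G a))" .
qed

lemma ebar_carrier: "v \<in> V \<Longrightarrow> ebar v \<in> carrier (cohom_dual N 1)"
  unfolding ebar_def by (intro r_carrier e_carrier)

lemma ebar_class: "v \<in> V \<Longrightarrow> \<phi> \<in> group_chars N \<Longrightarrow> ebar v (char_class N \<phi>) = \<phi> (npart (gen v))"
  by (simp add: ebar_def r_class[OF e_carrier] e_class[OF _ extend_char])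

text \<open>The correction is the coordinate of \<open>m u\<close> times \<tau>, since
  \<open>\<iota> (ebar u)\<close> is \<open>e u\<close> minus that multiple of \<tau>.\<close>

lemma coord_ebar:
  assumes "u \<in> V" "v \<in> V" shows "coord (ebar u) v = (if v = u then 1 else 0) - m u * co v t"
  using char_npart[OF co gen[OF assms(1)], of v] assms
  by (simp add: coord_def ebar_class[OF _ restrict_char[OF co]] co_gen m_def eq_commute)

lemma frame_\<iota>:
  assumes x: "x \<in> carrier (cohom_dual N 1)"
  shows "\<iota> x = (\<lambda>X. \<Sum>v\<in>V. coord x v * e v X)"
  using frame_G[OF \<iota>_carrier[OF x]] by (simp add: coord_def \<iota>_class[OF co])

lemma frame_N:
  assumes x: "x \<in> carrier (cohom_dual N 1)"
  shows "x = (\<lambda>X. \<Sum>v\<in>V. coord x v * ebar v X)"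
  using r_lincomb[where I = V and c = "coord x" and w = e] r_\<iota>[OF x] frame_\<iota>[OF x] by (simp add: ebar_def)

lemma coord_contraction:
  assumes x: "x \<in> carrier (cohom_dual N 1)"
  shows "(\<Sum>v\<in>V. m v * coord x v) = 0"
proof -
  have "char_class N \<chi>' = char_class N (\<lambda>g. \<Sum>v\<in>V. m v * co v g)"
    by (rule char_class_cong) (simp add: \<chi>'_sum K_carrier)
  then have "(\<Sum>v\<in>V. m v * coord x v) = x (char_class N \<chi>')"
    using cohom_dual_1_lincomb[OF group_N x V, where a = co and c = m] restrict_char[OF co] by (simp add: coord_def)
  then show ?thesis using N_char_vanish[OF x] by simp
qed

text \<open>A matrix whose only nonzero entry sits at a non-adjacent pair is trivially symmetric on
  edges, so \<open>heis\<close> provides a primitive.\<close>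

lemma cup_nonadj:
  assumes "u \<in> V" "v \<in> V" "\<not> adj u v"
  shows "\<exists>A. \<forall>x\<in>carrier G. \<forall>y\<in>carrier G. co u x * co v y = A x + A y - A (x \<otimes>\<^bsub>G\<^esub> y)"
proof -
  define M where "M a b = (if a = u then 1 else 0) * (if b = v then 1 else (0::rat))" for a b
  have "M a b = M b a" if "adj a b" for a b using that assms adj_sym[OF that] by (auto simp: M_def)
  then obtain A where A: "\<And>x y. x \<in> carrier G \<Longrightarrow> y \<in> carrier G \<Longrightarrow>
      A (x \<otimes>\<^bsub>G\<^esub> y) = A x + A y - bilin V M (\<lambda>v. co v x) (\<lambda>v. co v y)"
    using heis[of M] by blast
  have "bilin V M (\<lambda>v. co v x) (\<lambda>v. co v y) = co u x * co v y" for x y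
    unfolding M_def[abs_def] bilin_co_split using V assms by (simp add: if_distrib[of "\<lambda>c. c * _"] cong: if_cong)
  then show ?thesis using A by (intro exI[of _ A]) simp
qed

subsection \<open>The derivation induced by the stable letter\<close>

definition tri_x :: "'v \<times> 'v \<times> 'v \<Rightarrow> 'g hdual" where "tri_x T = (\<lambda>X. \<Sum>v\<in>V. tri_fst T v * ebar v X)"
definition tri_y :: "'v \<times> 'v \<times> 'v \<Rightarrow> 'g hdual" where "tri_y T = (\<lambda>X. \<Sum>v\<in>V. tri_snd T v * ebar v X)"

lemma tri_carrier: "tri_x T \<in> carrier (cohom_dual N 1)" "tri_y T \<in> carrier (cohom_dual N 1)"
  by (auto simp: tri_x_def tri_y_def intro!: JN.V_sum_closed ebar_carrier)

text \<open>The exponents are such that \<chi> vanishes on \<open>g\<close>, and the class of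
  \<open>g\<close> is \<open>m s\<close> times \<open>x\<close>. Thus a rational combination of
  generators is realised, up to a scalar, by an element of \<open>N\<close>.\<close>

lemma tri_element:
  assumes uv: "u \<in> V" "s \<in> V" and ms: "m s \<noteq> 0" and x: "x \<in> carrier (cohom_dual N 1)"
    and xf: "\<And>\<phi>. x (char_class N \<phi>) = ebar u (char_class N \<phi>) - m u / m s * ebar s (char_class N \<phi>)"
    and g: "g = gen u [^]\<^bsub>G\<^esub> \<chi> (gen s) \<otimes>\<^bsub>G\<^esub> gen s [^]\<^bsub>G\<^esub> (- \<chi> (gen u))"
  shows "g \<in> K" "x = (\<lambda>X. (1 / m s) * eval_char N g X)"
proof -
  have pw: "a (gen w [^]\<^bsub>G\<^esub> (k::int)) = of_int k * a (gen w)" if "w \<in> V" "a \<in> group_chars G" for w k a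
    by (rule group_chars_int_pow[OF G that(2) gen[OF that(1)]])
  have gc: "gen u [^]\<^bsub>G\<^esub> (k::int) \<in> carrier G" "gen s [^]\<^bsub>G\<^esub> (k::int) \<in> carrier G" for k
    using gen uv by auto
  have ag: "a g = m s * a (gen u) - m u * a (gen s)" if a: "a \<in> group_chars G" for a
  proof -
    have "a g = a (gen u [^]\<^bsub>G\<^esub> \<chi> (gen s)) + a (gen s [^]\<^bsub>G\<^esub> (- \<chi> (gen u)))"
      unfolding g using a gc by (auto simp: group_chars_def)
    then show ?thesis using pw[OF uv(1) a] pw[OF uv(2) a] by (simp add: m_def \<chi>'_def)
  qed
  have "\<chi>' g = 0" using ag[OF \<chi>'_char] by (simp add: m_def)
  then show gK: "g \<in> K" using gc by (simp add: K_iff \<chi>'_def) (simp add: g)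
  show "x = (\<lambda>X. (1 / m s) * eval_char N g X)"
  proof (rule cohom_dual_1_ext[OF group_N x])
    show "(\<lambda>X. (1 / m s) * eval_char N g X) \<in> carrier (cohom_dual N 1)"
      using gK by (intro JN.V_closed eval_char_carrier[OF group_N]) simp
    fix \<phi> assume \<phi>: "\<phi> \<in> group_chars N"
    have "\<phi> g = m s * \<phi> (npart (gen u)) - m u * \<phi> (npart (gen s))"
      using ag[OF extend_char[OF \<phi>]] npart_N[OF gK] by simp
    then show "x (char_class N \<phi>) = (1 / m s) * eval_char N g (char_class N \<phi>)"
      using ms uv gK \<phi> by (simp add: xf ebar_class eval_char_class[OF group_N] field_simps)
  qed
qed

text \<open>The elements \<open>g\<close> and \<open>h\<close> that realise the two factors are
  words in three pairwise commuting generators, so \<open>commuting_pair_nabla_rel\<close> applies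
  to them in \<open>N\<close>.\<close>

lemma triangle_relation:
  assumes T: "T \<in> triangles"
  shows "mag_gen (tri_x T) \<star> mag_gen (tri_y T) \<in> hol_ideal N"
proof -
  obtain p q s where pqs: "T = (p, q, s)" "adj p q" "adj q s" "adj p s" "m s \<noteq> 0"
    using T by (auto simp: triangles_def)
  have PV: "p \<in> V" "q \<in> V" "s \<in> V" using adj_V pqs by auto
  define g where "g = gen p [^]\<^bsub>G\<^esub> \<chi> (gen s) \<otimes>\<^bsub>G\<^esub> gen s [^]\<^bsub>G\<^esub> (- \<chi> (gen p))"
  define h where "h = gen q [^]\<^bsub>G\<^esub> \<chi> (gen s) \<otimes>\<^bsub>G\<^esub> gen s [^]\<^bsub>G\<^esub> (- \<chi> (gen q))"
  have gx: "g \<in> K" "tri_x T = (\<lambda>X. (1 / m s) * eval_char N g X)"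
  proof -
    have "tri_x T (char_class N \<phi>) = ebar p (char_class N \<phi>) - m p / m s * ebar s (char_class N \<phi>)" for \<phi>
      unfolding tri_x_def pqs(1) by (rule tri_sum(1)[OF PV(1,3)])
    from tri_element[OF PV(1,3) pqs(5) tri_carrier(1) this g_def]
    show "g \<in> K" "tri_x T = (\<lambda>X. (1 / m s) * eval_char N g X)" by auto
  qed
  have hy: "h \<in> K" "tri_y T = (\<lambda>X. (1 / m s) * eval_char N h X)"
  proof -
    have "tri_y T (char_class N \<phi>) = ebar q (char_class N \<phi>) - m q / m s * ebar s (char_class N \<phi>)" for \<phi>
      unfolding tri_y_def pqs(1) by (rule tri_sum(2)[OF PV(2,3)])
    from tri_element[OF PV(2,3) pqs(5) tri_carrier(2) this h_def]
    show "h \<in> K" "tri_y T = (\<lambda>X. (1 / m s) * eval_char N h X)" by auto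
  qed
  have pw: "gen a [^]\<^bsub>G\<^esub> (i::int) \<otimes>\<^bsub>G\<^esub> gen b [^]\<^bsub>G\<^esub> (j::int) = gen b [^]\<^bsub>G\<^esub> j \<otimes>\<^bsub>G\<^esub> gen a [^]\<^bsub>G\<^esub> i"
    if "a \<in> V" "b \<in> V" "adj a b \<or> a = b" for a b i j
  proof -
    have c: "gen a \<otimes>\<^bsub>G\<^esub> gen b = gen b \<otimes>\<^bsub>G\<^esub> gen a" using that gen_commute by auto
    have "gen a [^]\<^bsub>G\<^esub> i \<otimes>\<^bsub>G\<^esub> gen b = gen b \<otimes>\<^bsub>G\<^esub> gen a [^]\<^bsub>G\<^esub> i"
      using that gen by (intro commute_int_pow[OF G _ _ c]) auto
    then show ?thesis
      using that gen by (intro commute_int_pow[OF G, of "gen b" "gen a [^]\<^bsub>G\<^esub> i" j, symmetric]) auto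
  qed
  have comm4: "(a \<otimes>\<^bsub>G\<^esub> b) \<otimes>\<^bsub>G\<^esub> (c \<otimes>\<^bsub>G\<^esub> d) = (c \<otimes>\<^bsub>G\<^esub> d) \<otimes>\<^bsub>G\<^esub> (a \<otimes>\<^bsub>G\<^esub> b)"
    if "a \<in> carrier G" "b \<in> carrier G" "c \<in> carrier G" "d \<in> carrier G"
      "a \<otimes>\<^bsub>G\<^esub> c = c \<otimes>\<^bsub>G\<^esub> a" "a \<otimes>\<^bsub>G\<^esub> d = d \<otimes>\<^bsub>G\<^esub> a" "b \<otimes>\<^bsub>G\<^esub> c = c \<otimes>\<^bsub>G\<^esub> b" "b \<otimes>\<^bsub>G\<^esub> d = d \<otimes>\<^bsub>G\<^esub> b"
    for a b c d
  proof -
    have "(a \<otimes>\<^bsub>G\<^esub> b) \<otimes>\<^bsub>G\<^esub> (c \<otimes>\<^bsub>G\<^esub> d) = a \<otimes>\<^bsub>G\<^esub> (b \<otimes>\<^bsub>G\<^esub> c) \<otimes>\<^bsub>G\<^esub> d" using that(1-4) by (simp add: G.m_assoc)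
    also have "\<dots> = (a \<otimes>\<^bsub>G\<^esub> c) \<otimes>\<^bsub>G\<^esub> (b \<otimes>\<^bsub>G\<^esub> d)" unfolding that(7) using that(1-4) by (simp add: G.m_assoc)
    also have "\<dots> = c \<otimes>\<^bsub>G\<^esub> (a \<otimes>\<^bsub>G\<^esub> d) \<otimes>\<^bsub>G\<^esub> b" unfolding that(5,8) using that(1-4) by (simp add: G.m_assoc)
    also have "\<dots> = (c \<otimes>\<^bsub>G\<^esub> d) \<otimes>\<^bsub>G\<^esub> (a \<otimes>\<^bsub>G\<^esub> b)" unfolding that(6) using that(1-4) by (simp add: G.m_assoc)
    finally show ?thesis .
  qed
  have "g \<otimes>\<^bsub>G\<^esub> h = h \<otimes>\<^bsub>G\<^esub> g"
    unfolding g_def h_def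
    using PV gen pqs adj_sym by (intro comm4 pw) auto
  then have "mag_gen (eval_char N g) \<star> mag_gen (eval_char N h) \<in> hol_ideal N"
    using gx(1) hy(1) by (intro nabla_rels_hol_ideal commuting_pair_nabla_rel[OF group_N]) simp_all
  then have "fscale (1 / m s) (mag_gen (eval_char N g)) \<star> fscale (1 / m s) (mag_gen (eval_char N h)) \<in> hol_ideal N"
    by (simp add: mag_mult_simps JN.J_fscale)
  moreover have "mag_gen (tri_x T) \<star> mag_gen (tri_y T)
      - fscale (1 / m s) (mag_gen (eval_char N g)) \<star> fscale (1 / m s) (mag_gen (eval_char N h)) \<in> hol_ideal N"
    unfolding gx(2) hy(2)
    using gx(1) hy(1)
    by (intro JN.J_mult_cong JN.J_gen_scale eval_char_carrier[OF group_N] free_carrier_fscale free_carrier_gen JN.V_closed) simp_all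
  ultimately show ?thesis using JN.J_mem_cong by blast
qed

text \<open>\<open>exact_2_primal\<close> expands the antisymmetric part of \<open>c\<close> in
  triangle vectors. The congruence is modulo the Lie ideal only, because \<open>D\<close> will be
  applied to it before \<open>D\<close> is known to preserve \<open>hol_ideal N\<close>.\<close>

lemma wedge_triangles:
  assumes supp: "\<And>u v. \<not> adj u v \<Longrightarrow> c u v - c v u = 0"
    and c: "\<And>v. v \<in> V \<Longrightarrow> (\<Sum>u\<in>V. m u * (c u v - c v u)) = 0"
  shows "\<exists>k. wedge V ebar c - (\<Sum>T\<in>triangles. fscale (k T) (mag_gen (tri_x T) \<star> mag_gen (tri_y T)))
    \<in> lie_ideal (cohom_dual N 1)"
proof -
  interpret I: fun_lie_kernel "cohom_dual N 1" "lie_ideal (cohom_dual N 1)" by (rule fun_lie_kernel_lie_ideal)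
  have "\<exists>k. \<forall>u\<in>V. \<forall>v\<in>V. c u v - c v u =
    (\<Sum>T\<in>triangles. k T * (tri_fst T u * tri_snd T v - tri_fst T v * tri_snd T u))"
    by (rule exact_2_primal) (use supp c in auto)
  then obtain k where k: "\<And>u v. u \<in> V \<Longrightarrow> v \<in> V \<Longrightarrow> c u v - c v u =
    (\<Sum>T\<in>triangles. k T * (tri_fst T u * tri_snd T v - tri_fst T v * tri_snd T u))" by blast
  define c' where "c' u v = (\<Sum>T\<in>triangles. k T * (tri_fst T u * tri_snd T v))" for u v
  have w1: "wedge V ebar c - wedge V ebar c' \<in> lie_ideal (cohom_dual N 1)"
    by (rule I.wedge_antisym_cong[OF ebar_carrier])
      (simp_all add: k c'_def sum_subtractf[symmetric] right_diff_distrib)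
  have w2: "wedge V ebar c' = (\<Sum>T\<in>triangles. fscale (k T) (wedge V ebar (\<lambda>u v. tri_fst T u * tri_snd T v)))"
    unfolding c'_def[abs_def] by (simp add: I.wedge_linear)
  have w3: "(\<Sum>T\<in>triangles. fscale (k T) (wedge V ebar (\<lambda>u v. tri_fst T u * tri_snd T v)))
      - (\<Sum>T\<in>triangles. fscale (k T) (mag_gen (tri_x T) \<star> mag_gen (tri_y T))) \<in> lie_ideal (cohom_dual N 1)"
  proof (rule I.J_sum_cong)
    fix T
    have "mag_gen (tri_x T) \<star> mag_gen (tri_y T) - wedge V ebar (\<lambda>u v. tri_fst T u * tri_snd T v) \<in> lie_ideal (cohom_dual N 1)"
      by (rule I.gen_mult_wedge[OF V ebar_carrier]) (simp_all add: tri_x_def tri_y_def)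
    then have "wedge V ebar (\<lambda>u v. tri_fst T u * tri_snd T v) - mag_gen (tri_x T) \<star> mag_gen (tri_y T) \<in> lie_ideal (cohom_dual N 1)"
      by (rule I.J_commute)
    then show "fscale (k T) (wedge V ebar (\<lambda>u v. tri_fst T u * tri_snd T v))
        - fscale (k T) (mag_gen (tri_x T) \<star> mag_gen (tri_y T)) \<in> lie_ideal (cohom_dual N 1)"
      by (simp only: fscale_diff_right[symmetric] I.J_fscale)
  qed
  show ?thesis using I.J_trans[OF w1[unfolded w2] w3] by blast
qed

text \<open>An edge combination with zero contraction represents the zero vector; that its quadratic
  element is a relation makes the bracket with \<tau> well defined.\<close>

lemma wedge_relation:
  assumes "\<And>u v. \<not> adj u v \<Longrightarrow> c u v = 0" "\<And>v. v \<in> V \<Longrightarrow> (\<Sum>u\<in>V. m u * (c u v - c v u)) = 0"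
  shows "wedge V ebar c \<in> hol_ideal N"
proof -
  have "c u v - c v u = 0" if "\<not> adj u v" for u v using that assms(1) adj_sym by (metis diff_self)
  then obtain k where "wedge V ebar c - (\<Sum>T\<in>triangles. fscale (k T) (mag_gen (tri_x T) \<star> mag_gen (tri_y T)))
    \<in> lie_ideal (cohom_dual N 1)" using wedge_triangles[of c] assms(2) by blast
  then have "wedge V ebar c - (\<Sum>T\<in>triangles. fscale (k T) (mag_gen (tri_x T) \<star> mag_gen (tri_y T))) \<in> hol_ideal N"
    by (rule lie_ideal_hol_ideal)
  moreover have "(\<Sum>T\<in>triangles. fscale (k T) (mag_gen (tri_x T) \<star> mag_gen (tri_y T))) \<in> hol_ideal N"
    by (intro JN.J_sum JN.J_fscale triangle_relation)
  ultimately show ?thesis by (rule JN.J_mem_cong)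
qed

text \<open>A choice of edge combination whose contraction gives the coordinates of
  \<open>x\<close>. It is not made linearly; \<open>D0_eq\<close> removes the dependence on it
  modulo relations.\<close>

definition edge_coeffs :: "'g hdual \<Rightarrow> 'v \<Rightarrow> 'v \<Rightarrow> rat" where
  "edge_coeffs x = (SOME c. (\<forall>u w. \<not> adj u w \<longrightarrow> c u w = 0) \<and>
     (\<forall>v\<in>V. coord x v = (\<Sum>u\<in>V. m u * (c u v - c v u))))"

lemma edge_coeffs:
  assumes x: "x \<in> carrier (cohom_dual N 1)"
  shows "\<not> adj u w \<Longrightarrow> edge_coeffs x u w = 0"
    "v \<in> V \<Longrightarrow> coord x v = (\<Sum>u\<in>V. m u * (edge_coeffs x u v - edge_coeffs x v u))"
  using someI_ex[OF exact_1_primal[OF coord_contraction[OF x]]] unfolding edge_coeffs_def by blast+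

text \<open>\<open>D0 x\<close> is the bracket of \<open>\<tau>\<close> with \<open>x\<close>: it is read off from the relations
  \<open>[e u, e v] = 0\<close> on edges, where \<open>e v = \<iota> (ebar v) + m v \<tau>\<close>.\<close>

definition D0 :: "'g hdual \<Rightarrow> ('g hdual magma \<Rightarrow>\<^sub>0 rat)" where
  "D0 x = - wedge V ebar (edge_coeffs x)"

text \<open>Two edge combinations with the same contraction differ by one to which
  \<open>wedge_relation\<close> applies. Values of \<open>D0\<close> can therefore be computed from
  any convenient \<open>c\<close>.\<close>

lemma D0_eq:
  assumes x: "x \<in> carrier (cohom_dual N 1)" and c: "\<And>u v. \<not> adj u v \<Longrightarrow> c u v = 0"
    "\<And>v. v \<in> V \<Longrightarrow> coord x v = (\<Sum>u\<in>V. m u * (c u v - c v u))"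
  shows "D0 x + wedge V ebar c \<in> hol_ideal N"
proof -
  have "wedge V ebar (\<lambda>u v. c u v - edge_coeffs x u v) \<in> hol_ideal N"
  proof (rule wedge_relation)
    fix v assume v: "v \<in> V"
    have "(\<Sum>u\<in>V. m u * (c u v - edge_coeffs x u v - (c v u - edge_coeffs x v u))) =
        (\<Sum>u\<in>V. m u * (c u v - c v u)) - (\<Sum>u\<in>V. m u * (edge_coeffs x u v - edge_coeffs x v u))"
      by (simp add: sum_subtractf[symmetric] algebra_simps)
    then show "(\<Sum>u\<in>V. m u * (c u v - edge_coeffs x u v - (c v u - edge_coeffs x v u))) = 0"
      using c(2)[OF v] edge_coeffs(2)[OF x v] by simp
  qed (simp add: c(1) edge_coeffs(1)[OF x])
  then show ?thesis by (simp add: D0_def JN.wedge_linear)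
qed

lemma D0_closed: "D0 x \<in> hol_gens N"
  unfolding D0_def by (intro free_carrier_uminus JN.wedge_closed ebar_carrier)

lemma D0_add:
  assumes "x \<in> carrier (cohom_dual N 1)" "y \<in> carrier (cohom_dual N 1)"
  shows "D0 (\<lambda>X. x X + y X) - (D0 x + D0 y) \<in> hol_ideal N"
proof -
  have "D0 (\<lambda>X. x X + y X) + wedge V ebar (\<lambda>u v. edge_coeffs x u v + edge_coeffs y u v) \<in> hol_ideal N"
  proof (rule D0_eq)
    show "(\<lambda>X. x X + y X) \<in> carrier (cohom_dual N 1)" by (intro JN.V_closed assms)
    fix v assume v: "v \<in> V"
    have "coord (\<lambda>X. x X + y X) v = coord x v + coord y v" by (simp add: coord_def)
    then show "coord (\<lambda>X. x X + y X) v = (\<Sum>u\<in>V. m u * (edge_coeffs x u v + edge_coeffs y u v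
        - (edge_coeffs x v u + edge_coeffs y v u)))"
      unfolding edge_coeffs(2)[OF assms(1) v] edge_coeffs(2)[OF assms(2) v]
      by (simp add: sum.distrib[symmetric] algebra_simps)
  qed (simp add: edge_coeffs(1) assms)
  then show ?thesis by (simp add: JN.wedge_linear D0_def algebra_simps)
qed

lemma D0_scale:
  assumes "x \<in> carrier (cohom_dual N 1)"
  shows "D0 (\<lambda>X. k * x X) - fscale k (D0 x) \<in> hol_ideal N"
proof -
  have "D0 (\<lambda>X. k * x X) + wedge V ebar (\<lambda>u v. k * edge_coeffs x u v) \<in> hol_ideal N"
  proof (rule D0_eq)
    show "(\<lambda>X. k * x X) \<in> carrier (cohom_dual N 1)" by (intro JN.V_closed assms)
    fix v assume v: "v \<in> V"
    have "coord (\<lambda>X. k * x X) v = k * coord x v" by (simp add: coord_def)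
    then show "coord (\<lambda>X. k * x X) v = (\<Sum>u\<in>V. m u * (k * edge_coeffs x u v - k * edge_coeffs x v u))"
      unfolding edge_coeffs(2)[OF assms v] by (simp add: sum_distrib_left algebra_simps)
  qed (simp add: edge_coeffs(1) assms)
  then show ?thesis by (simp add: JN.wedge_linear D0_def fscale_minus_right algebra_simps)
qed

definition D where "D = free_deriv D0"

lemma D_closed: "p \<in> hol_gens N \<Longrightarrow> D p \<in> hol_gens N"
  unfolding D_def by (rule free_deriv_closed[OF D0_closed])

text \<open>As \<open>s\<close> and \<open>u\<close> commute, \<open>e s\<close> should commute with
  \<open>x\<close>; since \<open>e s\<close> is \<open>\<iota> (ebar s)\<close> plus
  \<open>m s\<close> times \<tau>, the bracket with \<tau> is \<open>- 1 / m s\<close> times that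
  with \<open>ebar s\<close>. The edge from \<open>s\<close> to \<open>u\<close> with coefficient
  \<open>1 / m s\<close> has contraction \<open>x\<close>.\<close>

lemma D0_triangle:
  assumes uv: "u \<in> V" "adj s u" "m s \<noteq> 0" and x: "x = (\<lambda>X. ebar u X + (- (m u / m s)) * ebar s X)"
  shows "D0 x + fscale (1 / m s) (mag_gen (ebar s) \<star> mag_gen x) \<in> hol_ideal N"
proof -
  have s: "s \<in> V" using adj_V uv by auto
  have xc: "x \<in> carrier (cohom_dual N 1)" unfolding x by (intro JN.V_closed ebar_carrier uv s)
  let ?S = "mag_gen (ebar s)" and ?U = "mag_gen (ebar u)"
  define c where "c a b = (if a = s \<and> b = u then 1 / m s else 0)" for a b
  have "D0 x + wedge V ebar c \<in> hol_ideal N"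
  proof (rule D0_eq[OF xc])
    show "c a b = 0" if "\<not> adj a b" for a b using that uv by (auto simp: c_def)
    fix v assume v: "v \<in> V"
    have "coord x v = coord (ebar u) v - m u / m s * coord (ebar s) v" by (simp add: x coord_def)
    also have "\<dots> = (if v = u then 1 else 0) - m u / m s * (if v = s then 1 else 0)"
      using uv s v by (simp add: coord_ebar field_simps)
    also have "\<dots> = (\<Sum>a\<in>V. if a = s then if v = u then 1 else 0 else 0)
        - (\<Sum>a\<in>V. if a = u then if v = s then m u / m s else 0 else 0)"
      using V s uv by simp
    also have "\<dots> = (\<Sum>a\<in>V. m a * (c a v - c v a))"
      unfolding sum_subtractf[symmetric] using uv(3) by (intro sum.cong HOL.refl) (auto simp: c_def field_simps)
    finally show "coord x v = (\<Sum>a\<in>V. m a * (c a v - c v a))" .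
  qed
  moreover have "wedge V ebar c = fscale (1 / m s) (?S \<star> ?U)"
  proof -
    have "wedge V ebar c = (\<Sum>a\<in>V. if a = s then (\<Sum>b\<in>V. if b = u then fscale (1 / m s) (?S \<star> ?U) else 0) else 0)"
      unfolding JN.wedge_def by (intro sum.cong HOL.refl) (auto simp: c_def fscale_zero_left intro!: sum.cong sum.neutral)
    then show ?thesis using V s uv by simp
  qed
  ultimately have 1: "D0 x + fscale (1 / m s) (?S \<star> ?U) \<in> hol_ideal N" by simp
  \<comment> \<open>Passing from \<open>ebar u\<close> to \<open>x\<close> adds a multiple of
    \<open>ebar s\<close>, whose bracket with \<open>ebar s\<close> vanishes.\<close>
  have "mag_gen x - (?U + mag_gen (\<lambda>X. (- (m u / m s)) * ebar s X)) \<in> hol_ideal N"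
    unfolding x by (intro JN.J_gen_plus JN.V_closed ebar_carrier uv s)
  moreover have "mag_gen (\<lambda>X. (- (m u / m s)) * ebar s X) - fscale (- (m u / m s)) ?S \<in> hol_ideal N"
    by (intro JN.J_gen_scale ebar_carrier s)
  ultimately have "mag_gen x - (?U + mag_gen (\<lambda>X. (- (m u / m s)) * ebar s X))
      + (mag_gen (\<lambda>X. (- (m u / m s)) * ebar s X) - fscale (- (m u / m s)) ?S) \<in> hol_ideal N"
    by (rule JN.J_add)
  then have "mag_gen x - ?U - fscale (- (m u / m s)) ?S \<in> hol_ideal N" by (simp add: algebra_simps)
  from JN.J_mult_right[OF this free_carrier_gen[OF ebar_carrier[OF s]]]
  have "?S \<star> mag_gen x - ?S \<star> ?U - fscale (- (m u / m s)) (?S \<star> ?S) \<in> hol_ideal N"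
    by (simp add: mag_mult_simps)
  moreover have "fscale (- (m u / m s)) (?S \<star> ?S) \<in> hol_ideal N"
    by (intro JN.J_fscale JN.J_square free_carrier_gen ebar_carrier s)
  ultimately have "?S \<star> mag_gen x - ?S \<star> ?U - fscale (- (m u / m s)) (?S \<star> ?S) + fscale (- (m u / m s)) (?S \<star> ?S) \<in> hol_ideal N"
    by (rule JN.J_add)
  then have "fscale (1 / m s) (?S \<star> mag_gen x - ?S \<star> ?U) \<in> hol_ideal N" by (intro JN.J_fscale) simp
  from JN.J_add[OF 1 this] show ?thesis by (simp add: fscale_diff_right)
qed

text \<open>On both factors \<open>D\<close> acts as \<open>- 1 / m s\<close> times left
  multiplication by \<open>ebar s\<close>. By \<open>J_leibniz\<close> it acts in this way on their
  product too, and the product is already a relation.\<close>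

lemma D_triangle:
  assumes T: "T \<in> triangles"
  shows "D (mag_gen (tri_x T) \<star> mag_gen (tri_y T)) \<in> hol_ideal N"
proof -
  obtain p q s where pqs: "T = (p, q, s)" "adj p q" "adj q s" "adj p s" "m s \<noteq> 0"
    using T by (auto simp: triangles_def)
  have PV: "p \<in> V" "q \<in> V" "s \<in> V" using adj_V pqs by auto
  let ?x = "tri_x T" and ?y = "tri_y T"
  let ?X = "mag_gen (tri_x T)" and ?Y = "mag_gen (tri_y T)" and ?S = "mag_gen (ebar s)"
  have F: "?X \<in> hol_gens N" "?Y \<in> hol_gens N" "?S \<in> hol_gens N"
    by (intro free_carrier_gen tri_carrier ebar_carrier PV)+
  have x: "?x = (\<lambda>X. ebar p X + (- (m p / m s)) * ebar s X)"
    using tri_sum(1)[OF PV(1,3), of q] by (simp add: tri_x_def pqs(1))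
  have y: "?y = (\<lambda>X. ebar q X + (- (m q / m s)) * ebar s X)"
    using tri_sum(2)[OF PV(2,3), of p] by (simp add: tri_y_def pqs(1))
  have dx: "D0 ?x + fscale (1 / m s) (?S \<star> ?X) \<in> hol_ideal N"
    by (rule D0_triangle[OF PV(1) adj_sym[OF pqs(4)] pqs(5) x])
  have dy: "D0 ?y + fscale (1 / m s) (?S \<star> ?Y) \<in> hol_ideal N"
    by (rule D0_triangle[OF PV(2) adj_sym[OF pqs(3)] pqs(5) y])
  have "(D0 ?x + fscale (1 / m s) (?S \<star> ?X)) \<star> ?Y + ?X \<star> (D0 ?y + fscale (1 / m s) (?S \<star> ?Y))
      + fscale (1 / m s) (?S \<star> (?X \<star> ?Y) - (?S \<star> ?X \<star> ?Y + ?X \<star> (?S \<star> ?Y)))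
      - fscale (1 / m s) (?S \<star> (?X \<star> ?Y)) \<in> hol_ideal N"
    using F triangle_relation[OF T]
    by (intro JN.J_add JN.J_diff JN.J_fscale JN.J_leibniz JN.J_mult_left[OF dx] JN.J_mult_right[OF dy])
      (auto intro: JN.J_mult_right)
  then show ?thesis
    by (simp add: D_def free_deriv_mult mag_mult_simps fscale_simps algebra_simps)
qed

lemma D0_module_ops:
  "x \<in> carrier (cohom_dual N 1) \<Longrightarrow> y \<in> carrier (cohom_dual N 1) \<Longrightarrow>
    D0 (x \<oplus>\<^bsub>cohom_dual N 1\<^esub> y) - (D0 x + D0 y) \<in> hol_ideal N"
  "x \<in> carrier (cohom_dual N 1) \<Longrightarrow> D0 (k \<odot>\<^bsub>cohom_dual N 1\<^esub> x) - fscale k (D0 x) \<in> hol_ideal N"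
  using D0_add[of x y] D0_scale[of x k] by (simp_all only: cohom_dual_sel plus_fun_def)

lemma D_lie_ideal:
  assumes "p \<in> lie_ideal (cohom_dual N 1)" shows "D p \<in> hol_ideal N"
  unfolding D_def
proof (rule free_deriv_gen_ideal[OF JN.lie_kernel_axioms _ D0_closed D0_module_ops, where R = "{}"])
  show "p \<in> lie_gen_ideal (cohom_dual N 1) {}" using assms by (simp add: lie_gen_ideal_empty)
qed auto

text \<open>In terms of \<open>ebar\<close> the relation has an antisymmetric matrix. Its entries
  vanish off the edges, since those cup products are trivial already in \<open>G\<close>, and its
  contraction with \<open>m\<close> vanishes by \<open>coord_contraction\<close>.\<close>

lemma nabla_rels_N:
  assumes p: "p \<in> nabla_rels N"
  shows "\<exists>k. p - (\<Sum>T\<in>triangles. fscale (k T) (mag_gen (tri_x T) \<star> mag_gen (tri_y T)))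
    \<in> lie_ideal (cohom_dual N 1)"
proof -
  interpret I: fun_lie_kernel "cohom_dual N 1" "lie_ideal (cohom_dual N 1)" by (rule fun_lie_kernel_lie_ideal)
  note ex = nabla_rel_wedge[OF group_N V restrict_char[OF co] ebar_carrier frame_N[unfolded coord_def] p]
  then obtain \<Omega> where \<Omega>: "(\<forall>u v. \<Omega> u v = - \<Omega> v u) \<and>
    (\<forall>c. (\<forall>x\<in>carrier (cohom_dual N 1). (\<Sum>v\<in>V. c v * x (char_class N (co v))) = 0) \<longrightarrow>
       (\<forall>v. (\<Sum>u\<in>V. c u * \<Omega> u v) = 0)) \<and>
    (\<forall>u v. cup_chars N (co u) (co v) \<in> bar_coboundaries N 2 \<longrightarrow> \<Omega> u v = 0) \<and>
    p - wedge V ebar (\<lambda>u v. \<Omega> u v / 2) \<in> lie_ideal (cohom_dual N 1)" by (rule exE)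
  note anti = \<Omega>[THEN conjunct1, rule_format]
  note contr = \<Omega>[THEN conjunct2, THEN conjunct1, rule_format]
  note van = \<Omega>[THEN conjunct2, THEN conjunct2, THEN conjunct1, rule_format]
  note pw = \<Omega>[THEN conjunct2, THEN conjunct2, THEN conjunct2]
  \<comment> \<open>The matrix is cut off outside \<open>V\<close> because the support condition of
    \<open>wedge_triangles\<close> concerns all pairs, whereas \<open>cup_nonadj\<close> speaks
    about vertices.\<close>
  define c where "c u v = (if u \<in> V \<and> v \<in> V then \<Omega> u v / 2 else 0)" for u v
  have cc: "c u v - c v u = (if u \<in> V \<and> v \<in> V then \<Omega> u v else 0)" for u v
    using anti[of v u] by (simp add: c_def)
  have wc: "wedge V ebar c = wedge V ebar (\<lambda>u v. \<Omega> u v / 2)"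
    by (rule I.wedge_cong) (simp add: c_def)
  have "\<exists>k. wedge V ebar c - (\<Sum>T\<in>triangles. fscale (k T) (mag_gen (tri_x T) \<star> mag_gen (tri_y T)))
    \<in> lie_ideal (cohom_dual N 1)"
  proof (rule wedge_triangles)
    show "c u v - c v u = 0" if na: "\<not> adj u v" for u v
    proof (cases "u \<in> V \<and> v \<in> V")
      case True
      then obtain A where "\<forall>x\<in>carrier G. \<forall>y\<in>carrier G. co u x * co v y = A x + A y - A (x \<otimes>\<^bsub>G\<^esub> y)"
        using cup_nonadj[OF _ _ na] by blast
      then have "\<Omega> u v = 0"
        by (intro van cup_chars_coboundary[OF group_N, where A = A]) (simp add: K_carrier)
      then show ?thesis by (simp add: cc)
    qed (auto simp: cc)
    show "(\<Sum>u\<in>V. m u * (c u v - c v u)) = 0" if "v \<in> V" for v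
      using contr[of m v] coord_contraction that by (simp add: cc coord_def)
  qed
  then obtain k where "wedge V ebar (\<lambda>u v. \<Omega> u v / 2)
      - (\<Sum>T\<in>triangles. fscale (k T) (mag_gen (tri_x T) \<star> mag_gen (tri_y T))) \<in> lie_ideal (cohom_dual N 1)"
    unfolding wc by (rule exE)
  with pw show ?thesis by (intro exI[of _ k]) (rule I.J_trans)
qed

lemma D_hol_ideal:
  assumes "p \<in> hol_ideal N" shows "D p \<in> hol_ideal N"
  unfolding D_def
proof (rule free_deriv_gen_ideal[OF JN.lie_kernel_axioms _ D0_closed D0_module_ops])
  show "nabla_rels N \<subseteq> hol_ideal N" using nabla_rels_hol_ideal by auto
  show "p \<in> lie_gen_ideal (cohom_dual N 1) (nabla_rels N)" using assms by (simp add: hol_ideal_def)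
  fix q assume "q \<in> nabla_rels N"
  then obtain k where "q - (\<Sum>T\<in>triangles. fscale (k T) (mag_gen (tri_x T) \<star> mag_gen (tri_y T)))
      \<in> lie_ideal (cohom_dual N 1)" using nabla_rels_N by blast
  from D_lie_ideal[OF this]
  have "D q - (\<Sum>T\<in>triangles. fscale (k T) (D (mag_gen (tri_x T) \<star> mag_gen (tri_y T)))) \<in> hol_ideal N"
    by (simp add: D_def free_deriv_linear)
  moreover have "(\<Sum>T\<in>triangles. fscale (k T) (D (mag_gen (tri_x T) \<star> mag_gen (tri_y T)))) \<in> hol_ideal N"
    by (intro JN.J_sum JN.J_fscale D_triangle)
  ultimately show "free_deriv D0 q \<in> hol_ideal N" unfolding D_def by (rule JN.J_mem_cong)
qed

end

subsection \<open>The splitting\<close>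

text \<open>A functional on generators, extended by zero to brackets; for \<mu> it is the coordinate
  along \<tau>.\<close>

primrec weight_magma :: "('v \<Rightarrow> rat) \<Rightarrow> 'v magma \<Rightarrow> rat" where
  "weight_magma \<mu> (Gen y) = \<mu> y"
| "weight_magma \<mu> (Br s t) = 0"

definition weight :: "('v \<Rightarrow> rat) \<Rightarrow> ('v magma \<Rightarrow>\<^sub>0 rat) \<Rightarrow> rat" where
  "weight \<mu> = lin_eval (weight_magma \<mu>)"

lemma weight_linear:
  "weight \<mu> (p + q) = weight \<mu> p + weight \<mu> q" "weight \<mu> (fscale c p) = c * weight \<mu> p"
  "weight \<mu> (p - q) = weight \<mu> p - weight \<mu> q" "weight \<mu> 0 = 0"
  "weight \<mu> (\<Sum>i\<in>I. f i) = (\<Sum>i\<in>I. weight \<mu> (f i))"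
  by (simp_all add: weight_def lin_eval_add lin_eval_fscale lin_eval_diff lin_eval_sum)

lemma weight_gen [simp]: "weight \<mu> (mag_gen y) = \<mu> y"
  by (simp add: weight_def)

lemma weight_mult [simp]: "weight \<mu> (p \<star> q) = 0"
proof -
  have "weight \<mu> (p \<star> q) = lin_eval (\<lambda>t. 0) (p \<star> q)"
    unfolding weight_def using keys_mag_mult[of p q] by (intro lin_eval_cong) auto
  then show ?thesis by (simp add: lin_eval_def)
qed

lemma weight_gcomp_1: "weight \<mu> p = weight \<mu> (gcomp 1 p)"
proof -
  have "p \<in> {p. weight \<mu> p = weight \<mu> (gcomp 1 p)}"
  proof (rule span_singles_induct)
    fix t
    have "weight_magma \<mu> t = (if bracket_length t = 1 then weight_magma \<mu> t else 0)"
    proof (cases t)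
      case (Br a b)
      then show ?thesis by simp
    qed simp
    then show "Poly_Mapping.single t 1 \<in> {p. weight \<mu> p = weight \<mu> (gcomp 1 p)}"
      by (auto simp: weight_def gcomp_def lin_ext_single fscale_one)
  qed (auto simp: weight_linear gcomp_linear)
  then show ?thesis by simp
qed

context raag_kernel begin

interpretation G: group G by (rule G)
interpretation JN: fun_lie_kernel "cohom_dual N 1" "hol_ideal N" by (rule fun_lie_kernel_hol_ideal)
interpretation JG: fun_lie_kernel "cohom_dual G 1" "hol_ideal G" by (rule fun_lie_kernel_hol_ideal)

abbreviation Mu where "Mu \<equiv> weight \<mu>"

text \<open>\<open>P\<close> and \<open>Mu\<close> lift the two components of the map from \<open>\<hh>(G)\<close> to the semidirect product of
  \<open>\<hh>(N)\<close> and the line spanned by \<open>\<tau>\<close>, which acts on \<open>\<hh>(N)\<close> by \<open>D\<close>.\<close>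

primrec P_magma :: "'g hdual magma \<Rightarrow> ('g hdual magma \<Rightarrow>\<^sub>0 rat)" where
  "P_magma (Gen y) = mag_gen (r y)"
| "P_magma (Br s s') = P_magma s \<star> P_magma s' + fscale (weight_magma \<mu> s) (D (P_magma s'))
     - fscale (weight_magma \<mu> s') (D (P_magma s))"

definition P where "P = lin_ext P_magma"

abbreviation \<Phi> where "\<Phi> \<equiv> mag_map \<iota>"

lemma D_linear:
  "D (p + q) = D p + D q" "D (fscale k p) = fscale k (D p)" "D (p - q) = D p - D q" "D 0 = 0"
  by (simp_all add: D_def free_deriv_linear)

lemma D_mult: "D (p \<star> q) = D p \<star> q + p \<star> D q"
  by (simp add: D_def free_deriv_mult)

lemma P_linear:
  "P (p + q) = P p + P q" "P (fscale k p) = fscale k (P p)" "P (p - q) = P p - P q" "P 0 = 0"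
  "P (\<Sum>i\<in>I. f i) = (\<Sum>i\<in>I. P (f i))"
  by (simp_all add: P_def lin_ext_add lin_ext_fscale lin_ext_diff lin_ext_sum)

lemma P_gen [simp]: "P (mag_gen y) = mag_gen (r y)"
  by (simp add: P_def lin_ext_single fscale_one)

text \<open>The bracket of the semidirect product, in its first component; the second component of a
  bracket is 0 by \<open>weight_mult\<close>.\<close>

lemma P_mult: "P (p \<star> q) = P p \<star> P q + fscale (Mu p) (D (P q)) - fscale (Mu q) (D (P p))"
  by (rule bilinear_eqI[where b = "\<lambda>p q. P (p \<star> q)"
        and b' = "\<lambda>p q. P p \<star> P q + fscale (Mu p) (D (P q)) - fscale (Mu q) (D (P p))"])
    (simp_all add: mag_mult_simps P_linear D_linear weight_linear fscale_simps mult_ac flip: single_Br,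
      simp add: P_def lin_ext_single fscale_one weight_def)

lemma P_closed: "p \<in> hol_gens G \<Longrightarrow> P p \<in> hol_gens N"
  by (induction rule: free_carrier_induct)
    (auto simp: P_linear P_mult r_carrier intro!: free_carrier_add free_carrier_diff free_carrier_mult D_closed)

lemma \<Phi>_closed: "p \<in> hol_gens N \<Longrightarrow> \<Phi> p \<in> hol_gens G"
  by (rule mag_map_closed[where X = "carrier (cohom_dual N 1)"]) (rule \<iota>_carrier)

lemma \<mu>_linear:
  assumes "y \<in> carrier (cohom_dual G 1)" "z \<in> carrier (cohom_dual G 1)"
  shows "\<mu> (\<lambda>X. y X + z X) = \<mu> y + \<mu> z" "\<mu> (\<lambda>X. k * y X) = k * \<mu> y"
  by (simp_all add: \<mu>_def)

lemma Mu_\<Phi>: "p \<in> hol_gens N \<Longrightarrow> Mu (\<Phi> p) = 0"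
  by (induction rule: free_carrier_induct) (auto simp: mag_map_linear mag_map_mult weight_linear \<mu>_\<iota>)

lemma P_\<Phi>: "p \<in> hol_gens N \<Longrightarrow> P (\<Phi> p) = p"
  by (induction rule: free_carrier_induct)
    (simp_all add: mag_map_linear mag_map_mult P_linear P_mult Mu_\<Phi> fscale_zero_left r_\<iota>)

lemma edge_relation: "adj u v \<Longrightarrow> mag_gen (e u) \<star> mag_gen (e v) \<in> hol_ideal G"
  unfolding e_def
  by (intro nabla_rels_hol_ideal commuting_pair_nabla_rel[OF G] gen gen_commute) (auto dest: adj_V)

text \<open>The single edge from \<open>u\<close> to \<open>v\<close> has contraction
  \<open>z\<close>, so \<open>D0_eq\<close> identifies \<open>D0 z\<close> with minus the product of
  \<open>ebar u\<close> and \<open>ebar v\<close>. The terms of \<open>P\<close> that involve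
  \<open>D\<close> add up to \<open>D0 z\<close>.\<close>

lemma P_edge:
  assumes uv: "adj u v"
  shows "P (mag_gen (e u) \<star> mag_gen (e v)) \<in> hol_ideal N"
proof -
  have V': "u \<in> V" "v \<in> V" using adj_V[OF uv] by auto
  note eb = ebar_carrier[OF V'(1)] ebar_carrier[OF V'(2)]
  define z where "z = (\<lambda>X. m u * ebar v X + (- m v) * ebar u X)"
  have zc: "z \<in> carrier (cohom_dual N 1)" unfolding z_def by (intro JN.V_closed eb)
  define c where "c a b = (if a = u \<and> b = v then 1 else (0::rat))" for a b
  have "D0 z + wedge V ebar c \<in> hol_ideal N"
  proof (rule D0_eq[OF zc])
    show "c a b = 0" if "\<not> adj a b" for a b using that uv by (auto simp: c_def)
    fix w assume w: "w \<in> V"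
    have "coord z w = m u * coord (ebar v) w - m v * coord (ebar u) w" by (simp add: z_def coord_def)
    also have "\<dots> = (if w = v then m u else 0) - (if w = u then m v else 0)"
      using V' w by (simp add: coord_ebar algebra_simps)
    also have "\<dots> = (\<Sum>a\<in>V. if a = u then if w = v then m u else 0 else 0)
        - (\<Sum>a\<in>V. if a = v then if w = u then m v else 0 else 0)"
      using V V' by simp
    also have "\<dots> = (\<Sum>a\<in>V. m a * (c a w - c w a))"
      unfolding sum_subtractf[symmetric] by (intro sum.cong HOL.refl) (auto simp: c_def)
    finally show "coord z w = (\<Sum>a\<in>V. m a * (c a w - c w a))" .
  qed
  moreover have "wedge V ebar c = mag_gen (ebar u) \<star> mag_gen (ebar v)"
  proof -
    have "wedge V ebar c = (\<Sum>a\<in>V. if a = u then (\<Sum>b\<in>V. if b = v then mag_gen (ebar u) \<star> mag_gen (ebar v) else 0) else 0)"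
      unfolding JN.wedge_def
      by (intro sum.cong HOL.refl) (auto simp: c_def fscale_zero_left fscale_one intro!: sum.cong sum.neutral)
    then show ?thesis using V V' by simp
  qed
  ultimately have 1: "D0 z + mag_gen (ebar u) \<star> mag_gen (ebar v) \<in> hol_ideal N" by simp
  have "D0 z - (D0 (\<lambda>X. m u * ebar v X) + D0 (\<lambda>X. (- m v) * ebar u X))
      + (D0 (\<lambda>X. m u * ebar v X) - fscale (m u) (D0 (ebar v)))
      + (D0 (\<lambda>X. (- m v) * ebar u X) - fscale (- m v) (D0 (ebar u))) \<in> hol_ideal N"
    unfolding z_def by (intro JN.J_add D0_add D0_scale JN.V_closed eb)
  then have "D0 z - fscale (m u) (D0 (ebar v)) - fscale (- m v) (D0 (ebar u)) \<in> hol_ideal N"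
    by (simp add: algebra_simps)
  from JN.J_diff[OF 1 this]
  show ?thesis
    using V' by (simp add: P_mult \<mu>_e D_def fscale_minus_left algebra_simps flip: ebar_def)
qed

lemma lie_kernel_P: "lie_kernel (cohom_dual G 1) {p \<in> hol_gens G. P p \<in> hol_ideal N \<and> Mu p = 0}"
  (is "lie_kernel _ ?K")
proof (rule lie_kernel.intro)
  show "module Rat (cohom_dual G 1)" by (rule module_cohom_dual)
  show "algebra_ideal (free_nonassoc (carrier (cohom_dual G 1))) ?K"
    unfolding algebra_ideal_free_iff
    by (auto simp: P_linear P_mult weight_linear fscale_zero_left P_closed
        intro!: JN.J_add JN.J_diff JN.J_fscale D_hol_ideal intro: JN.J_mult_left JN.J_mult_right)
  show "lie_relators (cohom_dual G 1) \<subseteq> ?K"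
  proof
    fix x assume x: "x \<in> lie_relators (cohom_dual G 1)"
    have "P x \<in> hol_ideal N \<and> Mu x = 0"
      using x unfolding lie_relators_def
    proof (elim UnE CollectE exE conjE)
      fix v w assume *: "x = mag_gen (v \<oplus>\<^bsub>cohom_dual G 1\<^esub> w) - mag_gen v - mag_gen w"
        "v \<in> carrier (cohom_dual G 1)" "w \<in> carrier (cohom_dual G 1)"
      have "v \<oplus>\<^bsub>cohom_dual G 1\<^esub> w = (\<lambda>X. v X + w X)" by (simp add: cohom_dual_sel plus_fun_def)
      then show ?thesis
        using JN.J_gen_plus[OF r_carrier[OF *(2)] r_carrier[OF *(3)]] \<mu>_linear(1)[OF *(2,3)]
        by (simp add: *(1) P_linear weight_linear r_linear diff_diff_eq)
    next
      fix k v assume *: "x = mag_gen (k \<odot>\<^bsub>cohom_dual G 1\<^esub> v) - fscale k (mag_gen v)" "v \<in> carrier (cohom_dual G 1)"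
      have "k \<odot>\<^bsub>cohom_dual G 1\<^esub> v = (\<lambda>X. k * v X)" by (simp add: cohom_dual_sel)
      then show ?thesis
        using JN.J_gen_scale[OF r_carrier[OF *(2)], of k] \<mu>_linear(2)[OF *(2,2)]
        by (simp add: *(1) P_linear weight_linear r_linear)
    next
      fix p assume *: "x = p \<star> p" "p \<in> hol_gens G"
      then show ?thesis by (simp add: P_mult JN.J_square P_closed)
    next
      fix p q s assume *: "x = p \<star> (q \<star> s) + q \<star> (s \<star> p) + s \<star> (p \<star> q)" "p \<in> hol_gens G" "q \<in> hol_gens G" "s \<in> hol_gens G"
      let ?a = "P p" and ?b = "P q" and ?c = "P s"
      note F = P_closed[OF *(2)] P_closed[OF *(3)] P_closed[OF *(4)]
      \<comment> \<open>The terms with \<open>D\<close> applied twice cancel in the cyclic sum, and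
        the remaining ones with \<open>D\<close> pair up to anticommutators.\<close>
      have "P x = (?a \<star> (?b \<star> ?c) + ?b \<star> (?c \<star> ?a) + ?c \<star> (?a \<star> ?b))
          + fscale (Mu q) (?a \<star> D ?c + D ?c \<star> ?a) + fscale (Mu p) (D ?b \<star> ?c + ?c \<star> D ?b)
          + fscale (Mu s) (?b \<star> D ?a + D ?a \<star> ?b)"
        unfolding *(1)
        by (simp add: P_linear P_mult weight_linear D_linear D_mult mag_mult_simps fscale_simps fscale_zero_left)
          (simp add: mult.commute algebra_simps)
      also have "\<dots> \<in> hol_ideal N"
        using F by (intro JN.J_add JN.J_fscale JN.J_jacobi JN.J_anticomm D_closed)
      finally show ?thesis by (simp add: *(1) weight_linear)
    qed
    then show "x \<in> ?K" using x lie_relators_subset[OF module_cohom_dual] by auto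
  qed
qed

text \<open>Modulo the Lie ideal, a relation of \<open>G\<close> is a combination of products
  \<open>e u \<star> e v\<close> over edges, which \<open>P_edge\<close> covers.\<close>

lemma P_hol_ideal:
  assumes "p \<in> hol_ideal G" shows "P p \<in> hol_ideal N" "Mu p = 0"
proof -
  let ?K = "{p \<in> hol_gens G. P p \<in> hol_ideal N \<and> Mu p = 0}"
  interpret K: lie_kernel "cohom_dual G 1" ?K by (rule lie_kernel_P)
  have "hol_ideal G \<subseteq> ?K"
    unfolding hol_ideal_def[of G]
  proof (rule lie_kernel_least[OF lie_kernel_P], rule subsetI)
    fix q assume q: "q \<in> nabla_rels G"
    from nabla_rel_wedge[OF G V co e_carrier frame_G q]
    obtain \<Omega> where \<Omega>: "(\<forall>u v. \<Omega> u v = - \<Omega> v u) \<and>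
      (\<forall>c. (\<forall>x\<in>carrier (cohom_dual G 1). (\<Sum>v\<in>V. c v * x (char_class G (co v))) = 0) \<longrightarrow>
         (\<forall>v. (\<Sum>u\<in>V. c u * \<Omega> u v) = 0)) \<and>
      (\<forall>u v. cup_chars G (co u) (co v) \<in> bar_coboundaries G 2 \<longrightarrow> \<Omega> u v = 0) \<and>
      q - wedge V e (\<lambda>u v. \<Omega> u v / 2) \<in> lie_ideal (cohom_dual G 1)" by (rule exE)
    note van = \<Omega>[THEN conjunct2, THEN conjunct2, THEN conjunct1, rule_format]
    have "wedge V e (\<lambda>u v. \<Omega> u v / 2) \<in> ?K"
      unfolding JG.wedge_def
    proof (intro K.J_sum)
      fix u v assume uv: "u \<in> V" "v \<in> V"
      show "fscale (\<Omega> u v / 2) (mag_gen (e u) \<star> mag_gen (e v)) \<in> ?K"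
      proof (cases "adj u v")
        case True
        have "mag_gen (e u) \<star> mag_gen (e v) \<in> ?K"
          using P_edge[OF True] e_carrier uv by auto
        then show ?thesis by (rule K.J_fscale)
      next
        case False
        obtain A where "\<forall>x\<in>carrier G. \<forall>y\<in>carrier G. co u x * co v y = A x + A y - A (x \<otimes>\<^bsub>G\<^esub> y)"
          using cup_nonadj[OF uv False] by blast
        then have "\<Omega> u v = 0" by (intro van cup_chars_coboundary[OF G, where A = A]) simp
        then have "fscale (\<Omega> u v / 2) (mag_gen (e u) \<star> mag_gen (e v)) = 0" by (simp add: fscale_zero_left)
        then show ?thesis using K.J_zero by (simp only:)
      qed
    qed
    moreover have "q - wedge V e (\<lambda>u v. \<Omega> u v / 2) \<in> ?K"
      using \<Omega>[THEN conjunct2, THEN conjunct2, THEN conjunct2] lie_ideal_subset_gen_ideal[OF lie_kernel_P] by blast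
    ultimately show "q \<in> ?K" using K.J_mem_cong by blast
  qed
  then show "P p \<in> hol_ideal N" "Mu p = 0" using assms by auto
qed

text \<open>On an edge, \<open>[e u, e w] = 0\<close> turns the bracket of
  \<open>\<iota> (ebar u)\<close> and \<open>\<iota> (ebar w)\<close> into
  \<open>m w [\<tau>, e u] - m u [\<tau>, e w]\<close>. Weighted with the edge coefficients, these
  sum to minus the bracket of \<tau> with \<open>\<iota> x\<close>, by the contraction
  property.\<close>

lemma \<tau>_bracket_gen:
  assumes x: "x \<in> carrier (cohom_dual N 1)"
  shows "mag_gen \<tau> \<star> mag_gen (\<iota> x) - \<Phi> (D0 x) \<in> hol_ideal G"
proof -
  let ?T = "mag_gen \<tau>" and ?e = "\<lambda>v. mag_gen (e v)" and ?c = "edge_coeffs x"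
  have TF: "?T \<in> hol_gens G" by (intro free_carrier_gen \<tau>_carrier)
  have eF: "?e v \<in> hol_gens G" if "v \<in> V" for v using that by (intro free_carrier_gen e_carrier)
  have gen_\<iota>: "mag_gen (\<iota> (ebar v)) - (?e v - fscale (m v) ?T) \<in> hol_ideal G" if v: "v \<in> V" for v
  proof -
    have eq: "\<iota> (ebar v) = (\<lambda>X. e v X + (- m v) * \<tau> X)"
      using \<iota>_r[OF e_carrier[OF v]] \<mu>_e[OF v] by (simp add: ebar_def)
    have "mag_gen (\<iota> (ebar v)) - (?e v + mag_gen (\<lambda>X. (- m v) * \<tau> X))
       + (mag_gen (\<lambda>X. (- m v) * \<tau> X) - fscale (- m v) ?T) \<in> hol_ideal G"
      unfolding eq by (intro JG.J_add JG.J_gen_plus JG.J_gen_scale JG.V_closed e_carrier v \<tau>_carrier)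
    then show ?thesis by (simp add: fscale_minus_left algebra_simps)
  qed
  have edge: "mag_gen (\<iota> (ebar u)) \<star> mag_gen (\<iota> (ebar w)) - (fscale (m w) (?T \<star> ?e u) - fscale (m u) (?T \<star> ?e w)) \<in> hol_ideal G"
    if uw: "adj u w" for u w
  proof -
    have V': "u \<in> V" "w \<in> V" using adj_V[OF uw] by auto
    have "mag_gen (\<iota> (ebar u)) \<star> mag_gen (\<iota> (ebar w)) - (?e u - fscale (m u) ?T) \<star> (?e w - fscale (m w) ?T) \<in> hol_ideal G"
      using V' eF TF by (intro JG.J_mult_cong gen_\<iota> free_carrier_diff free_carrier_fscale free_carrier_gen \<iota>_carrier
          ebar_carrier e_carrier \<tau>_carrier)
    moreover have "?e u \<star> ?e w - fscale (m w) (?e u \<star> ?T + ?T \<star> ?e u) + fscale (m u * m w) (?T \<star> ?T) \<in> hol_ideal G"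
      using V' eF TF uw by (intro JG.J_add JG.J_diff JG.J_fscale JG.J_anticomm JG.J_square edge_relation) auto
    ultimately have "mag_gen (\<iota> (ebar u)) \<star> mag_gen (\<iota> (ebar w)) - (?e u - fscale (m u) ?T) \<star> (?e w - fscale (m w) ?T)
       + (?e u \<star> ?e w - fscale (m w) (?e u \<star> ?T + ?T \<star> ?e u) + fscale (m u * m w) (?T \<star> ?T)) \<in> hol_ideal G"
      by (rule JG.J_add)
    then show ?thesis by (simp add: mag_mult_simps fscale_simps algebra_simps)
  qed
  have "\<Phi> (D0 x) = - (\<Sum>u\<in>V. \<Sum>w\<in>V. fscale (?c u w) (mag_gen (\<iota> (ebar u)) \<star> mag_gen (\<iota> (ebar w))))"
    by (simp add: D0_def JN.wedge_def mag_map_linear mag_map_mult)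
  moreover have "(\<Sum>u\<in>V. \<Sum>w\<in>V. fscale (?c u w) (mag_gen (\<iota> (ebar u)) \<star> mag_gen (\<iota> (ebar w))))
      - (\<Sum>u\<in>V. \<Sum>w\<in>V. fscale (?c u w) (fscale (m w) (?T \<star> ?e u) - fscale (m u) (?T \<star> ?e w))) \<in> hol_ideal G"
  proof (intro JG.J_sum_cong)
    fix u w
    show "fscale (?c u w) (mag_gen (\<iota> (ebar u)) \<star> mag_gen (\<iota> (ebar w)))
      - fscale (?c u w) (fscale (m w) (?T \<star> ?e u) - fscale (m u) (?T \<star> ?e w)) \<in> hol_ideal G"
    proof (cases "adj u w")
      case True
      then show ?thesis unfolding fscale_diff_right[of "?c u w", symmetric] by (intro JG.J_fscale edge)
    next
      case False
      then show ?thesis using edge_coeffs(1)[OF x] by (simp add: fscale_zero_left)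
    qed
  qed
  moreover have "(\<Sum>u\<in>V. \<Sum>w\<in>V. fscale (?c u w) (fscale (m w) (?T \<star> ?e u) - fscale (m u) (?T \<star> ?e w)))
      = - (\<Sum>v\<in>V. fscale (coord x v) (?T \<star> ?e v))"
  proof -
    have "(\<Sum>u\<in>V. \<Sum>w\<in>V. fscale (?c u w) (fscale (m w) (?T \<star> ?e u) - fscale (m u) (?T \<star> ?e w)))
        = (\<Sum>u\<in>V. \<Sum>w\<in>V. fscale (m w * ?c u w) (?T \<star> ?e u)) - (\<Sum>u\<in>V. \<Sum>w\<in>V. fscale (m u * ?c u w) (?T \<star> ?e w))"
      by (simp add: fscale_simps sum_subtractf mult.commute)
    also have "(\<Sum>u\<in>V. \<Sum>w\<in>V. fscale (m u * ?c u w) (?T \<star> ?e w)) = (\<Sum>w\<in>V. \<Sum>u\<in>V. fscale (m u * ?c u w) (?T \<star> ?e w))"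
      by (rule sum.swap)
    also have "(\<Sum>u\<in>V. \<Sum>w\<in>V. fscale (m w * ?c u w) (?T \<star> ?e u)) - (\<Sum>w\<in>V. \<Sum>u\<in>V. fscale (m u * ?c u w) (?T \<star> ?e w))
        = (\<Sum>v\<in>V. fscale ((\<Sum>u\<in>V. m u * ?c v u) - (\<Sum>u\<in>V. m u * ?c u v)) (?T \<star> ?e v))"
      by (simp add: fscale_diff_left fscale_sum_left sum_subtractf)
    also have "\<dots> = (\<Sum>v\<in>V. - fscale (coord x v) (?T \<star> ?e v))"
      by (intro sum.cong HOL.refl)
        (simp add: edge_coeffs(2)[OF x] right_diff_distrib sum_subtractf fscale_diff_left)
    finally show ?thesis by (simp add: sum_negf)
  qed
  moreover have "?T \<star> mag_gen (\<iota> x) - (\<Sum>v\<in>V. fscale (coord x v) (?T \<star> ?e v)) \<in> hol_ideal G"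
  proof -
    have "mag_gen (\<iota> x) - (\<Sum>v\<in>V. fscale (coord x v) (?e v)) \<in> hol_ideal G"
      unfolding frame_\<iota>[OF x] by (rule JG.J_gen_lincomb[OF V e_carrier])
    from JG.J_mult_right[OF this TF] show ?thesis
      by (simp add: mag_mult_simps mag_mult_sum_right)
  qed
  ultimately show ?thesis
    using JG.J_add[of "?T \<star> mag_gen (\<iota> x) - (\<Sum>v\<in>V. fscale (coord x v) (?T \<star> ?e v))"
      "(\<Sum>u\<in>V. \<Sum>w\<in>V. fscale (?c u w) (mag_gen (\<iota> (ebar u)) \<star> mag_gen (\<iota> (ebar w))))
      - (\<Sum>u\<in>V. \<Sum>w\<in>V. fscale (?c u w) (fscale (m w) (?T \<star> ?e u) - fscale (m u) (?T \<star> ?e w)))"]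
    by simp
qed

text \<open>Left multiplication by \<tau> and \<open>D\<close> are both derivations modulo the
  relations, so generators decide.\<close>

lemma \<tau>_bracket:
  assumes "p \<in> hol_gens N" shows "mag_gen \<tau> \<star> \<Phi> p - \<Phi> (D p) \<in> hol_ideal G"
  using assms
proof (induction rule: free_carrier_induct)
  case (gen x)
  then show ?case using \<tau>_bracket_gen by (simp add: D_def)
next
  case (mult p q)
  let ?T = "mag_gen \<tau>"
  have TF: "?T \<in> hol_gens G" by (intro free_carrier_gen \<tau>_carrier)
  note F = \<Phi>_closed[OF mult(1)] \<Phi>_closed[OF mult(2)]
  have "?T \<star> (\<Phi> p \<star> \<Phi> q) - ((?T \<star> \<Phi> p) \<star> \<Phi> q + \<Phi> p \<star> (?T \<star> \<Phi> q))
     + (?T \<star> \<Phi> p - \<Phi> (D p)) \<star> \<Phi> q + \<Phi> p \<star> (?T \<star> \<Phi> q - \<Phi> (D q)) \<in> hol_ideal G"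
    by (intro JG.J_add JG.J_leibniz JG.J_mult_left[OF mult(3)] JG.J_mult_right[OF mult(4)] F TF)
  then show ?case by (simp add: mag_map_mult mag_map_linear D_mult mag_mult_simps algebra_simps)
next
  case zero
  then show ?case by (simp add: D_linear mag_map_linear JG.J_zero)
next
  case (add p q)
  from JG.J_add[OF add(3,4)] show ?case by (simp add: D_linear mag_map_linear mag_mult_simps algebra_simps)
next
  case (fscale k p)
  from JG.J_fscale[OF fscale(2), of k] show ?case by (simp add: D_linear mag_map_linear mag_mult_simps fscale_diff_right)
qed

text \<open>In a product of two such decompositions, \<open>\<tau>_bracket\<close> moves the
  brackets with \<tau> into the image of \<open>\<Phi>\<close>, and the square of \<tau>
  vanishes.\<close>

lemma \<Phi>_P:
  assumes "q \<in> hol_gens G" shows "q - (\<Phi> (P q) + fscale (Mu q) (mag_gen \<tau>)) \<in> hol_ideal G"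
  using assms
proof (induction rule: free_carrier_induct)
  case (gen y)
  have eq: "\<iota> (r y) = (\<lambda>X. y X + (- \<mu> y) * \<tau> X)" by (rule \<iota>_r[OF gen])
  have "mag_gen (\<iota> (r y)) - (mag_gen y + mag_gen (\<lambda>X. (- \<mu> y) * \<tau> X))
     + (mag_gen (\<lambda>X. (- \<mu> y) * \<tau> X) - fscale (- \<mu> y) (mag_gen \<tau>)) \<in> hol_ideal G"
    unfolding eq by (intro JG.J_add JG.J_gen_plus JG.J_gen_scale JG.V_closed gen \<tau>_carrier)
  from JG.J_uminus[OF this] show ?case by (simp add: fscale_minus_left algebra_simps)
next
  case (mult a b)
  let ?T = "mag_gen \<tau>" and ?A = "\<Phi> (P a)" and ?B = "\<Phi> (P b)"
  have TF: "?T \<in> hol_gens G" by (intro free_carrier_gen \<tau>_carrier)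
  note PF = P_closed[OF mult(1)] P_closed[OF mult(2)]
  note F = \<Phi>_closed[OF PF(1)] \<Phi>_closed[OF PF(2)]
  have "a \<star> b - (?A + fscale (Mu a) ?T) \<star> (?B + fscale (Mu b) ?T) \<in> hol_ideal G"
    using mult(2) F TF by (intro JG.J_mult_cong[OF mult(3,4)] free_carrier_add free_carrier_fscale)
  moreover have "fscale (Mu a) (?T \<star> ?B - \<Phi> (D (P b))) + fscale (Mu b) (?A \<star> ?T + ?T \<star> ?A)
      - fscale (Mu b) (?T \<star> ?A - \<Phi> (D (P a))) + fscale (Mu a * Mu b) (?T \<star> ?T) \<in> hol_ideal G"
    using F TF PF by (intro JG.J_add JG.J_diff JG.J_fscale JG.J_anticomm JG.J_square \<tau>_bracket)
  ultimately have "a \<star> b - (?A + fscale (Mu a) ?T) \<star> (?B + fscale (Mu b) ?T)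
      + (fscale (Mu a) (?T \<star> ?B - \<Phi> (D (P b))) + fscale (Mu b) (?A \<star> ?T + ?T \<star> ?A)
      - fscale (Mu b) (?T \<star> ?A - \<Phi> (D (P a))) + fscale (Mu a * Mu b) (?T \<star> ?T)) \<in> hol_ideal G"
    by (rule JG.J_add)
  then show ?case
    by (simp add: P_mult mag_map_mult mag_map_linear mag_mult_simps fscale_simps fscale_zero_left algebra_simps)
next
  case zero
  then show ?case by (simp add: P_linear mag_map_linear weight_linear fscale_zero_left JG.J_zero)
next
  case (add p q)
  from JG.J_add[OF add(3,4)] show ?case
    by (simp add: P_linear mag_map_linear weight_linear fscale_simps algebra_simps)
next
  case (fscale k p)
  from JG.J_fscale[OF fscale(2), of k] show ?case
    by (simp add: P_linear mag_map_linear weight_linear fscale_simps)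
qed

end

subsection \<open>The holonomy Lie algebra of the integers\<close>

definition int_unit :: "int hdual" where "int_unit = eval_char integer_group 1"

definition int_weight :: "(int hdual magma \<Rightarrow>\<^sub>0 rat) \<Rightarrow> rat" where
  "int_weight = weight (\<lambda>y. y (char_class integer_group of_int))"

lemma of_int_char: "of_int \<in> group_chars integer_group"
  by (simp add: group_chars_def)

lemma int_char: "a \<in> group_chars integer_group \<Longrightarrow> a k = of_int k * a 1"
  using group_chars_int_pow[OF group_integer_group, of a 1 k] by simp

lemma int_unit_carrier: "int_unit \<in> carrier (cohom_dual integer_group 1)"
  unfolding int_unit_def by (rule eval_char_carrier[OF group_integer_group]) simp

lemma int_unit_class: "a \<in> group_chars integer_group \<Longrightarrow> int_unit (char_class integer_group a) = a 1"
  unfolding int_unit_def by (rule eval_char_class[OF group_integer_group]) simp_all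

lemma cohom_dual_integer_group:
  assumes y: "y \<in> carrier (cohom_dual integer_group 1)"
  shows "y = (\<lambda>X. y (char_class integer_group of_int) * int_unit X)"
proof (rule cohom_dual_1_ext[OF group_integer_group y])
  interpret fun_lie_kernel "cohom_dual integer_group 1" "hol_ideal integer_group" by (rule fun_lie_kernel_hol_ideal)
  show "(\<lambda>X. y (char_class integer_group of_int) * int_unit X) \<in> carrier (cohom_dual integer_group 1)"
    by (intro V_closed int_unit_carrier)
  fix a assume a: "a \<in> group_chars integer_group"
  have "char_class integer_group a = char_class integer_group (\<lambda>k. a 1 * of_int k)"
  proof (rule char_class_cong)
    show "a k = a 1 * of_int k" for k by (subst int_char[OF a, of k]) (rule mult.commute)
  qed
  moreover have "y (char_class integer_group (\<lambda>k. a 1 * of_int k)) = a 1 * y (char_class integer_group of_int)"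
    by (rule y[unfolded cohom_dual_1_iff[OF group_integer_group], THEN conjunct2, THEN conjunct1, rule_format, OF of_int_char])
  ultimately show "y (char_class integer_group a) = y (char_class integer_group of_int) * int_unit (char_class integer_group a)"
    unfolding int_unit_class[OF a] by (simp only: mult.commute)
qed

text \<open>All generators are multiples of \<open>int_unit\<close>, so every bracket vanishes and
  only a line remains.\<close>

lemma hol_gens_integer_group:
  assumes "p \<in> hol_gens integer_group"
  shows "p - fscale (int_weight p) (mag_gen int_unit) \<in> hol_ideal integer_group"
  using assms
proof (induction rule: free_carrier_induct)
  interpret fun_lie_kernel "cohom_dual integer_group 1" "hol_ideal integer_group" by (rule fun_lie_kernel_hol_ideal)
  note U = free_carrier_gen[OF int_unit_carrier]
  {
    case (gen y)
    then show ?case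
      using J_gen_scale[OF int_unit_carrier, of "y (char_class integer_group of_int)"]
      by (simp add: int_weight_def flip: cohom_dual_integer_group[OF gen])
  next
    case (mult p q)
    have "p \<star> q - fscale (int_weight p) (mag_gen int_unit) \<star> fscale (int_weight q) (mag_gen int_unit) \<in> hol_ideal integer_group"
      using mult U by (intro J_mult_cong) auto
    moreover have "fscale (int_weight p * int_weight q) (mag_gen int_unit \<star> mag_gen int_unit) \<in> hol_ideal integer_group"
      using U by (intro J_fscale J_square)
    ultimately have "p \<star> q \<in> hol_ideal integer_group"
      by (intro J_mem_cong[of "p \<star> q"]) (simp_all add: mag_mult_simps fscale_fscale mult.commute)
    then show ?case by (simp add: int_weight_def fscale_zero_left)
  next
    case zero
    then show ?case by (simp add: int_weight_def weight_linear fscale_zero_left)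
  next
    case (add p q)
    from J_add[OF add(3,4)] show ?case by (simp add: int_weight_def weight_linear fscale_add_left algebra_simps)
  next
    case (fscale k p)
    from J_fscale[OF fscale(2), of k] show ?case
      by (simp add: int_weight_def weight_linear fscale_diff_right fscale_fscale)
  }
qed

text \<open>The weight is linear on generators and zero on products, hence zero on all
  relators.\<close>

lemma int_weight_hol_ideal:
  assumes "p \<in> hol_ideal integer_group" shows "int_weight p = 0"
proof -
  let ?K = "{p \<in> hol_gens integer_group. int_weight p = 0}"
  have "lie_kernel (cohom_dual integer_group 1) ?K"
  proof (rule lie_kernel.intro)
    show "lie_relators (cohom_dual integer_group 1) \<subseteq> ?K"
    proof
      fix x assume x: "x \<in> lie_relators (cohom_dual integer_group 1)"
      then have "int_weight x = 0"
        by (auto simp: lie_relators_def int_weight_def weight_linear cohom_dual_sel)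
      then show "x \<in> ?K" using x lie_relators_subset[OF module_cohom_dual] by auto
    qed
  qed (auto simp: module_cohom_dual algebra_ideal_free_iff int_weight_def weight_linear)
  moreover have "nabla_rels integer_group \<subseteq> ?K"
  proof
    fix p assume p: "p \<in> nabla_rels integer_group"
    then have "int_weight p = 0" by (auto simp: nabla_rels_def int_weight_def weight_linear)
    then show "p \<in> ?K" using p nabla_rels_subset[of integer_group] by blast
  qed
  ultimately have "hol_ideal integer_group \<subseteq> ?K" unfolding hol_ideal_def by (rule lie_kernel_least)
  then show ?thesis using assms by auto
qed

lemma hol_ideal_integer_group_iff:
  assumes "p \<in> hol_gens integer_group"
  shows "p \<in> hol_ideal integer_group \<longleftrightarrow> int_weight p = 0"
  using hol_gens_integer_group[OF assms] int_weight_hol_ideal[of p] by (auto simp: fscale_zero_left)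

subsection \<open>The main theorem\<close>

lemma graded_lie_hom_funcset: "f \<in> graded_lie_hom L M \<Longrightarrow> f \<in> carrier L \<rightarrow> carrier M"
  by (simp add: graded_lie_hom_def linear_maps_def)

context raag_kernel begin

interpretation G: group G by (rule G)
interpretation HN: lie_presentation "holonomy N" "hol_gens N" "hol_ideal N" "hol_proj N"
  by (rule lie_presentation_holonomy[OF group_N])
interpretation HG: lie_presentation "holonomy G" "hol_gens G" "hol_ideal G" "hol_proj G"
  by (rule lie_presentation_holonomy[OF G])
interpretation HZ: lie_presentation "holonomy integer_group" "hol_gens integer_group" "hol_ideal integer_group" "hol_proj integer_group"
  by (rule lie_presentation_holonomy[OF group_integer_group])
interpretation JN: lie_kernel "cohom_dual N 1" "hol_ideal N" by (rule lie_kernel_hol_ideal)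
interpretation JG: lie_kernel "cohom_dual G 1" "hol_ideal G" by (rule lie_kernel_hol_ideal)

abbreviation \<iota>\<^sub>h where "\<iota>\<^sub>h \<equiv> holonomy_map N G (\<lambda>x. x)"
abbreviation \<chi>\<^sub>h where "\<chi>\<^sub>h \<equiv> holonomy_map G integer_group \<chi>"
abbreviation \<chi>\<^sub>1 where "\<chi>\<^sub>1 \<equiv> cohom_dual_map G integer_group 1 \<chi>"

lemma \<iota>\<^sub>h_proj: "p \<in> hol_gens N \<Longrightarrow> \<iota>\<^sub>h (hol_proj N p) = hol_proj G (\<Phi> p)"
  unfolding \<iota>_def by (rule holonomy_map_proj[OF group_N G incl_hom])

lemma \<chi>\<^sub>h_proj: "p \<in> hol_gens G \<Longrightarrow> \<chi>\<^sub>h (hol_proj G p) = hol_proj integer_group (mag_map \<chi>\<^sub>1 p)"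
  by (rule holonomy_map_proj[OF G group_integer_group \<chi>])

lemma \<chi>\<^sub>1_closed: "p \<in> hol_gens G \<Longrightarrow> mag_map \<chi>\<^sub>1 p \<in> hol_gens integer_group"
  by (rule cohom_dual_map_gens[OF G group_integer_group \<chi>])

lemma int_weight_\<chi>\<^sub>1: "p \<in> hol_gens G \<Longrightarrow> int_weight (mag_map \<chi>\<^sub>1 p) = Mu p"
proof (induction rule: free_carrier_induct)
  case (gen y)
  have "\<chi>' = (\<lambda>g. of_int (\<chi> g))" by (simp add: \<chi>'_def fun_eq_iff)
  then show ?case
    using cohom_dual_map_char_class[OF G group_integer_group \<chi> of_int_char, of y]
    by (simp add: int_weight_def \<mu>_def)
qed (simp_all add: int_weight_def mag_map_linear mag_map_mult weight_linear)

lemma \<chi>\<^sub>h_zero_iff: "p \<in> hol_gens G \<Longrightarrow> \<chi>\<^sub>h (hol_proj G p) = \<zero>\<^bsub>holonomy integer_group\<^esub> \<longleftrightarrow> Mu p = 0"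
  by (simp add: \<chi>\<^sub>h_proj HZ.L(2,7) \<chi>\<^sub>1_closed hol_ideal_integer_group_iff int_weight_\<chi>\<^sub>1)

text \<open>\<open>P\<close> is a left inverse of \<open>\<Phi>\<close> that takes relations of
  \<open>G\<close> to relations of \<open>N\<close>.\<close>

lemma \<iota>\<^sub>h_inj: "inj_on \<iota>\<^sub>h (carrier (holonomy N))"
proof (rule inj_onI)
  fix x y assume "x \<in> carrier (holonomy N)" "y \<in> carrier (holonomy N)" and eq: "\<iota>\<^sub>h x = \<iota>\<^sub>h y"
  then obtain p q where p: "p \<in> hol_gens N" "x = hol_proj N p" and q: "q \<in> hol_gens N" "y = hol_proj N q"
    unfolding HN.L(1) by blast
  have "hol_proj G (\<Phi> p) = hol_proj G (\<Phi> q)" using eq p q by (simp add: \<iota>\<^sub>h_proj)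
  then have "\<Phi> p - \<Phi> q \<in> hol_ideal G"
    using HG.L(7)[OF \<Phi>_closed[OF p(1)] \<Phi>_closed[OF q(1)]] by simp
  then have "P (\<Phi> (p - q)) \<in> hol_ideal N" by (intro P_hol_ideal) (simp add: mag_map_linear)
  then show "x = y" using p q by (simp add: P_\<Phi> HN.L(7))
qed

lemma \<iota>\<^sub>h_image: "\<iota>\<^sub>h ` carrier (holonomy N) = {x \<in> carrier (holonomy G). \<chi>\<^sub>h x = \<zero>\<^bsub>holonomy integer_group\<^esub>}"
proof (intro equalityI subsetI)
  fix x assume "x \<in> \<iota>\<^sub>h ` carrier (holonomy N)"
  then obtain p where p: "p \<in> hol_gens N" "x = \<iota>\<^sub>h (hol_proj N p)" unfolding HN.L(1) by blast
  then have x: "x = hol_proj G (\<Phi> p)" by (simp add: \<iota>\<^sub>h_proj)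
  show "x \<in> {x \<in> carrier (holonomy G). \<chi>\<^sub>h x = \<zero>\<^bsub>holonomy integer_group\<^esub>}"
    using \<Phi>_closed[OF p(1)] Mu_\<Phi>[OF p(1)] by (simp add: x HG.L(1) \<chi>\<^sub>h_zero_iff)
next
  fix x assume "x \<in> {x \<in> carrier (holonomy G). \<chi>\<^sub>h x = \<zero>\<^bsub>holonomy integer_group\<^esub>}"
  then obtain q where q: "q \<in> hol_gens G" "x = hol_proj G q" "Mu q = 0"
    unfolding HG.L(1) by (auto simp: \<chi>\<^sub>h_zero_iff)
  have "q - \<Phi> (P q) \<in> hol_ideal G" using \<Phi>_P[OF q(1)] q(3) by (simp add: fscale_zero_left)
  then have "x = \<iota>\<^sub>h (hol_proj N (P q))"
    using q P_closed[OF q(1)] \<Phi>_closed[OF P_closed[OF q(1)]] by (simp add: \<iota>\<^sub>h_proj HG.L(7))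
  then show "x \<in> \<iota>\<^sub>h ` carrier (holonomy N)" using P_closed[OF q(1)] unfolding HN.L(1) by blast
qed

text \<open>Functoriality applied to the group section \<open>k \<mapsto> t^k\<close> of
  \<chi>.\<close>

lemma \<chi>\<^sub>h_section:
  shows "\<exists>s\<in>graded_lie_hom (holonomy integer_group) (holonomy G).
    \<forall>z\<in>carrier (holonomy integer_group). \<chi>\<^sub>h (s z) = z"
proof (intro bexI ballI)
  let ?t = "\<lambda>k::int. t [^]\<^bsub>G\<^esub> k"
  have th: "?t \<in> hom integer_group G" using G.hom_integer_group_pow[OF t(1)] by simp
  show "holonomy_map integer_group G ?t \<in> graded_lie_hom (holonomy integer_group) (holonomy G)"
    by (rule holonomy_map_hom[OF group_integer_group G th])
  fix z assume "z \<in> carrier (holonomy integer_group)"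
  then obtain p where p: "p \<in> hol_gens integer_group" "z = hol_proj integer_group p" unfolding HZ.L(1) by blast
  let ?s = "cohom_dual_map integer_group G 1 ?t"
  have sc: "?s y \<in> carrier (cohom_dual G 1)" if "y \<in> carrier (cohom_dual integer_group 1)" for y
    using that by (intro cohom_dual_map_carrier[OF group_integer_group G th]) simp_all
  have id: "\<chi>\<^sub>1 (?s y) = y" if y: "y \<in> carrier (cohom_dual integer_group 1)" for y
  proof (rule cohom_dual_1_ext[OF group_integer_group _ y])
    show "\<chi>\<^sub>1 (?s y) \<in> carrier (cohom_dual integer_group 1)"
      by (intro cohom_dual_map_carrier[OF G group_integer_group \<chi>] sc y) simp
    fix a assume a: "a \<in> group_chars integer_group"
    show "\<chi>\<^sub>1 (?s y) (char_class integer_group a) = y (char_class integer_group a)"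
      by (simp add: cohom_dual_map_char_class[OF G group_integer_group \<chi> a]
          cohom_dual_map_char_class[OF group_integer_group G th group_chars_comp[OF G group_integer_group \<chi> a]] \<chi>_pow)
  qed
  have "\<chi>\<^sub>h (holonomy_map integer_group G ?t z) = \<chi>\<^sub>h (hol_proj G (mag_map ?s p))"
    unfolding p(2) by (simp add: holonomy_map_proj[OF group_integer_group G th p(1)])
  also have "\<dots> = hol_proj integer_group (mag_map \<chi>\<^sub>1 (mag_map ?s p))"
    by (rule \<chi>\<^sub>h_proj[OF cohom_dual_map_gens[OF group_integer_group G th p(1)]])
  also have "mag_map \<chi>\<^sub>1 (mag_map ?s p) = mag_map (\<lambda>y. y) p"
    by (rule mag_map_comp[where X = "carrier (cohom_dual integer_group 1)"]) (rule id, assumption, rule p(1))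
  also have "mag_map (\<lambda>y. y) p = p" by (rule mag_map_id[where X = "carrier (cohom_dual integer_group 1)"]) (rule HOL.refl, rule p(1))
  finally show "\<chi>\<^sub>h (holonomy_map integer_group G ?t z) = z" by (simp add: p(2))
qed

lemma split_exact: "split_exact_graded_lie (holonomy N) \<iota>\<^sub>h (holonomy G) \<chi>\<^sub>h (holonomy integer_group)"
  unfolding split_exact_graded_lie_def
proof (intro conjI)
  show \<chi>h: "\<chi>\<^sub>h \<in> graded_lie_hom (holonomy G) (holonomy integer_group)"
    by (rule holonomy_map_hom[OF G group_integer_group \<chi>])
  show "\<iota>\<^sub>h \<in> graded_lie_hom (holonomy N) (holonomy G)"
    by (rule holonomy_map_hom[OF group_N G incl_hom])
  show "\<chi>\<^sub>h ` carrier (holonomy G) = carrier (holonomy integer_group)"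
  proof (intro equalityI subsetI)
    show "z \<in> carrier (holonomy integer_group)" if "z \<in> \<chi>\<^sub>h ` carrier (holonomy G)" for z
      using that \<chi>h by (auto simp: graded_lie_hom_def linear_maps_def)
    fix z assume z: "z \<in> carrier (holonomy integer_group)"
    from \<chi>\<^sub>h_section obtain s where "s \<in> graded_lie_hom (holonomy integer_group) (holonomy G)" "\<chi>\<^sub>h (s z) = z"
      using z by blast
    then show "z \<in> \<chi>\<^sub>h ` carrier (holonomy G)"
      using z by (intro image_eqI[of _ _ "s z"]) (auto simp: graded_lie_hom_def linear_maps_def)
  qed
qed (rule HN.graded_lie_algebra_L HG.graded_lie_algebra_L HZ.graded_lie_algebra_L \<iota>\<^sub>h_inj \<iota>\<^sub>h_image \<chi>\<^sub>h_section)+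

lemma derived_iso:
  "graded_lie_iso (derived_subalgebra (holonomy N)) (derived_subalgebra (holonomy G))
     (restrict \<iota>\<^sub>h (carrier (derived_subalgebra (holonomy N))))"
proof -
  let ?CN = "{p \<in> hol_gens N. gcomp 1 p = 0}" and ?CG = "{p \<in> hol_gens G. gcomp 1 p = 0}"
  let ?DN = "derived_subalgebra (holonomy N)" and ?DG = "derived_subalgebra (holonomy G)"
  let ?f = "restrict \<iota>\<^sub>h (carrier ?DN)"
  interpret DN: lie_presentation ?DN ?CN "hol_ideal N" "hol_proj N"
    by (rule HN.lie_presentation_derived[OF HOL.refl])
  interpret DG: lie_presentation ?DG ?CG "hol_ideal G" "hol_proj G"
    by (rule HG.lie_presentation_derived[OF HOL.refl])
  have f: "?f (hol_proj N p) = hol_proj G (\<Phi> p)" if "p \<in> ?CN" for p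
    using that by (simp add: DN.L(1) \<iota>\<^sub>h_proj)
  have \<Phi>: "\<Phi> p \<in> ?CG" if "p \<in> ?CN" for p
    using that by (simp add: \<Phi>_closed gcomp_mag_map mag_map_linear)
  have hom: "?f \<in> graded_lie_hom ?DN ?DG"
    by (rule DN.graded_lie_hom_L[where \<Phi> = "\<Phi>" and f = ?f, OF DG.lie_presentation_axioms f \<Phi>])
      (simp_all add: mag_map_linear mag_map_mult gcomp_mag_map JG.J_zero)
  have "bij_betw ?f (carrier ?DN) (carrier ?DG)"
    unfolding bij_betw_def
  proof
    have sub: "carrier ?DN \<subseteq> carrier (holonomy N)" unfolding DN.L(1) HN.L(1) by blast
    show "inj_on ?f (carrier ?DN)"
      using inj_on_subset[OF \<iota>\<^sub>h_inj sub] by (simp add: inj_on_def)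
    show "?f ` carrier ?DN = carrier ?DG"
    proof (intro equalityI subsetI)
      note funcset_mem[OF graded_lie_hom_funcset[OF hom]]
      then show "y \<in> carrier ?DG" if "y \<in> ?f ` carrier ?DN" for y
        using that by (elim imageE) simp
      fix y assume "y \<in> carrier ?DG"
      then obtain q where q: "q \<in> hol_gens G" "gcomp 1 q = 0" "y = hol_proj G q" unfolding DG.L(1) by blast
      \<comment> \<open>The weight sees only the part of degree 1, so elements of the derived
        subalgebra have no component along \<tau>.\<close>
      have "Mu q = 0" using weight_gcomp_1[of \<mu> q] q(2) by (simp add: weight_linear)
      then have q\<Phi>: "q - \<Phi> (P q) \<in> hol_ideal G" using \<Phi>_P[OF q(1)] by (simp add: fscale_zero_left)
      \<comment> \<open>The part of degree 1 is removed from \<open>P q\<close> to obtain a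
        representative in the derived subalgebra. Its image is a relation of \<open>G\<close>, being
        up to sign the degree 1 component of \<open>q - \<Phi> (P q)\<close>.\<close>
      define p where "p = P q - gcomp 1 (P q)"
      have g: "gcomp 1 (P q) \<in> hol_gens N" by (intro gcomp_closed P_closed q)
      have pC: "p \<in> ?CN" using g P_closed[OF q(1)] by (simp add: p_def gcomp_linear gcomp_gcomp)
      have "gcomp 1 (q - \<Phi> (P q)) \<in> hol_ideal G" by (rule HG.J(3)[OF q\<Phi>])
      then have "- \<Phi> (gcomp 1 (P q)) \<in> hol_ideal G" by (simp add: gcomp_linear q(2) gcomp_mag_map)
      from JG.J_diff[OF q\<Phi> this] have "q - \<Phi> p \<in> hol_ideal G"
        by (simp add: p_def mag_map_linear algebra_simps)
      then have "y = ?f (hol_proj N p)"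
        unfolding f[OF pC] q(3) using HG.L(7)[OF q(1), of "\<Phi> p"] \<Phi>[OF pC] by simp
      then show "y \<in> ?f ` carrier ?DN" using pC unfolding DN.L(1) by blast
    qed
  qed
  then show ?thesis
    by (intro DN.graded_lie_iso_L[where \<Phi> = "\<Phi>" and f = ?f, OF DG.lie_presentation_axioms f \<Phi> _ hom]) (assumption | rule gcomp_mag_map)+
qed

end

theorem theorem9p5:
  fixes V :: "'v set" and E :: "'v set set"
    and G :: "'v word set monoid" and \<chi> :: "'v word set \<Rightarrow> int"
    and K :: "'v word set set" and N :: "'v word set monoid"
    and \<iota> :: "'v word set \<Rightarrow> 'v word set"
  assumes graph: "finite_simple_graph V E"
    and G: "G = raag V E"
    and chi: "\<chi> \<in> epi G integer_group"
    and K: "K = kernel G integer_group \<chi>"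
    and N: "N = G\<lparr>carrier := K\<rparr>"
    and iota: "\<iota> = (\<lambda>x. x)"
    and H1: "trivial_homology_action G K 1"
    and H2: "trivial_homology_action G K 2"
  shows "split_exact_graded_lie
           (holonomy N) (holonomy_map N G \<iota>)
           (holonomy G) (holonomy_map G integer_group \<chi>)
           (holonomy integer_group)
       \<and> graded_lie_iso
           (derived_subalgebra (holonomy N)) (derived_subalgebra (holonomy G))
           (restrict (holonomy_map N G \<iota>) (carrier (derived_subalgebra (holonomy N))))"
proof -
  have "(1::int) \<in> \<chi> ` carrier G" using chi by (simp add: epi_def)
  then obtain t where t: "t \<in> carrier G" "\<chi> t = 1" by (metis imageE)
  interpret raag_group G V "\<lambda>u v. {u, v} \<in> E" "\<lambda>v. word_class V (raag_rels E) [(v, True)]"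
    "\<lambda>v. class_lift (\<lambda>w. word_exp w v)"
    unfolding G by (rule raag_group_raag[OF graph])
  interpret raag_kernel G V "\<lambda>u v. {u, v} \<in> E" "\<lambda>v. word_class V (raag_rels E) [(v, True)]"
    "\<lambda>v. class_lift (\<lambda>w. word_exp w v)" \<chi> K t
    by (intro raag_kernel.intro raag_kernel_axioms.intro raag_group_axioms K t H1 H2)
      (use chi in \<open>simp add: epi_def\<close>)
  show ?thesis unfolding N iota using split_exact derived_iso by blast
qed

end
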